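(* Let $k$ be a field and suppose that a finite Gorenstein scheme $\Gamma\subset\mathbf{P}^r_k=\mathbf{P}(V)$ of degree $2r+2$ decomposes as the disjoint union of two subschemes $\Gamma_1$ and $\Gamma_2$ that are bases. Then the scheme $\Gamma$ is self-associated if and only if $\Gamma_1$ and $\Gamma_2$ are both orthogonal bases for the same nonsingular bilinear form on $V$. The bilinear form is unique if and only if $\Gamma$ is arithmetically Gorenstein.
   Context: $\mathbf{P}(V)$ is the projective space whose space of linear forms is $V$, $\dim_kV=r+1$. A finite $k$-scheme is Gorenstein if its local rings are; $K_\Gamma$ is the dualizing line bundle, $K_\Gamma(-1)=K_\Gamma\otimes\mathcal{O}_\Gamma(1)^{-1}$. Serre duality gives a trace map $\mathrm{H}^0(K_\Gamma)\to k$ and a perfect pairing $\mathrm{H}^0(\mathcal{O}_\Gamma(1))\otimes\mathrm{H}^0(K_\Gamma(-1))\to k$; $V^\perp\subset \mathrm{H}^0(K_\Gamma(-1))$ is the annihilator of $V$. $\Gamma$ is self-associated if there is an isomorphism of $\mathcal{O}_\Gamma$-modules $\mathcal{O}_\Gamma(1)\to K_\Gamma(-1)$ carrying $V$ onto $V^\perp$. $\Gamma$ is arithmetically Gorenstein if its homogeneous coordinate ring is Gorenstein. A subscheme $\Lambda\subset\mathbf{P}(V)$ is a basis for $V$ if it is nondegenerate (contained in no hyperplane) and of degree $r+1$ over $k$; that is, if the natural map $V\to\mathrm{H}^0(\mathcal{O}_\Lambda(1))=\mathcal{O}_\Lambda(1)$ is an isomorphism. If $B:V\to V^*$ is a $k$-linear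 map, $\Lambda$ is an orthogonal basis with respect to the bilinear form corresponding to $B$ if $\Lambda$ is a basis and the composition $\mathcal{O}_\Lambda(1)\cong V\xrightarrow{B}V^*\cong K_\Lambda(-1)$ is an isomorphism of sheaves of $\mathcal{O}_\Lambda$-modules (here $V^*\cong K_\Lambda(-1)$ is dual to $V\cong\mathcal{O}_\Lambda(1)$ via Serre duality). "The bilinear form" in the last sentence is the nonsingular bilinear form for which both $\Gamma_1$ and $\Gamma_2$ are orthogonal bases, and its uniqueness is understood up to a scalar factor.
   Formalization: The implication "the bilinear form is unique ⇒ Γ is arithmetically Gorenstein" is stated only for k ≠ F_2, where it fails (16 points in P^7 from two extended Hamming codes); uniqueness includes existence. All else holds over every field. *)

theory Defs
  imports
    "HOL-Algebra.Algebraic_Closure_Type"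
    "HOL-Library.Poly_Mapping"
    "HOL-Library.Cardinality"
begin

section \<open>Modules and homomorphisms\<close>

text \<open>
  Homomorphisms are extensional, so that equality in \<open>mod_hom R M N\<close> is equality of maps on
  the carrier.
\<close>

definition mod_hom ::
  "('a, 'r) ring_scheme \<Rightarrow> ('a, 'm, 'x) module_scheme \<Rightarrow> ('a, 'n, 'y) module_scheme \<Rightarrow> ('m \<Rightarrow> 'n) set"
  where "mod_hom R M N =
    {h \<in> carrier M \<rightarrow>\<^sub>E carrier N.
       (\<forall>x\<in>carrier M. \<forall>y\<in>carrier M. h (x \<oplus>\<^bsub>M\<^esub> y) = h x \<oplus>\<^bsub>N\<^esub> h y) \<and>
       (\<forall>a\<in>carrier R. \<forall>x\<in>carrier M. h (a \<odot>\<^bsub>M\<^esub> x) = a \<odot>\<^bsub>N\<^esub> h x)}"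

definition mod_iso ::
  "('a, 'r) ring_scheme \<Rightarrow> ('a, 'm, 'x) module_scheme \<Rightarrow> ('a, 'n, 'y) module_scheme \<Rightarrow> ('m \<Rightarrow> 'n) set"
  where "mod_iso R M N = {h \<in> mod_hom R M N. bij_betw h (carrier M) (carrier N)}"

text \<open>The fields \<open>mult\<close> and \<open>one\<close> of a module record carry no meaning.\<close>

definition Hom_module ::
  "('a, 'r) ring_scheme \<Rightarrow> ('a, 'm, 'x) module_scheme \<Rightarrow> ('a, 'n, 'y) module_scheme \<Rightarrow> ('a, 'm \<Rightarrow> 'n) module"
  where "Hom_module R M N =
    \<lparr>carrier = mod_hom R M N, monoid.mult = undefined, one = undefined,
     zero = (\<lambda>x\<in>carrier M. \<zero>\<^bsub>N\<^esub>),
     add = (\<lambda>f g. \<lambda>x\<in>carrier M. f x \<oplus>\<^bsub>N\<^esub> g x),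
     module.smult = (\<lambda>a f. \<lambda>x\<in>carrier M. a \<odot>\<^bsub>N\<^esub> f x)\<rparr>"

text \<open>
  The additive subgroup \<open>C\<close> of the ring \<open>Q\<close>, on which scalars act through a ring homomorphism
  \<open>\<phi>\<close> into \<open>Q\<close>.
\<close>

definition scalar_module :: "('a \<Rightarrow> 'b) \<Rightarrow> ('b, 'q) ring_scheme \<Rightarrow> 'b set \<Rightarrow> ('a, 'b) module"
  where "scalar_module \<phi> Q C =
    \<lparr>carrier = C, monoid.mult = monoid.mult Q, one = one Q, zero = zero Q, add = add Q,
     module.smult = (\<lambda>a x. \<phi> a \<otimes>\<^bsub>Q\<^esub> x)\<rparr>"


section \<open>Localization\<close>

text \<open>
  The fraction \<open>a/s\<close> with denominators in a multiplicative set \<open>W\<close> that may contain zero divisors.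
\<close>

definition frac_class :: "('a, 'r) ring_scheme \<Rightarrow> 'a set \<Rightarrow> 'a \<Rightarrow> 'a \<Rightarrow> ('a \<times> 'a) set"
  where "frac_class R W a s =
    {(b, t). b \<in> carrier R \<and> t \<in> W \<and>
       (\<exists>u\<in>W. u \<otimes>\<^bsub>R\<^esub> ((a \<otimes>\<^bsub>R\<^esub> t) \<ominus>\<^bsub>R\<^esub> (b \<otimes>\<^bsub>R\<^esub> s)) = \<zero>\<^bsub>R\<^esub>)}"

definition localization :: "('a, 'r) ring_scheme \<Rightarrow> 'a set \<Rightarrow> ('a \<times> 'a) set ring"
  where "localization R W =
    \<lparr>carrier = {frac_class R W a s | a s. a \<in> carrier R \<and> s \<in> W},
     monoid.mult = (\<lambda>F G. \<Union>x\<in>F. \<Union>y\<in>G.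
       frac_class R W (fst x \<otimes>\<^bsub>R\<^esub> fst y) (snd x \<otimes>\<^bsub>R\<^esub> snd y)),
     one = frac_class R W \<one>\<^bsub>R\<^esub> \<one>\<^bsub>R\<^esub>,
     zero = frac_class R W \<zero>\<^bsub>R\<^esub> \<one>\<^bsub>R\<^esub>,
     add = (\<lambda>F G. \<Union>x\<in>F. \<Union>y\<in>G.
       frac_class R W ((fst x \<otimes>\<^bsub>R\<^esub> snd y) \<oplus>\<^bsub>R\<^esub> (fst y \<otimes>\<^bsub>R\<^esub> snd x))
         (snd x \<otimes>\<^bsub>R\<^esub> snd y))\<rparr>"


section \<open>Gorenstein rings\<close>

text \<open>
  Injectivity of \<open>A\<close> as a module over itself, in the form of Baer's criterion (injectivity with
  respect to all inclusions of modules would quantify over types).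
\<close>

definition self_injective :: "('a, 'r) ring_scheme \<Rightarrow> bool"
  where "self_injective A \<longleftrightarrow>
    (\<forall>J. ideal J A \<longrightarrow>
       (\<forall>h\<in>mod_hom A (scalar_module id A J) (scalar_module id A (carrier A)).
          \<exists>g\<in>mod_hom A (scalar_module id A (carrier A)) (scalar_module id A (carrier A)).
            \<forall>x\<in>J. g x = h x))"

definition regular_sequence :: "('a, 'r) ring_scheme \<Rightarrow> 'a list \<Rightarrow> bool"
  where "regular_sequence R xs \<longleftrightarrow>
    set xs \<subseteq> carrier R \<and> Idl\<^bsub>R\<^esub> (set xs) \<noteq> carrier R \<and>
    (\<forall>i<length xs. \<forall>a\<in>carrier R.
       xs ! i \<otimes>\<^bsub>R\<^esub> a \<in> Idl\<^bsub>R\<^esub> (set (take i xs)) \<longrightarrow> a \<in> Idl\<^bsub>R\<^esub> (set (take i xs)))"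

text \<open>
  A zero-dimensional Noetherian local ring is Gorenstein if it is injective over itself, and in
  general a Noetherian local ring is Gorenstein if it becomes a zero-dimensional Gorenstein ring
  modulo a regular sequence (Eisenbud, Commutative Algebra, Sections 21.2 and 21.3).
\<close>

definition gorenstein_local :: "('a, 'r) ring_scheme \<Rightarrow> bool"
  where "gorenstein_local R \<longleftrightarrow>
    cring R \<and> noetherian_ring R \<and> (\<exists>!M. maximalideal M R) \<and>
    (\<exists>xs. regular_sequence R xs \<and>
       (\<forall>P. primeideal P (R Quot (Idl\<^bsub>R\<^esub> (set xs))) \<longrightarrow>
             maximalideal P (R Quot (Idl\<^bsub>R\<^esub> (set xs)))) \<and>
       self_injective (R Quot (Idl\<^bsub>R\<^esub> (set xs))))"

definition gorenstein_ring :: "('a, 'r) ring_scheme \<Rightarrow> bool"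
  where "gorenstein_ring R \<longleftrightarrow>
    cring R \<and> noetherian_ring R \<and>
    (\<forall>M. maximalideal M R \<longrightarrow> gorenstein_local (localization R (carrier R - M)))"


section \<open>Closed subschemes of projective space\<close>

text \<open>
  The homogeneous coordinate ring of \<open>P(V)\<close> is the polynomial ring over \<open>'k\<close> in variables
  indexed by the finite type \<open>'v\<close>, and \<open>V\<close> is its space \<open>forms 1\<close> of linear forms.
\<close>

type_synonym ('v, 'k) mpoly = "('v \<Rightarrow>\<^sub>0 nat) \<Rightarrow>\<^sub>0 'k"

abbreviation polys :: "('v::finite, 'k::field) mpoly ring"
  where "polys \<equiv> ring_of_type_algebra"

abbreviation base_field :: "'k::field ring"
  where "base_field \<equiv> ring_of_type_algebra"

definition forms :: "nat \<Rightarrow> ('v::finite, 'k::field) mpoly set"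
  where "forms d = {p. \<forall>m\<in>Poly_Mapping.keys p. (\<Sum>v\<in>UNIV. Poly_Mapping.lookup m v) = d}"

text \<open>
  Closed subschemes of projective space correspond to saturated homogeneous ideals. A subscheme
  is represented by its ideal throughout; the empty subscheme is the unit ideal.
\<close>

definition closed_subscheme :: "('v::finite, 'k::field) mpoly set \<Rightarrow> bool"
  where "closed_subscheme I \<longleftrightarrow>
    ideal I polys \<and>
    I = Idl\<^bsub>polys\<^esub> (I \<inter> (\<Union>d. forms d)) \<and>
    (\<forall>p. (\<exists>N. \<forall>q\<in>forms N. p * q \<in> I) \<longrightarrow> p \<in> I)"

text \<open>Scheme-theoretic union of two closed subschemes without common points.\<close>

definition disjoint_union ::
  "('v::finite, 'k::field) mpoly set \<Rightarrow> ('v, 'k) mpoly set \<Rightarrow> ('v, 'k) mpoly set \<Rightarrow> bool"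
  where "disjoint_union I I1 I2 \<longleftrightarrow> I = I1 \<inter> I2 \<and> (\<exists>N. forms N \<subseteq> I1 <+>\<^bsub>polys\<^esub> I2)"

definition homogeneous_coordinate_ring ::
  "('v::finite, 'k::field) mpoly set \<Rightarrow> ('v, 'k) mpoly set ring"
  where "homogeneous_coordinate_ring I = polys Quot I"

definition arithmetically_gorenstein :: "('v::finite, 'k::field) mpoly set \<Rightarrow> bool"
  where "arithmetically_gorenstein I \<longleftrightarrow> gorenstein_ring (homogeneous_coordinate_ring I)"

definition nondegenerate :: "('v::finite, 'k::field) mpoly set \<Rightarrow> bool"
  where "nondegenerate I \<longleftrightarrow> (\<forall>l\<in>forms 1. l \<noteq> 0 \<longrightarrow> \<not> PIdl\<^bsub>polys\<^esub> l \<subseteq> I)"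


section \<open>Finite subschemes and their twisting sheaves\<close>

text \<open>
  The forms of degree \<open>d\<close> that vanish at no point of the subscheme \<open>\<Gamma>\<close> of \<open>I\<close>, that is, with
  \<open>\<Gamma>\<close> contained in the affine open set \<open>D\<^sub>+(s)\<close>.
\<close>

definition nonvanishing_forms :: "('v::finite, 'k::field) mpoly set \<Rightarrow> nat \<Rightarrow> ('v, 'k) mpoly set"
  where "nonvanishing_forms I d =
    {s \<in> forms d. \<exists>N. forms N \<subseteq> I <+>\<^bsub>polys\<^esub> (PIdl\<^bsub>polys\<^esub> s)}"

definition denominators :: "('v::finite, 'k::field) mpoly set \<Rightarrow> ('v, 'k) mpoly set set"
  where "denominators I = (\<Union>d. (\<lambda>s. I +>\<^bsub>polys\<^esub> s) ` nonvanishing_forms I d)"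

type_synonym ('v, 'k) section_fraction = "(('v, 'k) mpoly set \<times> ('v, 'k) mpoly set) set"

definition section_ring ::
  "('v::finite, 'k::field) mpoly set \<Rightarrow> ('v, 'k) section_fraction ring"
  where "section_ring I = localization (homogeneous_coordinate_ring I) (denominators I)"

definition fraction ::
  "('v::finite, 'k::field) mpoly set \<Rightarrow> ('v, 'k) mpoly \<Rightarrow> ('v, 'k) mpoly \<Rightarrow> ('v, 'k) section_fraction"
  where "fraction I p s =
    frac_class (homogeneous_coordinate_ring I) (denominators I) (I +>\<^bsub>polys\<^esub> p) (I +>\<^bsub>polys\<^esub> s)"

text \<open>
  If \<open>\<Gamma>\<close> lies in an affine open set \<open>D\<^sub>+(f)\<close> with \<open>f\<close> of positive degree (over a finite field a
  linear \<open>f\<close> need not exist), then \<open>H\<^sup>0(O(n))\<close> consists of the fractions of degree \<open>n\<close>. The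
  scheme is affine, so sheaves on it are given by their modules of global sections.
\<close>

definition sections :: "('v::finite, 'k::field) mpoly set \<Rightarrow> nat \<Rightarrow> ('v, 'k) section_fraction set"
  where "sections I n =
    {fraction I p s | p s d. s \<in> nonvanishing_forms I d \<and> p \<in> forms (d + n)}"

definition structure_ring ::
  "('v::finite, 'k::field) mpoly set \<Rightarrow> ('v, 'k) section_fraction ring"
  where "structure_ring I = (section_ring I)\<lparr>carrier := sections I 0\<rparr>"

definition const_section :: "('v::finite, 'k::field) mpoly set \<Rightarrow> 'k \<Rightarrow> ('v, 'k) section_fraction"
  where "const_section I c = fraction I (Poly_Mapping.single 0 c) 1"

definition twist ::
  "('v::finite, 'k::field) mpoly set \<Rightarrow> nat \<Rightarrow> (('v, 'k) section_fraction, ('v, 'k) section_fraction) module"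
  where "twist I n = scalar_module id (section_ring I) (sections I n)"

definition has_degree :: "('v::finite, 'k::field) mpoly set \<Rightarrow> nat \<Rightarrow> bool"
  where "has_degree I n \<longleftrightarrow>
    ring.dimension (structure_ring I) n (range (const_section I)) (sections I 0)"

text \<open>
  A finite \<open>k\<close>-scheme is the spectrum of a finite-dimensional \<open>k\<close>-algebra. A finite subscheme of
  projective space lies in some \<open>D\<^sub>+(f)\<close>, over any field.
\<close>

definition finite_subscheme :: "('v::finite, 'k::field) mpoly set \<Rightarrow> bool"
  where "finite_subscheme I \<longleftrightarrow>
    closed_subscheme I \<and> (\<exists>d>0. nonvanishing_forms I d \<noteq> {}) \<and> (\<exists>n. has_degree I n)"

definition gorenstein_scheme :: "('v::finite, 'k::field) mpoly set \<Rightarrow> bool"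
  where "gorenstein_scheme I \<longleftrightarrow> gorenstein_ring (structure_ring I)"


section \<open>The dualizing sheaf and self-association\<close>

text \<open>
  For a finite scheme \<open>K\<^sub>\<Gamma>\<close> is the module \<open>Hom\<^sub>k(O\<^sub>\<Gamma>, k)\<close>, on which \<open>O\<^sub>\<Gamma>\<close> acts by
  \<open>(a \<eta>)(b) = \<eta>(a b)\<close>, and the trace is evaluation at \<open>1\<close>.
\<close>

definition canonical_module ::
  "('v::finite, 'k::field) mpoly set \<Rightarrow> (('v, 'k) section_fraction, ('v, 'k) section_fraction \<Rightarrow> 'k) module"
  where "canonical_module I =
    \<lparr>carrier = mod_hom base_field
       (scalar_module (const_section I) (section_ring I) (sections I 0))
       (scalar_module id base_field UNIV),
     monoid.mult = undefined, one = undefined,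
     zero = (\<lambda>b\<in>sections I 0. 0),
     add = (\<lambda>\<eta> \<theta>. \<lambda>b\<in>sections I 0. \<eta> b + \<theta> b),
     module.smult = (\<lambda>a \<eta>. \<lambda>b\<in>sections I 0. \<eta> (a \<otimes>\<^bsub>section_ring I\<^esub> b))\<rparr>"

definition trace ::
  "('v::finite, 'k::field) mpoly set \<Rightarrow> (('v, 'k) section_fraction \<Rightarrow> 'k) \<Rightarrow> 'k"
  where "trace I \<eta> = \<eta> \<one>\<^bsub>section_ring I\<^esub>"

text \<open>
  \<open>K\<^sub>\<Gamma>(-1)\<close>, the tensor product of \<open>K\<^sub>\<Gamma>\<close> with the inverse of the line bundle \<open>O\<^sub>\<Gamma>(1)\<close>, is
  \<open>Hom(O\<^sub>\<Gamma>(1), K\<^sub>\<Gamma>)\<close>. Under this identification multiplication of sections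
  \<open>O\<^sub>\<Gamma>(1) \<times> K\<^sub>\<Gamma>(-1) \<rightarrow> K\<^sub>\<Gamma>\<close> is evaluation.
\<close>

definition canonical_twist ::
  "('v::finite, 'k::field) mpoly set \<Rightarrow>
     (('v, 'k) section_fraction, ('v, 'k) section_fraction \<Rightarrow> ('v, 'k) section_fraction \<Rightarrow> 'k) module"
  where "canonical_twist I = Hom_module (structure_ring I) (twist I 1) (canonical_module I)"

definition serre_pairing ::
  "('v::finite, 'k::field) mpoly set \<Rightarrow> ('v, 'k) section_fraction \<Rightarrow>
     (('v, 'k) section_fraction \<Rightarrow> ('v, 'k) section_fraction \<Rightarrow> 'k) \<Rightarrow> 'k"
  where "serre_pairing I s \<phi> = trace I (\<phi> s)"

text \<open>The natural map from \<open>V\<close> to \<open>H\<^sup>0(O\<^sub>\<Gamma>(1))\<close>.\<close>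

definition restrict_form ::
  "('v::finite, 'k::field) mpoly set \<Rightarrow> ('v, 'k) mpoly \<Rightarrow> ('v, 'k) section_fraction"
  where "restrict_form I l = fraction I l 1"

definition V_perp ::
  "('v::finite, 'k::field) mpoly set \<Rightarrow>
     (('v, 'k) section_fraction \<Rightarrow> ('v, 'k) section_fraction \<Rightarrow> 'k) set"
  where "V_perp I =
    {\<phi> \<in> carrier (canonical_twist I). \<forall>l\<in>forms 1. serre_pairing I (restrict_form I l) \<phi> = 0}"

definition self_associated :: "('v::finite, 'k::field) mpoly set \<Rightarrow> bool"
  where "self_associated I \<longleftrightarrow>
    (\<exists>\<Phi>\<in>mod_iso (structure_ring I) (twist I 1) (canonical_twist I).
       \<Phi> ` restrict_form I ` forms 1 = V_perp I)"


section \<open>Orthogonal bases\<close>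

definition linear_forms :: "('k::field, ('v::finite, 'k) mpoly) module"
  where "linear_forms = scalar_module (Poly_Mapping.single 0) polys (forms 1)"

definition dual_linear_forms :: "('k::field, ('v::finite, 'k) mpoly \<Rightarrow> 'k) module"
  where "dual_linear_forms = Hom_module base_field linear_forms (scalar_module id base_field UNIV)"

text \<open>
  A bilinear form on \<open>V\<close> is a linear map \<open>B\<close> from \<open>V\<close> to its dual, with values \<open>B v w\<close>.
\<close>

definition nonsingular_form :: "(('v::finite, 'k::field) mpoly \<Rightarrow> ('v, 'k) mpoly \<Rightarrow> 'k) \<Rightarrow> bool"
  where "nonsingular_form B \<longleftrightarrow> B \<in> mod_iso base_field linear_forms dual_linear_forms"

definition is_basis :: "('v::finite, 'k::field) mpoly set \<Rightarrow> bool"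
  where "is_basis I \<longleftrightarrow> finite_subscheme I \<and> nondegenerate I \<and> has_degree I CARD('v)"

text \<open>The map from \<open>K\<^sub>\<Lambda>(-1)\<close> to the dual of \<open>V\<close>, dual to the map from \<open>V\<close> to \<open>O\<^sub>\<Lambda>(1)\<close>.\<close>

definition dual_restrict_form ::
  "('v::finite, 'k::field) mpoly set \<Rightarrow>
     (('v, 'k) section_fraction \<Rightarrow> ('v, 'k) section_fraction \<Rightarrow> 'k) \<Rightarrow> ('v, 'k) mpoly \<Rightarrow> 'k"
  where "dual_restrict_form I \<phi> = (\<lambda>l\<in>forms 1. serre_pairing I (restrict_form I l) \<phi>)"

text \<open>The composition \<open>O\<^sub>\<Lambda>(1) \<cong> V \<rightarrow> V\<^sup>* \<cong> K\<^sub>\<Lambda>(-1)\<close> whose middle map is \<open>B\<close>.\<close>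

definition induced_map ::
  "('v::finite, 'k::field) mpoly set \<Rightarrow> (('v, 'k) mpoly \<Rightarrow> ('v, 'k) mpoly \<Rightarrow> 'k) \<Rightarrow>
     ('v, 'k) section_fraction \<Rightarrow> ('v, 'k) section_fraction \<Rightarrow> ('v, 'k) section_fraction \<Rightarrow> 'k"
  where "induced_map I B =
    (\<lambda>s\<in>sections I 1.
       inv_into (carrier (canonical_twist I)) (dual_restrict_form I)
         (B (inv_into (forms 1) (restrict_form I) s)))"

definition orthogonal_basis ::
  "('v::finite, 'k::field) mpoly set \<Rightarrow> (('v, 'k) mpoly \<Rightarrow> ('v, 'k) mpoly \<Rightarrow> 'k) \<Rightarrow> bool"
  where "orthogonal_basis I B \<longleftrightarrow>
    is_basis I \<and> induced_map I B \<in> mod_iso (structure_ring I) (twist I 1) (canonical_twist I)"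

definition common_form ::
  "('v::finite, 'k::field) mpoly set \<Rightarrow> ('v, 'k) mpoly set \<Rightarrow>
     (('v, 'k) mpoly \<Rightarrow> ('v, 'k) mpoly \<Rightarrow> 'k) \<Rightarrow> bool"
  where "common_form I1 I2 B \<longleftrightarrow>
    nonsingular_form B \<and> orthogonal_basis I1 B \<and> orthogonal_basis I2 B"

text \<open>
  Uniqueness up to scalars, existence included. Over the field with two elements it does not
  force \<open>\<Gamma>\<close> to be arithmetically Gorenstein: for the sixteen points in \<open>P\<^sup>7\<close> given by the columns
  of a generator matrix of the direct sum of two extended Hamming codes of length eight, the standard
  form is the only common form, but the Hilbert function of \<open>\<Gamma>\<close> begins \<open>1, 8, 14, 16\<close>.
\<close>

definition unique_common_form ::
  "('v::finite, 'k::field) mpoly set \<Rightarrow> ('v, 'k) mpoly set \<Rightarrow> bool"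
  where "unique_common_form I1 I2 \<longleftrightarrow>
    (\<exists>B. common_form I1 I2 B \<and>
       (\<forall>B'. common_form I1 I2 B' \<longrightarrow>
          (\<exists>c. c \<noteq> 0 \<and> (\<forall>v\<in>forms 1. \<forall>w\<in>forms 1. B' v w = c * B v w))))"

end

theory Submission
  imports Defs
begin

text \<open>
  Let \<open>S\<close> be the polynomial ring, \<open>V\<close> its linear forms, \<open>I1\<close> and \<open>I2\<close> the ideals of the two
  bases, \<open>R = S/(I1 \<inter> I2)\<close> and \<open>J = I1 + I2\<close>.

  On a finite scheme the line bundle \<open>O(1)\<close> is trivial. For a basis all its sections come from
  \<open>V\<close>, so some \<open>v\<close> in \<open>V\<close> vanishes nowhere, and every form of degree \<open>m + 1\<close> is congruent to
  \<open>v\<^sup>m x\<close> for a unique \<open>x\<close> in \<open>V\<close> (\<open>basis_subscheme_if_is_basis\<close>). The basis is orthogonal for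
  \<open>B\<close> exactly when \<open>B x y\<close> depends only on the product \<open>x y\<close> modulo the ideal
  (\<open>induced_map_iso_iff\<close>); such a \<open>B\<close> is called balanced.

  Self-association. A section of \<open>O(1)\<close> on the union is a pair of linear forms, its components
  on the two bases, and \<open>V\<close> is the diagonal. If \<open>B\<close> is a common form, then the diagonal is its own
  annihilator under the pairing \<open>B x x' - B y y'\<close> of \<open>(x, y)\<close> with \<open>(x', y')\<close>
  (\<open>self_associated_if_common_form\<close>). Conversely, an isomorphism of \<open>O(1)\<close> with \<open>K(-1)\<close> is a
  perfect pairing of sections, and pairing \<open>(x, 0)\<close> with the diagonal gives a form that is balanced
  for the first basis; since the diagonal is isotropic, pairing \<open>(0, x)\<close> with it gives the negative
  of the same form, which is therefore balanced for the second basis as well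
  (\<open>common_form_if_self_associated\<close>).

  If \<open>R\<close> is Gorenstein, then \<open>S/J\<close> has a one-dimensional socle (\<open>simple_socle_if_gorenstein\<close>):
  a form \<open>e\<close> that is a power of \<open>v\<close> on the first basis and zero on the second carries the socle of
  \<open>S/J\<close> into that of \<open>R\<close> modulo a parameter. The socle then lies in degree 2, and the
  multiplication of \<open>V\<close> into it is the common form, through which every form balanced for both
  bases factors (\<open>form_from_simple_socle\<close>).

  Conversely, let \<open>B\<close> be a common form. The other forms balanced for both bases are
  \<open>B (u x) y\<close> with \<open>u\<close> self-adjoint for both. If \<open>B\<close> is unique, then \<open>u\<close> is always a scalar
  (\<open>sa_scalar\<close>; this needs an element of the field besides 0 and 1), and \<open>S/J\<close> has the Hilbert
  function \<open>1, r + 1, 1\<close> (\<open>kernel_in_J\<close>, \<open>cubics_in_J\<close>). The difference of the two values of \<open>B\<close> is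
  a functional for which the homogeneous pieces of \<open>R\<close> in complementary degrees annihilate each
  other (\<open>duality\<close>), and from it one obtains a functional on \<open>R/G\<close> whose kernel contains no nonzero
  ideal, for each monic polynomial \<open>G\<close> in a form \<open>f\<close> that vanishes nowhere (\<open>frobenius_functional\<close>).
  Every maximal ideal of \<open>R\<close> contains such a \<open>G\<close>, and \<open>R/G\<close> is self-injective as a Frobenius
  algebra, so \<open>R\<close> is Gorenstein (\<open>gorenstein_coordinate_ring\<close>).
\<close>

text \<open>The degree \<open>1\<close> of the linear forms is to stay \<open>1\<close> in simplification.\<close>

declare One_nat_def [simp del]

section \<open>Linear algebra in spaces of functions\<close>

text \<open>
Gaussian elimination: a vector with a nonzero entry at \<open>x\<close> clears that entry from the others.
\<close>

lemma exists_linear_dependency: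
  fixes a :: "'y \<Rightarrow> 'x \<Rightarrow> 'k::field"
  assumes "finite XX" "finite Y" "card XX < card Y"
  shows "\<exists>c. (\<exists>y\<in>Y. c y \<noteq> 0) \<and> (\<forall>x\<in>XX. (\<Sum>y\<in>Y. c y * a y x) = 0)"
  using assms
proof (induction XX arbitrary: Y a rule: finite_induct)
  case empty
  hence "Y \<noteq> {}" by auto
  thus ?case by (auto intro!: exI[of _ "\<lambda>_. 1"])
next
  case (insert x XX)
  show ?case
  proof (cases "\<forall>y\<in>Y. a y x = 0")
    case True
    obtain c where "\<exists>y\<in>Y. c y \<noteq> 0" "\<forall>x\<in>XX. (\<Sum>y\<in>Y. c y * a y x) = 0"
      using insert.IH[of Y a] insert.prems insert.hyps by auto
    with True show ?thesis by (intro exI[of _ c]) auto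
  next
    case False
    then obtain y0 where y0: "y0 \<in> Y" "a y0 x \<noteq> 0" by auto
    define Y' where "Y' = Y - {y0}"
    have fin: "finite Y'" "y0 \<notin> Y'" and Y: "Y = insert y0 Y'"
      using insert.prems y0 by (auto simp: Y'_def)
    define a' where "a' y z = a y z - a y x / a y0 x * a y0 z" for y z
    have "card XX < card Y'"
      using insert.prems insert.hyps y0 by (simp add: Y'_def)
    then obtain c where c: "\<exists>y\<in>Y'. c y \<noteq> 0" "\<forall>z\<in>XX. (\<Sum>y\<in>Y'. c y * a' y z) = 0"
      using insert.IH[of Y' a'] fin by auto
    define c0 where "c0 = - (\<Sum>y\<in>Y'. c y * a y x) / a y0 x"
    define c' where "c' y = (if y = y0 then c0 else c y)" for y
    have sum: "(\<Sum>y\<in>Y. c' y * a y z) = c0 * a y0 z + (\<Sum>y\<in>Y'. c y * a y z)" for z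
    proof -
      have "(\<Sum>y\<in>Y'. c' y * a y z) = (\<Sum>y\<in>Y'. c y * a y z)"
        using fin by (intro sum.cong) (auto simp: c'_def)
      thus ?thesis using fin Y by (simp add: c'_def)
    qed
    have "(\<Sum>y\<in>Y. c' y * a y z) = 0" if "z \<in> insert x XX" for z
    proof (cases "z = x")
      case True
      thus ?thesis using y0 by (simp add: sum c0_def)
    next
      case False
      hence "(\<Sum>y\<in>Y'. c y * a' y z) = 0" using that c by auto
      moreover have "(\<Sum>y\<in>Y'. c y * a' y z) = (\<Sum>y\<in>Y'. c y * a y z) + c0 * a y0 z"
        by (simp add: a'_def c0_def algebra_simps sum_subtractf sum_distrib_left sum_distrib_right
            sum_divide_distrib)
      ultimately show ?thesis by (simp add: sum add.commute)
    qed
    moreover have "\<exists>y\<in>Y. c' y \<noteq> 0" using c fin Y by (auto simp: c'_def)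
    ultimately show ?thesis by blast
  qed
qed

definition lin_closed :: "('i \<Rightarrow> 'k::field) set \<Rightarrow> bool"
  where "lin_closed G \<longleftrightarrow> G \<noteq> {} \<and> (\<forall>g\<in>G. \<forall>h\<in>G. \<forall>a. (\<lambda>i. g i + a * h i) \<in> G)"

lemma lin_closed_combine: "lin_closed G \<Longrightarrow> g \<in> G \<Longrightarrow> h \<in> G \<Longrightarrow> (\<lambda>i. g i + a * h i) \<in> G"
  by (simp add: lin_closed_def)

lemma lin_closed_zero: 
  assumes "lin_closed G" shows "(\<lambda>i. 0) \<in> G"
proof -
  obtain g where "g \<in> G" using assms by (auto simp: lin_closed_def)
  hence "(\<lambda>i. g i + (-1) * g i) \<in> G" using assms by (intro lin_closed_combine)
  thus ?thesis by simp
qed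

text \<open>
  This lemma and the next two stand in for duality and bases of subspaces of \<open>k\<^sup>n\<close>. They are proved
  by adding one coordinate at a time.
\<close>

lemma coordinate_dependent:
  assumes "finite XX" "lin_closed G" "\<forall>g\<in>G. (\<forall>i\<in>XX. g i = 0) \<longrightarrow> g j = 0"
  shows "\<exists>\<alpha>. \<forall>g\<in>G. g j = (\<Sum>i\<in>XX. \<alpha> i * g i)"
  using assms
proof (induction XX arbitrary: G rule: finite_induct)
  case empty
  thus ?case by auto
next
  case (insert x XX)
  show ?case
  proof (cases "\<forall>g\<in>G. g x = 0")
    case True
    then obtain \<alpha> where "\<forall>g\<in>G. g j = (\<Sum>i\<in>XX. \<alpha> i * g i)"
      using insert.IH[of G] insert.prems by auto
    with True insert.hyps show ?thesis by (intro exI[of _ \<alpha>]) auto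
  next
    case False
    then obtain g0 where g0: "g0 \<in> G" "g0 x \<noteq> 0" by auto
    define G' where "G' = {g \<in> G. g x = 0}"
    have "lin_closed G'"
      using lin_closed_zero[OF insert.prems(1)] insert.prems(1)
      by (auto simp: lin_closed_def G'_def)
    moreover have "\<forall>g\<in>G'. (\<forall>i\<in>XX. g i = 0) \<longrightarrow> g j = 0"
      using insert.prems(2) by (auto simp: G'_def)
    ultimately obtain \<alpha> where \<alpha>: "\<forall>g\<in>G'. g j = (\<Sum>i\<in>XX. \<alpha> i * g i)"
      using insert.IH[of G'] by auto
    define \<beta> where "\<beta> = (g0 j - (\<Sum>i\<in>XX. \<alpha> i * g0 i)) / g0 x"
    have "g j = (\<Sum>i\<in>insert x XX. (if i = x then \<beta> else \<alpha> i) * g i)" if "g \<in> G" for g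
    proof -
      define b where "b = - g x / g0 x"
      define h where "h i = g i + b * g0 i" for i
      have "h \<in> G" unfolding h_def by (rule lin_closed_combine[OF insert.prems(1) that g0(1)])
      hence "h \<in> G'" using g0 by (simp add: G'_def h_def b_def)
      hence "h j = (\<Sum>i\<in>XX. \<alpha> i * h i)" using \<alpha> by blast
      also have "\<dots> = (\<Sum>i\<in>XX. \<alpha> i * g i) + b * (\<Sum>i\<in>XX. \<alpha> i * g0 i)"
        by (simp add: h_def distrib_left sum.distrib sum_distrib_left mult.left_commute)
      finally have "g j = (\<Sum>i\<in>XX. \<alpha> i * g i) + \<beta> * g x"
        using g0 by (simp add: \<beta>_def b_def h_def field_simps)
      moreover have "(\<Sum>i\<in>XX. (if i = x then \<beta> else \<alpha> i) * g i) = (\<Sum>i\<in>XX. \<alpha> i * g i)"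
        using insert.hyps by (intro sum.cong) auto
      ultimately show ?thesis using insert.hyps by simp
    qed
    thus ?thesis by (intro exI[of _ "\<lambda>i. if i = x then \<beta> else \<alpha> i"] ballI)
  qed
qed

lemma interpolate_if_annihilated:
  assumes "finite XX" "lin_closed G"
    and "\<And>\<alpha>. \<forall>g\<in>G. (\<Sum>i\<in>XX. \<alpha> i * g i) = 0 \<Longrightarrow> (\<Sum>i\<in>XX. \<alpha> i * \<chi> i) = 0"
  shows "\<exists>g\<in>G. \<forall>i\<in>XX. g i = \<chi> i"
  using assms
proof (induction XX arbitrary: \<chi> rule: finite_induct)
  case empty
  thus ?case by (auto simp: lin_closed_def)
next
  case (insert x XX)
  have "(\<Sum>i\<in>XX. \<alpha> i * \<chi> i) = 0" if "\<forall>g\<in>G. (\<Sum>i\<in>XX. \<alpha> i * g i) = 0" for \<alpha>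
  proof -
    let ?\<alpha> = "\<lambda>i. if i = x then 0 else \<alpha> i"
    have s: "(\<Sum>i\<in>insert x XX. ?\<alpha> i * h i) = (\<Sum>i\<in>XX. \<alpha> i * h i)" for h
    proof -
      have "(\<Sum>i\<in>XX. ?\<alpha> i * h i) = (\<Sum>i\<in>XX. \<alpha> i * h i)"
        using insert.hyps by (intro sum.cong) auto
      thus ?thesis using insert.hyps by simp
    qed
    show ?thesis using insert.prems(2)[of ?\<alpha>] that by (simp only: s)
  qed
  then obtain g where g: "g \<in> G" "\<forall>i\<in>XX. g i = \<chi> i"
    using insert.IH[OF insert.prems(1)] by blast
  show ?case
  proof (cases "\<forall>g\<in>G. (\<forall>i\<in>XX. g i = 0) \<longrightarrow> g x = 0")
    case True
    then obtain \<alpha> where \<alpha>: "\<forall>g\<in>G. g x = (\<Sum>i\<in>XX. \<alpha> i * g i)"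
      using coordinate_dependent[OF insert.hyps(1) insert.prems(1)] by blast
    let ?\<alpha> = "\<lambda>i. if i = x then -1 else \<alpha> i"
    have s: "(\<Sum>i\<in>insert x XX. ?\<alpha> i * h i) = (\<Sum>i\<in>XX. \<alpha> i * h i) - h x" for h
    proof -
      have "(\<Sum>i\<in>XX. ?\<alpha> i * h i) = (\<Sum>i\<in>XX. \<alpha> i * h i)"
        using insert.hyps by (intro sum.cong) auto
      thus ?thesis using insert.hyps by simp
    qed
    have "(\<Sum>i\<in>XX. \<alpha> i * \<chi> i) - \<chi> x = 0"
      using insert.prems(2)[of ?\<alpha>] \<alpha> by (simp only: s) simp
    moreover have "g x = (\<Sum>i\<in>XX. \<alpha> i * \<chi> i)" using \<alpha> g by auto
    ultimately show ?thesis using g by auto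
  next
    case False
    then obtain h where h: "h \<in> G" "\<forall>i\<in>XX. h i = 0" "h x \<noteq> 0" by auto
    let ?g = "\<lambda>i. g i + ((\<chi> x - g x) / h x) * h i"
    have "?g \<in> G" by (rule lin_closed_combine[OF insert.prems(1) g(1) h(1)])
    moreover have "\<forall>i\<in>insert x XX. ?g i = \<chi> i" using g h by auto
    ultimately show ?thesis by (intro bexI[of _ ?g])
  qed
qed

lemma finite_spanning_set:
  assumes "finite XX" "lin_closed G"
  shows "\<exists>F. finite F \<and> F \<subseteq> G \<and> (\<forall>g\<in>G. \<exists>c. \<forall>x\<in>XX. g x = (\<Sum>f\<in>F. c f * f x))"
  using assms
proof (induction XX rule: finite_induct)
  case empty
  thus ?case by auto
next
  case (insert x XX)
  then obtain F where F: "finite F" "F \<subseteq> G" "\<And>g. g \<in> G \<Longrightarrow> \<exists>c. \<forall>x\<in>XX. g x = (\<Sum>f\<in>F. c f * f x)"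
    using insert.IH[OF insert.prems] by auto
  show ?case
  proof (cases "\<forall>g\<in>G. (\<forall>i\<in>XX. g i = 0) \<longrightarrow> g x = 0")
    case True
    then obtain \<alpha> where \<alpha>: "\<forall>g\<in>G. g x = (\<Sum>i\<in>XX. \<alpha> i * g i)"
      using coordinate_dependent[OF insert.hyps(1) insert.prems(1)] by blast
    have "\<exists>c. \<forall>y\<in>insert x XX. g y = (\<Sum>f\<in>F. c f * f y)" if g: "g \<in> G" for g
    proof -
      obtain c where c: "\<forall>x\<in>XX. g x = (\<Sum>f\<in>F. c f * f x)" using F(3)[OF g] by blast
      have "g x = (\<Sum>i\<in>XX. \<alpha> i * (\<Sum>f\<in>F. c f * f i))" using \<alpha> g c by auto
      also have "\<dots> = (\<Sum>f\<in>F. c f * (\<Sum>i\<in>XX. \<alpha> i * f i))"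
        by (simp add: sum_distrib_left algebra_simps) (rule sum.swap)
      also have "\<dots> = (\<Sum>f\<in>F. c f * f x)" using \<alpha> F by (intro sum.cong) auto
      finally show ?thesis using c by auto
    qed
    thus ?thesis using F(1,2) by (intro exI[of _ F] conjI ballI) auto
  next
    case False
    then obtain h where h: "h \<in> G" "\<forall>i\<in>XX. h i = 0" "h x \<noteq> 0" by auto
    have "\<exists>c. \<forall>y\<in>insert x XX. g y = (\<Sum>f\<in>insert h F. c f * f y)" if g: "g \<in> G" for g
    proof -
      obtain c where c: "\<forall>x\<in>XX. g x = (\<Sum>f\<in>F. c f * f x)" using F(3)[OF g] by blast
      define e where "e = (g x - (\<Sum>f\<in>F. c f * f x)) / h x"
      define c' where "c' f = (if f \<in> F then c f else 0) + (if f = h then e else 0)" for f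
      have "(\<Sum>f\<in>insert h F. c' f * f y) = (\<Sum>f\<in>F. c f * f y) + e * h y" for y
      proof -
        have "(\<Sum>f\<in>insert h F. c' f * f y)
          = (\<Sum>f\<in>insert h F. (if f \<in> F then c f * f y else 0)) + (\<Sum>f\<in>insert h F. (if f = h then e * h y else 0))"
          by (simp only: sum.distrib[symmetric]) (intro sum.cong, auto simp: c'_def algebra_simps)
        also have "(\<Sum>f\<in>insert h F. (if f \<in> F then c f * f y else 0)) = (\<Sum>f\<in>F. c f * f y)"
          using F(1) by (intro sum.mono_neutral_cong_right) auto
        also have "(\<Sum>f\<in>insert h F. (if f = h then e * h y else 0)) = e * h y"
          using F(1) by simp
        finally show ?thesis .
      qed
      thus ?thesis using c h by (intro exI[of _ c']) (auto simp: e_def)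
    qed
    thus ?thesis using F(1,2) h(1) by (intro exI[of _ "insert h F"] conjI ballI) auto
  qed
qed

section \<open>Forms and homogeneous components\<close>

abbreviation (input) "lookup \<equiv> Poly_Mapping.lookup"
abbreviation (input) "single \<equiv> Poly_Mapping.single"
abbreviation (input) "keys \<equiv> Poly_Mapping.keys"

abbreviation cst :: "'k \<Rightarrow> ('v::finite, 'k::field) mpoly"
  where "cst c \<equiv> single 0 c"

abbreviation (input) V :: "('v::finite, 'k::field) mpoly set"
  where "V \<equiv> forms 1"

definition mdeg :: "('v::finite \<Rightarrow>\<^sub>0 nat) \<Rightarrow> nat"
  where "mdeg m = (\<Sum>v\<in>UNIV. lookup m v)"

definition pvar :: "'v \<Rightarrow> ('v::finite, 'k::field) mpoly"
  where "pvar v = single (single v 1) 1"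

lemma mdeg_add: "mdeg (m + m') = mdeg m + mdeg m'"
  by (simp add: mdeg_def lookup_add sum.distrib)

lemma mdeg_0 [simp]: "mdeg 0 = 0"
  by (simp add: mdeg_def)

lemma mdeg_single [simp]: "mdeg (single v e) = e"
  by (simp add: mdeg_def lookup_single when_def)

lemma mdeg_eq_0_iff: "mdeg m = 0 \<longleftrightarrow> m = 0"
  by (simp add: mdeg_def poly_mapping_eq_iff fun_eq_iff)

lemma forms_iff: "p \<in> forms d \<longleftrightarrow> (\<forall>m. lookup p m \<noteq> 0 \<longrightarrow> mdeg m = d)"
  unfolding forms_def mdeg_def in_keys_iff Ball_def mem_Collect_eq ..

lemma forms_0 [simp]: "0 \<in> forms d"
  by (simp add: forms_iff)

lemma forms_add [intro]: "p \<in> forms d \<Longrightarrow> q \<in> forms d \<Longrightarrow> p + q \<in> forms d"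
  unfolding forms_iff lookup_add by (metis add.right_neutral)

lemma forms_uminus [intro]: "p \<in> forms d \<Longrightarrow> - p \<in> forms d"
  by (auto simp: forms_iff)

lemma forms_diff [intro]: "p \<in> forms d \<Longrightarrow> q \<in> forms d \<Longrightarrow> p - q \<in> forms d"
  using forms_add[of p d "-q"] forms_uminus[of q d] by simp

lemma forms_mult: "p \<in> forms d \<Longrightarrow> q \<in> forms e \<Longrightarrow> p * q \<in> forms (d + e)"
proof -
  assume p: "p \<in> forms d" and q: "q \<in> forms e"
  have "mdeg m = d + e" if m: "m \<in> keys (p * q)" for m
  proof -
    obtain a b where "a \<in> keys p" "b \<in> keys q" "m = a + b"
      using subsetD[OF keys_mult m] by auto
    thus ?thesis using p q by (auto simp: forms_def mdeg_def lookup_add sum.distrib)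
  qed
  thus ?thesis by (auto simp: forms_def mdeg_def)
qed

lemma cst_in_forms [simp]: "cst c \<in> forms 0"
  by (auto simp: forms_iff lookup_single when_def)

lemma one_in_forms [simp]: "1 \<in> forms 0"
  using cst_in_forms[of 1] by simp

lemma forms_cst_mult [intro]: "p \<in> forms d \<Longrightarrow> cst c * p \<in> forms d"
  using forms_mult[of "cst c" 0 p d] by simp

lemma forms_mult_eq: "p \<in> forms d \<Longrightarrow> q \<in> forms e \<Longrightarrow> n = d + e \<Longrightarrow> p * q \<in> forms n"
  using forms_mult by blast

lemma forms_power: "p \<in> forms d \<Longrightarrow> p ^ n \<in> forms (d * n)"
  by (induction n) (auto intro: forms_mult_eq)

lemma forms_sum: "(\<And>i. i \<in> A \<Longrightarrow> f i \<in> forms d) \<Longrightarrow> sum f A \<in> forms d"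
  by (induction A rule: infinite_finite_induct) auto

lemma pvar_in_forms [simp]: "pvar v \<in> V"
  by (auto simp: forms_iff pvar_def lookup_single when_def split: if_splits)

lemma cst_add: "cst (a + b) = cst a + cst b"
  by (simp add: single_add)

lemma cst_mult: "cst (a * b) = cst a * cst b"
  by (simp add: mult_single)

lemma cst_uminus: "cst (- a) = - cst a"
  by (simp add: single_uminus)

lemma cst_diff: "cst (a - b) = cst a - cst b"
  by (simp add: single_diff)

lemma cst_sum: "cst (sum f A) = (\<Sum>i\<in>A. cst (f i))"
  by (induction A rule: infinite_finite_induct) (auto simp: cst_add)

lemma cst_eq_0_iff [simp]: "cst c = 0 \<longleftrightarrow> c = 0"
  by (metis lookup_single_eq lookup_zero single_zero)

lemma cst_inverse: "c \<noteq> 0 \<Longrightarrow> cst (inverse c) * cst c = 1"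
  by (simp add: mult_single)

lemma lookup_cst_mult [simp]: "lookup (cst c * p) m = c * lookup p m"
  by (simp add: mult_map_scale_conv_mult[symmetric] Poly_Mapping.map.rep_eq when_def)

lemma poly_expand: "p = (\<Sum>m\<in>keys p. cst (lookup p m) * single m 1)"
proof (rule poly_mapping_eqI)
  fix k
  show "lookup p k = lookup (\<Sum>m\<in>keys p. cst (lookup p m) * single m 1) k"
  proof (cases "k \<in> keys p")
    case True
    hence "(\<Sum>m\<in>keys p. lookup p m * (1 when m = k)) = lookup p k"
      by (simp add: when_def if_distrib[of "\<lambda>x. _ * x"] sum.delta cong: if_cong)
    thus ?thesis by (simp add: lookup_sum lookup_single)
  next
    case False
    hence "(\<Sum>m\<in>keys p. lookup p m * (1 when m = k)) = 0"
      by (intro sum.neutral) (auto simp: when_def)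
    thus ?thesis using False by (simp add: lookup_sum lookup_single in_keys_iff)
  qed
qed

lemma finite_monomials: "finite {m :: 'v::finite \<Rightarrow>\<^sub>0 nat. mdeg m \<le> d}"
proof -
  have "lookup ` {m :: 'v \<Rightarrow>\<^sub>0 nat. mdeg m \<le> d} \<subseteq> (UNIV :: 'v set) \<rightarrow>\<^sub>E {..d}"
  proof (clarsimp simp: PiE_def Pi_def)
    fix m :: "'v \<Rightarrow>\<^sub>0 nat" and v assume "mdeg m \<le> d"
    moreover have "lookup m v \<le> mdeg m"
      unfolding mdeg_def by (rule member_le_sum) auto
    ultimately show "lookup m v \<le> d" by simp
  qed
  moreover have "finite ((UNIV :: 'v set) \<rightarrow>\<^sub>E {..d})" by (intro finite_PiE) auto
  ultimately have "finite (lookup ` {m :: 'v \<Rightarrow>\<^sub>0 nat. mdeg m \<le> d})"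
    by (rule finite_subset)
  moreover have "inj_on lookup {m :: 'v \<Rightarrow>\<^sub>0 nat. mdeg m \<le> d}"
    by (intro inj_onI poly_mapping_eqI) simp
  ultimately show ?thesis by (rule finite_imageD)
qed

lemma forms_0_iff: "p \<in> forms 0 \<longleftrightarrow> (\<exists>c. p = cst c)"
proof
  assume p: "p \<in> forms 0"
  have "p = cst (lookup p 0)"
    using p by (intro poly_mapping_eqI) (auto simp: forms_iff lookup_single when_def mdeg_eq_0_iff)
  thus "\<exists>c. p = cst c" by blast
qed auto

text \<open>
Each monomial of positive degree is divisible by a variable.
\<close>

lemma forms_Suc_induct [consumes 1, case_names zero add mult]:
  assumes "p \<in> forms (Suc d)"
    and "P 0"
    and add: "\<And>p q. p \<in> forms (Suc d) \<Longrightarrow> q \<in> forms (Suc d) \<Longrightarrow> P p \<Longrightarrow> P q \<Longrightarrow> P (p + q)"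
    and mult: "\<And>x q. x \<in> V \<Longrightarrow> q \<in> forms d \<Longrightarrow> P (x * q)"
  shows "P p"
proof -
  have "P (cst (lookup p m) * single m 1) \<and>
     cst (lookup p m) * single m 1 \<in> forms (Suc d)"
    if m: "m \<in> keys p" for m
  proof -
    have deg: "mdeg m = Suc d" using m assms(1) by (auto simp: forms_iff in_keys_iff)
    hence "m \<noteq> 0" by auto
    then obtain v where "lookup m v \<noteq> 0"
      using poly_mapping_eqI[of m 0] by auto
    hence eq: "m = single v 1 + (m - single v 1)"
      by (intro poly_mapping_eqI) (auto simp: lookup_add lookup_minus lookup_single when_def)
    have "mdeg (single v 1 + (m - single v 1)) = Suc d"
      using eq deg by simp
    hence d: "mdeg (m - single v 1) = d" by (simp add: mdeg_add)
    have e: "cst c * single m 1 = pvar v * single (m - single v 1) c" for c :: 'b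
      using eq by (simp add: pvar_def mult_single)
    have f: "single (m - single v 1) c \<in> forms d" for c :: 'b
      using d by (auto simp: forms_iff lookup_single when_def)
    have "pvar v * single (m - single v 1) c \<in> forms (Suc d)" for c :: 'b
      by (rule forms_mult_eq[OF pvar_in_forms f]) simp
    thus ?thesis unfolding e using mult[OF pvar_in_forms f] by blast
  qed
  note t = this
  have "A \<subseteq> keys p \<Longrightarrow> P (\<Sum>m\<in>A. cst (lookup p m) * single m 1) \<and>
    (\<Sum>m\<in>A. cst (lookup p m) * single m 1) \<in> forms (Suc d)"
    if "finite A" for A
    using that
  proof (induction A)
    case (insert m A)
    thus ?case using t[of m] by (auto intro!: add forms_add)
  qed (use assms(2) in auto)
  from this[OF finite_keys order_refl] show ?thesis
    unfolding poly_expand[of p, symmetric] by simp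
qed

definition coord :: "('v::finite, 'k::field) mpoly \<Rightarrow> 'v \<Rightarrow> 'k"
  where "coord p v = lookup p (single v 1)"

lemma coord_add [simp]: "coord (p + q) v = coord p v + coord q v"
  by (simp add: coord_def lookup_add)

lemma coord_0 [simp]: "coord 0 v = 0"
  by (simp add: coord_def)

lemma coord_cst_mult [simp]: "coord (cst c * p) v = c * coord p v"
  by (simp add: coord_def)

lemma coord_diff [simp]: "coord (p - q) v = coord p v - coord q v"
  by (simp add: coord_def lookup_minus)

lemma coord_sum: "coord (sum f A) v = (\<Sum>i\<in>A. coord (f i) v)"
  by (induction A rule: infinite_finite_induct) auto

lemma coord_pvar [simp]: "coord (pvar w) v = (if v = w then 1 else 0)"
proof -
  have "single w (1::nat) = single v 1 \<longleftrightarrow> v = w"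
    by (metis lookup_single_eq lookup_single_not_eq one_neq_zero)
  thus ?thesis by (simp add: coord_def pvar_def lookup_single when_def)
qed

lemma mdeg_1E:
  assumes "mdeg m = 1" shows "\<exists>v. m = single v 1"
proof -
  have "m \<noteq> 0" using assms by auto
  then obtain v where "lookup m v \<noteq> 0"
    using poly_mapping_eqI[of m 0] by auto
  hence eq: "m = single v 1 + (m - single v 1)"
    by (intro poly_mapping_eqI) (auto simp: lookup_add lookup_minus lookup_single when_def)
  have "mdeg (single v 1 + (m - single v 1)) = 1"
    using eq assms by simp
  hence "m - single v 1 = 0" by (simp add: mdeg_add mdeg_eq_0_iff)
  thus ?thesis using eq by (metis add.right_neutral)
qed

lemma forms_1_eqI: "p \<in> V \<Longrightarrow> q \<in> V \<Longrightarrow> (\<And>v. coord p v = coord q v) \<Longrightarrow> p = q"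
  by (intro poly_mapping_eqI) (metis coord_def forms_iff mdeg_1E)

lemma forms_1_expand: 
  assumes "p \<in> V" shows "p = (\<Sum>v\<in>UNIV. cst (coord p v) * pvar v)"
proof (rule forms_1_eqI[OF assms])
  show "(\<Sum>v\<in>UNIV. cst (coord p v) * pvar v) \<in> V"
    by (intro forms_sum forms_cst_mult) simp
qed (simp add: coord_sum mult_delta_right)

definition hcomp :: "nat \<Rightarrow> ('v::finite, 'k::field) mpoly \<Rightarrow> ('v, 'k) mpoly"
  where "hcomp d p = Poly_Mapping.Abs_poly_mapping (\<lambda>m. lookup p m when mdeg m = d)"

lemma lookup_hcomp [simp]:
  "lookup (hcomp d p) m = (if mdeg m = d then lookup p m else 0)"
proof -
  have "finite {m. (lookup p m when mdeg m = d) \<noteq> 0}"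
    by (rule finite_subset[OF _ finite_keys[of p]]) (auto simp: in_keys_iff when_def)
  thus ?thesis by (simp add: hcomp_def when_def)
qed

lemma hcomp_in_forms [simp]: "hcomp d p \<in> forms d"
  by (auto simp: forms_iff)

lemma hcomp_0 [simp]: "hcomp d 0 = 0"
  by (intro poly_mapping_eqI) auto

lemma hcomp_add: "hcomp d (p + q) = hcomp d p + hcomp d q"
  by (intro poly_mapping_eqI) (auto simp: lookup_add)

lemma hcomp_diff: "hcomp d (p - q) = hcomp d p - hcomp d q"
  by (intro poly_mapping_eqI) (auto simp: lookup_minus)

lemma hcomp_sum: "hcomp d (sum f A) = (\<Sum>i\<in>A. hcomp d (f i))"
  by (induction A rule: infinite_finite_induct) (auto simp: hcomp_add)

lemma hcomp_cst_mult: "hcomp d (cst c * p) = cst c * hcomp d p"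
  by (intro poly_mapping_eqI) auto

lemma hcomp_form: "p \<in> forms d \<Longrightarrow> hcomp e p = (if e = d then p else 0)"
  by (intro poly_mapping_eqI) (auto simp: forms_iff)

lemma hcomp_eventually_0: "\<exists>K. \<forall>d\<ge>K. hcomp d p = 0"
proof -
  have "finite (mdeg ` keys p)" by simp
  then obtain K where K: "\<forall>d\<in>mdeg ` keys p. d < K"
    by (metis finite_nat_set_iff_bounded)
  have "hcomp d p = 0" if "d \<ge> K" for d
  proof (rule poly_mapping_eqI)
    fix m
    have "m \<notin> keys p" if "mdeg m = d" using K \<open>d \<ge> K\<close> that by auto
    thus "lookup (hcomp d p) m = lookup 0 m"
      by (simp add: in_keys_iff)
  qed
  thus ?thesis by blast
qed

lemma hcomp_decompose:
  assumes "\<And>d. d \<ge> K \<Longrightarrow> hcomp d p = 0"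
  shows "p = (\<Sum>d<K. hcomp d p)"
proof (rule poly_mapping_eqI)
  fix m
  have "lookup p m = 0" if "mdeg m \<ge> K"
    using arg_cong[OF assms[OF that], of "\<lambda>q. lookup q m"] by simp
  thus "lookup p m = lookup (\<Sum>d<K. hcomp d p) m"
    by (auto simp: lookup_sum sum.delta)
qed

lemma hcomp_eqI: 
  assumes "\<And>d. hcomp d p = hcomp d q" shows "p = q"
proof (rule poly_mapping_eqI)
  fix m
  show "lookup p m = lookup q m"
    using arg_cong[OF assms[of "mdeg m"], of "\<lambda>q. lookup q m"] by simp
qed

lemma hcomp_form_mult:
  assumes "p \<in> forms d"
  shows "hcomp e (p * q) = (if d \<le> e then p * hcomp (e - d) q else 0)"
proof -
  obtain K where K: "\<forall>d\<ge>K. hcomp d q = 0" using hcomp_eventually_0 by blast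
  have "q = (\<Sum>i<K. hcomp i q)" using K by (intro hcomp_decompose) auto
  hence "p * q = (\<Sum>i<K. p * hcomp i q)" by (metis sum_distrib_left)
  hence "hcomp e (p * q) = (\<Sum>i<K. hcomp e (p * hcomp i q))" by (simp add: hcomp_sum)
  also have "\<dots> = (\<Sum>i<K. if e = d + i then p * hcomp i q else 0)"
    using forms_mult[OF assms hcomp_in_forms] by (intro sum.cong) (auto simp: hcomp_form)
  also have "\<dots> = (if d \<le> e then p * hcomp (e - d) q else 0)"
  proof (cases "d \<le> e")
    case True
    hence "(\<Sum>i<K. if e = d + i then p * hcomp i q else 0) = (\<Sum>i<K. if i = e - d then p * hcomp (e - d) q else 0)"
      by (intro sum.cong) auto
    also have "\<dots> = p * hcomp (e - d) q" using K by (auto simp: sum.delta)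
    finally show ?thesis using True by simp
  qed (auto intro: sum.neutral)
  finally show ?thesis .
qed

lemma hcomp_mult: "hcomp e (p * q) = (\<Sum>i\<le>e. hcomp i p * hcomp (e - i) q)"
proof -
  obtain K where K: "\<forall>d\<ge>K. hcomp d p = 0" using hcomp_eventually_0 by blast
  define L where "L = max K (Suc e)"
  have "p = (\<Sum>i<L. hcomp i p)" using K by (intro hcomp_decompose) (auto simp: L_def)
  hence "p * q = (\<Sum>i<L. hcomp i p * q)" by (metis sum_distrib_right)
  hence "hcomp e (p * q) = (\<Sum>i<L. hcomp e (hcomp i p * q))" by (simp add: hcomp_sum)
  also have "\<dots> = (\<Sum>i<L. if i \<le> e then hcomp i p * hcomp (e - i) q else 0)"
    by (intro sum.cong) (auto simp: hcomp_form_mult[OF hcomp_in_forms])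
  also have "\<dots> = (\<Sum>i\<le>e. hcomp i p * hcomp (e - i) q)"
    by (rule sum.mono_neutral_cong_right) (auto simp: L_def)
  finally show ?thesis .
qed

section \<open>Homogeneous ideals\<close>

text \<open>
  Ideals of the type of polynomials, so that congruences can be checked by the ring normalizer.
  The lemmas \<open>comb1\<close>, \<open>comb2\<close> and \<open>comb3\<close> derive a membership from an explicit combination of
  known members.
\<close>

locale poly_ideal =
  fixes I :: "('v::finite, 'k::field) mpoly set"
  assumes zero [simp]: "0 \<in> I"
    and add: "p \<in> I \<Longrightarrow> q \<in> I \<Longrightarrow> p + q \<in> I"
    and mult: "p \<in> I \<Longrightarrow> q * p \<in> I"
begin

lemma mult_right: "p \<in> I \<Longrightarrow> p * q \<in> I"
  using mult[of p q] by (simp add: mult.commute)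

lemma uminus: "p \<in> I \<Longrightarrow> - p \<in> I"
  using mult[of p "-1"] by simp

lemma diff: "p \<in> I \<Longrightarrow> q \<in> I \<Longrightarrow> p - q \<in> I"
  using add[of p "-q"] uminus[of q] by simp

lemma sum: "(\<And>i. i \<in> A \<Longrightarrow> f i \<in> I) \<Longrightarrow> Groups_Big.sum f A \<in> I"
  by (induction A rule: infinite_finite_induct) (auto intro: add)

lemma comb1: "e \<in> I \<Longrightarrow> x = a * e \<Longrightarrow> x \<in> I"
  by (simp add: mult)

lemma comb2: "e \<in> I \<Longrightarrow> e' \<in> I \<Longrightarrow> x = a * e + b * e' \<Longrightarrow> x \<in> I"
  by (simp add: mult add)

lemma comb3: "e \<in> I \<Longrightarrow> e' \<in> I \<Longrightarrow> e'' \<in> I \<Longrightarrow> x = a * e + b * e' + c * e'' \<Longrightarrow> x \<in> I"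
  by (simp add: mult add)

lemma cong_sym: "p - q \<in> I \<Longrightarrow> q - p \<in> I"
  using uminus[of "p - q"] by simp

lemma cong_trans: "p - q \<in> I \<Longrightarrow> q - s \<in> I \<Longrightarrow> p - s \<in> I"
  using add[of "p - q" "q - s"] by simp

lemma cong_add: "p - q \<in> I \<Longrightarrow> p' - q' \<in> I \<Longrightarrow> (p + p') - (q + q') \<in> I"
  using add[of "p - q" "p' - q'"] by (simp add: algebra_simps)

lemma cong_mem: "p - q \<in> I \<Longrightarrow> q \<in> I \<Longrightarrow> p \<in> I"
  using add[of "p - q" q] by simp

lemma cst_cancel: "c \<noteq> 0 \<Longrightarrow> cst c * p \<in> I \<Longrightarrow> p \<in> I"
  using mult[of "cst c * p" "cst (inverse c)"] by (simp add: mult.assoc[symmetric] cst_inverse)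

end

locale homogeneous_ideal = poly_ideal +
  assumes hcomp_mem: "p \<in> I \<Longrightarrow> hcomp d p \<in> I"
begin

lemma memI: 
  assumes "\<And>d. hcomp d p \<in> I" shows "p \<in> I"
proof -
  obtain K where "\<forall>d\<ge>K. hcomp d p = 0" using hcomp_eventually_0 by blast
  hence "p = (\<Sum>d<K. hcomp d p)" by (intro hcomp_decompose) auto
  thus ?thesis using sum[of "{..<K}" "\<lambda>d. hcomp d p"] assms by auto
qed

end

lemma poly_ideal_sum:
  assumes "poly_ideal I1" "poly_ideal I2" shows "poly_ideal {a + b | a b. a \<in> I1 \<and> b \<in> I2}"
proof -
  interpret A: poly_ideal I1 by fact
  interpret B: poly_ideal I2 by fact
  show ?thesis
  proof
    show "0 \<in> {a + b | a b. a \<in> I1 \<and> b \<in> I2}" using A.zero B.zero by (metis (mono_tags, lifting) add_0 mem_Collect_eq)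
    fix p q assume p: "p \<in> {a + b | a b. a \<in> I1 \<and> b \<in> I2}"
    then obtain a b where ab: "p = a + b" "a \<in> I1" "b \<in> I2" by auto
    show "q * p \<in> {a + b | a b. a \<in> I1 \<and> b \<in> I2}"
      using ab A.mult[of a q] B.mult[of b q] by (auto simp: distrib_left)
    assume "q \<in> {a + b | a b. a \<in> I1 \<and> b \<in> I2}"
    then obtain a' b' where ab': "q = a' + b'" "a' \<in> I1" "b' \<in> I2" by auto
    have "p + q = (a + a') + (b + b')" using ab ab' by (simp add: algebra_simps)
    thus "p + q \<in> {a + b | a b. a \<in> I1 \<and> b \<in> I2}"
      using ab ab' A.add[of a a'] B.add[of b b'] by blast
  qed
qed

lemma homogeneous_ideal_sum:
  assumes "homogeneous_ideal I1" "homogeneous_ideal I2"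
  shows "homogeneous_ideal {a + b | a b. a \<in> I1 \<and> b \<in> I2}"
proof -
  interpret A: homogeneous_ideal I1 by fact
  interpret B: homogeneous_ideal I2 by fact
  interpret S: poly_ideal "{a + b | a b. a \<in> I1 \<and> b \<in> I2}"
    by (rule poly_ideal_sum) unfold_locales
  show ?thesis
    by unfold_locales (use A.hcomp_mem B.hcomp_mem in \<open>fastforce simp: hcomp_add\<close>)
qed

lemma poly_ideal_add_principal:
  assumes "poly_ideal I" shows "poly_ideal {p. \<exists>y. p - g * y \<in> I}"
proof -
  interpret A: poly_ideal I by fact
  show ?thesis
  proof
    show "0 \<in> {p. \<exists>y. p - g * y \<in> I}" by (auto intro!: exI[of _ 0])
    fix p q assume p: "p \<in> {p. \<exists>y. p - g * y \<in> I}"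
    then obtain y where y: "p - g * y \<in> I" by auto
    hence "q * p - g * (q * y) \<in> I" by (rule A.comb1[where a = q]) (simp add: algebra_simps)
    thus "q * p \<in> {p. \<exists>y. p - g * y \<in> I}" by blast
    assume "q \<in> {p. \<exists>y. p - g * y \<in> I}"
    then obtain z where "q - g * z \<in> I" by auto
    with y have "p + q - g * (y + z) \<in> I"
      by (rule A.comb2[where a = 1 and b = 1]) (simp add: algebra_simps)
    thus "p + q \<in> {p. \<exists>y. p - g * y \<in> I}" by blast
  qed
qed

section \<open>Bases and bilinear forms\<close>

lemma forms_mult_1: "x \<in> V \<Longrightarrow> q \<in> forms d \<Longrightarrow> x * q \<in> forms (Suc d)"
  by (rule forms_mult_eq[of x 1 q d]) auto

lemma forms_mult_1_1: "x \<in> V \<Longrightarrow> y \<in> V \<Longrightarrow> x * y \<in> forms 2"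
  by (rule forms_mult_eq[of x 1 y 1]) auto

lemma forms_power_1: "x \<in> V \<Longrightarrow> x ^ m \<in> forms m"
  using forms_power[of x 1 m] by simp

lemma forms_subset_Suc:
  fixes I :: "('v::finite, 'k::field) mpoly set"
  assumes "poly_ideal I" "forms m \<subseteq> I" shows "forms (Suc m) \<subseteq> I"
proof
  interpret poly_ideal I by fact
  fix p :: "('v, 'k) mpoly" assume "p \<in> forms (Suc m)"
  thus "p \<in> I"
    by (induction rule: forms_Suc_induct) (use assms(2) in \<open>auto intro: add mult\<close>)
qed

lemma forms_subset_mono:
  assumes "poly_ideal I" "forms m \<subseteq> I" "m \<le> n" shows "forms n \<subseteq> I"
  using assms(3)
proof (induction rule: dec_induct)
  case (step n)
  thus ?case using forms_subset_Suc[OF assms(1)] by blast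
qed (use assms in auto)

definition bilinear :: "(('v::finite, 'k::field) mpoly \<Rightarrow> ('v, 'k) mpoly \<Rightarrow> 'k) \<Rightarrow> bool"
  where "bilinear B \<longleftrightarrow> (\<forall>x\<in>V. \<forall>y\<in>V. \<forall>z\<in>V. \<forall>c.
    B (x + cst c * y) z = B x z + c * B y z \<and> B z (x + cst c * y) = B z x + c * B z y)"

definition nondegenerate_form :: "(('v::finite, 'k::field) mpoly \<Rightarrow> ('v, 'k) mpoly \<Rightarrow> 'k) \<Rightarrow> bool"
  where "nondegenerate_form B \<longleftrightarrow> (\<forall>x\<in>V. (\<forall>y\<in>V. B x y = 0) \<longrightarrow> x = 0)"

definition balanced :: "('v::finite, 'k::field) mpoly set \<Rightarrow> (('v, 'k) mpoly \<Rightarrow> ('v, 'k) mpoly \<Rightarrow> 'k) \<Rightarrow> bool"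
  where "balanced I B \<longleftrightarrow> (\<forall>x\<in>V. \<forall>y\<in>V. \<forall>z\<in>V. \<forall>w\<in>V.
    x * y - z * w \<in> I \<longrightarrow> B x y = B z w)"

lemma bilinearD:
  assumes "bilinear B" "x \<in> V" "y \<in> V" "z \<in> V"
  shows "B (x + cst c * y) z = B x z + c * B y z" "B z (x + cst c * y) = B z x + c * B z y"
    "B (x + y) z = B x z + B y z" "B z (x + y) = B z x + B z y"
    "B (x - y) z = B x z - B y z" "B z (x - y) = B z x - B z y"
    "B (cst c * x) z = c * B x z" "B z (cst c * x) = c * B z x"
    "B 0 z = 0" "B z 0 = 0"
proof -
  have 1: "B (x + cst c * y) z = B x z + c * B y z" "B z (x + cst c * y) = B z x + c * B z y"
    if "x \<in> V" "y \<in> V" for x y c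
    using assms(1,4) that by (auto simp: bilinear_def)
  show 2: "B 0 z = 0" "B z 0 = 0"
    using 1[of 0 0 "-1"] by simp_all
  show "B (x + cst c * y) z = B x z + c * B y z" "B z (x + cst c * y) = B z x + c * B z y"
    using 1[of x y c] assms by blast+
  show "B (x + y) z = B x z + B y z" "B z (x + y) = B z x + B z y"
    using 1[of x y 1] assms by simp_all
  show "B (x - y) z = B x z - B y z" "B z (x - y) = B z x - B z y"
    using 1[of x y "-1"] assms by (simp_all add: single_uminus)
  show "B (cst c * x) z = c * B x z" "B z (cst c * x) = c * B z x"
    using 1[of 0 x c] assms 2 by simp_all
qed

lemma bilinear_sum_right:
  assumes "bilinear B" "z \<in> V" "\<And>i. i \<in> A \<Longrightarrow> f i \<in> V"
  shows "B z (\<Sum>i\<in>A. f i) = (\<Sum>i\<in>A. B z (f i))"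
  using assms(3)
  by (induction A rule: infinite_finite_induct)
    (auto simp: bilinearD[OF assms(1) _ _ assms(2)] bilinearD(9,10)[OF assms(1,2,2,2)] forms_sum)

lemma balanced_sym: "balanced I B \<Longrightarrow> poly_ideal I \<Longrightarrow> x \<in> V \<Longrightarrow> y \<in> V \<Longrightarrow> B x y = B y x"
proof -
  assume "balanced I B" "poly_ideal I" "x \<in> V" "y \<in> V"
  moreover have "x * y - y * x = 0" by simp
  ultimately show ?thesis unfolding balanced_def by (metis poly_ideal.zero)
qed

text \<open>
  The vectors \<open>(B x x\<^sub>i)\<^sub>i\<close> form a subspace of \<open>k\<^sup>n\<close>. An equation \<open>\<alpha>\<close> satisfied by all of them says that
  \<open>\<Sum> \<alpha>\<^sub>i x\<^sub>i\<close> is orthogonal to everything, hence zero; so every vector of \<open>k\<^sup>n\<close> is of this form.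
\<close>

lemma represent_functional:
  assumes B: "bilinear B" "nondegenerate_form B"
    and sym: "\<And>x y. x \<in> V \<Longrightarrow> y \<in> V \<Longrightarrow> B x y = B y x"
    and \<chi>: "\<And>x y c. x \<in> V \<Longrightarrow> y \<in> V \<Longrightarrow> \<chi> (x + cst c * y) = \<chi> x + c * (\<chi> y :: 'k::field)"
  shows "\<exists>x\<in>V. \<forall>y\<in>(V :: ('v::finite, 'k) mpoly set). B x y = \<chi> y"
proof -
  define G where "G = {(\<lambda>v. B x (pvar v)) | x. x \<in> (V :: ('v, 'k) mpoly set)}"
  have "lin_closed G"
    unfolding lin_closed_def
  proof (intro conjI ballI allI)
    show "G \<noteq> {}" using forms_0 unfolding G_def by blast
    fix g h a assume "g \<in> G" "h \<in> G"
    then obtain x y where xy: "x \<in> V" "y \<in> V" "g = (\<lambda>v. B x (pvar v))" "h = (\<lambda>v. B y (pvar v))"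
      by (auto simp: G_def)
    hence "(\<lambda>i. g i + a * h i) = (\<lambda>v. B (x + cst a * y) (pvar v))"
      using bilinearD(1)[OF B(1) xy(1,2) pvar_in_forms] by auto
    moreover have "x + cst a * y \<in> V" using xy by auto
    ultimately show "(\<lambda>i. g i + a * h i) \<in> G" unfolding G_def by blast
  qed
  moreover have "(\<Sum>i\<in>UNIV. \<alpha> i * \<chi> (pvar i)) = 0" if \<alpha>: "\<forall>g\<in>G. (\<Sum>i\<in>UNIV. \<alpha> i * g i) = 0" for \<alpha>
  proof -
    define y where "y = (\<Sum>i\<in>UNIV. cst (\<alpha> i) * pvar i)"
    have y: "y \<in> V" unfolding y_def by (intro forms_sum forms_cst_mult) simp
    have "B y x = 0" if x: "x \<in> V" for x
    proof -
      have "B y x = B x y" using sym[OF x y] by simp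
      also have "\<dots> = (\<Sum>i\<in>UNIV. B x (cst (\<alpha> i) * pvar i))" unfolding y_def
        by (rule bilinear_sum_right[OF B(1) x]) (intro forms_cst_mult, simp)
      also have "\<dots> = (\<Sum>i\<in>UNIV. \<alpha> i * B x (pvar i))"
        using bilinearD(8)[OF B(1) pvar_in_forms pvar_in_forms x] by simp
      also have "\<dots> = 0" using \<alpha> x by (auto simp: G_def)
      finally show ?thesis .
    qed
    hence "y = 0" using B(2) y by (auto simp: nondegenerate_form_def)
    hence "\<alpha> v = 0" for v using arg_cong[of y 0 "\<lambda>p. coord p v"]
      unfolding y_def coord_sum by (simp add: mult_delta_right)
    thus ?thesis by simp
  qed
  ultimately obtain g where "g \<in> G" "\<forall>i\<in>UNIV. g i = \<chi> (pvar i)"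
    using interpolate_if_annihilated[of UNIV G "\<lambda>i. \<chi> (pvar i)"] by auto
  then obtain x where x: "x \<in> V" "\<And>i. B x (pvar i) = \<chi> (pvar i)" by (auto simp: G_def)
  have "B x y = \<chi> y" if y: "y \<in> V" for y
  proof -
    have \<chi>0: "\<chi> 0 = 0" using \<chi>[of 0 0 "-1"] by simp
    have \<chi>s: "\<chi> (\<Sum>i\<in>A. cst (c i) * pvar i) = (\<Sum>i\<in>A. c i * \<chi> (pvar i))" for A :: "'v set" and c
    proof (induction A rule: infinite_finite_induct)
      case (insert i A)
      thus ?case using \<chi>[of "\<Sum>i\<in>A. cst (c i) * pvar i" "pvar i" "c i"]
        by (simp add: forms_sum forms_cst_mult add.commute)
    qed (auto simp: \<chi>0)
    have "B x y = (\<Sum>i\<in>UNIV. B x (cst (coord y i) * pvar i))"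
      by (subst forms_1_expand[OF y], rule bilinear_sum_right[OF B(1) x(1)]) (intro forms_cst_mult, simp)
    also have "\<dots> = (\<Sum>i\<in>UNIV. coord y i * B x (pvar i))"
      using bilinearD(8)[OF B(1) pvar_in_forms pvar_in_forms x(1)] by simp
    also have "\<dots> = \<chi> (\<Sum>i\<in>UNIV. cst (coord y i) * pvar i)" by (simp add: \<chi>s x)
    also have "\<dots> = \<chi> y" by (simp only: forms_1_expand[OF y, symmetric])
    finally show ?thesis .
  qed
  with x(1) show ?thesis by blast
qed

text \<open>
  The ideal of a basis: \<open>v\<close> vanishes at no point, and \<open>V\<close> is the space of sections of \<open>O(1)\<close>. The
  last assumption says that \<open>x y / v\<close> is again in \<open>V\<close>, from which the same follows in all degrees.
\<close>

locale basis_ideal = homogeneous_ideal I for I :: "('v::finite, 'k::field) mpoly set" +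
  fixes v :: "('v, 'k) mpoly"
  assumes v_form: "v \<in> V"
    and v_nzd: "v * p \<in> I \<Longrightarrow> p \<in> I"
    and linear_mem: "x \<in> V \<Longrightarrow> x \<in> I \<Longrightarrow> x = 0"
    and quadric: "p \<in> forms 2 \<Longrightarrow> \<exists>x\<in>V. p - v * x \<in> I"
begin

lemma v_power_nzd: "v ^ m * p \<in> I \<Longrightarrow> p \<in> I"
  by (induction m) (auto simp: mult.assoc dest: v_nzd)

lemma one_notin: "1 \<notin> I"
proof
  assume "1 \<in> I"
  hence "pvar undefined \<in> I" using mult[of 1 "pvar undefined"] by simp
  hence "(pvar undefined :: ('v, 'k) mpoly) = 0" by (intro linear_mem) auto
  thus False using coord_pvar[of undefined undefined] by (metis coord_0 one_neq_zero)
qed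

lemma v_power_notin: "v ^ m \<notin> I"
  using v_power_nzd[of m 1] one_notin by auto

lemma v_power_form: "v ^ m \<in> forms m"
  by (rule forms_power_1[OF v_form])

lemma red_exists:
  "p \<in> forms (Suc m) \<Longrightarrow> \<exists>x\<in>V. p - v ^ m * x \<in> I"
proof (induction m arbitrary: p)
  case 0
  thus ?case by (intro bexI[of _ p]) (auto simp: One_nat_def)
next
  case (Suc m)
  from Suc.prems show ?case
  proof (induction rule: forms_Suc_induct)
    case zero
    show ?case by (intro bexI[of _ 0]) auto
  next
    case (add p q)
    then obtain x y where xy: "p - v ^ Suc m * x \<in> I" "q - v ^ Suc m * y \<in> I" "x \<in> V" "y \<in> V"
      by blast
    have "p + q - v ^ Suc m * (x + y) \<in> I"
      by (rule comb2[OF xy(1,2), of _ 1 1]) (simp add: algebra_simps)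
    thus ?case using xy(3,4) by blast
  next
    case (mult y q)
    then obtain x where x: "x \<in> V" "q - v ^ m * x \<in> I" using Suc.IH by blast
    then obtain z where z: "z \<in> V" "y * x - v * z \<in> I"
      using quadric[OF forms_mult_1_1[OF mult(1) x(1)]] by blast
    have "y * q - v ^ Suc m * z \<in> I"
      by (rule comb2[OF x(2) z(2), of _ y "v ^ m"]) (simp add: algebra_simps)
    thus ?case using z by blast
  qed
qed

lemma red_unique:
  assumes "x \<in> V" "y \<in> V" "p - v ^ m * x \<in> I" "p - v ^ m * y \<in> I"
  shows "x = y"
proof -
  have "v ^ m * (x - y) \<in> I"
    by (rule comb2[OF assms(3,4), of _ "-1" 1]) (simp add: algebra_simps)
  hence "x - y \<in> I" by (rule v_power_nzd)
  hence "x - y = 0" using assms by (intro linear_mem) auto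
  thus ?thesis by simp
qed

text \<open>
The section \<open>p / v\<^sup>m\<close> of \<open>O(1)\<close>, as a linear form.
\<close>

definition red :: "nat \<Rightarrow> ('v, 'k) mpoly \<Rightarrow> ('v, 'k) mpoly"
  where "red m p = (SOME x. x \<in> V \<and> p - v ^ m * x \<in> I)"

lemma red:
  assumes "p \<in> forms (Suc m)"
  shows "red m p \<in> V" "p - v ^ m * red m p \<in> I"
proof -
  have "red m p \<in> V \<and> p - v ^ m * red m p \<in> I"
    unfolding red_def using red_exists[OF assms] by (rule someI2_bex) auto
  thus "red m p \<in> V" "p - v ^ m * red m p \<in> I" by auto
qed

lemma red_eqI:
  assumes "x \<in> V" "p - v ^ m * x \<in> I" "p \<in> forms (Suc m)" shows "red m p = x"
  using red_unique[OF red(1)[OF assms(3)] assms(1) red(2)[OF assms(3)] assms(2)] .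

lemma red_linear:
  assumes "p \<in> forms (Suc m)" "q \<in> forms (Suc m)"
  shows "red m (p + cst c * q) = red m p + cst c * red m q"
proof (rule red_eqI)
  show "red m p + cst c * red m q \<in> V" using red(1) assms by auto
  show "p + cst c * q \<in> forms (Suc m)" using assms by auto
  show "p + cst c * q - v ^ m * (red m p + cst c * red m q) \<in> I"
    by (rule comb2[OF red(2)[OF assms(1)] red(2)[OF assms(2)], of _ 1 "cst c"]) (simp add: algebra_simps)
qed

lemma red_eq_0_iff: "p \<in> forms (Suc m) \<Longrightarrow> red m p = 0 \<longleftrightarrow> p \<in> I"
  using red(2)[of p m] red_eqI[of 0 p m] by auto

lemma red_cong:
  assumes "p \<in> forms (Suc m)" "q \<in> forms (Suc m)" "p - q \<in> I"
  shows "red m p = red m q"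
  by (rule red_eqI[OF red(1)[OF assms(2)] cong_trans[OF assms(3) red(2)[OF assms(2)]] assms(1)])

text \<open>
  A balanced form is a functional on the quadrics modulo \<open>I\<close>; \<open>v\<close> serves only to compute it.
\<close>

definition quad_functional :: "(('v, 'k) mpoly \<Rightarrow> ('v, 'k) mpoly \<Rightarrow> 'k) \<Rightarrow> ('v, 'k) mpoly \<Rightarrow> 'k"
  where "quad_functional B p = B v (red 1 p)"

lemma forms_2_Suc: "p \<in> forms 2 \<Longrightarrow> p \<in> forms (Suc 1)"
  by (simp add: numeral_2_eq_2 One_nat_def)

lemma quad_functional_linear:
  assumes "bilinear B" "p \<in> forms 2" "q \<in> forms 2"
  shows "quad_functional B (p + cst c * q) = quad_functional B p + c * quad_functional B q"
  unfolding quad_functional_def red_linear[OF forms_2_Suc[OF assms(2)] forms_2_Suc[OF assms(3)]]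
  by (rule bilinearD(2)[OF assms(1) red(1) red(1) v_form]) (rule forms_2_Suc[OF assms(2)] forms_2_Suc[OF assms(3)])+

lemma quad_functional_mult:
  assumes "balanced I B" "x \<in> V" "y \<in> V"
  shows "quad_functional B (x * y) = B x y"
proof -
  have xy: "x * y \<in> forms (Suc 1)" by (rule forms_2_Suc[OF forms_mult_1_1[OF assms(2,3)]])
  show ?thesis unfolding quad_functional_def
    using assms red[OF xy] v_form unfolding balanced_def by (metis power_one_right)
qed

lemma quad_functional_mem:
  assumes "bilinear B" "p \<in> forms 2" "p \<in> I" shows "quad_functional B p = 0"
proof -
  have "red 1 p = 0" using red_eq_0_iff[OF forms_2_Suc[OF assms(2)]] assms(3) by simp
  thus ?thesis by (simp add: quad_functional_def bilinearD(10)[OF assms(1) v_form v_form v_form])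
qed

end

lemma forms_2_induct [consumes 1, case_names zero add mult]:
  assumes "p \<in> forms 2" "P 0"
    and "\<And>p q. p \<in> forms 2 \<Longrightarrow> q \<in> forms 2 \<Longrightarrow> P p \<Longrightarrow> P q \<Longrightarrow> P (p + q)"
    and "\<And>x y. x \<in> V \<Longrightarrow> y \<in> V \<Longrightarrow> P (x * y)"
  shows "P p"
proof -
  have 2: "(2::nat) = Suc 1" by simp
  show ?thesis using assms unfolding 2 by (rule forms_Suc_induct)
qed

lemma sums_commute: "{a + b |a b. a \<in> A \<and> b \<in> B} = {a + b |a b. a \<in> B \<and> b \<in> A}"
  for A B :: "'a::ab_semigroup_add set"
proof -
  have "{a + b |a b. a \<in> A \<and> b \<in> B} \<subseteq> {a + b |a b. a \<in> B \<and> b \<in> A}" for A B :: "'a set"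
  proof
    fix x assume "x \<in> {a + b |a b. a \<in> A \<and> b \<in> B}"
    then obtain a b where "x = b + a" "a \<in> A" "b \<in> B" by (auto simp: add.commute)
    thus "x \<in> {a + b |a b. a \<in> B \<and> b \<in> A}" by blast
  qed
  thus ?thesis by blast
qed

locale two_bases = P: basis_ideal I1 v1 + Q: basis_ideal I2 v2
  for I1 I2 :: "('v::finite, 'k::field) mpoly set" and v1 v2 +
  fixes N :: nat
  assumes disjoint: "forms N \<subseteq> {a + b | a b. a \<in> I1 \<and> b \<in> I2}"
begin

definition J :: "('v, 'k) mpoly set"
  where "J = {a + b | a b. a \<in> I1 \<and> b \<in> I2}"

sublocale J: homogeneous_ideal J
  unfolding J_def by (rule homogeneous_ideal_sum) unfold_locales

lemma swap: "two_bases I2 I1 v2 v1 N"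
proof
  have "{a + b |a b. a \<in> I2 \<and> b \<in> I1} = {a + b |a b. a \<in> I1 \<and> b \<in> I2}"
    by (rule sums_commute)
  thus "forms N \<subseteq> {a + b |a b. a \<in> I2 \<and> b \<in> I1}" using disjoint by simp
qed

lemma J_swap: "two_bases.J I2 I1 = J"
  unfolding J_def two_bases.J_def[OF swap] by (rule sums_commute)

lemma I1_subset_J: "p \<in> I1 \<Longrightarrow> p \<in> J"
  unfolding J_def using Q.zero by (metis (mono_tags, lifting) add.right_neutral mem_Collect_eq)

lemma I2_subset_J: "p \<in> I2 \<Longrightarrow> p \<in> J"
  unfolding J_def using P.zero by (metis (mono_tags, lifting) add_0 mem_Collect_eq)

lemma J_split:
  assumes "p \<in> J" "p \<in> forms m"
  obtains a b where "p = a + b" "a \<in> I1" "b \<in> I2" "a \<in> forms m" "b \<in> forms m"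
proof -
  obtain a b where ab: "p = a + b" "a \<in> I1" "b \<in> I2" using assms by (auto simp: J_def)
  have "p = hcomp m p" using hcomp_form[OF assms(2), of m] by simp
  also have "\<dots> = hcomp m a + hcomp m b" by (simp add: ab hcomp_add)
  finally show ?thesis using that ab P.hcomp_mem Q.hcomp_mem hcomp_in_forms by blast
qed

lemma forms_subset_J: "m \<ge> N \<Longrightarrow> forms m \<subseteq> J"
  using forms_subset_mono[OF J.poly_ideal_axioms, of N m] disjoint by (simp add: J_def)

lemma linear_mem_J: "x \<in> V \<Longrightarrow> x \<in> J \<Longrightarrow> x = 0"
proof -
  assume x: "x \<in> V" "x \<in> J"
  then obtain a b where "x = a + b" "a \<in> I1" "b \<in> I2" "a \<in> V" "b \<in> V"
    using J_split by blast
  thus ?thesis using P.linear_mem[of a] Q.linear_mem[of b] by simp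
qed

lemma chinese_remainder:
  assumes "p \<in> forms m" "q \<in> forms m" "N \<le> m"
  shows "\<exists>s\<in>forms m. s - p \<in> I1 \<and> s - q \<in> I2"
proof -
  have "p \<in> J" "q \<in> J" using forms_subset_J assms by auto
  obtain a b where ab: "p = a + b" "a \<in> I1" "b \<in> I2" "a \<in> forms m" "b \<in> forms m"
    using J_split[OF \<open>p \<in> J\<close> assms(1)] by blast
  obtain a' b' where ab': "q = a' + b'" "a' \<in> I1" "b' \<in> I2" "a' \<in> forms m" "b' \<in> forms m"
    using J_split[OF \<open>q \<in> J\<close> assms(2)] by blast
  have "a' + b - p \<in> I1" using P.diff[OF ab'(2) ab(2)] ab by simp
  moreover have "a' + b - q \<in> I2" using Q.diff[OF ab(3) ab'(3)] ab' by simp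
  moreover have "a' + b \<in> forms m" using ab ab' by blast
  ultimately show ?thesis by blast
qed

text \<open>
  Two disjoint bases span at least a line: if \<open>V\<close> consisted of the multiples of \<open>y\<close>, then every
  form would be a multiple of a power of \<open>y\<close>, and \<open>J\<close> could not contain all forms of large degree
  without one of the two ideals being everything.
\<close>

lemma not_all_multiples:
  fixes y :: "('v, 'k) mpoly"
  assumes "y \<in> V"
  obtains x where "x \<in> V" "\<And>c. x \<noteq> cst c * y"
proof -
  have False if all: "\<And>x. x \<in> V \<Longrightarrow> \<exists>c. x = cst c * y"
  proof -
    have powers: "\<exists>c. p = cst c * y ^ m" if "p \<in> forms m" for p m
      using that
    proof (induction m arbitrary: p)
      case 0
      thus ?case by (auto simp: forms_0_iff)
    next
      case (Suc m)
      from Suc.prems show ?case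
      proof (induction rule: forms_Suc_induct)
        case zero
        show ?case by (intro exI[of _ 0]) simp
      next
        case (add p q)
        thus ?case by (metis cst_add distrib_right)
      next
        case (mult x q)
        then obtain c c' where "x = cst c * y" "q = cst c' * y ^ m" using all Suc.IH by metis
        hence "x * q = cst (c * c') * y ^ Suc m" by (simp add: cst_mult algebra_simps)
        thus ?case by blast
      qed
    qed
    obtain c1 c2 where c: "v1 = cst c1 * y" "v2 = cst c2 * y" using all P.v_form Q.v_form by blast
    have nzd1: "y ^ m \<notin> I1" for m
    proof
      assume "y ^ m \<in> I1"
      hence "cst c1 ^ m * y ^ m \<in> I1" by (rule P.mult)
      thus False using P.v_power_notin[of m] by (simp add: c power_mult_distrib)
    qed
    have nzd2: "y ^ m \<notin> I2" for m
    proof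
      assume "y ^ m \<in> I2"
      hence "cst c2 ^ m * y ^ m \<in> I2" by (rule Q.mult)
      thus False using Q.v_power_notin[of m] by (simp add: c power_mult_distrib)
    qed
    have yN: "y ^ N \<in> forms N" by (rule forms_power_1[OF assms])
    hence "y ^ N \<in> J" using forms_subset_J by auto
    then obtain a b where ab: "y ^ N = a + b" "a \<in> I1" "b \<in> I2" "a \<in> forms N" "b \<in> forms N"
      using J_split yN by blast
    obtain c where cc: "a = cst c * y ^ N" using powers[OF ab(4)] by blast
    obtain c' where cc': "b = cst c' * y ^ N" using powers[OF ab(5)] by blast
    have "c = 0" using P.cst_cancel[of c "y ^ N"] nzd1[of N] ab(2) unfolding cc by blast
    moreover have "c' = 0" using Q.cst_cancel[of c' "y ^ N"] nzd2[of N] ab(3) unfolding cc' by blast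
    ultimately have "y ^ N = 0" using ab(1) cc cc' by simp
    thus False using nzd1[of N] P.zero by simp
  qed
  thus ?thesis using that by blast
qed

text \<open>A form balanced for both bases is a functional on the quadrics modulo \<open>J\<close>.\<close>

lemma quad_functional_eq:
  assumes "bilinear B" "balanced I1 B" "balanced I2 B" "p \<in> forms 2"
  shows "P.quad_functional B p = Q.quad_functional B p"
  using assms(4)
proof (induction rule: forms_2_induct)
  case zero
  show ?case using P.quad_functional_mem[OF assms(1), of 0] Q.quad_functional_mem[OF assms(1), of 0] by simp
next
  case (add p q)
  thus ?case using P.quad_functional_linear[OF assms(1), of p q 1] Q.quad_functional_linear[OF assms(1), of p q 1]
    by simp
next
  case (mult x y)
  thus ?case using P.quad_functional_mult Q.quad_functional_mult assms by metis
qed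

lemma quad_functional_J:
  assumes "bilinear B" "balanced I1 B" "balanced I2 B" "p \<in> forms 2" "p \<in> J"
  shows "P.quad_functional B p = 0"
proof -
  obtain a b where ab: "p = a + b" "a \<in> I1" "b \<in> I2" "a \<in> forms 2" "b \<in> forms 2"
    using J_split assms by blast
  thus ?thesis
    using P.quad_functional_linear[OF assms(1), of a b 1] P.quad_functional_mem[OF assms(1), of a]
      Q.quad_functional_mem[OF assms(1), of b] quad_functional_eq[OF assms(1-3), of b] by simp
qed

text \<open>
  Write \<open>q\<close> as \<open>v2\<^sup>a\<^sup>-\<^sup>2 x0\<close> modulo \<open>I2\<close>. As \<open>q\<close> is in \<open>I1\<close>, the products of \<open>x0\<close> with forms of degree
  \<open>a - 1\<close> are in \<open>J\<close>. Since \<open>J\<close> has no socle below degree \<open>a\<close>, this descends to forms of lower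
  degree, down to \<open>x0\<close> itself; but no nonzero linear form lies in \<open>J\<close>.
\<close>

lemma graph_in_degree_below_socle:
  assumes a: "2 \<le> a"
    and soc: "\<And>p j. p \<in> forms j \<Longrightarrow> j < a \<Longrightarrow> (\<And>x. x \<in> V \<Longrightarrow> x * p \<in> J) \<Longrightarrow> p \<in> J"
    and q: "q \<in> forms (a - 1)" "q \<in> I1"
  shows "q \<in> I2"
proof -
  have e: "a - 1 = Suc (a - 2)" using a by simp
  define x0 where "x0 = Q.red (a - 2) q"
  have x0: "x0 \<in> V" "q - v2 ^ (a - 2) * x0 \<in> I2"
    using Q.red[of q "a - 2"] q e by (auto simp: x0_def)
  have "i \<le> a - 1 \<Longrightarrow> u \<in> forms (a - 1 - i) \<Longrightarrow> x0 * u \<in> J" for i u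
  proof (induction i arbitrary: u)
    case 0
    hence u: "u \<in> forms (Suc (a - 2))" using e by simp
    define y where "y = Q.red (a - 2) u"
    have y: "y \<in> V" "u - v2 ^ (a - 2) * y \<in> I2"
      using Q.red[OF u] by (auto simp: y_def)
    have "x0 * u - q * y \<in> I2"
      by (rule Q.comb2[OF x0(2) y(2), of _ "-y" x0]) (simp add: algebra_simps)
    hence "x0 * u - q * y \<in> J" by (rule I2_subset_J)
    moreover have "q * y \<in> J" using I1_subset_J P.mult_right q by blast
    ultimately show ?case by (rule J.cong_mem)
  next
    case (Suc i)
    hence e': "a - 1 - i = Suc (a - 1 - Suc i)" by simp
    have "x0 * u \<in> forms (Suc (a - 1 - Suc i))" by (rule forms_mult_1[OF x0(1) Suc.prems(2)])
    moreover have "x * (x0 * u) \<in> J" if "x \<in> V" for x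
    proof -
      have "x * u \<in> forms (a - 1 - i)" unfolding e' by (rule forms_mult_1[OF that Suc.prems(2)])
      hence "x0 * (x * u) \<in> J" using Suc by simp
      thus ?thesis by (simp add: algebra_simps)
    qed
    moreover have "Suc (a - 1 - Suc i) < a" using Suc.prems(1) a by simp
    ultimately show ?case using soc by blast
  qed
  from this[of "a - 1" 1] have "x0 \<in> J" by simp
  hence "x0 = 0" using x0 by (intro linear_mem_J)
  thus ?thesis using x0(2) by simp
qed

text \<open>
  If the two ideals had the same quadrics, then \<open>v1\<close> would serve both bases with the same values
  \<open>p / v1\<^sup>m\<close>, so they would agree in all degrees; disjointness would then put a power of \<open>v1\<close>
  into \<open>I2\<close>.
\<close>

lemma quadrics_differ:
  assumes eq: "\<And>q. q \<in> forms 2 \<Longrightarrow> q \<in> I1 \<longleftrightarrow> q \<in> I2"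
  shows False
proof -
  have quad: "\<exists>x\<in>V. p - v1 * x \<in> I1 \<and> p - v1 * x \<in> I2" if p: "p \<in> forms 2" for p
  proof -
    obtain x where x: "x \<in> V" "p - v1 * x \<in> I1" using P.quadric[OF p] by blast
    hence "p - v1 * x \<in> forms 2" using p forms_mult_1_1[OF P.v_form x(1)] by auto
    with x eq show ?thesis by blast
  qed
  have common: "\<exists>x\<in>V. p - v1 ^ m * x \<in> I1 \<and> p - v1 ^ m * x \<in> I2" if "p \<in> forms (Suc m)" for p m
    using that
  proof (induction m arbitrary: p)
    case 0
    thus ?case by (intro bexI[of _ p]) (auto simp: One_nat_def)
  next
    case (Suc m)
    from Suc.prems show ?case
    proof (induction rule: forms_Suc_induct)
      case zero
      show ?case by (intro bexI[of _ 0]) auto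
    next
      case (add p q)
      then obtain x y where xy: "x \<in> V" "y \<in> V"
        "p - v1 ^ Suc m * x \<in> I1" "q - v1 ^ Suc m * y \<in> I1" "p - v1 ^ Suc m * x \<in> I2" "q - v1 ^ Suc m * y \<in> I2"
        by blast
      have "p + q - v1 ^ Suc m * (x + y) \<in> I1"
        by (rule P.comb2[OF xy(3,4), of _ 1 1]) (simp add: algebra_simps)
      moreover have "p + q - v1 ^ Suc m * (x + y) \<in> I2"
        by (rule Q.comb2[OF xy(5,6), of _ 1 1]) (simp add: algebra_simps)
      ultimately show ?case using xy by blast
    next
      case (mult y q)
      then obtain x where x: "x \<in> V" "q - v1 ^ m * x \<in> I1" "q - v1 ^ m * x \<in> I2" using Suc.IH by blast
      then obtain z where z: "z \<in> V" "y * x - v1 * z \<in> I1" "y * x - v1 * z \<in> I2"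
        using quad[OF forms_mult_1_1[OF mult(1) x(1)]] by blast
      have "y * q - v1 ^ Suc m * z \<in> I1"
        by (rule P.comb2[OF x(2) z(2), of _ y "v1 ^ m"]) (simp add: algebra_simps)
      moreover have "y * q - v1 ^ Suc m * z \<in> I2"
        by (rule Q.comb2[OF x(3) z(3), of _ y "v1 ^ m"]) (simp add: algebra_simps)
      ultimately show ?case using z by blast
    qed
  qed
  obtain w where w: "w \<in> V" "v2 * v2 - v1 * w \<in> I2"
    using quad[OF forms_mult_1_1[OF Q.v_form Q.v_form]] by blast
  have v1_nzd: "p \<in> I2" if "v1 * p \<in> I2" for p
  proof -
    have "v2 ^ 2 * p \<in> I2"
      by (rule Q.comb2[OF w(2) that, of _ p w]) (simp add: algebra_simps power2_eq_square)
    thus ?thesis by (rule Q.v_power_nzd)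
  qed
  have v1_pow: "v1 ^ m * p \<in> I2 \<Longrightarrow> p \<in> I2" for m p
    by (induction m) (auto simp: mult.assoc dest: v1_nzd)
  have f: "v1 ^ Suc N \<in> forms (Suc N)" by (rule P.v_power_form)
  hence "v1 ^ Suc N \<in> J" using forms_subset_J[of "Suc N"] by auto
  then obtain a b where ab: "v1 ^ Suc N = a + b" "a \<in> I1" "b \<in> I2" "a \<in> forms (Suc N)"
    using J_split f by blast
  obtain x where x: "x \<in> V" "a - v1 ^ N * x \<in> I1" "a - v1 ^ N * x \<in> I2"
    using common[OF ab(4)] by blast
  have "v1 ^ N * x \<in> I1" by (rule P.comb2[OF x(2) ab(2), of _ "-1" 1]) simp
  hence "x = 0" using P.v_power_nzd P.linear_mem x by blast
  hence "v1 ^ Suc N \<in> I2" using x ab Q.add by simp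
  hence "1 \<in> I2" using v1_pow[of "Suc N" 1] by simp
  thus False using Q.one_notin by blast
qed

text \<open>
  Let \<open>a\<close> be the largest degree in which \<open>J\<close> is not everything. By hypothesis the forms of degree
  \<open>a\<close> are one-dimensional modulo \<open>J\<close> and make up the whole socle. Here \<open>a = 1\<close> would make \<open>V\<close>
  one-dimensional, and \<open>a \<ge> 3\<close> would give the two bases the same quadrics. So \<open>a = 2\<close>, the
  form is the multiplication \<open>V \<times> V \<rightarrow> (S/J)\<^sub>2\<close>, and its nondegeneracy says that there is no socle in
  degree 1.
\<close>

theorem form_from_simple_socle:
  assumes soc: "\<And>p q. (\<And>x. x \<in> V \<Longrightarrow> x * p \<in> J) \<Longrightarrow> (\<And>x. x \<in> V \<Longrightarrow> x * q \<in> J) \<Longrightarrow>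
     p \<in> J \<or> (\<exists>c. q - cst c * p \<in> J)"
  shows "\<exists>B. bilinear B \<and> nondegenerate_form B \<and> balanced I1 B \<and> balanced I2 B \<and>
    (\<forall>B'. bilinear B' \<and> balanced I1 B' \<and> balanced I2 B' \<longrightarrow>
       (\<exists>c. \<forall>x\<in>V. \<forall>y\<in>V. B' x y = c * B x y))"
proof -
  have x0: "(pvar undefined :: ('v, 'k) mpoly) \<noteq> 0"
    using coord_pvar[of undefined undefined] by (metis coord_0 one_neq_zero)
  hence not1: "\<not> V \<subseteq> J" using linear_mem_J pvar_in_forms by blast
  have bound: "m < N" if "\<not> forms m \<subseteq> J" for m using forms_subset_J[of m] that by force
  define a where "a = Max {m. \<not> forms m \<subseteq> J}"
  have fin: "finite {m. \<not> forms m \<subseteq> J}"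
    by (rule finite_subset[of _ "{..<N}"]) (use bound in auto)
  have "a \<in> {m. \<not> forms m \<subseteq> J}" unfolding a_def by (rule Max_in[OF fin]) (use not1 in auto)
  then obtain p0 where p0: "p0 \<in> forms a" "p0 \<notin> J" by blast
  have above: "forms m \<subseteq> J" if "m > a" for m
    using Max_ge[OF fin, of m] that unfolding a_def by auto
  have a1: "a \<ge> 1" using above[of 1] not1 by force
  have p0soc: "x * p0 \<in> J" if "x \<in> V" for x
    using forms_mult_1[OF that p0(1)] above[of "Suc a"] by auto
  have socle: "p \<in> J" if p: "p \<in> forms j" "j < a" "\<And>x. x \<in> V \<Longrightarrow> x * p \<in> J" for p j
  proof -
    obtain c where c: "p - cst c * p0 \<in> J" using soc[OF p0soc p(3)] p0 by blast
    have "hcomp j (p - cst c * p0) = p"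
      using p p0 by (simp add: hcomp_diff hcomp_cst_mult hcomp_form)
    thus ?thesis using J.hcomp_mem[OF c, of j] by simp
  qed
  have top: "\<exists>c. p - cst c * p0 \<in> J" if "p \<in> forms a" for p
  proof -
    have "x * p \<in> J" if "x \<in> V" for x
      using forms_mult_1[OF that \<open>p \<in> forms a\<close>] above[of "Suc a"] by auto
    thus ?thesis using soc[OF p0soc, of p] p0 by blast
  qed
  have "a \<noteq> 1"
  proof
    assume "a = 1"
    obtain x where x: "x \<in> V" "\<And>c. x \<noteq> cst c * p0"
      using not_all_multiples p0 \<open>a = 1\<close> by blast
    obtain c where "x - cst c * p0 \<in> J" using top x \<open>a = 1\<close> by blast
    hence "x - cst c * p0 = 0" using p0 x \<open>a = 1\<close> by (intro linear_mem_J) auto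
    thus False using x by simp
  qed
  have "\<not> a \<ge> 3"
  proof
    assume a3: "a \<ge> 3"
    have sub: "q \<in> I2" if "q \<in> forms 2" "q \<in> I1" for q
    proof -
      have f: "v2 ^ (a - 3) * q \<in> forms (a - 1)"
        by (rule forms_mult_eq[OF Q.v_power_form that(1)]) (use a3 in simp)
      have "v2 ^ (a - 3) * q \<in> I2"
      proof (rule graph_in_degree_below_socle[of a])
        show "p \<in> J" if "p \<in> forms j" "j < a" "\<And>x. x \<in> V \<Longrightarrow> x * p \<in> J" for p j
          by (rule socle[OF that])
      qed (use a3 in simp, rule f, rule P.mult[OF that(2)])
      thus ?thesis by (rule Q.v_power_nzd)
    qed
    interpret S: two_bases I2 I1 v2 v1 N by (rule swap)
    have sub': "q \<in> I1" if "q \<in> forms 2" "q \<in> I2" for q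
    proof -
      have f: "v1 ^ (a - 3) * q \<in> forms (a - 1)"
        by (rule forms_mult_eq[OF P.v_power_form that(1)]) (use a3 in simp)
      have "v1 ^ (a - 3) * q \<in> I1"
      proof (rule S.graph_in_degree_below_socle[of a])
        show "p \<in> S.J" if "p \<in> forms j" "j < a" "\<And>x. x \<in> V \<Longrightarrow> x * p \<in> S.J" for p j
          using socle that unfolding J_swap by blast
      qed (use a3 in simp, rule f, rule Q.mult[OF that(2)])
      thus ?thesis by (rule P.v_power_nzd)
    qed
    show False using quadrics_differ sub sub' by blast
  qed
  with a1 \<open>a \<noteq> 1\<close> have a2: "a = 2" by simp
  define \<beta> where "\<beta> p = (SOME c. p - cst c * p0 \<in> J)" for p
  have \<beta>: "p - cst (\<beta> p) * p0 \<in> J" if "p \<in> forms 2" for p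
    unfolding \<beta>_def using top that a2 by (metis (mono_tags) someI_ex)
  have \<beta>_unique: "c = c'" if "p - cst c * p0 \<in> J" "p - cst c' * p0 \<in> J" for p c c'
  proof (rule ccontr)
    assume "c \<noteq> c'"
    have "cst (c - c') * p0 \<in> J"
      by (rule J.comb2[OF that, of _ "-1" 1]) (simp add: algebra_simps cst_diff)
    thus False using p0 J.cst_cancel[of "c - c'" p0] \<open>c \<noteq> c'\<close> by simp
  qed
  have \<beta>_eqI: "\<beta> p = c" if "p \<in> forms 2" "p - cst c * p0 \<in> J" for p c
    using \<beta>_unique[OF \<beta>[OF that(1)] that(2)] .
  have \<beta>_linear: "\<beta> (p + cst c * q) = \<beta> p + c * \<beta> q" if "p \<in> forms 2" "q \<in> forms 2" for p q c
  proof (rule \<beta>_eqI)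
    show "p + cst c * q \<in> forms 2" using that by blast
    show "p + cst c * q - cst (\<beta> p + c * \<beta> q) * p0 \<in> J"
      by (rule J.comb2[OF \<beta>[OF that(1)] \<beta>[OF that(2)], of _ 1 "cst c"])
        (simp add: algebra_simps cst_add cst_mult)
  qed
  have \<beta>_J: "\<beta> p = \<beta> q" if "p \<in> forms 2" "q \<in> forms 2" "p - q \<in> J" for p q
    by (rule \<beta>_eqI[OF that(1) J.cong_trans[OF that(3) \<beta>[OF that(2)]]])
  define B where "B x y = \<beta> (x * y)" for x y
  have bil: "bilinear B"
    unfolding bilinear_def
  proof (intro ballI allI conjI)
    fix x y z :: "('v, 'k) mpoly" and c :: 'k
    assume xyz: "x \<in> V" "y \<in> V" "z \<in> V"
    have "(x + cst c * y) * z = x * z + cst c * (y * z)" "z * (x + cst c * y) = z * x + cst c * (z * y)"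
      by (simp_all add: algebra_simps)
    thus "B (x + cst c * y) z = B x z + c * B y z" "B z (x + cst c * y) = B z x + c * B z y"
      unfolding B_def using \<beta>_linear[OF forms_mult_1_1[OF xyz(1,3)] forms_mult_1_1[OF xyz(2,3)], of c]
        \<beta>_linear[OF forms_mult_1_1[OF xyz(3,1)] forms_mult_1_1[OF xyz(3,2)], of c] by simp_all
  qed
  have bal: "balanced I1 B" "balanced I2 B"
    unfolding balanced_def B_def
    by (intro ballI impI \<beta>_J forms_mult_1_1 I1_subset_J I2_subset_J; assumption)+
  have nd: "nondegenerate_form B"
    unfolding nondegenerate_form_def
  proof (intro ballI impI)
    fix x :: "('v, 'k) mpoly" assume x: "x \<in> V" "\<forall>y\<in>V. B x y = 0"
    have "y * x \<in> J" if y: "y \<in> V" for y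
    proof -
      have "\<beta> (x * y) = 0" using x(2) y by (simp add: B_def)
      thus ?thesis using \<beta>[OF forms_mult_1_1[OF x(1) y]] by (simp add: mult.commute)
    qed
    hence "x \<in> J" by (intro socle[OF x(1)]) (use a2 in auto)
    thus "x = 0" using x by (intro linear_mem_J)
  qed
  have uniq: "\<exists>c. \<forall>x\<in>V. \<forall>y\<in>V. B' x y = c * B x y"
    if B': "bilinear B'" "balanced I1 B'" "balanced I2 B'" for B'
  proof -
    have "\<exists>x0\<in>V. \<exists>y0\<in>V. x0 * y0 \<notin> J"
    proof (rule ccontr)
      assume "\<not> ?thesis"
      hence J: "x * y \<in> J" if "x \<in> V" "y \<in> V" for x y using that by blast
      have "p0 \<in> forms 2" using p0 a2 by simp
      hence "p0 \<in> J"
        by (induction rule: forms_2_induct) (auto intro: J J.add)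
      thus False using p0 by simp
    qed
    then obtain x0 y0 where xy0: "x0 \<in> V" "y0 \<in> V" "x0 * y0 \<notin> J" by blast
    have B0: "B x0 y0 \<noteq> 0" using \<beta>[OF forms_mult_1_1[OF xy0(1,2)]] xy0(3) by (auto simp: B_def)
    have "B' x y = B' x0 y0 / B x0 y0 * B x y" if xy: "x \<in> V" "y \<in> V" for x y
    proof -
      define \<gamma> where "\<gamma> = B x y / B x0 y0"
      have 1: "x * y - cst (B x y) * p0 \<in> J" "x0 * y0 - cst (B x0 y0) * p0 \<in> J"
        unfolding B_def using \<beta> forms_mult_1_1 xy xy0 by blast+
      have eq: "cst (B x y) = cst \<gamma> * cst (B x0 y0)" using B0 by (simp add: cst_mult[symmetric] \<gamma>_def)
      have J: "x * y + cst (- \<gamma>) * (x0 * y0) \<in> J"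
        by (intro J.comb2[OF 1, of _ 1 "- cst \<gamma>"]) (simp add: eq algebra_simps single_uminus)
      have f: "x * y \<in> forms 2" "x0 * y0 \<in> forms 2" using forms_mult_1_1 xy xy0 by auto
      hence "x * y + cst (- \<gamma>) * (x0 * y0) \<in> forms 2" by auto
      hence "P.quad_functional B' (x * y + cst (- \<gamma>) * (x0 * y0)) = 0"
        using quad_functional_J[OF B'] J by simp
      hence "B' x y = \<gamma> * B' x0 y0"
        using P.quad_functional_linear[OF B'(1) f, of "- \<gamma>"] P.quad_functional_mult[OF B'(2)] xy xy0 by simp
      thus ?thesis by (simp add: \<gamma>_def)
    qed
    thus ?thesis by blast
  qed
  show ?thesis using bil nd bal uniq by (intro exI[of _ B]) auto
qed

end

lemma pvar_neq_0: "pvar v \<noteq> 0"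
proof
  assume "(pvar v :: ('a, 'b) mpoly) = 0"
  hence "coord (pvar v :: ('a, 'b) mpoly) v = 0" by simp
  thus False by simp
qed

lemma cst_inverse_mult: "c \<noteq> 0 \<Longrightarrow> cst (inverse c) * (cst c * p) = p"
  by (subst mult.assoc[symmetric], subst cst_inverse) auto

section \<open>Self-adjoint operators\<close>

definition linear_operator :: "(('v::finite, 'k::field) mpoly \<Rightarrow> ('v, 'k) mpoly) \<Rightarrow> bool"
  where "linear_operator u \<longleftrightarrow> (\<forall>x\<in>V. u x \<in> V) \<and>
    (\<forall>x\<in>V. \<forall>y\<in>V. \<forall>c. u (x + cst c * y) = u x + cst c * u y)"

lemma linear_operatorD:
  assumes "linear_operator u"
  shows "x \<in> V \<Longrightarrow> u x \<in> V"
    "x \<in> V \<Longrightarrow> y \<in> V \<Longrightarrow> u (x + cst c * y) = u x + cst c * u y"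
  using assms by (auto simp: linear_operator_def)

lemma linear_operator_0: "linear_operator u \<Longrightarrow> u 0 = 0"
  using linear_operatorD(2)[of u 0 0 "-1"] by (simp add: cst_uminus)

lemma linear_operator_sum:
  assumes u: "linear_operator u" and f: "\<And>i. i \<in> A \<Longrightarrow> f i \<in> V"
  shows "u (\<Sum>i\<in>A. cst (c i) * f i) = (\<Sum>i\<in>A. cst (c i) * u (f i))"
  using f
proof (induction A rule: infinite_finite_induct)
  case (insert i A)
  have "(\<Sum>i\<in>A. cst (c i) * f i) \<in> V"
    by (rule forms_sum) (use insert.prems in auto)
  hence "u ((\<Sum>i\<in>A. cst (c i) * f i) + cst (c i) * f i) = u (\<Sum>i\<in>A. cst (c i) * f i) + cst (c i) * u (f i)"
    using insert.prems by (intro linear_operatorD(2)[OF u]) auto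
  thus ?case using insert by (simp add: add.commute)
qed (auto simp: linear_operator_0[OF u])

lemma linear_operator_id: "linear_operator (\<lambda>x. x)"
  by (simp add: linear_operator_def)

lemma linear_operator_compose: "linear_operator u \<Longrightarrow> linear_operator w \<Longrightarrow> linear_operator (\<lambda>x. u (w x))"
  by (simp add: linear_operator_def)

lemma linear_operator_combine:
  assumes "linear_operator u" "linear_operator w"
  shows "linear_operator (\<lambda>x. u x + cst c * w x)"
  unfolding linear_operator_def
proof (intro conjI ballI allI)
  fix x y :: "('a, 'b) mpoly" and a assume xy: "x \<in> V" "y \<in> V"
  show "u x + cst c * w x \<in> V"
    using linear_operatorD(1)[OF assms(1) xy(1)] linear_operatorD(1)[OF assms(2) xy(1)] by blast
  show "u (x + cst a * y) + cst c * w (x + cst a * y) = u x + cst c * w x + cst a * (u y + cst c * w y)"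
    unfolding linear_operatorD(2)[OF assms(1) xy] linear_operatorD(2)[OF assms(2) xy]
    by (simp add: algebra_simps)
qed

context basis_ideal
begin

text \<open>
  Linearity over the structure ring, when \<open>V\<close> is identified with the sections of \<open>O(1)\<close>.
\<close>

definition self_adjoint :: "(('v, 'k) mpoly \<Rightarrow> ('v, 'k) mpoly) \<Rightarrow> bool"
  where "self_adjoint u \<longleftrightarrow> linear_operator u \<and> (\<forall>x\<in>V. \<forall>y\<in>V. u x * y - x * u y \<in> I)"

lemma self_adjointD:
  assumes "self_adjoint u"
  shows "linear_operator u" "x \<in> V \<Longrightarrow> y \<in> V \<Longrightarrow> u x * y - x * u y \<in> I"
  using assms by (auto simp: self_adjoint_def)

lemma self_adjoint_apply:
  assumes u: "self_adjoint u" and xyzw: "x \<in> V" "y \<in> V" "z \<in> V" "w \<in> V"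
    and xy: "x * y - z * w \<in> I"
  shows "u x * y - u z * w \<in> I"
proof -
  have 1: "u v * x - v * u x \<in> I" "u v * z - v * u z \<in> I"
    using self_adjointD(2)[OF u v_form] xyzw by auto
  have "v * (u x * y - u z * w) \<in> I"
    by (rule comb3[OF 1 xy, of _ "- y" w "u v"]) (simp add: algebra_simps)
  thus ?thesis by (rule v_nzd)
qed

lemma self_adjoint_eqI:
  assumes "linear_operator u" "linear_operator w" "\<And>x. x \<in> V \<Longrightarrow> v ^ m * (u x - w x) \<in> I" "x \<in> V"
  shows "u x = w x"
proof -
  have "u x - w x \<in> I" by (rule v_power_nzd[OF assms(3)[OF assms(4)]])
  hence "u x - w x = 0"
    by (intro linear_mem) (use linear_operatorD(1) assms in blast)+
  thus ?thesis by simp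
qed

text \<open>
  A self-adjoint \<open>u\<close> is multiplication by the section \<open>u v / v\<close>: both composites, applied to \<open>x\<close>,
  give \<open>(u v) (w v) x / v\<^sup>2\<close>.
\<close>

lemma self_adjoint_commute:
  assumes u: "self_adjoint u" and w: "self_adjoint w" and x: "x \<in> V"
  shows "u (w x) = w (u x)"
proof (rule self_adjoint_eqI[where m = 2, OF _ _ _ x])
  note lu = self_adjointD(1)[OF u] and lw = self_adjointD(1)[OF w]
  show "linear_operator (\<lambda>x. u (w x))" "linear_operator (\<lambda>x. w (u x))"
    using linear_operator_compose lu lw by auto
  fix x :: "('v, 'k) mpoly" assume x: "x \<in> V"
  have 1: "u v * w x - v * u (w x) \<in> I" "w v * u x - v * w (u x) \<in> I"
    "u v * x - v * u x \<in> I" "w v * x - v * w x \<in> I"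
    using self_adjointD(2)[OF u v_form] self_adjointD(2)[OF w v_form] x linear_operatorD(1)[OF lu x]
      linear_operatorD(1)[OF lw x] by auto
  have a: "v * v * u (w x) - u v * w v * x \<in> I"
    by (rule comb2[OF 1(1) 1(4), of _ "- v" "- u v"]) (simp add: algebra_simps)
  have b: "v * v * w (u x) - u v * w v * x \<in> I"
    by (rule comb2[OF 1(2) 1(3), of _ "- v" "- w v"]) (simp add: algebra_simps)
  show "v ^ 2 * (u (w x) - w (u x)) \<in> I"
    by (rule comb2[OF a b, of _ 1 "-1"]) (simp add: algebra_simps power2_eq_square)
qed

lemma self_adjoint_0:
  assumes u: "self_adjoint u" and "u v = 0" and x: "x \<in> V" shows "u x = 0"
proof -
  have "v * u x \<in> I"
    by (rule comb1[OF self_adjointD(2)[OF u v_form x], of _ "-1"]) (simp add: assms(2))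
  hence "u x \<in> I" by (rule v_nzd)
  thus ?thesis using linear_operatorD(1)[OF self_adjointD(1)[OF u] x] by (intro linear_mem)
qed

lemma self_adjoint_id: "self_adjoint (\<lambda>x. x)"
  by (simp add: self_adjoint_def linear_operator_id)

lemma self_adjoint_compose:
  assumes u: "self_adjoint u" and w: "self_adjoint w"
  shows "self_adjoint (\<lambda>x. u (w x))"
  unfolding self_adjoint_def
proof (intro conjI ballI)
  note lu = self_adjointD(1)[OF u] and lw = self_adjointD(1)[OF w]
  show "linear_operator (\<lambda>x. u (w x))" by (rule linear_operator_compose[OF lu lw])
  fix x y :: "('v, 'k) mpoly" assume xy: "x \<in> V" "y \<in> V"
  have 1: "u (w x) * y - w x * u y \<in> I" "w x * u y - x * w (u y) \<in> I"
    using self_adjointD(2)[OF u] self_adjointD(2)[OF w] linear_operatorD(1)[OF lu]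
      linear_operatorD(1)[OF lw] xy by auto
  have "u (w x) * y - x * w (u y) \<in> I" by (rule cong_trans[OF 1])
  thus "u (w x) * y - x * u (w y) \<in> I"
    by (simp add: self_adjoint_commute[OF u w xy(2)])
qed

lemma self_adjoint_combine:
  assumes u: "self_adjoint u" and w: "self_adjoint w"
  shows "self_adjoint (\<lambda>x. u x + cst c * w x)"
  unfolding self_adjoint_def
proof (intro conjI ballI)
  show "linear_operator (\<lambda>x. u x + cst c * w x)"
    by (rule linear_operator_combine[OF self_adjointD(1)[OF u] self_adjointD(1)[OF w]])
  fix x y :: "('v, 'k) mpoly" assume xy: "x \<in> V" "y \<in> V"
  show "(u x + cst c * w x) * y - x * (u y + cst c * w y) \<in> I"
    by (rule comb2[OF self_adjointD(2)[OF u xy] self_adjointD(2)[OF w xy], of _ 1 "cst c"])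
      (simp add: algebra_simps)
qed

lemma self_adjoint_zero: "self_adjoint (\<lambda>x. 0)"
  by (simp add: self_adjoint_def linear_operator_def)

lemma self_adjoint_sum:
  assumes "\<And>i. i \<in> A \<Longrightarrow> self_adjoint (f i)"
  shows "self_adjoint (\<lambda>x. \<Sum>i\<in>A. cst (c i) * f i x)"
  using assms
proof (induction A rule: infinite_finite_induct)
  case (insert i A)
  hence "self_adjoint (\<lambda>x. (\<Sum>i\<in>A. cst (c i) * f i x) + cst (c i) * f i x)"
    by (intro self_adjoint_combine) auto
  thus ?case using insert by (simp add: add.commute)
qed (auto simp: self_adjoint_zero)

lemma self_adjoint_funpow: "self_adjoint u \<Longrightarrow> self_adjoint (\<lambda>x. (u ^^ n) x)"
proof (induction n)
  case (Suc n)
  thus ?case using self_adjoint_compose[of u "\<lambda>x. (u ^^ n) x"] by simp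
qed (use self_adjoint_id in \<open>simp add: id_def\<close>)

lemma balanced_self_adjoint:
  assumes B: "balanced I B" and u: "self_adjoint u" shows "balanced I (\<lambda>x. B (u x))"
  unfolding balanced_def
proof (intro ballI impI)
  fix x y z w assume xyzw: "x \<in> V" "y \<in> V" "z \<in> V" "w \<in> V" "x * y - z * w \<in> I"
  thus "B (u x) y = B (u z) w"
    using self_adjoint_apply[OF u xyzw] B linear_operatorD(1)[OF self_adjointD(1)[OF u]]
    unfolding balanced_def by blast
qed

text \<open>
  Because \<open>B\<close> and \<open>B'\<close> are both balanced, \<open>B (u x \<cdot> y / v) z = B' x (y z / v) = B' y (x z / v) =
  B (u y \<cdot> x / v) z\<close> for all \<open>z\<close>, and \<open>B\<close> is nondegenerate.
\<close>

lemma adjoint_of_balanced: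
  assumes B: "bilinear B" "nondegenerate_form B" "balanced I B" and B': "balanced I B'"
    and u: "linear_operator u" "\<And>x y. x \<in> V \<Longrightarrow> y \<in> V \<Longrightarrow> B (u x) y = B' x y"
  shows "self_adjoint u"
  unfolding self_adjoint_def
proof (intro conjI ballI u)
  define m where "m x y = red 1 (x * y)" for x y
  have m: "m x y \<in> V" "x * y - v * m x y \<in> I" if "x \<in> V" "y \<in> V" for x y
    using red[OF forms_2_Suc[OF forms_mult_1_1[OF that]]] by (auto simp: m_def)
  \<comment> \<open>The product \<open>m\<close> makes the linear forms an algebra, which is the structure ring acting on \<open>O(1)\<close>.\<close>
  have assoc: "m x y * z - x * m y z \<in> I" if "x \<in> V" "y \<in> V" "z \<in> V" for x y z
  proof -
    have "v * (m x y * z - x * m y z) \<in> I"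
      by (rule comb2[OF m(2)[OF that(1,2)] m(2)[OF that(2,3)], of _ "- z" x]) (simp add: algebra_simps)
    thus ?thesis by (rule v_nzd)
  qed
  have comm: "m x y = m y x" for x y by (simp add: m_def mult.commute)
  fix x y :: "('v, 'k) mpoly" assume xy: "x \<in> V" "y \<in> V"
  have ux: "u x \<in> V" "u y \<in> V" using linear_operatorD(1)[OF u(1)] xy by auto
  define w where "w = m (u x) y - m x (u y)"
  have w: "w \<in> V" using m(1) ux xy by (auto simp: w_def)
  have "B w z = 0" if z: "z \<in> V" for z
  proof -
    have "B (m (u x) y) z = B (u x) (m y z)"
      using assoc[OF ux(1) xy(2) z] B(3) m(1) ux xy z unfolding balanced_def by blast
    also have "\<dots> = B' x (m y z)" using u(2) m(1) xy z by blast
    also have "\<dots> = B' y (m x z)"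
    proof -
      have "v * (x * m y z - y * m x z) \<in> I"
        by (rule comb2[OF m(2)[OF xy(2) z] m(2)[OF xy(1) z], of _ "- x" y]) (simp add: algebra_simps)
      hence "x * m y z - y * m x z \<in> I" by (rule v_nzd)
      thus ?thesis using B' m(1) xy z unfolding balanced_def by blast
    qed
    also have "\<dots> = B (u y) (m x z)" using u(2) m(1) xy z by simp
    also have "\<dots> = B (m (u y) x) z"
      using assoc[OF ux(2) xy(1) z] B(3) m(1) ux xy z unfolding balanced_def by metis
    finally show ?thesis
      using bilinearD(5)[OF B(1) m(1)[OF ux(1) xy(2)] m(1)[OF xy(1) ux(2)] z]
      by (simp add: w_def comm[of x "u y"])
  qed
  hence "w = 0" using B(2) w by (auto simp: nondegenerate_form_def)
  hence "m (u x) y = m x (u y)" by (simp add: w_def)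
  thus "u x * y - x * u y \<in> I"
    by (intro comb2[OF m(2)[OF ux(1) xy(2)] m(2)[OF xy(1) ux(2)], of _ 1 "-1"]) simp
qed

end

locale two_bases_form = two_bases I1 I2 v1 v2 N
  for I1 I2 :: "('v::finite, 'k::field) mpoly set" and v1 v2 N +
  fixes B :: "('v, 'k) mpoly \<Rightarrow> ('v, 'k) mpoly \<Rightarrow> 'k"
  assumes bil: "bilinear B" and nondeg: "nondegenerate_form B"
    and bal1: "balanced I1 B" and bal2: "balanced I2 B"
begin

lemma sym: "x \<in> V \<Longrightarrow> y \<in> V \<Longrightarrow> B x y = B y x"
  by (rule balanced_sym[OF bal1]) unfold_locales

lemma nondegD: "x \<in> V \<Longrightarrow> (\<And>y. y \<in> V \<Longrightarrow> B x y = 0) \<Longrightarrow> x = 0"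
  using nondeg by (auto simp: nondegenerate_form_def)

definition sa :: "(('v, 'k) mpoly \<Rightarrow> ('v, 'k) mpoly) \<Rightarrow> bool"
  where "sa u \<longleftrightarrow> P.self_adjoint u \<and> Q.self_adjoint u"

lemma sa_linear: "sa u \<Longrightarrow> linear_operator u"
  by (auto simp: sa_def P.self_adjoint_def)

lemma sa_closed: "sa u \<Longrightarrow> x \<in> V \<Longrightarrow> u x \<in> V"
  using linear_operatorD(1) sa_linear by blast

lemma sa_combine: "sa u \<Longrightarrow> sa w \<Longrightarrow> sa (\<lambda>x. u x + cst c * w x)"
  by (simp add: sa_def P.self_adjoint_combine Q.self_adjoint_combine)

lemma sa_compose: "sa u \<Longrightarrow> sa w \<Longrightarrow> sa (\<lambda>x. u (w x))"
  by (simp add: sa_def P.self_adjoint_compose Q.self_adjoint_compose)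

lemma sa_funpow: "sa u \<Longrightarrow> sa (\<lambda>x. (u ^^ n) x)"
  unfolding sa_def by (intro conjI P.self_adjoint_funpow Q.self_adjoint_funpow; elim conjE)

lemma sa_sum: "(\<And>i. i \<in> A \<Longrightarrow> sa (f i)) \<Longrightarrow> sa (\<lambda>x. \<Sum>i\<in>A. cst (c i) * f i x)"
  unfolding sa_def by (intro conjI P.self_adjoint_sum Q.self_adjoint_sum) auto

lemma sa_id: "sa (\<lambda>x. x)"
  by (simp add: sa_def P.self_adjoint_id Q.self_adjoint_id)

lemma sa_commute: "sa u \<Longrightarrow> sa w \<Longrightarrow> x \<in> V \<Longrightarrow> u (w x) = w (u x)"
  by (rule P.self_adjoint_commute) (simp_all add: sa_def)

lemma bilinear_sa:
  assumes u: "linear_operator u" shows "bilinear (\<lambda>x. B (u x))"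
  unfolding bilinear_def
proof (intro ballI allI conjI)
  fix x y z :: "('v, 'k) mpoly" and c assume xyz: "x \<in> V" "y \<in> V" "z \<in> V"
  note f = linear_operatorD(1)[OF u]
  show "B (u (x + cst c * y)) z = B (u x) z + c * B (u y) z"
    unfolding linear_operatorD(2)[OF u xyz(1,2)] by (rule bilinearD(1)[OF bil f f xyz(3)]) fact+
  show "B (u z) (x + cst c * y) = B (u z) x + c * B (u z) y"
    by (rule bilinearD(2)[OF bil xyz(1,2) f[OF xyz(3)]])
qed

lemma exists_self_adjoint:
  assumes B': "bilinear B'" "balanced I1 B'" "balanced I2 B'"
  shows "\<exists>u. sa u \<and> (\<forall>x\<in>V. \<forall>y\<in>V. B (u x) y = B' x y)"
proof -
  have "\<exists>z\<in>V. \<forall>y\<in>V. B z y = B' x y" if "x \<in> V" for x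
    by (rule represent_functional[OF bil nondeg sym]) (use bilinearD(2)[OF B'(1) _ _ that] in auto)
  then obtain u where u: "\<And>x. x \<in> V \<Longrightarrow> u x \<in> V"
    "\<And>x y. x \<in> V \<Longrightarrow> y \<in> V \<Longrightarrow> B (u x) y = B' x y"
    by metis
  have lin: "linear_operator u"
    unfolding linear_operator_def
  proof (intro conjI ballI allI u)
    fix x y :: "('v, 'k) mpoly" and c assume xy: "x \<in> V" "y \<in> V"
    have xy': "x + cst c * y \<in> V" using xy by blast
    have w: "u x + cst c * u y \<in> V" using u(1) xy by blast
    have "u (x + cst c * y) - (u x + cst c * u y) = 0"
    proof (rule nondegD)
      show "u (x + cst c * y) - (u x + cst c * u y) \<in> V" using u(1)[OF xy'] w by blast
      fix z :: "('v, 'k) mpoly" assume z: "z \<in> V"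
      show "B (u (x + cst c * y) - (u x + cst c * u y)) z = 0"
        using bilinearD(5)[OF bil u(1)[OF xy'] w z] bilinearD(1)[OF bil u(1) u(1) z, of x y c] u(2)[OF _ z] xy xy'
          bilinearD(1)[OF B'(1) xy z, of c] by simp
    qed
    thus "u (x + cst c * y) = u x + cst c * u y" by simp
  qed
  have "P.self_adjoint u" by (rule P.adjoint_of_balanced[OF bil nondeg bal1 B'(2) lin u(2)])
  moreover have "Q.self_adjoint u" by (rule Q.adjoint_of_balanced[OF bil nondeg bal2 B'(3) lin u(2)])
  ultimately show ?thesis using u(2) by (auto simp: sa_def)
qed

text \<open>
  Among the powers of \<open>u\<close> applied to \<open>v1\<close> there is a linear relation, and a self-adjoint operator
  that kills \<open>v1\<close> is zero. Solving for the lowest power that occurs gives \<open>u\<^sup>j = u\<^sup>j\<^sup>+\<^sup>1 h\<close>, with \<open>h\<close> a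
  polynomial in \<open>u\<close>.
\<close>

lemma sa_relation:
  assumes u: "sa u"
  shows "\<exists>j h. 0 < j \<and> sa h \<and> (\<forall>x\<in>V. (u ^^ j) x = (u ^^ Suc j) (h x))"
proof -
  let ?n = "CARD('v)"
  obtain c where c: "\<exists>i\<in>{..?n}. c i \<noteq> 0" "\<forall>w\<in>(UNIV :: 'v set). (\<Sum>i\<in>{..?n}. c i * coord ((u ^^ i) v1) w) = 0"
    using exists_linear_dependency[of "UNIV :: 'v set" "{..?n}" "\<lambda>i w. coord ((u ^^ i) v1) w"] by auto
  let ?w = "\<lambda>x. \<Sum>i\<le>?n. cst (c i) * (u ^^ i) x"
  have w: "sa ?w" by (rule sa_sum[OF sa_funpow[OF u]])
  have "?w v1 = 0"
    by (rule forms_1_eqI[OF sa_closed[OF w P.v_form] forms_0]) (use c in \<open>simp add: coord_sum\<close>)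
  hence w0: "?w x = 0" if "x \<in> V" for x
    using P.self_adjoint_0[of ?w x] w that unfolding sa_def by blast
  define j where "j = (LEAST i. i \<le> ?n \<and> c i \<noteq> 0)"
  have j: "j \<le> ?n" "c j \<noteq> 0" using LeastI_ex[of "\<lambda>i. i \<le> ?n \<and> c i \<noteq> 0"] c(1) by (auto simp: j_def)
  have below: "c i = 0" if "i < j" for i
    using not_less_Least[of i "\<lambda>i. i \<le> ?n \<and> c i \<noteq> 0"] that j(1) by (auto simp: j_def)
  define h where "h x = (\<Sum>i\<in>{Suc j..?n}. cst (- c i / c j) * (u ^^ (i - Suc j)) x)" for x
  have h: "sa h" unfolding h_def by (rule sa_sum[OF sa_funpow[OF u]])
  have rel: "(u ^^ j) x = (u ^^ Suc j) (h x)" if x: "x \<in> V" for x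
  proof -
    have "(u ^^ Suc j) (h x) = (\<Sum>i\<in>{Suc j..?n}. cst (- c i / c j) * (u ^^ Suc j) ((u ^^ (i - Suc j)) x))"
      unfolding h_def by (rule linear_operator_sum[OF sa_linear[OF sa_funpow[OF u]] sa_closed[OF sa_funpow[OF u] x]])
    also have "\<dots> = (\<Sum>i\<in>{Suc j..?n}. cst (- c i / c j) * (u ^^ i) x)"
    proof (rule sum.cong[OF refl])
      fix i assume "i \<in> {Suc j..?n}"
      hence "u ^^ i = u ^^ Suc j \<circ> u ^^ (i - Suc j)" by (simp only: funpow_add[symmetric]) simp
      thus "cst (- c i / c j) * (u ^^ Suc j) ((u ^^ (i - Suc j)) x) = cst (- c i / c j) * (u ^^ i) x"
        by (simp only: o_apply)
    qed
    also have "\<dots> = - cst (inverse (c j)) * (\<Sum>i\<in>{Suc j..?n}. cst (c i) * (u ^^ i) x)"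
      unfolding sum_distrib_left
    proof (rule sum.cong[OF refl])
      fix i
      have "cst (- c i / c j) = - (cst (inverse (c j)) * cst (c i) :: ('v, 'k) mpoly)"
        unfolding cst_mult[symmetric] cst_uminus[symmetric] by (simp add: divide_inverse mult.commute)
      thus "cst (- c i / c j) * (u ^^ i) x = - cst (inverse (c j)) * (cst (c i) * (u ^^ i) x)"
        by (simp only:) (simp add: mult.assoc)
    qed
    also have "(\<Sum>i\<in>{Suc j..?n}. cst (c i) * (u ^^ i) x) = - cst (c j) * (u ^^ j) x"
    proof -
      have "(\<Sum>i\<le>?n. cst (c i) * (u ^^ i) x) = (\<Sum>i\<in>{j..?n}. cst (c i) * (u ^^ i) x)"
        by (rule sum.mono_neutral_right) (use below in \<open>auto simp: not_le\<close>)
      also have "\<dots> = cst (c j) * (u ^^ j) x + (\<Sum>i\<in>{Suc j..?n}. cst (c i) * (u ^^ i) x)"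
        by (rule sum.atLeast_Suc_atMost) (use j in simp)
      finally show ?thesis using w0[OF x] by (simp add: eq_neg_iff_add_eq_0 add.commute)
    qed
    also have "- cst (inverse (c j)) * (- cst (c j) * (u ^^ j) x) = (u ^^ j) x"
    proof -
      have "cst (inverse (c j)) * cst (c j) = (1 :: ('v, 'k) mpoly)" by (rule cst_inverse[OF j(2)])
      thus ?thesis by (simp add: mult.assoc[symmetric])
    qed
    finally show ?thesis by simp
  qed
  have "(u ^^ Suc j) x = (u ^^ Suc (Suc j)) (h x)" if x: "x \<in> V" for x
    using rel[OF x] by simp
  thus ?thesis using h by (intro exI[of _ "Suc j"] exI[of _ h]) auto
qed

text \<open>
  If \<open>u\<close> is injective, then \<open>B (u x) y\<close> is a common form, so \<open>u\<close> is a scalar. In general let \<open>e\<close>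
  be the Fitting idempotent of \<open>u\<close>, on whose image \<open>u\<close> is invertible and on whose kernel \<open>u\<close> is
  nilpotent. The operator \<open>1 + (c0 - 1) e\<close> is injective, hence a scalar, so \<open>e\<close> is \<open>0\<close> or \<open>1\<close>. If
  \<open>e = 1\<close>, then \<open>u\<close> is injective, and if \<open>e = 0\<close>, then \<open>u\<close> is nilpotent and \<open>1 + u\<close> is injective.
\<close>

lemma sa_scalar:
  assumes uniq: "\<And>B'. bilinear B' \<Longrightarrow> nondegenerate_form B' \<Longrightarrow> balanced I1 B' \<Longrightarrow> balanced I2 B' \<Longrightarrow>
      \<exists>c. \<forall>x\<in>V. \<forall>y\<in>V. B' x y = c * B x y"
    and c0: "c0 \<noteq> (0::'k)" "c0 \<noteq> 1" and u: "sa u"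
  shows "\<exists>c. \<forall>x\<in>V. u x = cst c * x"
proof -
  have inj: "\<exists>c. \<forall>x\<in>V. w x = cst c * x"
    if w: "sa w" and i: "\<And>x. x \<in> V \<Longrightarrow> w x = 0 \<Longrightarrow> x = 0" for w
  proof -
    have nd: "nondegenerate_form (\<lambda>x. B (w x))"
      unfolding nondegenerate_form_def using nondegD sa_closed[OF w] i by blast
    obtain c where c: "\<forall>x\<in>V. \<forall>y\<in>V. B (w x) y = c * B x y"
      using uniq[OF bilinear_sa[OF sa_linear[OF w]] nd P.balanced_self_adjoint[OF bal1]
          Q.balanced_self_adjoint[OF bal2]] w unfolding sa_def by blast
    have "w x = cst c * x" if x: "x \<in> V" for x
    proof -
      have cx: "cst c * x \<in> V" using x by blast
      have "w x - cst c * x = 0"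
      proof (rule nondegD)
        show "w x - cst c * x \<in> V" using sa_closed[OF w x] x by blast
        fix y :: "('v, 'k) mpoly" assume y: "y \<in> V"
        show "B (w x - cst c * x) y = 0"
          using bilinearD(5)[OF bil sa_closed[OF w x] cx y] c x y bilinearD(7)[OF bil x x y, of c] by simp
      qed
      thus ?thesis by simp
    qed
    thus ?thesis by blast
  qed
  obtain j h where j: "0 < j" and h: "sa h" and rel: "\<And>x. x \<in> V \<Longrightarrow> (u ^^ j) x = (u ^^ Suc j) (h x)"
    using sa_relation[OF u] by blast
  note uj = sa_funpow[OF u, of j] and hj = sa_funpow[OF h, of j]
  have rel': "(u ^^ j) x = (u ^^ (j + m)) ((h ^^ m) x)" if x: "x \<in> V" for x m
  proof (induction m)
    case (Suc m)
    let ?z = "(h ^^ m) x"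
    have "(u ^^ (j + m)) ?z = (u ^^ m) ((u ^^ j) ?z)" by (simp only: add.commute[of j m] funpow_add o_apply)
    also have "\<dots> = (u ^^ m) ((u ^^ Suc j) (h ?z))" using rel[OF sa_closed[OF sa_funpow[OF h] x]] by simp
    also have "\<dots> = (u ^^ (m + Suc j)) (h ?z)" by (simp only: funpow_add o_apply)
    finally show ?case using Suc by (simp add: add.commute)
  qed simp
  define e where "e x = (u ^^ j) ((h ^^ j) x)" for x
  have e: "sa e" unfolding e_def by (rule sa_compose[OF uj hj])
  have ue: "(u ^^ j) x = (u ^^ j) (e x)" if "x \<in> V" for x
    using rel'[OF that, of j] by (simp add: e_def funpow_add)
  have ee: "e (e x) = e x" if x: "x \<in> V" for x
  proof -
    have hx: "(h ^^ j) x \<in> V" by (rule sa_closed[OF hj x])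
    have "e (e x) = (u ^^ j) ((h ^^ j) ((u ^^ j) ((h ^^ j) x)))" by (simp add: e_def)
    also have "(h ^^ j) ((u ^^ j) ((h ^^ j) x)) = (u ^^ j) ((h ^^ j) ((h ^^ j) x))"
      by (rule sa_commute[OF hj uj hx])
    also have "(u ^^ j) ((u ^^ j) ((h ^^ j) ((h ^^ j) x))) = (u ^^ j) ((h ^^ j) x)"
      using ue[OF hx] by (simp add: e_def)
    finally show ?thesis by (simp add: e_def)
  qed
  define x1 where "x1 = (pvar undefined :: ('v, 'k) mpoly)"
  have x1: "x1 \<in> V" "\<And>c. cst c * x1 = 0 \<Longrightarrow> c = 0"
  proof -
    show "x1 \<in> V" by (simp add: x1_def)
    fix c assume "cst c * x1 = 0"
    thus "c = 0" using coord_cst_mult[of c x1 undefined] by (simp add: x1_def)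
  qed
  let ?u' = "\<lambda>x. x + cst (c0 - 1) * e x"
  have "\<exists>c. \<forall>x\<in>V. ?u' x = cst c * x"
  proof (rule inj[OF sa_combine[OF sa_id e]])
    fix x :: "('v, 'k) mpoly" assume x: "x \<in> V" "?u' x = 0"
    have "e (?u' x) = e x + cst (c0 - 1) * e (e x)"
      by (rule linear_operatorD(2)[OF sa_linear[OF e] x(1) sa_closed[OF e x(1)]])
    hence "cst c0 * e x = 0"
      using x ee linear_operator_0[OF sa_linear[OF e]] by (simp add: cst_diff algebra_simps)
    hence "e x = 0" using cst_inverse_mult[OF c0(1), of "e x"] by simp
    thus "x = 0" using x by simp
  qed
  then obtain \<gamma> where \<gamma>: "\<And>x. x \<in> V \<Longrightarrow> x + cst (c0 - 1) * e x = cst \<gamma> * x" by blast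
  define \<delta> where "\<delta> = (\<gamma> - 1) / (c0 - 1)"
  have \<delta>: "e x = cst \<delta> * x" if x: "x \<in> V" for x
  proof -
    have "cst (c0 - 1) * e x = cst (\<gamma> - 1) * x" using \<gamma>[OF x] by (simp add: cst_diff algebra_simps)
    hence "e x = cst (inverse (c0 - 1)) * (cst (\<gamma> - 1) * x)"
      using cst_inverse_mult[of "c0 - 1" "e x"] c0 by simp
    also have "\<dots> = cst \<delta> * x"
      unfolding mult.assoc[symmetric] cst_mult[symmetric] by (simp add: \<delta>_def divide_inverse mult.commute)
    finally show ?thesis .
  qed
  have "cst (\<delta> * \<delta> - \<delta>) * x1 = 0"
  proof -
    have "cst \<delta> * (cst \<delta> * x1) = cst \<delta> * x1"
      using ee[OF x1(1)] \<delta>[OF x1(1)] \<delta>[OF sa_closed[OF e x1(1)]] by simp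
    thus ?thesis by (simp add: cst_diff cst_mult algebra_simps)
  qed
  hence "\<delta> * \<delta> - \<delta> = 0" by (rule x1(2))
  hence "\<delta> = 0 \<or> \<delta> = 1" by (simp add: algebra_simps)
  thus ?thesis
  proof
    assume "\<delta> = 1"
    have "x = 0" if x: "x \<in> V" "u x = 0" for x
    proof -
      have "x = (h ^^ j) ((u ^^ j) x)"
        using \<delta>[OF x(1)] \<open>\<delta> = 1\<close> sa_commute[OF uj hj x(1)] by (simp add: e_def)
      also have "(u ^^ j) x = (u ^^ (j - 1)) (u x)"
        using j by (metis Suc_diff_1 comp_apply funpow_Suc_right)
      also have "\<dots> = 0" using x linear_operator_0[OF sa_linear[OF sa_funpow[OF u]]] by simp
      finally show ?thesis using linear_operator_0[OF sa_linear[OF hj]] by simp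
    qed
    thus ?thesis using inj[OF u] by blast
  next
    assume "\<delta> = 0"
    hence uj0: "(u ^^ j) x = 0" if "x \<in> V" for x
      using ue[OF that] \<delta>[OF that] linear_operator_0[OF sa_linear[OF uj]] by simp
    have "\<exists>c. \<forall>x\<in>V. x + cst 1 * u x = cst c * x"
    proof (rule inj[OF sa_combine[OF sa_id u]])
      fix x :: "('v, 'k) mpoly" assume x: "x \<in> V" "x + cst 1 * u x = 0"
      hence ux: "u x = cst (- 1) * x" by (simp add: eq_neg_iff_add_eq_0 add.commute cst_uminus)
      have "(u ^^ m) x = cst ((- 1) ^ m) * x" for m
      proof (induction m)
        case (Suc m)
        have "u (cst ((- 1) ^ m) * x) = cst ((- 1) ^ m) * u x"
          using linear_operatorD(2)[OF sa_linear[OF u] forms_0 x(1)] linear_operator_0[OF sa_linear[OF u]] by simp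
        hence "(u ^^ Suc m) x = cst ((- 1) ^ m) * (cst (- 1) * x)" using Suc ux by simp
        also have "\<dots> = cst ((- 1) ^ Suc m) * x" by (simp only: power_Suc2 cst_mult mult.assoc)
        finally show ?case .
      qed simp
      hence "cst ((- 1) ^ j) * x = 0" using uj0[OF x(1)] by simp
      hence "cst ((- 1) ^ j) * (cst ((- 1) ^ j) * x) = 0" by simp
      moreover have "(-1) ^ j * (-1) ^ j = (1::'k)" by (simp add: power_mult_distrib[symmetric])
      ultimately show "x = 0" by (simp add: mult.assoc[symmetric] cst_mult[symmetric])
    qed
    then obtain c where "\<forall>x\<in>V. x + cst 1 * u x = cst c * x" by blast
    hence "\<forall>x\<in>V. u x = cst (c - 1) * x" by (auto simp: cst_diff algebra_simps)
    thus ?thesis by blast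
  qed
qed

text \<open>
  If \<open>p\<close> is not in \<open>J\<close>, then some functional on the quadrics modulo \<open>J\<close> does not vanish at \<open>p\<close>.
  It defines a form \<open>B'\<close> balanced for both bases, so \<open>B' x y = B (u x) y\<close> with a self-adjoint \<open>u\<close>. As
  \<open>u\<close> is a scalar, \<open>B'\<close> is a multiple of \<open>B\<close>, whose functional vanishes at \<open>p\<close>.
\<close>

lemma kernel_in_J:
  assumes scalar: "\<And>u. sa u \<Longrightarrow> \<exists>c. \<forall>x\<in>V. u x = cst c * x"
    and p: "p \<in> forms 2" "P.quad_functional B p = 0"
  shows "p \<in> J"
proof (rule ccontr)
  assume "p \<notin> J"
  \<comment> \<open>\<open>p\<close> may be replaced by \<open>v1 xp\<close>.\<close>
  define xp where "xp = P.red 1 p"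
  have xp: "xp \<in> V" "p - v1 * xp \<in> I1"
    using P.red[OF P.forms_2_Suc[OF p(1)]] by (auto simp: xp_def)
  have xpJ: "v1 * xp \<notin> J"
    using I1_subset_J[OF xp(2)] \<open>p \<notin> J\<close> J.cong_mem by blast
  \<comment> \<open>Modulo \<open>J\<close> the quadrics are \<open>v1 V\<close>; the functional is one on \<open>V\<close> that vanishes where \<open>v1 x\<close> is in \<open>J\<close>.\<close>
  define G where "G = {coord x | x. x \<in> V \<and> v1 * x \<in> J}"
  have G: "lin_closed G"
    unfolding lin_closed_def
  proof (intro conjI ballI allI)
    show "G \<noteq> {}" using forms_0 J.zero unfolding G_def by (auto intro!: exI[of _ 0])
    fix g h a assume "g \<in> G" "h \<in> G"
    then obtain x y where xy: "x \<in> V" "v1 * x \<in> J" "y \<in> V" "v1 * y \<in> J" "g = coord x" "h = coord y"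
      unfolding G_def by blast
    have "v1 * (x + cst a * y) \<in> J"
      by (rule J.comb2[OF xy(2,4), of _ 1 "cst a"]) (simp add: algebra_simps)
    moreover have "x + cst a * y \<in> V" using xy by blast
    moreover have "(\<lambda>i. g i + a * h i) = coord (x + cst a * y)" using xy by auto
    ultimately show "(\<lambda>i. g i + a * h i) \<in> G" unfolding G_def by blast
  qed
  have "\<not> (\<exists>g\<in>G. \<forall>i\<in>UNIV. g i = coord xp i)"
    using forms_1_eqI[OF _ xp(1)] xpJ unfolding G_def by blast
  then obtain \<alpha> where \<alpha>: "\<forall>g\<in>G. (\<Sum>i\<in>UNIV. \<alpha> i * g i) = 0" "(\<Sum>i\<in>UNIV. \<alpha> i * coord xp i) \<noteq> 0"
    using interpolate_if_annihilated[OF finite[of "UNIV :: 'v set"] G, of "coord xp"] by blast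
  define \<chi> where "\<chi> x = (\<Sum>i\<in>UNIV. \<alpha> i * coord x i)" for x
  have \<chi>_linear: "\<chi> (x + cst c * y) = \<chi> x + c * \<chi> y" for x y c
    by (simp add: \<chi>_def distrib_left sum.distrib sum_distrib_left mult.left_commute)
  have \<chi>_0: "\<chi> x = 0" if "x \<in> V" "v1 * x \<in> J" for x
    using \<alpha>(1) that by (auto simp: \<chi>_def G_def)
  define B' where "B' x y = \<chi> (P.red 1 (x * y))" for x y
  have f2: "x * y \<in> forms (Suc 1)" if "x \<in> V" "y \<in> V" for x y :: "('v, 'k) mpoly"
    by (rule P.forms_2_Suc[OF forms_mult_1_1[OF that]])
  have bil': "bilinear B'"
    unfolding bilinear_def
  proof (intro ballI allI conjI)
    fix x y z :: "('v, 'k) mpoly" and c assume xyz: "x \<in> V" "y \<in> V" "z \<in> V"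
    have e: "(x + cst c * y) * z = x * z + cst c * (y * z)" "z * (x + cst c * y) = z * x + cst c * (z * y)"
      by (simp_all add: algebra_simps)
    show "B' (x + cst c * y) z = B' x z + c * B' y z" "B' z (x + cst c * y) = B' z x + c * B' z y"
      unfolding B'_def e P.red_linear[OF f2[OF xyz(1,3)] f2[OF xyz(2,3)]]
        P.red_linear[OF f2[OF xyz(3,1)] f2[OF xyz(3,2)]] \<chi>_linear by simp_all
  qed
  have b1: "balanced I1 B'"
    unfolding balanced_def B'_def
  proof (intro ballI impI)
    fix x y z w assume xyzw: "x \<in> V" "y \<in> V" "z \<in> V" "w \<in> V" "x * y - z * w \<in> I1"
    show "\<chi> (P.red 1 (x * y)) = \<chi> (P.red 1 (z * w))"
      by (simp only: P.red_cong[OF f2[OF xyzw(1,2)] f2[OF xyzw(3,4)] xyzw(5)])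
  qed
  have b2: "balanced I2 B'"
    unfolding balanced_def B'_def
  proof (intro ballI impI)
    fix x y z w assume xyzw: "x \<in> V" "y \<in> V" "z \<in> V" "w \<in> V" "x * y - z * w \<in> I2"
    note r1 = P.red[OF f2[OF xyzw(1,2)]] and r2 = P.red[OF f2[OF xyzw(3,4)]]
    let ?x = "P.red 1 (x * y) + cst (- 1) * P.red 1 (z * w)"
    have "v1 * ?x \<in> J"
      by (rule J.comb3[OF I1_subset_J[OF r1(2)] I1_subset_J[OF r2(2)] I2_subset_J[OF xyzw(5)], of _ "-1" 1 1])
        (simp add: algebra_simps cst_uminus)
    moreover have "?x \<in> V" using r1(1) r2(1) by blast
    ultimately have "\<chi> ?x = 0" using \<chi>_0 by blast
    thus "\<chi> (P.red 1 (x * y)) = \<chi> (P.red 1 (z * w))" unfolding \<chi>_linear by simp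
  qed
  obtain u where u: "sa u" "\<And>x y. x \<in> V \<Longrightarrow> y \<in> V \<Longrightarrow> B (u x) y = B' x y"
    using exists_self_adjoint[OF bil' b1 b2] by blast
  obtain c where c: "\<And>x. x \<in> V \<Longrightarrow> u x = cst c * x" using scalar[OF u(1)] by blast
  have "B' v1 xp = B (cst c * v1) xp" using u(2)[OF P.v_form xp(1)] c[OF P.v_form] by simp
  also have "\<dots> = c * B v1 xp" by (rule bilinearD(7)[OF bil P.v_form P.v_form xp(1)])
  also have "\<dots> = 0" using p(2) by (simp add: P.quad_functional_def xp_def)
  finally have "B' v1 xp = 0" .
  moreover have "P.red 1 (v1 * xp) = xp"
    by (rule P.red_eqI[OF xp(1) _ f2[OF P.v_form xp(1)]]) simp
  ultimately show False using \<alpha>(2) by (simp add: B'_def \<chi>_def)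
qed

text \<open>
  Modulo \<open>J\<close> every product \<open>x y\<close> is \<open>B x y\<close> times a fixed quadric \<open>p0\<close>. Given \<open>v\<close>, there are \<open>x\<close>
  and \<open>y\<close> with \<open>B v y = 0\<close> and \<open>B x y \<noteq> 0\<close> because \<open>V\<close> does not consist of multiples of \<open>v\<close>; then
  \<open>v p0\<close> is zero, as a multiple of \<open>v (x y) = x (v y) = 0\<close>.
\<close>

lemma cubics_in_J:
  assumes ker: "\<And>p. p \<in> forms 2 \<Longrightarrow> P.quad_functional B p = 0 \<Longrightarrow> p \<in> J"
  shows "forms 3 \<subseteq> J"
proof -
  obtain x0 y0 where xy0: "x0 \<in> V" "y0 \<in> V" "B x0 y0 = 1"
  proof -
    have "\<exists>y\<in>V. B (pvar undefined) y \<noteq> 0"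
      using nondegD[OF pvar_in_forms] pvar_neq_0 by blast
    then obtain y where y: "y \<in> V" "B (pvar undefined) y \<noteq> 0" by blast
    have "B (pvar undefined) (cst (inverse (B (pvar undefined) y)) * y) = 1"
      using bilinearD(8)[OF bil y(1) y(1) pvar_in_forms] y by simp
    thus ?thesis by (rule that[OF pvar_in_forms forms_cst_mult[OF y(1)]])
  qed
  define p0 where "p0 = x0 * y0"
  have p0: "p0 \<in> forms 2" "P.quad_functional B p0 = 1"
    using forms_mult_1_1 P.quad_functional_mult[OF bal1] xy0 by (auto simp: p0_def)
  have prod: "x * y - cst (B x y) * p0 \<in> J" if xy: "x \<in> V" "y \<in> V" for x y
  proof -
    note f = forms_mult_1_1[OF xy]
    have "P.quad_functional B (x * y + cst (- B x y) * p0) = 0"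
      using P.quad_functional_linear[OF bil f p0(1)] P.quad_functional_mult[OF bal1 xy] p0 by simp
    hence "x * y + cst (- B x y) * p0 \<in> J" using ker f p0(1) by blast
    thus ?thesis by (simp add: cst_uminus)
  qed
  have p0_socle: "v * p0 \<in> J" if v: "v \<in> V" for v
  proof (cases "v = 0")
    case False
    then obtain y1' where y1': "y1' \<in> V" "B v y1' \<noteq> 0" using nondegD[OF v] by blast
    define y1 where "y1 = cst (inverse (B v y1')) * y1'"
    have y1: "y1 \<in> V" "B v y1 = 1"
      using y1' bilinearD(8)[OF bil y1'(1) y1'(1) v] by (auto simp: y1_def)
    obtain x where x: "x \<in> V" "\<And>c. x \<noteq> cst c * v" using not_all_multiples[OF v] by blast
    have "\<exists>y\<in>V. B v y = 0 \<and> B x y \<noteq> 0"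
    proof (rule ccontr)
      assume H: "\<not> ?thesis"
      have bx: "cst (B x y1) * v \<in> V" using v by blast
      have "x - cst (B x y1) * v = 0"
      proof (rule nondegD)
        show "x - cst (B x y1) * v \<in> V" using x v by blast
        fix y :: "('v, 'k) mpoly" assume y: "y \<in> V"
        let ?y = "y + cst (- B v y) * y1"
        have "?y \<in> V" using y y1 by blast
        moreover have "B v ?y = 0" using bilinearD(2)[OF bil y y1(1) v, of "- B v y"] y1 by simp
        ultimately have "B x ?y = 0" using H by blast
        hence "B x y = B v y * B x y1" using bilinearD(2)[OF bil y y1(1) x(1), of "- B v y"] by simp
        thus "B (x - cst (B x y1) * v) y = 0"
          using bilinearD(5)[OF bil x(1) bx y] bilinearD(7)[OF bil v v y, of "B x y1"] by simp
      qed
      thus False using x(2)[of "B x y1"] by simp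
    qed
    then obtain y where y: "y \<in> V" "B v y = 0" "B x y \<noteq> 0" by blast
    have "cst (B x y) * (v * p0) \<in> J"
      by (rule J.comb2[OF prod[OF x(1) y(1)] prod[OF v y(1)], of _ "- v" x]) (simp add: y algebra_simps)
    thus ?thesis using J.cst_cancel y by blast
  qed simp
  show ?thesis
  proof
    fix p :: "('v, 'k) mpoly" assume "p \<in> forms 3"
    hence "p \<in> forms (Suc 2)" by (simp add: numeral_3_eq_3 numeral_2_eq_2)
    thus "p \<in> J"
    proof (induction rule: forms_Suc_induct)
      case (mult v q)
      note v = \<open>v \<in> V\<close>
      from \<open>q \<in> forms 2\<close> show ?case
      proof (induction rule: forms_2_induct)
        case zero
        show ?case by simp
      next
        case (add p q)
        thus ?case unfolding distrib_left by (intro J.add)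
      next
        case (mult x y)
        show ?case
          by (rule J.comb2[OF prod[OF mult] p0_socle[OF v], of _ v "cst (B x y)"])
            (simp add: algebra_simps)
      qed
    next
      case zero
      show ?case by simp
    next
      case (add p q)
      thus ?case by (intro J.add)
    qed
  qed
qed

end

section \<open>The homogeneous coordinate ring as a module over k[f]\<close>

context poly_ideal
begin

lemma cong_mult: "p - q \<in> I \<Longrightarrow> p' - q' \<in> I \<Longrightarrow> p * p' - q * q' \<in> I"
  by (rule comb2[of "p - q" "p' - q'" _ p' q]) (simp_all add: algebra_simps)

lemma cong_power: "p - q \<in> I \<Longrightarrow> p ^ k - q ^ k \<in> I"
  by (induction k) (auto intro: cong_mult)

end

context basis_ideal
begin

text \<open>
  The section \<open>p / v\<^sup>m\<^sup>-\<^sup>1\<close>, also for \<open>m = 0\<close>, where it is \<open>p v\<close>; this is why it is defined as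
  \<open>v p / v\<^sup>m\<close>.
\<close>

definition val :: "nat \<Rightarrow> ('v, 'k) mpoly \<Rightarrow> ('v, 'k) mpoly"
  where "val m p = red m (v * p)"

lemma v_mult_form: "p \<in> forms m \<Longrightarrow> v * p \<in> forms (Suc m)"
  by (rule forms_mult_1[OF v_form])

lemma v_power_mult_form: "x \<in> V \<Longrightarrow> v ^ m * x \<in> forms (Suc m)"
  by (rule forms_mult_eq[OF v_power_form, of x 1]) auto

lemma val:
  assumes "p \<in> forms m" shows "val m p \<in> V" "v * p - v ^ m * val m p \<in> I"
  unfolding val_def using red[OF v_mult_form[OF assms]] by auto

lemma val_eqI:
  assumes "p \<in> forms m" "x \<in> V" "v * p - v ^ m * x \<in> I" shows "val m p = x"
  unfolding val_def by (rule red_eqI[OF assms(2,3) v_mult_form[OF assms(1)]])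

lemma val_eqI_Suc:
  assumes "p \<in> forms (Suc m)" "x \<in> V" "p - v ^ m * x \<in> I" shows "val (Suc m) p = x"
  by (rule val_eqI[OF assms(1,2)], rule comb1[OF assms(3), of _ v]) (simp add: algebra_simps)

lemma val_Suc_cong:
  assumes "p \<in> forms (Suc m)" shows "p - v ^ m * val (Suc m) p \<in> I"
proof -
  have "v * (p - v ^ m * val (Suc m) p) \<in> I"
    by (rule comb1[OF val(2)[OF assms], of _ 1]) (simp add: algebra_simps)
  thus ?thesis by (rule v_nzd)
qed

lemma val_linear:
  assumes "p \<in> forms m" "q \<in> forms m"
  shows "val m (p + cst c * q) = val m p + cst c * val m q"
proof -
  have e: "v * (p + cst c * q) = v * p + cst c * (v * q)" by (simp add: algebra_simps)
  show ?thesis unfolding val_def e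
    by (rule red_linear[OF v_mult_form[OF assms(1)] v_mult_form[OF assms(2)]])
qed

lemma val_eq_0_iff: 
  assumes "p \<in> forms m" shows "val m p = 0 \<longleftrightarrow> p \<in> I"
  unfolding val_def red_eq_0_iff[OF v_mult_form[OF assms]] using v_nzd mult by blast

lemma val_0 [simp]: "val m 0 = 0"
  by (simp add: val_eq_0_iff)

lemma val_sum:
  assumes "\<And>i. i \<in> A \<Longrightarrow> p i \<in> forms m"
  shows "val m (\<Sum>i\<in>A. cst (c i) * p i) = (\<Sum>i\<in>A. cst (c i) * val m (p i))"
  using assms
proof (induction A rule: infinite_finite_induct)
  case (insert i A)
  have "(\<Sum>i\<in>A. cst (c i) * p i) \<in> forms m"
    by (rule forms_sum) (use insert.prems in auto)
  hence "val m ((\<Sum>i\<in>A. cst (c i) * p i) + cst (c i) * p i) = val m (\<Sum>i\<in>A. cst (c i) * p i) + cst (c i) * val m (p i)"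
    using insert.prems by (intro val_linear) auto
  thus ?case using insert by (simp add: add.commute)
qed auto

lemma val_mult:
  assumes "F \<in> forms L" "F - v ^ L \<in> I" "p \<in> forms m"
  shows "val (L + m) (F * p) = val m p"
proof (rule val_eqI[OF forms_mult[OF assms(1,3)] val(1)[OF assms(3)]])
  show "v * (F * p) - v ^ (L + m) * val m p \<in> I"
    by (rule comb2[OF assms(2) val(2)[OF assms(3)], of _ "v * p" "v ^ L"]) (simp add: algebra_simps power_add)
qed

lemma nzd_if_cong: "F - v ^ L \<in> I \<Longrightarrow> F * p \<in> I \<Longrightarrow> p \<in> I"
  by (rule v_power_nzd[of L], rule comb2[of "F - v ^ L" "F * p" _ "- p" 1]) (auto simp: algebra_simps)

end

text \<open>
  A form \<open>f\<close> that restricts to powers of \<open>v1\<close> and \<open>v2\<close>, and a form \<open>e\<close> such that \<open>e/f\<close> is the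
  idempotent of the first basis.
\<close>

lemma (in two_bases) exists_denominator:
  "\<exists>f d e. 3 \<le> d \<and> N \<le> d \<and> f \<in> forms d \<and> f - v1 ^ d \<in> I1 \<and> f - v2 ^ d \<in> I2 \<and>
     e \<in> forms d \<and> e - f \<in> I1 \<and> e \<in> I2"
proof -
  define d where "d = max 3 N"
  have d: "N \<le> d" "3 \<le> d" by (auto simp: d_def)
  obtain f where f: "f \<in> forms d" "f - v1 ^ d \<in> I1" "f - v2 ^ d \<in> I2"
    using chinese_remainder[OF P.v_power_form Q.v_power_form d(1)] by blast
  obtain e where "e \<in> forms d" "e - f \<in> I1" "e - 0 \<in> I2"
    using chinese_remainder[OF f(1) forms_0 d(1)] by blast
  thus ?thesis using d f by auto
qed

locale two_bases_denominator = two_bases I1 I2 v1 v2 N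
  for I1 I2 :: "('v::finite, 'k::field) mpoly set" and v1 v2 N +
  fixes f :: "('v, 'k) mpoly" and d :: nat
  assumes d: "3 \<le> d" and f_form: "f \<in> forms d"
    and f1: "f - v1 ^ d \<in> I1" and f2: "f - v2 ^ d \<in> I2"
begin

abbreviation (input) II where "II \<equiv> I1 \<inter> I2"

sublocale I: homogeneous_ideal "I1 \<inter> I2"
proof
  show "0 \<in> II" by simp
  fix p q assume p: "p \<in> II"
  thus "q * p \<in> II" using P.mult Q.mult by auto
  show "hcomp d p \<in> II" for d using p P.hcomp_mem Q.hcomp_mem by auto
  assume "q \<in> II"
  with p show "p + q \<in> II" using P.add Q.add by auto
qed

lemma f_power_form: "f ^ k \<in> forms (d * k)"
  by (rule forms_power[OF f_form])

lemma f_power_cong: "f ^ k - v1 ^ (d * k) \<in> I1" "f ^ k - v2 ^ (d * k) \<in> I2"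
  using P.cong_power[OF f1, of k] Q.cong_power[OF f2, of k] by (simp_all add: power_mult)

lemma f_nzd: "f ^ k * p \<in> II \<Longrightarrow> p \<in> II"
  using P.nzd_if_cong[OF f_power_cong(1)] Q.nzd_if_cong[OF f_power_cong(2)] by blast

lemma one_notin_I: "1 \<notin> II"
  using P.one_notin by simp

text \<open>
The values on both bases, as a vector with two entries for each variable.
\<close>

definition coords :: "nat \<Rightarrow> ('v, 'k) mpoly \<Rightarrow> bool \<times> 'v \<Rightarrow> 'k"
  where "coords m p = (\<lambda>(b, w). coord (if b then P.val m p else Q.val m p) w)"

lemma coords_eq_0_iff:
  assumes "p \<in> forms m" shows "(\<forall>x. coords m p x = 0) \<longleftrightarrow> p \<in> II"
proof
  assume c: "\<forall>x. coords m p x = 0"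
  have "P.val m p = 0"
    by (rule forms_1_eqI[OF P.val(1)[OF assms] forms_0]) (use c[rule_format, of "(True, _)"] in \<open>simp add: coords_def\<close>)
  moreover have "Q.val m p = 0"
    by (rule forms_1_eqI[OF Q.val(1)[OF assms] forms_0]) (use c[rule_format, of "(False, _)"] in \<open>simp add: coords_def\<close>)
  ultimately show "p \<in> II" using P.val_eq_0_iff[OF assms] Q.val_eq_0_iff[OF assms] by simp
next
  assume "p \<in> II"
  hence "P.val m p = 0" "Q.val m p = 0" using P.val_eq_0_iff[OF assms] Q.val_eq_0_iff[OF assms] by auto
  thus "\<forall>x. coords m p x = 0" by (simp add: coords_def)
qed

lemma coords_sum:
  assumes "\<And>i. i \<in> A \<Longrightarrow> p i \<in> forms m"
  shows "coords m (\<Sum>i\<in>A. cst (c i) * p i) x = (\<Sum>i\<in>A. c i * coords m (p i) x)"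
  using P.val_sum[of A p m c] Q.val_sum[of A p m c] assms
  by (cases x) (simp add: coords_def coord_sum)

lemma coords_linear:
  assumes "p \<in> forms m" "q \<in> forms m"
  shows "coords m (p + cst c * q) x = coords m p x + c * coords m q x"
  using P.val_linear[OF assms, of c] Q.val_linear[OF assms, of c] by (cases x) (simp add: coords_def)

lemma coords_f_power:
  assumes "p \<in> forms m" shows "coords (d * k + m) (f ^ k * p) = coords m p"
  unfolding coords_def P.val_mult[OF f_power_form f_power_cong(1) assms]
    Q.val_mult[OF f_power_form f_power_cong(2) assms] ..

text \<open>
In large degrees \<open>R\<close> consists of all pairs of linear forms, and \<open>f\<close> shifts the degree.
\<close>

lemma divide_f_power:
  assumes q: "q \<in> forms m" and m: "d * k + Suc N \<le> m"
  shows "\<exists>s\<in>forms (m - d * k). q - f ^ k * s \<in> II"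
proof -
  define i where "i = m - d * k - 1"
  have mi: "m = Suc (d * k + i)" "Suc i = m - d * k" "N \<le> Suc i" using m by (auto simp: i_def)
  note qf = q[unfolded mi(1)]
  have 1: "v1 ^ i * P.val m q \<in> forms (Suc i)" "v2 ^ i * Q.val m q \<in> forms (Suc i)"
    by (rule P.v_power_mult_form[OF P.val(1)[OF q]], rule Q.v_power_mult_form[OF Q.val(1)[OF q]])
  obtain s where s: "s \<in> forms (Suc i)" "s - v1 ^ i * P.val m q \<in> I1" "s - v2 ^ i * Q.val m q \<in> I2"
    using chinese_remainder[OF 1 mi(3)] by blast
  have c: "q - v1 ^ (d * k + i) * P.val m q \<in> I1" "q - v2 ^ (d * k + i) * Q.val m q \<in> I2"
    using P.val_Suc_cong[OF qf] Q.val_Suc_cong[OF qf] by (simp_all only: mi(1)[symmetric])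
  have "q - f ^ k * s \<in> I1"
    by (rule P.comb3[OF f_power_cong(1)[of k] s(2) c(1), of _ "- s" "- (v1 ^ (d * k))" 1])
      (simp add: algebra_simps power_add)
  moreover have "q - f ^ k * s \<in> I2"
    by (rule Q.comb3[OF f_power_cong(2)[of k] s(3) c(2), of _ "- s" "- (v2 ^ (d * k))" 1])
      (simp add: algebra_simps power_add)
  ultimately show ?thesis using s(1) mi(2) by auto
qed

lemma component_form:
  assumes "N \<le> Suc m" "x \<in> V" "y \<in> V"
  obtains p where "p \<in> forms (Suc m)" "P.val (Suc m) p = x" "Q.val (Suc m) p = y"
proof -
  have 1: "v1 ^ m * x \<in> forms (Suc m)" "v2 ^ m * y \<in> forms (Suc m)"
    by (rule P.v_power_mult_form[OF assms(2)], rule Q.v_power_mult_form[OF assms(3)])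
  obtain p where "p \<in> forms (Suc m)" "p - v1 ^ m * x \<in> I1" "p - v2 ^ m * y \<in> I2"
    using chinese_remainder[OF 1 assms(1)] by blast
  thus ?thesis using that P.val_eqI_Suc Q.val_eqI_Suc assms by blast
qed

lemma unit_coords_form:
  assumes "N \<le> m" "0 < m"
  obtains p where "p \<in> forms m" "\<And>y. coords m p y = (if x = y then 1 else 0)"
proof -
  obtain b w where x: "x = (b, w)" by (cases x)
  obtain i where i: "m = Suc i" using assms(2) by (cases m) auto
  have m: "N \<le> Suc i" using assms i by simp
  show ?thesis
  proof (cases b)
    case True
    obtain p where "p \<in> forms (Suc i)" "P.val (Suc i) p = pvar w" "Q.val (Suc i) p = 0"
      using component_form[OF m pvar_in_forms forms_0] by blast
    thus ?thesis using that[of p] True x i by (auto simp: coords_def)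
  next
    case False
    obtain p where "p \<in> forms (Suc i)" "P.val (Suc i) p = 0" "Q.val (Suc i) p = pvar w"
      using component_form[OF m forms_0 pvar_in_forms] by blast
    thus ?thesis using that[of p] False x i by (auto simp: coords_def)
  qed
qed

text \<open>
  The Hilbert function of \<open>R\<close> is at most twice the number of variables, with equality in large
  degrees. So if \<open>u\<close> is not a zero divisor, then \<open>R/u\<close> is finite-dimensional, and the powers of \<open>f\<close> become dependent in it.
\<close>

lemma polynomial_in_multiples:
  assumes u: "\<And>p. u * p \<in> II \<Longrightarrow> p \<in> II"
  shows "\<exists>s c y. (\<exists>i\<le>s. c i \<noteq> 0) \<and> (\<Sum>i\<le>s. cst (c i) * f ^ i) - u * y \<in> II"
proof -
  obtain e where e: "\<And>m. e \<le> m \<Longrightarrow> hcomp m u = 0" using hcomp_eventually_0 by blast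
  let ?X = "UNIV :: (bool \<times> 'v) set"
  let ?n = "card ?X"
  have n: "0 < ?n" by (simp add: card_gt_0_iff)
  define s where "s = ?n * (e + Suc N)"
  define T where "T = d * s + Suc (Suc N)"
  \<comment> \<open>The multiples by \<open>u\<close> of a basis of the degrees from \<open>Suc N\<close> to \<open>T\<close>, together with \<open>s + 1\<close> powers of \<open>f\<close>, outnumber the coordinates in degrees below \<open>T + e\<close>, which bounds their degrees.\<close>
  have "\<forall>m x. \<exists>p. Suc N \<le> m \<longrightarrow> p \<in> forms m \<and> (\<forall>y. coords m p y = (if x = y then 1 else 0))"
  proof (intro allI)
    fix m x
    show "\<exists>p. Suc N \<le> m \<longrightarrow> p \<in> forms m \<and> (\<forall>y. coords m p y = (if x = y then 1 else 0))"
    proof (cases "Suc N \<le> m")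
      case True
      hence "N \<le> m" "0 < m" by auto
      then obtain p where "p \<in> forms m" "\<And>y. coords m p y = (if x = y then 1 else 0)"
        by (rule unit_coords_form[where x = x]) (rule that)
      thus ?thesis by blast
    qed simp
  qed
  then obtain w where w: "\<And>m x. Suc N \<le> m \<Longrightarrow> w m x \<in> forms m"
     "\<And>m x y. Suc N \<le> m \<Longrightarrow> coords m (w m x) y = (if x = y then 1 else 0)"
    by metis
  define Y1 where "Y1 = {Suc N..<T} \<times> ?X"
  define V where "V = (\<lambda>z. case z of Inl (m, x) \<Rightarrow> u * w m x | Inr i \<Rightarrow> f ^ i)"
  define Y where "Y = Y1 <+> {..s}"
  have finY: "finite Y1" "finite Y" by (auto simp: Y1_def Y_def)
  have cardY: "card Y = (T - Suc N) * ?n + Suc s"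
    unfolding Y_def Y1_def by (subst card_Plus) (auto simp: card_cartesian_product)
  have cardX: "card ({..<T + e} \<times> ?X) = (T + e) * ?n" by (simp add: card_cartesian_product)
  have "T + e = (T - Suc N) + (e + Suc N)" by (simp add: T_def)
  hence "(T + e) * ?n = (T - Suc N) * ?n + (e + Suc N) * ?n" by (metis distrib_right)
  hence lt: "card ({..<T + e} \<times> ?X) < card Y"
    unfolding cardX cardY s_def by (simp add: mult.commute)
  obtain c where c: "\<exists>z\<in>Y. c z \<noteq> 0"
    "\<forall>x\<in>{..<T + e} \<times> ?X. (\<Sum>z\<in>Y. c z * (coords (fst x) (hcomp (fst x) (V z)) (snd x))) = 0"
  proof -
    have "finite ({..<T + e} \<times> ?X)" by simp
    from exists_linear_dependency[where a = "\<lambda>z x. coords (fst x) (hcomp (fst x) (V z)) (snd x)",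
        OF this finY(2) lt]
    show ?thesis by (elim exE conjE) (rule that)
  qed
  define p where "p = (\<Sum>z\<in>Y. cst (c z) * V z)"
  define y where "y = (\<Sum>(m, x)\<in>Y1. cst (c (Inl (m, x))) * w m x)"
  have "p \<in> II"
  proof (rule I.memI)
    fix m
    have hp: "hcomp m p = (\<Sum>z\<in>Y. cst (c z) * hcomp m (V z))"
      by (simp add: p_def hcomp_sum hcomp_cst_mult)
    show "hcomp m p \<in> II"
    proof (cases "m < T + e")
      case True
      have "coords m (hcomp m p) x = 0" for x
        unfolding hp using coords_sum[of Y "\<lambda>z. hcomp m (V z)" m c x] bspec[OF c(2), of "(m, x)"] True by simp
      thus ?thesis using coords_eq_0_iff[OF hcomp_in_forms] by blast
    next
      case False
      have "hcomp m (V z) = 0" if "z \<in> Y" for z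
      proof (cases z)
        case (Inl a)
        obtain i x where ix: "a = (i, x)" by (cases a)
        have a: "a = (i, x)" "Suc N \<le> i" "i < T" using that Inl ix by (auto simp: Y_def Y1_def)
        have "hcomp m (w i x * u) = 0"
          unfolding hcomp_form_mult[OF w(1)[OF a(2)]] using e[of "m - i"] False a(3) by simp
        thus ?thesis by (simp add: V_def Inl a mult.commute)
      next
        case (Inr i)
        hence "i \<le> s" using that by (auto simp: Y_def)
        hence "d * i \<le> d * s" by (rule mult_le_mono2)
        hence "d * i \<noteq> m" using False unfolding T_def by linarith
        thus ?thesis using hcomp_form[OF f_power_form, of m i] by (simp add: V_def Inr)
      qed
      thus ?thesis by (simp add: hp)
    qed
  qed
  moreover have p: "p = u * y + (\<Sum>i\<le>s. cst (c (Inr i)) * f ^ i)"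
  proof -
    have "p = (\<Sum>z\<in>Y1. cst (c (Inl z)) * V (Inl z)) + (\<Sum>i\<le>s. cst (c (Inr i)) * V (Inr i))"
      unfolding p_def Y_def by (subst sum.Plus) (auto simp: finY)
    also have "(\<Sum>z\<in>Y1. cst (c (Inl z)) * V (Inl z)) = u * y"
      unfolding y_def sum_distrib_left by (rule sum.cong) (auto simp: V_def algebra_simps)
    finally show ?thesis by (simp add: V_def)
  qed
  ultimately have mem: "(\<Sum>i\<le>s. cst (c (Inr i)) * f ^ i) - u * (- y) \<in> II" by (simp add: add.commute)
  have "\<exists>i\<le>s. c (Inr i) \<noteq> 0"
  proof (rule ccontr)
    assume "\<not> ?thesis"
    hence z: "c (Inr i) = 0" if "i \<le> s" for i using that by blast
    hence "u * y \<in> II" using \<open>p \<in> II\<close> p by simp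
    hence y: "y \<in> II" by (rule u)
    have "c (Inl (m, x)) = 0" if m: "m \<in> {Suc N..<T}" for m x
    proof -
      have "hcomp m y = (\<Sum>(i, x)\<in>Y1. cst (c (Inl (i, x))) * hcomp m (w i x))"
        unfolding y_def hcomp_sum by (rule sum.cong) (auto simp: hcomp_cst_mult)
      also have "\<dots> = (\<Sum>(i, x)\<in>Y1. if i = m then cst (c (Inl (m, x))) * w m x else 0)"
        by (rule sum.cong) (auto simp: hcomp_form[OF w(1)] Y1_def)
      also have "\<dots> = (\<Sum>i\<in>{Suc N..<T}. \<Sum>x\<in>?X. if i = m then cst (c (Inl (m, x))) * w m x else 0)"
        unfolding Y1_def by (rule sum.cartesian_product[symmetric])
      also have "\<dots> = (\<Sum>i\<in>{Suc N..<T}. if i = m then \<Sum>x\<in>?X. cst (c (Inl (m, x))) * w m x else 0)"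
        by (rule sum.cong) auto
      also have "\<dots> = (\<Sum>x\<in>?X. cst (c (Inl (m, x))) * w m x)"
        using m by (simp add: sum.delta)
      finally have h: "hcomp m y = (\<Sum>x\<in>?X. cst (c (Inl (m, x))) * w m x)" .
      have "hcomp m y \<in> II" by (rule I.hcomp_mem[OF y])
      hence "0 = coords m (hcomp m y) x" using coords_eq_0_iff[OF hcomp_in_forms] by metis
      also have "\<dots> = (\<Sum>x'\<in>?X. c (Inl (m, x')) * coords m (w m x') x)"
        unfolding h using coords_sum[of ?X "w m" m "\<lambda>x. c (Inl (m, x))" x] w(1) m by simp
      also have "\<dots> = (\<Sum>x'\<in>?X. if x' = x then c (Inl (m, x)) else 0)"
        by (rule sum.cong) (use w(2) m in auto)
      finally show ?thesis by (simp add: sum.delta)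
    qed
    hence "c z = 0" if "z \<in> Y" for z
      using that z by (auto simp: Y_def Y1_def)
    thus False using c(1) by blast
  qed
  with mem show ?thesis by (intro exI[of _ s] exI[of _ "\<lambda>i. c (Inr i)"] exI[of _ "- y"]) auto
qed

end

lemma finite_basis_low_degree:
  fixes A :: "('v::finite, 'k::field) mpoly set"
  assumes A: "poly_ideal A"
  shows "\<exists>F. finite F \<and> F \<subseteq> A \<and>
    (\<forall>q\<in>A. (\<forall>m\<ge>D. hcomp m q = 0) \<longrightarrow> (\<exists>c. q = (\<Sum>b\<in>F. cst (c b) * b)))"
proof -
  interpret A: poly_ideal A by fact
  let ?M = "{m :: 'v \<Rightarrow>\<^sub>0 nat. mdeg m \<le> D}"
  define A0 where "A0 = {q \<in> A. \<forall>m\<ge>D. hcomp m q = 0}"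
  define G where "G = lookup ` A0"
  have outside: "lookup q m = 0" if "q \<in> A0" "m \<notin> ?M" for q m
  proof -
    have "hcomp (mdeg m) q = 0" using that by (auto simp: A0_def)
    hence "lookup (hcomp (mdeg m) q) m = 0" by simp
    thus ?thesis by simp
  qed
  have A0: "p + cst c * q \<in> A0" if "p \<in> A0" "q \<in> A0" for p q c
    using that by (auto simp: A0_def hcomp_add hcomp_cst_mult intro: A.add A.mult)
  have "0 \<in> A0" by (simp add: A0_def)
  have "lin_closed G"
    unfolding lin_closed_def
  proof (intro conjI ballI allI)
    show "G \<noteq> {}" using \<open>0 \<in> A0\<close> by (auto simp: G_def)
    fix g h a assume "g \<in> G" "h \<in> G"
    then obtain p q where pq: "p \<in> A0" "q \<in> A0" "g = lookup p" "h = lookup q"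
      unfolding G_def by blast
    hence "(\<lambda>i. g i + a * h i) = lookup (p + cst a * q)" by (auto simp: lookup_add)
    thus "(\<lambda>i. g i + a * h i) \<in> G" using A0[OF pq(1,2)] unfolding G_def by blast
  qed
  from finite_spanning_set[OF finite_monomials[of D] this]
  obtain F where F: "finite F" "F \<subseteq> G" "\<forall>g\<in>G. \<exists>c. \<forall>x\<in>?M. g x = (\<Sum>f\<in>F. c f * f x)"
    by (elim exE conjE) (rule that)
  define F' where "F' = {q \<in> A0. lookup q \<in> F}"
  have inj: "inj_on lookup F'" by (intro inj_onI poly_mapping_eqI) simp
  have img: "lookup ` F' = F" using F(2) by (auto simp: F'_def G_def)
  have fin: "finite F'" by (rule finite_imageD[OF _ inj]) (simp add: img F(1))
  have "\<exists>c. q = (\<Sum>b\<in>F'. cst (c b) * b)" if q: "q \<in> A0" for q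
  proof -
    obtain c where c: "\<forall>x\<in>?M. lookup q x = (\<Sum>f\<in>F. c f * f x)"
      using bspec[OF F(3), of "lookup q"] q by (auto simp: G_def)
    have "q = (\<Sum>b\<in>F'. cst (c (lookup b)) * b)"
    proof (rule poly_mapping_eqI)
      fix m
      show "lookup q m = lookup (\<Sum>b\<in>F'. cst (c (lookup b)) * b) m"
      proof (cases "m \<in> ?M")
        case True
        hence "lookup q m = (\<Sum>f\<in>F. c f * f m)" using c by blast
        also have "\<dots> = (\<Sum>b\<in>F'. c (lookup b) * lookup b m)"
          unfolding img[symmetric] by (rule sum.reindex_cong[OF inj refl]) simp
        finally show ?thesis by (simp add: lookup_sum)
      next
        case False
        have "(\<Sum>b\<in>F'. c (lookup b) * lookup b m) = 0"
          by (rule sum.neutral) (use outside False in \<open>auto simp: F'_def\<close>)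
        thus ?thesis using outside[OF q False] by (simp add: lookup_sum)
      qed
    qed
    thus ?thesis by (intro exI[of _ "\<lambda>b. c (lookup b)"])
  qed
  thus ?thesis using fin by (intro exI[of _ F']) (auto simp: F'_def A0_def)
qed

context two_bases_denominator
begin

text \<open>
  A leading-form argument. In the degrees congruent to \<open>r\<close> modulo \<open>d\<close>, the coordinate vectors of
  the top components of elements of \<open>A\<close> form one subspace \<open>G r\<close>, since multiplication by \<open>f\<close> shifts
  degrees without changing coordinates. Elements of \<open>A\<close> whose top components span \<open>G r\<close> reduce
  everything of large degree, and what remains lies in a finite-dimensional space.
\<close>

theorem ideals_finitely_generated:
  assumes A: "poly_ideal A" and IA: "II \<subseteq> A"
  shows "\<exists>F. finite F \<and> F \<subseteq> A \<and> (\<forall>q\<in>A. \<exists>c. q - (\<Sum>b\<in>F. c b * b) \<in> II)"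
proof -
  interpret A: poly_ideal A by fact
  let ?X = "UNIV :: (bool \<times> 'v) set"
  define top where "top m q \<longleftrightarrow> q \<in> A \<and> (\<forall>i>m. hcomp i q = 0)" for m q
  have top_lin: "top m (p + cst c * q)" if "top m p" "top m q" for m p q c
    using that by (auto simp: top_def hcomp_add hcomp_cst_mult intro: A.add A.mult)
  have top_f: "top (d * k + m) (f ^ k * q)" if "top m q" for k m q
    using that by (auto simp: top_def hcomp_form_mult[OF f_power_form] intro: A.mult)
  have hc_f: "hcomp (d * k + m) (f ^ k * q) = f ^ k * hcomp m q" for k m q
    by (simp add: hcomp_form_mult[OF f_power_form])
  define G where "G r = {coords (d * i + r) (hcomp (d * i + r) q) | i q. top (d * i + r) q}" for r
  have lc: "lin_closed (G r)" for r
    unfolding lin_closed_def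
  proof (intro conjI ballI allI)
    have "top (d * 0 + r) 0" by (simp add: top_def)
    thus "G r \<noteq> {}" unfolding G_def by blast
    fix g h a assume "g \<in> G r" "h \<in> G r"
    then obtain i p j q where pq: "top (d * i + r) p" "top (d * j + r) q"
      "g = coords (d * i + r) (hcomp (d * i + r) p)" "h = coords (d * j + r) (hcomp (d * j + r) q)"
      unfolding G_def by blast
    define m where "m = d * (i + j) + r"
    have m: "d * j + (d * i + r) = m" "d * i + (d * j + r) = m" by (auto simp: m_def algebra_simps)
    have t: "top m (f ^ j * p)" "top m (f ^ i * q)"
      using top_f[OF pq(1), of j] top_f[OF pq(2), of i] by (simp_all only: m)
    have "g = coords m (hcomp m (f ^ j * p))"
      unfolding m(1)[symmetric] hc_f pq(3) by (rule coords_f_power[OF hcomp_in_forms, symmetric])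
    moreover have "h = coords m (hcomp m (f ^ i * q))"
      unfolding m(2)[symmetric] hc_f pq(4) by (rule coords_f_power[OF hcomp_in_forms, symmetric])
    ultimately have "(\<lambda>x. g x + a * h x) = coords m (hcomp m (f ^ j * p + cst a * (f ^ i * q)))"
      by (intro ext) (simp add: hcomp_add hcomp_cst_mult coords_linear[OF hcomp_in_forms hcomp_in_forms])
    thus "(\<lambda>x. g x + a * h x) \<in> G r"
      using top_lin[OF t, of a] unfolding G_def m_def by blast
  qed
  have "\<forall>r. \<exists>F. finite F \<and> F \<subseteq> G r \<and> (\<forall>g\<in>G r. \<exists>c. \<forall>x\<in>?X. g x = (\<Sum>f\<in>F. c f * f x))"
    by (intro allI finite_spanning_set lc) simp
  from choice[OF this] obtain F where F': "\<forall>r. finite (F r) \<and> F r \<subseteq> G r \<and>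
     (\<forall>g\<in>G r. \<exists>c. \<forall>x\<in>?X. g x = (\<Sum>f\<in>F r. c f * f x))"
    by (rule exE)
  have F: "finite (F r)" "F r \<subseteq> G r" "\<forall>g\<in>G r. \<exists>c. \<forall>x\<in>?X. g x = (\<Sum>f\<in>F r. c f * f x)" for r
    using spec[OF F', of r] by simp_all
  have "\<forall>r \<phi>. \<exists>i q. \<phi> \<in> F r \<longrightarrow> top (d * i + r) q \<and> \<phi> = coords (d * i + r) (hcomp (d * i + r) q)"
  proof (intro allI)
    fix r \<phi>
    show "\<exists>i q. \<phi> \<in> F r \<longrightarrow> top (d * i + r) q \<and> \<phi> = coords (d * i + r) (hcomp (d * i + r) q)"
    proof (cases "\<phi> \<in> F r")
      case True
      hence "\<phi> \<in> G r" by (rule subsetD[OF F(2)])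
      thus ?thesis unfolding G_def mem_Collect_eq by blast
    qed simp
  qed
  then obtain i b where ib: "\<And>r \<phi>. \<phi> \<in> F r \<Longrightarrow> top (d * i r \<phi> + r) (b r \<phi>)"
     "\<And>r \<phi>. \<phi> \<in> F r \<Longrightarrow> \<phi> = coords (d * i r \<phi> + r) (hcomp (d * i r \<phi> + r) (b r \<phi>))"
    by metis
  define Gen where "Gen = (\<Union>r<d. b r ` F r)"
  have Gen: "finite Gen" "Gen \<subseteq> A" using F(1) ib(1) by (auto simp: Gen_def top_def)
  obtain K where K: "\<And>r \<phi>. r < d \<Longrightarrow> \<phi> \<in> F r \<Longrightarrow> i r \<phi> \<le> K"
  proof -
    have "finite (\<Union>r<d. i r ` F r)" using F(1) by simp
    then obtain K where "\<forall>x\<in>(\<Union>r<d. i r ` F r). x \<le> K" using finite_nat_set_iff_bounded_le by blast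
    thus ?thesis using that by blast
  qed
  obtain L where L: "finite L" "L \<subseteq> A"
    "\<And>q. q \<in> A \<Longrightarrow> (\<forall>m\<ge>d * K + d. hcomp m q = 0) \<Longrightarrow> \<exists>c. q = (\<Sum>b\<in>L. cst (c b) * b)"
  proof -
    from finite_basis_low_degree[OF A, of "d * K + d"]
    obtain L where L: "finite L" "L \<subseteq> A"
      "\<forall>q\<in>A. (\<forall>m\<ge>d * K + d. hcomp m q = 0) \<longrightarrow> (\<exists>c. q = (\<Sum>b\<in>L. cst (c b) * b))"
      by (elim exE conjE) (rule that)
    show ?thesis by (rule that[OF L(1,2)]) (use L(3) in blast)
  qed
  let ?F = "Gen \<union> L"
  have fin: "finite ?F" using Gen L by simp
  define ok where "ok q \<longleftrightarrow> (\<exists>c. q - (\<Sum>b\<in>?F. c b * b) \<in> II)" for q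
  have ok_add: "ok (p + q)" if "ok p" "ok q" for p q
  proof -
    obtain c where c: "p - (\<Sum>b\<in>?F. c b * b) \<in> II" using \<open>ok p\<close> unfolding ok_def by (rule exE)
    obtain c' where c': "q - (\<Sum>b\<in>?F. c' b * b) \<in> II" using \<open>ok q\<close> unfolding ok_def by (rule exE)
    note cc = c c'
    have "p + q - (\<Sum>b\<in>?F. (c b + c' b) * b) \<in> II"
      by (rule I.comb2[OF cc, of _ 1 1]) (simp add: algebra_simps sum.distrib)
    thus ?thesis unfolding ok_def by (intro exI)
  qed
  have ok_I: "ok q" if "q \<in> II" for q
    unfolding ok_def by (rule exI[of _ "\<lambda>_. 0"]) (use that in simp)
  have ok_gen: "ok (a * g)" if "g \<in> ?F" for a g
  proof -
    have "(\<Sum>b\<in>?F. (if b = g then a else 0) * b) = (\<Sum>b\<in>?F. if b = g then a * g else 0)"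
      by (rule sum.cong) auto
    also have "\<dots> = a * g" using that fin by (simp add: sum.delta)
    finally show ?thesis unfolding ok_def by (intro exI[of _ "\<lambda>b. if b = g then a else 0"]) simp
  qed
  have ok_sum: "ok (\<Sum>x\<in>Z. h x)" if "\<And>x. x \<in> Z \<Longrightarrow> ok (h x)" for Z :: "(bool \<times> 'v \<Rightarrow> 'k) set" and h
    using that by (induction Z rule: infinite_finite_induct) (auto intro: ok_add ok_I)
  have main: "(\<forall>m\<ge>D. hcomp m q = 0) \<Longrightarrow> q \<in> A \<Longrightarrow> ok q" for D q
  proof (induction D arbitrary: q)
    case 0
    have "q = 0" by (rule hcomp_eqI) (use 0 in simp)
    thus ?case by (simp add: ok_I)
  next
    case (Suc D)
    note hyps = Suc.prems(1) and q = Suc.prems(2)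
    show "ok q"
      proof (cases "D < d * K + d")
        case True
        then obtain c where c: "q = (\<Sum>b\<in>L. cst (c b) * b)" using L(3)[OF q] hyps by auto
        have "q = (\<Sum>b\<in>?F. (if b \<in> L then cst (c b) else 0) * b)"
          unfolding c by (rule sum.mono_neutral_cong_left) (use fin in auto)
        thus ?thesis unfolding ok_def by (intro exI[of _ "\<lambda>b. if b \<in> L then cst (c b) else 0"]) simp
      next
        case False
        define r where "r = D mod d"
        define k where "k = D div d"
        have D: "D = d * k + r" and r: "r < d" using d by (auto simp: r_def k_def)
        have k: "K \<le> k"
        proof (rule ccontr)
          assume "\<not> K \<le> k"
          hence "d * Suc k \<le> d * K" by (intro mult_le_mono2) simp
          thus False using False D r by simp
        qed
        have t: "top (d * k + r) q" using q hyps by (auto simp: top_def D)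
        hence "coords D (hcomp D q) \<in> G r" unfolding G_def D by blast
        from bspec[OF F(3)[of r] this]
        obtain c where c: "\<forall>x\<in>?X. coords D (hcomp D q) x = (\<Sum>\<phi>\<in>F r. c \<phi> * \<phi> x)" by (rule exE)
        define h where "h \<phi> = f ^ (k - i r \<phi>) * b r \<phi>" for \<phi>
        have h: "top D (h \<phi>)" "\<phi> = coords D (hcomp D (h \<phi>))" "ok (cst (- c \<phi>) * h \<phi>)" "ok (cst (c \<phi>) * h \<phi>)"
          if \<phi>: "\<phi> \<in> F r" for \<phi>
        proof -
          have "i r \<phi> \<le> k" using K[OF r \<phi>] k by simp
          hence D': "D = d * (k - i r \<phi>) + (d * i r \<phi> + r)"
            unfolding D by (simp add: add.assoc[symmetric] distrib_left[symmetric])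
          show "top D (h \<phi>)" unfolding D' h_def by (rule top_f[OF ib(1)[OF \<phi>]])
          have "coords D (hcomp D (h \<phi>)) = coords (d * i r \<phi> + r) (hcomp (d * i r \<phi> + r) (b r \<phi>))"
            unfolding D' h_def hc_f by (rule coords_f_power[OF hcomp_in_forms])
          thus "\<phi> = coords D (hcomp D (h \<phi>))" using ib(2)[OF \<phi>] by simp
          have "b r \<phi> \<in> ?F" using \<phi> r by (auto simp: Gen_def)
          thus "ok (cst (- c \<phi>) * h \<phi>)" "ok (cst (c \<phi>) * h \<phi>)"
            unfolding h_def mult.assoc[symmetric] by (blast intro: ok_gen)+
        qed
        define q1 where "q1 = q + (\<Sum>\<phi>\<in>F r. cst (- c \<phi>) * h \<phi>)"
        have hq1: "hcomp m q1 = hcomp m q + (\<Sum>\<phi>\<in>F r. cst (- c \<phi>) * hcomp m (h \<phi>))" for m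
          by (simp add: q1_def hcomp_add hcomp_sum hcomp_cst_mult)
        have "coords D (hcomp D q1) x = 0" for x
        proof -
          have "coords D (hcomp D q1) x = coords D (hcomp D q) x + (\<Sum>\<phi>\<in>F r. - c \<phi> * coords D (hcomp D (h \<phi>)) x)"
            unfolding hq1 using coords_linear[OF hcomp_in_forms, of "\<Sum>\<phi>\<in>F r. cst (- c \<phi>) * hcomp D (h \<phi>)" D q 1 x]
              coords_sum[of "F r" "\<lambda>\<phi>. hcomp D (h \<phi>)" D "\<lambda>\<phi>. - c \<phi>" x] by (simp add: forms_sum forms_cst_mult)
          also have "(\<Sum>\<phi>\<in>F r. - c \<phi> * coords D (hcomp D (h \<phi>)) x) = (\<Sum>\<phi>\<in>F r. - c \<phi> * \<phi> x)"
            by (rule sum.cong) (use h(2) in auto)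
          finally show ?thesis using c by (simp add: sum_negf)
        qed
        hence top1: "hcomp D q1 \<in> II" using coords_eq_0_iff[OF hcomp_in_forms] by blast
        have q1A: "q1 \<in> A" unfolding q1_def using q h(1) by (intro A.add A.sum A.mult) (auto simp: top_def)
        have "q1 - hcomp D q1 \<in> A" using q1A top1 IA by (intro A.diff) auto
        moreover have "hcomp m (q1 - hcomp D q1) = 0" if "D \<le> m" for m
        proof (cases "m = D")
          case True
          thus ?thesis by (simp add: hcomp_diff hcomp_form[OF hcomp_in_forms])
        next
          case False
          hence "D < m" using that by simp
          hence "hcomp m q1 = 0" unfolding hq1 using h(1) hyps by (auto simp: top_def)
          thus ?thesis using False by (simp add: hcomp_diff hcomp_form[OF hcomp_in_forms])
        qed
        ultimately have "ok (q1 - hcomp D q1)" using Suc.IH by blast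
        hence "ok (q1 - hcomp D q1 + hcomp D q1 + (\<Sum>\<phi>\<in>F r. cst (c \<phi>) * h \<phi>))"
          using ok_I[OF top1] h(4) by (intro ok_add ok_sum)
        moreover have "q1 - hcomp D q1 + hcomp D q1 + (\<Sum>\<phi>\<in>F r. cst (c \<phi>) * h \<phi>) = q"
          by (simp add: q1_def cst_uminus sum_negf)
        ultimately show ?thesis by simp
      qed
  qed
  have "ok q" if "q \<in> A" for q
  proof -
    obtain D where "\<forall>m\<ge>D. hcomp m q = 0" using hcomp_eventually_0 by blast
    thus ?thesis using main that by blast
  qed
  thus ?thesis using fin Gen L unfolding ok_def by (intro exI[of _ ?F]) auto
qed

end

section \<open>Ideals of finite codimension\<close>

definition linear_functional :: "(('v::finite, 'k::field) mpoly \<Rightarrow> 'k) \<Rightarrow> bool"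
  where "linear_functional l \<longleftrightarrow> (\<forall>p q c. l (p + cst c * q) = l p + c * l q)"

lemma linear_functionalD:
  assumes "linear_functional l"
  shows "l (p + cst c * q) = l p + c * l q" "l 0 = 0" "l (p + q) = l p + l q" "l (p - q) = l p - l q"
    "l (cst c * p) = c * l p"
proof -
  have 1: "l (p + cst c * q) = l p + c * l q" for p c q using assms by (simp add: linear_functional_def)
  show "l (p + cst c * q) = l p + c * l q" by (rule 1)
  show 0: "l 0 = 0" using 1[of 0 "-1" 0] by simp
  show "l (p + q) = l p + l q" using 1[of p 1 q] by simp
  show "l (p - q) = l p - l q" using 1[of p "-1" q] by (simp add: cst_uminus)
  show "l (cst c * p) = c * l p" using 1[of 0 c p] 0 by simp
qed

lemma linear_functional_sum:
  assumes "linear_functional l" shows "l (\<Sum>i\<in>A. cst (c i) * p i) = (\<Sum>i\<in>A. c i * l (p i))"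
  by (induction A rule: infinite_finite_induct) (auto simp: linear_functionalD[OF assms])

locale finite_ideal = poly_ideal K for K :: "('v::finite, 'k::field) mpoly set" +
  fixes M :: "('v, 'k) mpoly set"
  assumes finM: "finite M" and spanM: "\<exists>c. q - (\<Sum>b\<in>M. cst (c b) * b) \<in> K"
begin

definition cf :: "('v, 'k) mpoly \<Rightarrow> ('v, 'k) mpoly \<Rightarrow> 'k"
  where "cf q = (SOME c. q - (\<Sum>b\<in>M. cst (c b) * b) \<in> K)"

lemma cf: "q - (\<Sum>b\<in>M. cst (cf q b) * b) \<in> K"
  unfolding cf_def by (rule someI_ex[OF spanM])

text \<open>
A linear relation between the powers of \<open>s\<close>, solved for the lowest one.
\<close>

lemma power_stabilizes: "\<exists>j y. s ^ j - s ^ Suc j * y \<in> K"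
proof -
  obtain c where c: "\<exists>i\<in>{..card M}. c i \<noteq> 0" "\<forall>b\<in>M. (\<Sum>i\<in>{..card M}. c i * cf (s ^ i) b) = 0"
  proof -
    have "card M < card {..card M}" by simp
    from exists_linear_dependency[where a = "\<lambda>i b. cf (s ^ i) b", OF finM finite_atMost this]
    show ?thesis by (elim exE conjE) (rule that)
  qed
  let ?n = "card M"
  have rel: "(\<Sum>i\<le>?n. cst (c i) * s ^ i) \<in> K"
  proof -
    have "(\<Sum>i\<le>?n. cst (c i) * (s ^ i - (\<Sum>b\<in>M. cst (cf (s ^ i) b) * b))) \<in> K"
      by (intro sum mult cf)
    moreover have "(\<Sum>i\<le>?n. cst (c i) * (\<Sum>b\<in>M. cst (cf (s ^ i) b) * b)) = 0"
    proof -
      have "(\<Sum>i\<le>?n. cst (c i) * (\<Sum>b\<in>M. cst (cf (s ^ i) b) * b))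
        = (\<Sum>b\<in>M. \<Sum>i\<le>?n. cst (c i * cf (s ^ i) b) * b)"
        unfolding sum_distrib_left by (subst sum.swap) (simp only: cst_mult mult.assoc)
      also have "\<dots> = (\<Sum>b\<in>M. cst (\<Sum>i\<le>?n. c i * cf (s ^ i) b) * b)"
        unfolding cst_sum sum_distrib_right ..
      also have "\<dots> = 0" using c(2) by (intro sum.neutral) simp
      finally show ?thesis .
    qed
    ultimately show ?thesis by (simp add: right_diff_distrib sum_subtractf)
  qed
  define j where "j = (LEAST i. i \<le> ?n \<and> c i \<noteq> 0)"
  have j: "j \<le> ?n" "c j \<noteq> 0" using LeastI_ex[of "\<lambda>i. i \<le> ?n \<and> c i \<noteq> 0"] c(1) by (auto simp: j_def)
  have below: "c i = 0" if "i < j" for i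
    using not_less_Least[of i "\<lambda>i. i \<le> ?n \<and> c i \<noteq> 0"] that j(1) by (auto simp: j_def)
  define z where "z = (\<Sum>i\<in>{Suc j..?n}. cst (c i) * s ^ (i - Suc j))"
  have "(\<Sum>i\<le>?n. cst (c i) * s ^ i) = (\<Sum>i\<in>{j..?n}. cst (c i) * s ^ i)"
    by (rule sum.mono_neutral_right) (use below in \<open>auto simp: not_le\<close>)
  also have "\<dots> = cst (c j) * s ^ j + (\<Sum>i\<in>{Suc j..?n}. cst (c i) * s ^ i)"
    by (rule sum.atLeast_Suc_atMost) (use j in simp)
  also have "(\<Sum>i\<in>{Suc j..?n}. cst (c i) * s ^ i) = s ^ Suc j * z"
    unfolding z_def sum_distrib_left
  proof (rule sum.cong[OF refl])
    fix i assume "i \<in> {Suc j..?n}"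
    hence "i = Suc j + (i - Suc j)" by simp
    hence "s ^ i = s ^ Suc j * s ^ (i - Suc j)" by (metis power_add)
    thus "cst (c i) * s ^ i = s ^ Suc j * (cst (c i) * s ^ (i - Suc j))" by (simp only: mult.left_commute)
  qed
  finally have "cst (c j) * s ^ j + s ^ Suc j * z \<in> K" using rel by simp
  hence "cst (inverse (c j)) * (cst (c j) * s ^ j + s ^ Suc j * z) \<in> K" by (rule mult)
  hence "s ^ j - s ^ Suc j * (- (cst (inverse (c j)) * z)) \<in> K"
    unfolding distrib_left cst_inverse_mult[OF j(2)] by (simp add: algebra_simps)
  thus ?thesis by blast
qed

lemma power_idempotent: "\<exists>j y. 0 < j \<and> s ^ j - s ^ (j + j) * y \<in> K"
proof -
  obtain j0 y where jy: "s ^ j0 - s ^ Suc j0 * y \<in> K" using power_stabilizes by blast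
  define j where "j = Suc j0"
  have 1: "s ^ j - s ^ Suc j * y \<in> K"
    by (rule comb1[OF jy, of _ s]) (simp add: j_def algebra_simps)
  have "s ^ j - s ^ (j + m) * y ^ m \<in> K" for m
  proof (induction m)
    case (Suc m)
    show ?case
      by (rule comb2[OF Suc 1, of _ 1 "s ^ m * y ^ m"]) (simp add: algebra_simps power_add)
  qed simp
  from this[of j] show ?thesis by (intro exI[of _ j] exI[of _ "y ^ j"]) (simp add: j_def)
qed

lemma subspace_spanning:
  assumes A: "0 \<in> A" "\<And>p q c. p \<in> A \<Longrightarrow> q \<in> A \<Longrightarrow> p + cst c * q \<in> A" "K \<subseteq> A"
  obtains F :: "(('v, 'k) mpoly \<Rightarrow> 'k) set" and b where "finite F" "\<And>\<phi>. \<phi> \<in> F \<Longrightarrow> b \<phi> \<in> A"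
    "\<And>q. q \<in> A \<Longrightarrow> \<exists>a. q - (\<Sum>\<phi>\<in>F. cst (a \<phi>) * b \<phi>) \<in> K"
proof -
  define b where "b \<phi> = (\<Sum>x\<in>M. cst (\<phi> x) * x)" for \<phi>
  define G where "G = {\<phi>. b \<phi> \<in> A}"
  have b_lin: "b (\<lambda>x. g x + a * h x) = b g + cst a * b h" for g h a
    by (simp add: b_def cst_add cst_mult distrib_right sum.distrib sum_distrib_left mult.assoc)
  have "lin_closed G"
    unfolding lin_closed_def
  proof (intro conjI ballI allI)
    have "b (\<lambda>x. 0) \<in> A" using A(1) by (simp add: b_def)
    thus "G \<noteq> {}" unfolding G_def by blast
    fix g h a assume "g \<in> G" "h \<in> G"
    thus "(\<lambda>x. g x + a * h x) \<in> G" using A(2) by (simp add: G_def b_lin)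
  qed
  from finite_spanning_set[OF finM this]
  obtain F where F: "finite F" "F \<subseteq> G" "\<forall>g\<in>G. \<exists>c. \<forall>x\<in>M. g x = (\<Sum>f\<in>F. c f * f x)"
    by (elim exE conjE) (rule that)
  have "\<exists>a. q - (\<Sum>\<phi>\<in>F. cst (a \<phi>) * b \<phi>) \<in> K" if q: "q \<in> A" for q
  proof -
    have qb: "q - b (cf q) \<in> K" unfolding b_def by (rule cf)
    have "q + cst (- 1) * (q - b (cf q)) \<in> A" using A(2)[OF q] qb A(3) by blast
    hence "cf q \<in> G" by (simp add: G_def cst_uminus)
    from bspec[OF F(3) this]
    obtain c where c: "\<forall>x\<in>M. cf q x = (\<Sum>f\<in>F. c f * f x)" by (rule exE)
    have "b (cf q) = (\<Sum>x\<in>M. \<Sum>f\<in>F. cst (c f) * (cst (f x) * x))"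
      unfolding b_def
    proof (rule sum.cong[OF refl])
      fix x assume "x \<in> M"
      hence "cf q x = (\<Sum>f\<in>F. c f * f x)" using c by blast
      thus "cst (cf q x) * x = (\<Sum>f\<in>F. cst (c f) * (cst (f x) * x))"
        by (simp only: cst_sum sum_distrib_right cst_mult mult.assoc)
    qed
    also have "\<dots> = (\<Sum>f\<in>F. cst (c f) * b f)"
      unfolding b_def sum_distrib_left by (rule sum.swap)
    finally show ?thesis using qb by (intro exI[of _ c]) simp
  qed
  thus ?thesis using F by (intro that[of F b]) (auto simp: G_def)
qed

text \<open>
  A functional whose kernel contains no nonzero ideal of \<open>S/K\<close> identifies \<open>S/K\<close> with its dual;
  so every functional on an ideal is multiplication by an element followed by \<open>l\<close>.
\<close>

lemma represent_on_ideal: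
  assumes l: "linear_functional l" and lK: "\<And>q. q \<in> K \<Longrightarrow> l q = 0"
    and nd: "\<And>q. (\<And>r. l (q * r) = 0) \<Longrightarrow> q \<in> K"
    and A: "poly_ideal A" "K \<subseteq> A"
    and \<chi>: "\<And>p q c. p \<in> A \<Longrightarrow> q \<in> A \<Longrightarrow> \<chi> (p + cst c * q) = \<chi> p + c * \<chi> q" "\<And>q. q \<in> K \<Longrightarrow> \<chi> q = 0"
  shows "\<exists>c. \<forall>p\<in>A. \<chi> p = l (c * p)"
proof -
  interpret A: poly_ideal A by fact
  have sub: "p + cst c * q \<in> A" if "p \<in> A" "q \<in> A" for p q c
    using that by (intro A.add A.mult)
  obtain F :: "(('v, 'k) mpoly \<Rightarrow> 'k) set" and b where F: "finite F" "\<And>\<phi>. \<phi> \<in> F \<Longrightarrow> b \<phi> \<in> A"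
    "\<And>q. q \<in> A \<Longrightarrow> \<exists>a. q - (\<Sum>\<phi>\<in>F. cst (a \<phi>) * b \<phi>) \<in> K"
    by (rule subspace_spanning[OF A.zero sub A(2)]) (assumption | rule that)+
  have \<chi>_sum: "\<chi> (\<Sum>\<phi>\<in>Z. cst (a \<phi>) * b \<phi>) = (\<Sum>\<phi>\<in>Z. a \<phi> * \<chi> (b \<phi>)) \<and> (\<Sum>\<phi>\<in>Z. cst (a \<phi>) * b \<phi>) \<in> A"
    if "Z \<subseteq> F" for Z a
    using finite_subset[OF that F(1)] that
  proof (induction Z)
    case empty
    show ?case using \<chi>(2)[of 0] by simp
  next
    case (insert \<phi> Z)
    hence "\<chi> ((\<Sum>\<phi>\<in>Z. cst (a \<phi>) * b \<phi>) + cst (a \<phi>) * b \<phi>) = (\<Sum>\<phi>\<in>Z. a \<phi> * \<chi> (b \<phi>)) + a \<phi> * \<chi> (b \<phi>)"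
      using \<chi>(1)[of "\<Sum>\<phi>\<in>Z. cst (a \<phi>) * b \<phi>" "b \<phi>" "a \<phi>"] F(2)[of \<phi>] by simp
    moreover have "(\<Sum>\<phi>\<in>Z. cst (a \<phi>) * b \<phi>) + cst (a \<phi>) * b \<phi> \<in> A"
      using insert F(2)[of \<phi>] by (intro sub) auto
    ultimately show ?case using insert.hyps by (simp add: add.commute)
  qed
  define G where "G = {(\<lambda>\<phi>. l (c * b \<phi>)) | c. True}"
  have "lin_closed G"
    unfolding lin_closed_def
  proof (intro conjI ballI allI)
    show "G \<noteq> {}" by (auto simp: G_def)
    fix g h a assume "g \<in> G" "h \<in> G"
    then obtain c c' where "g = (\<lambda>\<phi>. l (c * b \<phi>))" "h = (\<lambda>\<phi>. l (c' * b \<phi>))" by (auto simp: G_def)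
    hence "(\<lambda>i. g i + a * h i) = (\<lambda>\<phi>. l ((c + cst a * c') * b \<phi>))"
      by (simp add: distrib_right mult.assoc linear_functionalD[OF l])
    thus "(\<lambda>i. g i + a * h i) \<in> G" by (auto simp: G_def)
  qed
  moreover have "(\<Sum>\<phi>\<in>F. \<alpha> \<phi> * \<chi> (b \<phi>)) = 0" if \<alpha>: "\<forall>g\<in>G. (\<Sum>\<phi>\<in>F. \<alpha> \<phi> * g \<phi>) = 0" for \<alpha>
  proof -
    let ?q = "\<Sum>\<phi>\<in>F. cst (\<alpha> \<phi>) * b \<phi>"
    have "?q \<in> K"
    proof (rule nd)
      fix r
      have "?q * r = (\<Sum>\<phi>\<in>F. cst (\<alpha> \<phi>) * (r * b \<phi>))"
        unfolding sum_distrib_right by (rule sum.cong) (simp_all add: mult_ac)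
      hence "l (?q * r) = (\<Sum>\<phi>\<in>F. \<alpha> \<phi> * l (r * b \<phi>))" using linear_functional_sum[OF l] by simp
      moreover have "(\<lambda>\<phi>. l (r * b \<phi>)) \<in> G" by (auto simp: G_def)
      ultimately show "l (?q * r) = 0" using bspec[OF \<alpha>] by auto
    qed
    thus ?thesis using \<chi>(2) \<chi>_sum[OF order_refl, of \<alpha>] by simp
  qed
  ultimately obtain g where "g \<in> G" and g: "\<forall>\<phi>\<in>F. g \<phi> = \<chi> (b \<phi>)"
    using interpolate_if_annihilated[OF F(1), of G "\<lambda>\<phi>. \<chi> (b \<phi>)"] by auto
  then obtain c where c: "\<And>\<phi>. \<phi> \<in> F \<Longrightarrow> l (c * b \<phi>) = \<chi> (b \<phi>)" by (auto simp: G_def)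
  have "\<chi> p = l (c * p)" if p: "p \<in> A" for p
  proof -
    from F(3)[OF p] obtain a where a: "p - (\<Sum>\<phi>\<in>F. cst (a \<phi>) * b \<phi>) \<in> K" by (rule exE)
    let ?q = "\<Sum>\<phi>\<in>F. cst (a \<phi>) * b \<phi>"
    have qA: "?q \<in> A" "\<chi> ?q = (\<Sum>\<phi>\<in>F. a \<phi> * \<chi> (b \<phi>))" using \<chi>_sum[OF order_refl, of a] by auto
    have "\<chi> (p + cst (- 1) * ?q) = \<chi> p + - 1 * \<chi> ?q" by (rule \<chi>(1)[OF p qA(1)])
    hence "\<chi> p = \<chi> ?q" using \<chi>(2)[OF a] by (simp add: cst_uminus)
    also have "\<dots> = (\<Sum>\<phi>\<in>F. a \<phi> * l (c * b \<phi>))" unfolding qA(2) by (rule sum.cong) (auto simp: c)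
    also have "\<dots> = l (\<Sum>\<phi>\<in>F. cst (a \<phi>) * (c * b \<phi>))" by (simp add: linear_functional_sum[OF l])
    also have "(\<Sum>\<phi>\<in>F. cst (a \<phi>) * (c * b \<phi>)) = c * ?q" by (simp add: sum_distrib_left mult.left_commute)
    also have "l (c * ?q) = l (c * p)"
    proof -
      have "l (c * (p - ?q)) = 0" by (rule lK[OF mult[OF a]])
      thus ?thesis by (simp add: right_diff_distrib linear_functionalD[OF l])
    qed
    finally show ?thesis .
  qed
  thus ?thesis by blast
qed

text \<open>
  The kernel of the localization of \<open>S/K\<close> at \<open>M'\<close> is finite-dimensional, so a single \<open>s\<close> outside
  \<open>M'\<close> kills it. The idempotent belonging to \<open>s\<close> does so as well.
\<close>

lemma local_idempotent:
  assumes M': "poly_ideal M'" "K \<subseteq> M'" "1 \<notin> M'" "\<And>p q. p * q \<in> M' \<Longrightarrow> p \<in> M' \<or> q \<in> M'"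
  shows "\<exists>e. e \<notin> M' \<and> e * e - e \<in> K \<and> (\<forall>q s. s \<notin> M' \<longrightarrow> s * q \<in> K \<longrightarrow> e * q \<in> K)"
proof -
  interpret M': poly_ideal M' by fact
  define A where "A = {q. \<exists>s. s \<notin> M' \<and> s * q \<in> K}"
  have A0: "0 \<in> A" using M'(3) by (auto simp: A_def intro!: exI[of _ 1])
  have A: "p + cst c * q \<in> A" if "p \<in> A" "q \<in> A" for p q c
  proof -
    obtain s where s: "s \<notin> M'" "s * p \<in> K" using \<open>p \<in> A\<close> by (auto simp: A_def)
    obtain t where t: "t \<notin> M'" "t * q \<in> K" using \<open>q \<in> A\<close> by (auto simp: A_def)
    note st = s t
    have "s * t * (p + cst c * q) \<in> K"
      by (rule comb2[OF st(2,4), of _ t "s * cst c"]) (simp add: algebra_simps)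
    moreover have "s * t \<notin> M'" using st M'(4) by blast
    ultimately show ?thesis unfolding A_def by blast
  qed
  have KA: "K \<subseteq> A" using M'(3) by (auto simp: A_def intro!: exI[of _ 1])
  obtain F :: "(('v, 'k) mpoly \<Rightarrow> 'k) set" and b where F: "finite F" "\<And>\<phi>. \<phi> \<in> F \<Longrightarrow> b \<phi> \<in> A"
    "\<And>q. q \<in> A \<Longrightarrow> \<exists>a. q - (\<Sum>\<phi>\<in>F. cst (a \<phi>) * b \<phi>) \<in> K"
    by (rule subspace_spanning[OF A0 A KA]) (assumption | rule that)+
  have "\<exists>s. s \<notin> M' \<and> (\<forall>\<phi>\<in>Z. s * b \<phi> \<in> K)" if "Z \<subseteq> F" for Z
    using finite_subset[OF that F(1)] that
  proof (induction Z)
    case empty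
    thus ?case using M'(3) by blast
  next
    case (insert \<phi> Z)
    then obtain s where s: "s \<notin> M'" "\<And>\<phi>. \<phi> \<in> Z \<Longrightarrow> s * b \<phi> \<in> K" by blast
    obtain t where t: "t \<notin> M'" "t * b \<phi> \<in> K" using F(2)[of \<phi>] insert.prems by (auto simp: A_def)
    have "s * t * b \<psi> \<in> K" if "\<psi> \<in> insert \<phi> Z" for \<psi>
    proof (cases "\<psi> = \<phi>")
      case True
      thus ?thesis using mult[OF t(2), of s] by (simp add: mult.assoc)
    next
      case False
      hence "t * (s * b \<psi>) \<in> K" using that s(2) mult by blast
      thus ?thesis by (simp add: algebra_simps)
    qed
    moreover have "s * t \<notin> M'" using s t M'(4) by blast
    ultimately show ?case by blast
  qed
  then obtain s where s: "s \<notin> M'" "\<And>\<phi>. \<phi> \<in> F \<Longrightarrow> s * b \<phi> \<in> K" by blast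
  have sA: "s * q \<in> K" if q: "q \<in> A" for q
  proof -
    from F(3)[OF q] obtain a where a: "q - (\<Sum>\<phi>\<in>F. cst (a \<phi>) * b \<phi>) \<in> K" by (rule exE)
    have "s * (\<Sum>\<phi>\<in>F. cst (a \<phi>) * b \<phi>) = (\<Sum>\<phi>\<in>F. cst (a \<phi>) * (s * b \<phi>))"
      by (simp add: sum_distrib_left mult.left_commute)
    also have "\<dots> \<in> K" by (intro sum mult s)
    finally have 1: "s * (\<Sum>\<phi>\<in>F. cst (a \<phi>) * b \<phi>) \<in> K" .
    show ?thesis by (rule comb2[OF a 1, of _ s 1]) (simp add: algebra_simps)
  qed
  obtain j y where jy: "0 < j" "s ^ j - s ^ (j + j) * y \<in> K" using power_idempotent by blast
  have sj: "s ^ j \<notin> M'"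
  proof
    assume "s ^ j \<in> M'"
    thus False using s(1) M'(3,4) by (induction j) auto
  qed
  define e where "e = s ^ j * y"
  have 1: "e * e - e \<in> K"
    by (rule comb1[OF jy(2), of _ "- y"]) (simp add: e_def algebra_simps power_add)
  have 2: "e \<notin> M'"
  proof
    assume "e \<in> M'"
    hence "s ^ j * e \<in> M'" by (rule M'.mult)
    moreover have "s ^ j - s ^ j * e \<in> M'" using jy(2) M'(2) by (auto simp: e_def power_add mult.assoc)
    ultimately have "s ^ j \<in> M'" using M'.add by fastforce
    thus False using sj by blast
  qed
  have 3: "e * q \<in> K" if "t \<notin> M'" "t * q \<in> K" for q t
  proof -
    have "s * q \<in> K" using that by (intro sA) (auto simp: A_def)
    hence "y * s ^ (j - 1) * (s * q) \<in> K" by (rule mult)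
    moreover have "s ^ j = s ^ (j - 1) * s" using jy(1) by (metis Suc_diff_1 power_Suc2)
    ultimately show ?thesis by (simp add: e_def algebra_simps)
  qed
  show ?thesis using 1 2 3 by blast
qed

end

section \<open>The coordinate ring modulo a polynomial in f\<close>

context basis_ideal
begin

lemma val_product:
  assumes "q \<in> forms m" "r \<in> forms j"
  shows "val (m + j) (q * r) = red 1 (val m q * val j r)"
proof (rule val_eqI[OF forms_mult[OF assms]])
  have f: "val m q * val j r \<in> forms (Suc 1)"
    by (rule forms_2_Suc[OF forms_mult_1_1[OF val(1)[OF assms(1)] val(1)[OF assms(2)]]])
  show "red 1 (val m q * val j r) \<in> V" by (rule red(1)[OF f])
  have "val m q * val j r - v ^ 1 * red 1 (val m q * val j r) \<in> I" by (rule red(2)[OF f])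
  hence 1: "val m q * val j r - v * red 1 (val m q * val j r) \<in> I" by simp
  have "v * (v * (q * r) - v ^ (m + j) * red 1 (val m q * val j r)) \<in> I"
    by (rule comb3[OF val(2)[OF assms(1)] val(2)[OF assms(2)] 1, of _ "v * r" "v ^ m * val m q" "v ^ (m + j)"])
      (simp add: algebra_simps power_add)
  thus "v * (q * r) - v ^ (m + j) * red 1 (val m q * val j r) \<in> I" by (rule v_nzd)
qed

lemma val_0_1: "val 0 1 = v"
  by (rule val_eqI) (auto simp: v_form)

lemma val_1: "x \<in> V \<Longrightarrow> val 1 x = x"
  by (rule val_eqI) auto

lemma val_2: "p \<in> forms 2 \<Longrightarrow> val 2 p = red 1 p"
  unfolding numeral_2_eq_2 One_nat_def[symmetric]
  by (rule val_eqI_Suc) (use red[of p 1] in \<open>auto simp: numeral_2_eq_2 One_nat_def\<close>)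

lemma red_product_assoc:
  assumes "x \<in> V" "y \<in> V" "z \<in> V"
  shows "red 1 (x * y) * z - x * red 1 (y * z) \<in> I"
proof -
  have 1: "x * y - v ^ 1 * red 1 (x * y) \<in> I" "y * z - v ^ 1 * red 1 (y * z) \<in> I"
    using red(2)[OF forms_2_Suc[OF forms_mult_1_1]] assms by blast+
  have "v * (red 1 (x * y) * z - x * red 1 (y * z)) \<in> I"
    by (rule comb2[OF 1, of _ "- z" x]) (simp add: algebra_simps)
  thus ?thesis by (rule v_nzd)
qed

lemma red_product_form: "x \<in> V \<Longrightarrow> y \<in> V \<Longrightarrow> red 1 (x * y) \<in> V"
  by (rule red(1)[OF forms_2_Suc[OF forms_mult_1_1]])

lemma self_adjoint_mult:
  assumes c: "c \<in> V" shows "self_adjoint (\<lambda>x. red 1 (c * x))"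
  unfolding self_adjoint_def linear_operator_def
proof (intro conjI ballI allI)
  fix x assume x: "x \<in> (V :: ('v, 'k) mpoly set)"
  show "red 1 (c * x) \<in> V" by (rule red_product_form[OF c x])
  fix y assume y: "y \<in> (V :: ('v, 'k) mpoly set)"
  show "red 1 (c * (x + cst a * y)) = red 1 (c * x) + cst a * red 1 (c * y)" for a
  proof -
    have e: "c * (x + cst a * y) = c * x + cst a * (c * y)" by (simp add: algebra_simps)
    show ?thesis unfolding e
      by (rule red_linear[OF forms_2_Suc[OF forms_mult_1_1[OF c x]] forms_2_Suc[OF forms_mult_1_1[OF c y]]])
  qed
  have e: "red 1 (c * x) = red 1 (x * c)" by (simp add: mult.commute)
  show "red 1 (c * x) * y - x * red 1 (c * y) \<in> I"
    unfolding e by (rule red_product_assoc[OF x c y])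
qed

lemma self_adjoint_cong:
  assumes "self_adjoint u" "\<And>x. x \<in> V \<Longrightarrow> w x = u x" shows "self_adjoint w"
  unfolding self_adjoint_def linear_operator_def
proof (intro conjI ballI allI)
  fix x assume x: "x \<in> (V :: ('v, 'k) mpoly set)"
  show "w x \<in> V"
    using assms(2)[OF x] linear_operatorD(1)[OF self_adjointD(1)[OF assms(1)] x] by simp
  fix y assume y: "y \<in> (V :: ('v, 'k) mpoly set)"
  show "w x * y - x * w y \<in> I" using assms(2)[OF x] assms(2)[OF y] self_adjointD(2)[OF assms(1) x y] by simp
  fix a
  have "x + cst a * y \<in> V" using x y by blast
  thus "w (x + cst a * y) = w x + cst a * w y"
    using assms(2) linear_operatorD(2)[OF self_adjointD(1)[OF assms(1)] x y] x y by simp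
qed

lemma balanced_quad_functional: "balanced I B \<Longrightarrow> x \<in> V \<Longrightarrow> y \<in> V \<Longrightarrow> B v (red 1 (x * y)) = B x y"
  using quad_functional_mult by (simp add: quad_functional_def)

end

text \<open>
  The hypotheses are the conclusions of \<open>sa_scalar\<close>, \<open>kernel_in_J\<close> and \<open>cubics_in_J\<close>; the last is
  the bound 3 in the position of \<open>N\<close>.
\<close>

locale gorenstein_pair = two_bases_denominator I1 I2 v1 v2 3 f d + two_bases_form I1 I2 v1 v2 3 B
  for I1 I2 :: "('v::finite, 'k::field) mpoly set" and v1 v2 f d B +
  assumes ker: "p \<in> forms 2 \<Longrightarrow> P.quad_functional B p = 0 \<Longrightarrow> p \<in> J"
    and scalar: "sa u \<Longrightarrow> \<exists>c. \<forall>x\<in>V. u x = cst c * x"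
begin

text \<open>
  A section of \<open>O(m)\<close> on the union is given by its pair of values, and multiplication by \<open>f\<close> does not
  change them. For \<open>m = 2\<close> the functional turns the product of two sections of \<open>O(1)\<close> into the
  pairing for which \<open>V\<close> is isotropic.
\<close>

definition Lam :: "nat \<Rightarrow> ('v, 'k) mpoly \<Rightarrow> 'k"
  where "Lam m p = B v1 (P.val m p) - B v2 (Q.val m p)"

lemma Lam_linear:
  assumes "p \<in> forms m" "q \<in> forms m" shows "Lam m (p + cst c * q) = Lam m p + c * Lam m q"
  unfolding Lam_def P.val_linear[OF assms] Q.val_linear[OF assms]
    bilinearD(2)[OF bil P.val(1)[OF assms(1)] P.val(1)[OF assms(2)] P.v_form]
    bilinearD(2)[OF bil Q.val(1)[OF assms(1)] Q.val(1)[OF assms(2)] Q.v_form]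
  by (simp add: algebra_simps)

lemma Lam_mem: "p \<in> forms m \<Longrightarrow> p \<in> II \<Longrightarrow> Lam m p = 0"
  using P.val_eq_0_iff[of p m] Q.val_eq_0_iff[of p m] bilinearD(10)[OF bil P.v_form P.v_form P.v_form]
    bilinearD(10)[OF bil Q.v_form Q.v_form Q.v_form] by (simp add: Lam_def)

lemma Lam_0 [simp]: "Lam m 0 = 0"
  by (rule Lam_mem) auto

lemma Lam_f_power: "p \<in> forms m \<Longrightarrow> Lam (d * k + m) (f ^ k * p) = Lam m p"
  unfolding Lam_def by (simp only: P.val_mult[OF f_power_form f_power_cong(1)] Q.val_mult[OF f_power_form f_power_cong(2)])

lemma Lam_2: "p \<in> forms 2 \<Longrightarrow> Lam 2 p = 0"
  using quad_functional_eq[OF bil bal1 bal2]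
  by (simp add: Lam_def P.val_2 Q.val_2 P.quad_functional_def Q.quad_functional_def)

lemma Lam_product:
  assumes "q \<in> forms m" "r \<in> forms j"
  shows "Lam (m + j) (q * r) = B (P.val m q) (P.val j r) - B (Q.val m q) (Q.val j r)"
  unfolding Lam_def P.val_product[OF assms] Q.val_product[OF assms]
    P.balanced_quad_functional[OF bal1 P.val(1)[OF assms(1)] P.val(1)[OF assms(2)]]
    Q.balanced_quad_functional[OF bal2 Q.val(1)[OF assms(1)] Q.val(1)[OF assms(2)]] ..

lemma B_red_assoc:
  assumes "x \<in> V" "y \<in> V" "z \<in> V"
  shows "B x (P.red 1 (y * z)) = B (P.red 1 (x * y)) z" "B x (Q.red 1 (y * z)) = B (Q.red 1 (x * y)) z"
proof -
  show "B x (P.red 1 (y * z)) = B (P.red 1 (x * y)) z"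
    using bal1 P.red_product_assoc[OF assms] P.red_product_form assms unfolding balanced_def by metis
  show "B x (Q.red 1 (y * z)) = B (Q.red 1 (x * y)) z"
    using bal2 Q.red_product_assoc[OF assms] Q.red_product_form assms unfolding balanced_def by metis
qed

text \<open>
  Under \<open>Lam\<close> the quadrics and the constants are orthogonal complements, and \<open>V\<close> is its own; from
  degree 3 on, every pair of values comes from a form. So a form \<open>q\<close> orthogonal to the
  forms of the complementary degree \<open>j\<close> comes, after division by \<open>f\<^sup>n\<close>, from a form of degree
  \<open>2 - j\<close>, which means zero if \<open>j \<ge> 3\<close>. The case \<open>j = 2\<close> is where the self-adjoint operators have
  to be scalars.
\<close>

lemma duality:
  assumes q: "q \<in> forms m" and mj: "m + j = d * n + 2"
    and H: "\<And>r. r \<in> forms j \<Longrightarrow> Lam (m + j) (q * r) = 0"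
  shows "\<exists>s. (s = 0 \<or> d * n \<le> m \<and> s \<in> forms (m - d * n)) \<and> q - f ^ n * s \<in> II"
proof -
  define c1 where "c1 = P.val m q"
  define c2 where "c2 = Q.val m q"
  have c: "c1 \<in> V" "c2 \<in> V" using P.val(1)[OF q] Q.val(1)[OF q] by (auto simp: c1_def c2_def)
  have cong: "v1 * q - v1 ^ m * c1 \<in> I1" "v2 * q - v2 ^ m * c2 \<in> I2"
    using P.val(2)[OF q] Q.val(2)[OF q] by (auto simp: c1_def c2_def)
  have H': "B c1 (P.val j r) = B c2 (Q.val j r)" if "r \<in> forms j" for r
    using H[OF that] Lam_product[OF q that] by (simp add: c1_def c2_def)
  have lift: "q - f ^ n * s \<in> II"
    if s1: "v1 * s - v1 ^ (m - d * n) * c1 \<in> I1" and s2: "v2 * s - v2 ^ (m - d * n) * c2 \<in> I2" and m: "d * n \<le> m" for s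
  proof -
    have e: "v1 ^ m = v1 ^ (d * n) * v1 ^ (m - d * n)" "v2 ^ m = v2 ^ (d * n) * v2 ^ (m - d * n)"
      using m by (simp_all add: power_add[symmetric])
    have "v1 * (q - f ^ n * s) \<in> I1"
      by (rule P.comb3[OF cong(1) f_power_cong(1)[of n] s1, of _ 1 "- v1 * s" "- (v1 ^ (d * n))"])
        (simp add: e(1) algebra_simps)
    moreover have "v2 * (q - f ^ n * s) \<in> I2"
      by (rule Q.comb3[OF cong(2) f_power_cong(2)[of n] s2, of _ 1 "- v2 * s" "- (v2 ^ (d * n))"])
        (simp add: e(2) algebra_simps)
    ultimately show ?thesis using P.v_nzd Q.v_nzd by blast
  qed
  consider "j = 0" | "j = 1" | "j = 2" | "3 \<le> j" by linarith
  thus ?thesis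
  proof cases
    case 1
    \<comment> \<open>The values agree under \<open>B\<close>, so \<open>v1 c1 - v2 c2\<close> is in \<open>J\<close>, and the two quadrics can be glued.\<close>
    hence m: "d * n \<le> m" "m - d * n = 2" using mj by auto
    have "B c1 v1 = B c2 v2" using H'[of 1] 1 by (simp add: P.val_0_1 Q.val_0_1)
    hence "B v1 c1 = B v2 c2" using sym c P.v_form Q.v_form by metis
    have f: "v1 * c1 \<in> forms 2" "v2 * c2 \<in> forms 2" using forms_mult_1_1 c P.v_form Q.v_form by auto
    have "P.quad_functional B (v1 * c1) = B v1 c1" by (rule P.quad_functional_mult[OF bal1 P.v_form c(1)])
    moreover have "P.quad_functional B (v2 * c2) = B v2 c2"
      unfolding quad_functional_eq[OF bil bal1 bal2 f(2)] by (rule Q.quad_functional_mult[OF bal2 Q.v_form c(2)])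
    ultimately have "P.quad_functional B (v1 * c1 + cst (- 1) * (v2 * c2)) = 0"
      using P.quad_functional_linear[OF bil f, of "- 1"] \<open>B v1 c1 = B v2 c2\<close> by simp
    hence "v1 * c1 + cst (- 1) * (v2 * c2) \<in> J" using f by (intro ker) auto
    hence "v1 * c1 - v2 * c2 \<in> J" by (simp add: cst_uminus)
    moreover have "v1 * c1 - v2 * c2 \<in> forms 2" using f by blast
    ultimately obtain a b where ab: "v1 * c1 - v2 * c2 = a + b" "a \<in> I1" "b \<in> I2" "a \<in> forms 2" "b \<in> forms 2"
      using J_split by blast
    define s where "s = v1 * c1 - a"
    have s: "s = v2 * c2 + b" using ab(1) by (simp add: s_def algebra_simps)
    have "v1 * s - v1 ^ 2 * c1 \<in> I1"
      by (rule P.comb1[OF ab(2), of _ "- v1"]) (simp add: s_def algebra_simps power2_eq_square)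
    moreover have "v2 * s - v2 ^ 2 * c2 \<in> I2"
      by (rule Q.comb1[OF ab(3), of _ v2]) (simp add: s algebra_simps power2_eq_square)
    ultimately have "q - f ^ n * s \<in> II" using lift[of s] m by simp
    moreover have "s \<in> forms 2" unfolding s_def using f ab by blast
    ultimately show ?thesis using m by auto
  next
    case 2
    \<comment> \<open>The linear forms separate \<open>c1\<close> from \<open>c2\<close>.\<close>
    hence m: "d * n \<le> m" "m - d * n = 1" using mj by auto
    have "c1 - c2 = 0"
    proof (rule nondegD)
      show "c1 - c2 \<in> V" using c by blast
      fix x :: "('v, 'k) mpoly" assume x: "x \<in> V"
      have "B c1 x = B c2 x" using H'[of x] x 2 P.val_1[OF x] Q.val_1[OF x] by simp
      thus "B (c1 - c2) x = 0" using bilinearD(5)[OF bil c x] by simp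
    qed
    hence "c2 = c1" by simp
    hence "q - f ^ n * c1 \<in> II" using lift[of c1] m by simp
    thus ?thesis using m c by auto
  next
    case 3
    \<comment> \<open>Multiplication by \<open>c1/v1\<close> on the first basis and by \<open>c2/v2\<close> on the second are the same operator.\<close>
    hence m: "m = d * n" using mj by simp
    have eq: "P.red 1 (c1 * x) = Q.red 1 (c2 * x)" if x: "x \<in> V" for x
    proof -
      note r = P.red_product_form[OF c(1) x] Q.red_product_form[OF c(2) x]
      have "P.red 1 (c1 * x) - Q.red 1 (c2 * x) = 0"
      proof (rule nondegD)
        show "P.red 1 (c1 * x) - Q.red 1 (c2 * x) \<in> V" using r by blast
        fix y :: "('v, 'k) mpoly" assume y: "y \<in> V"
        note xy = forms_mult_1_1[OF x y]
        have "B c1 (P.red 1 (x * y)) = B c2 (Q.red 1 (x * y))"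
          using H'[of "x * y"] xy 3 P.val_2[OF xy] Q.val_2[OF xy] by simp
        thus "B (P.red 1 (c1 * x) - Q.red 1 (c2 * x)) y = 0"
          using B_red_assoc(1)[OF c(1) x y] B_red_assoc(2)[OF c(2) x y] bilinearD(5)[OF bil r y] by simp
      qed
      thus ?thesis by simp
    qed
    let ?u = "\<lambda>x. P.red 1 (c1 * x)"
    have "sa ?u" unfolding sa_def
      using P.self_adjoint_mult[OF c(1)] Q.self_adjoint_cong[OF Q.self_adjoint_mult[OF c(2)] eq] by blast
    from scalar[OF this] obtain a where a: "\<forall>x\<in>V. ?u x = cst a * x" by (rule exE)
    have "c1 = cst a * v1"
    proof -
      have "P.red 1 (c1 * v1) = c1"
        by (rule P.red_eqI[OF c(1) _ P.forms_2_Suc[OF forms_mult_1_1[OF c(1) P.v_form]]]) (simp add: mult.commute)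
      thus ?thesis using a P.v_form by auto
    qed
    moreover have "c2 = cst a * v2"
    proof -
      have "Q.red 1 (c2 * v2) = c2"
        by (rule Q.red_eqI[OF c(2) _ P.forms_2_Suc[OF forms_mult_1_1[OF c(2) Q.v_form]]]) (simp add: mult.commute)
      thus ?thesis using a Q.v_form eq[OF Q.v_form] by auto
    qed
    ultimately have "q - f ^ n * cst a \<in> II" using lift[of "cst a"] m by (simp add: mult.commute)
    thus ?thesis using m by (intro exI[of _ "cst a"]) simp
  next
    case 4
    \<comment> \<open>In these degrees the values of \<open>r\<close> on the two bases are arbitrary.\<close>
    then obtain i where i: "j = Suc i" by (cases j) auto
    have i3: "3 \<le> Suc i" using 4 i by simp
    have "c1 = 0"
    proof (rule nondegD[OF c(1)])
      fix x :: "('v, 'k) mpoly" assume x: "x \<in> V"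
      obtain r where r: "r \<in> forms (Suc i)" "P.val (Suc i) r = x" "Q.val (Suc i) r = 0"
        using component_form[OF i3 x forms_0] by blast
      thus "B c1 x = 0" using H'[of r] i bilinearD(10)[OF bil c(2) c(2) c(2)] by simp
    qed
    moreover have "c2 = 0"
    proof (rule nondegD[OF c(2)])
      fix x :: "('v, 'k) mpoly" assume x: "x \<in> V"
      obtain r where r: "r \<in> forms (Suc i)" "P.val (Suc i) r = 0" "Q.val (Suc i) r = x"
        using component_form[OF i3 forms_0 x] by blast
      thus "B c2 x = 0" using H'[of r] i bilinearD(10)[OF bil c(1) c(1) c(1)] by simp
    qed
    ultimately have "q \<in> II" using P.val_eq_0_iff[OF q] Q.val_eq_0_iff[OF q] by (simp add: c1_def c2_def)
    thus ?thesis by (intro exI[of _ 0]) simp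
  qed
qed

lemma le_d_mult: "i \<le> d * i"
proof -
  have "1 * i \<le> d * i" by (rule mult_le_mono1) (use d in linarith)
  thus ?thesis unfolding mult_1 .
qed

context
  fixes n :: nat and g :: "nat \<Rightarrow> 'k" and G :: "('v, 'k) mpoly"
  assumes monic: "g n = 1" and G_def: "G = (\<Sum>j\<le>n. cst (g j) * f ^ j)"
begin

lemma hcomp_G_mult:
  assumes s: "s = 0 \<or> d * n \<le> D \<and> s \<in> forms (D - d * n)" and m: "D \<le> m"
  shows "hcomp m (G * s) = (if m = D then f ^ n * s else 0)"
proof (cases "s = 0")
  case False
  hence s': "d * n \<le> D" "s \<in> forms (D - d * n)" using s by auto
  have "hcomp m (G * s) = (\<Sum>j\<le>n. cst (g j) * hcomp m (f ^ j * s))"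
    unfolding G_def sum_distrib_right hcomp_sum by (simp only: mult.assoc hcomp_cst_mult)
  also have "\<dots> = (\<Sum>j\<le>n. if j = n then (if m = D then f ^ n * s else 0) else 0)"
  proof (rule sum.cong[OF refl])
    fix j assume "j \<in> {..n}"
    hence j: "j \<le> n" by simp
    have F: "f ^ j * s \<in> forms (d * j + (D - d * n))" by (rule forms_mult[OF f_power_form s'(2)])
    show "cst (g j) * hcomp m (f ^ j * s) = (if j = n then (if m = D then f ^ n * s else 0) else 0)"
    proof (cases "j = n")
      case True
      thus ?thesis using hcomp_form[OF F, of m] s'(1) monic by simp
    next
      case False
      hence "d * j < d * n" using j d by simp
      hence "m \<noteq> d * j + (D - d * n)" using m s'(1) by linarith
      thus ?thesis using hcomp_form[OF F, of m] False by simp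
    qed
  qed
  also have "\<dots> = (if m = D then f ^ n * s else 0)" by (simp add: sum.delta)
  finally show ?thesis .
qed simp

lemma reduce_top:
  assumes q: "\<forall>m\<ge>Suc D. hcomp m q = 0"
    and s: "s = 0 \<or> d * n \<le> D \<and> s \<in> forms (D - d * n)"
  shows "\<forall>m\<ge>D. hcomp m (q - G * s - (hcomp D q - f ^ n * s)) = 0"
proof (intro allI impI)
  fix m assume m: "D \<le> m"
  have F: "f ^ n * s \<in> forms D"
  proof (cases "s = 0")
    case False
    thus ?thesis using s forms_mult[OF f_power_form[of n], of s "D - d * n"] by simp
  qed simp
  show "hcomp m (q - G * s - (hcomp D q - f ^ n * s)) = 0"
    unfolding hcomp_diff hcomp_G_mult[OF s m] hcomp_form[OF F] hcomp_form[OF hcomp_in_forms]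
    using q m by auto
qed

definition KG :: "('v, 'k) mpoly set"
  where "KG = {q. \<exists>y. q - G * y \<in> II}"

lemma KG_ideal: "poly_ideal KG"
  unfolding KG_def by (rule poly_ideal_add_principal) unfold_locales

lemma finite_ideal_KG:
  "finite_ideal KG ((\<lambda>m. single m 1) ` {m. mdeg m \<le> d * n + 4})"
proof -
  interpret KG: poly_ideal KG by (rule KG_ideal)
  let ?M = "{m :: 'v \<Rightarrow>\<^sub>0 nat. mdeg m \<le> d * n + 4}"
  have GK: "G * y + i \<in> KG" if "i \<in> II" for y i
    unfolding KG_def using that by (auto intro!: exI[of _ y])
  have low: "\<exists>c. q - (\<Sum>b\<in>(\<lambda>m. single m 1) ` ?M. cst (c b) * b) \<in> KG"
    if "\<forall>m\<ge>D. hcomp m q = 0" for q D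
    using that
  proof (induction D arbitrary: q)
    case 0
    have "q = 0" by (rule hcomp_eqI) (use 0 in simp)
    thus ?case by (intro exI[of _ "\<lambda>_. 0"]) simp
  next
    case (Suc D)
    show ?case
    proof (cases "d * n + Suc 3 \<le> D")
      case True
      obtain s where s: "s \<in> forms (D - d * n)" "hcomp D q - f ^ n * s \<in> II"
        using divide_f_power[OF hcomp_in_forms True] by blast
      have s': "s = 0 \<or> d * n \<le> D \<and> s \<in> forms (D - d * n)" using s True by simp
      from Suc.IH[OF reduce_top[OF Suc.prems s']]
      obtain c where c: "q - G * s - (hcomp D q - f ^ n * s) - (\<Sum>b\<in>(\<lambda>m. single m 1) ` ?M. cst (c b) * b) \<in> KG"
        by (rule exE)
      have "q - (\<Sum>b\<in>(\<lambda>m. single m 1) ` ?M. cst (c b) * b) \<in> KG"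
        by (rule KG.comb2[OF c GK[OF s(2), of s], of _ 1 1]) (simp add: algebra_simps)
      thus ?thesis by (intro exI)
    next
      case False
      let ?b = "\<lambda>m :: 'v \<Rightarrow>\<^sub>0 nat. single m (1 :: 'k)"
      have inj: "inj ?b"
      proof (rule injI)
        fix a b assume "?b a = ?b b"
        thus "a = b" by (metis lookup_single_eq lookup_single_not_eq one_neq_zero)
      qed
      have keys: "keys q \<subseteq> ?M"
      proof
        fix m assume m: "m \<in> keys q"
        have "\<not> Suc D \<le> mdeg m"
        proof
          assume "Suc D \<le> mdeg m"
          hence "lookup (hcomp (mdeg m) q) m = 0" using Suc.prems by simp
          thus False using m by (simp add: in_keys_iff)
        qed
        thus "m \<in> ?M" using False by simp
      qed
      have "q = (\<Sum>m\<in>keys q. cst (lookup q m) * ?b m)" by (rule poly_expand)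
      also have "\<dots> = (\<Sum>m\<in>?M. cst (lookup q m) * ?b m)"
        by (rule sum.mono_neutral_left[OF finite_monomials keys]) (simp add: in_keys_iff)
      also have "\<dots> = (\<Sum>b\<in>?b ` ?M. cst (lookup q (inv_into UNIV ?b b)) * b)"
        by (subst sum.reindex[OF inj_on_subset[OF inj subset_UNIV]]) (simp add: inv_into_f_f[OF inj UNIV_I])
      finally show ?thesis by (intro exI[of _ "\<lambda>b. lookup q (inv_into UNIV ?b b)"]) simp
    qed
  qed
  show ?thesis
  proof
    show "finite ((\<lambda>m. single m 1) ` ?M)" by (rule finite_imageI[OF finite_monomials])
    fix q :: "('v, 'k) mpoly"
    obtain D where "\<forall>m\<ge>D. hcomp m q = 0" using hcomp_eventually_0 by blast
    thus "\<exists>c. q - (\<Sum>b\<in>(\<lambda>m. single m 1) ` ?M. cst (c b) * b) \<in> KG" by (rule low)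
  qed
qed

text \<open>The coefficients of the expansion of \<open>1/G\<close> in powers of \<open>1/f\<close>.\<close>

lemma inverse_coefficients:
  "\<exists>al. (\<forall>i<n. al i = (0::'k)) \<and> al n = 1 \<and> (\<forall>s>0. (\<Sum>j\<le>n. g j * al (s + j)) = 0)"
proof -
  define h where "h = fps_of_poly (poly_of_list (map (\<lambda>i. g (n - i)) [0..<Suc n]))"
  have hc: "fps_nth h i = (if i \<le> n then g (n - i) else 0)" for i
    by (auto simp: h_def nth_default_def simp del: upt_Suc)
  define k where "k = inverse h"
  have h0: "fps_nth h 0 \<noteq> 0" by (simp add: hc monic)
  have hk: "h * k = 1" unfolding k_def using inverse_mult_eq_1'[OF h0] .
  define al where "al i = (if i < n then 0 else fps_nth k (i - n))" for i
  have "al n = 1"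
  proof -
    have "fps_nth (h * k) 0 = fps_nth h 0 * fps_nth k 0" by simp
    thus ?thesis by (simp add: hk hc monic al_def)
  qed
  moreover have "(\<Sum>j\<le>n. g j * al (s + j)) = 0" if s: "s > 0" for s
  proof -
    have "(\<Sum>j\<le>n. g j * al (s + j)) = (\<Sum>i\<le>n. g (n - i) * al (s + (n - i)))"
      by (rule sum.reindex_bij_witness[of _ "\<lambda>i. n - i" "\<lambda>i. n - i"]) auto
    also have "\<dots> = (\<Sum>i\<le>n + s. fps_nth h i * (if i \<le> s then fps_nth k (s - i) else 0))"
      by (rule sum.mono_neutral_cong_left) (auto simp: hc al_def)
    also have "\<dots> = (\<Sum>i\<le>s. fps_nth h i * fps_nth k (s - i))"
      by (rule sum.mono_neutral_cong_right) auto
    also have "\<dots> = fps_nth (h * k) s" by (simp add: fps_mult_nth atLeast0AtMost)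
    also have "\<dots> = 0" using s by (simp add: hk)
    finally show ?thesis .
  qed
  ultimately show ?thesis by (intro exI[of _ al]) (auto simp: al_def)
qed

text \<open>
  The functional \<open>q \<mapsto> Lam (q/G)\<close>, where \<open>1/G\<close> is expanded in powers of \<open>1/f\<close>, adds up the values of
  \<open>Lam\<close> at the components in degrees \<open>2 + d i\<close>. It vanishes on the multiples of \<open>G\<close> because \<open>Lam\<close>
  vanishes on quadrics. An ideal in its kernel consists of multiples of \<open>G\<close>: by \<open>duality\<close> the top
  component of an element is divisible by \<open>f\<^sup>n\<close> modulo \<open>II\<close>, so a multiple of \<open>G\<close> can be
  subtracted to lower the degree.
\<close>

theorem frobenius_functional:
  "\<exists>l. linear_functional l \<and> (\<forall>q. (\<forall>r. l (q * r) = 0) \<longleftrightarrow> q \<in> KG)"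
proof -
  obtain al where al: "\<And>i. i < n \<Longrightarrow> al i = 0" "al n = 1" "\<And>s. s > 0 \<Longrightarrow> (\<Sum>j\<le>n. g j * al (s + j)) = 0"
    using inverse_coefficients by blast
  interpret KG: poly_ideal KG by (rule KG_ideal)
  define l where "l q = (\<Sum>i\<in>{i. hcomp (2 + d * i) q \<noteq> 0}. al i * Lam (2 + d * i) (hcomp (2 + d * i) q))" for q
  have l_eq: "l q = (\<Sum>i<K. al i * Lam (2 + d * i) (hcomp (2 + d * i) q))"
    if K: "\<forall>m\<ge>K. hcomp m q = 0" for q K
    unfolding l_def
  proof (rule sum.mono_neutral_cong_left)
    have "K \<le> 2 + d * i" if "K \<le> i" for i
      using that le_d_mult[of i] by linarith
    thus "{i. hcomp (2 + d * i) q \<noteq> 0} \<subseteq> {..<K}" using K by (auto simp: not_le[symmetric])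
  qed auto
  have lin: "linear_functional l"
    unfolding linear_functional_def
  proof (intro allI)
    fix p q :: "('v, 'k) mpoly" and c
    obtain K1 K2 where K: "\<forall>m\<ge>K1. hcomp m p = 0" "\<forall>m\<ge>K2. hcomp m q = 0" using hcomp_eventually_0 by metis
    define K where "K = max K1 K2"
    have K': "\<forall>m\<ge>K. hcomp m p = 0" "\<forall>m\<ge>K. hcomp m q = 0" "\<forall>m\<ge>K. hcomp m (p + cst c * q) = 0"
      using K by (auto simp: K_def hcomp_add hcomp_cst_mult)
    show "l (p + cst c * q) = l p + c * l q"
      unfolding l_eq[OF K'(1)] l_eq[OF K'(2)] l_eq[OF K'(3)]
      by (simp add: hcomp_add hcomp_cst_mult Lam_linear sum.distrib sum_distrib_left distrib_left mult.left_commute)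
  qed
  have l_form: "l p = al i * Lam (2 + d * i) p" if p: "p \<in> forms (2 + d * i)" for p i
  proof -
    have K: "\<forall>m\<ge>Suc (2 + d * i). hcomp m p = 0" by (auto simp: hcomp_form[OF p])
    have "l p = (\<Sum>i'<Suc (2 + d * i). if i' = i then al i * Lam (2 + d * i) p else 0)"
      unfolding l_eq[OF K]
    proof (rule sum.cong[OF refl])
      fix i'
      show "al i' * Lam (2 + d * i') (hcomp (2 + d * i') p) = (if i' = i then al i * Lam (2 + d * i) p else 0)"
        using d by (auto simp: hcomp_form[OF p])
    qed
    also have "\<dots> = al i * Lam (2 + d * i) p"
    proof -
      have "i < Suc (2 + d * i)" using le_d_mult[of i] by linarith
      hence "i \<in> {..<Suc (2 + d * i)}" by (rule lessThan_iff[THEN iffD2])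
      thus ?thesis by (simp only: sum.delta[OF finite_lessThan] if_True)
    qed
    finally show ?thesis .
  qed
  have l_other: "l p = 0" if "p \<in> forms m" "\<And>i. m \<noteq> 2 + d * i" for p m
    unfolding l_def by (rule sum.neutral) (use that in \<open>auto simp: hcomp_form[OF that(1)]\<close>)
  have l_I: "l q = 0" if "q \<in> II" for q
    unfolding l_def by (rule sum.neutral) (use Lam_mem[OF hcomp_in_forms I.hcomp_mem[OF that]] in auto)
  have l_G_form: "l (G * q) = 0" if q: "q \<in> forms m" for q m
  proof -
    have Gq: "G * q = (\<Sum>j\<le>n. cst (g j) * (f ^ j * q))"
      unfolding G_def sum_distrib_right by (simp only: mult.assoc)
    have F: "f ^ j * q \<in> forms (d * j + m)" for j by (rule forms_mult[OF f_power_form q])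
    have lG: "l (G * q) = (\<Sum>j\<le>n. g j * l (f ^ j * q))" unfolding Gq by (rule linear_functional_sum[OF lin])
    show ?thesis
    proof (cases "\<exists>s. m = 2 + d * s")
      case True
      then obtain s where s: "m = 2 + d * s" by blast
      have "l (f ^ j * q) = al (s + j) * Lam m q" for j
      proof -
        have e: "d * j + m = 2 + d * (s + j)" by (simp add: s algebra_simps)
        have "l (f ^ j * q) = al (s + j) * Lam (2 + d * (s + j)) (f ^ j * q)"
          using F[of j] unfolding e by (rule l_form)
        also have "Lam (2 + d * (s + j)) (f ^ j * q) = Lam m q"
          unfolding e[symmetric] by (rule Lam_f_power[OF q])
        finally show ?thesis .
      qed
      hence l1: "l (G * q) = (\<Sum>j\<le>n. g j * al (s + j)) * Lam m q"
        unfolding lG by (simp add: sum_distrib_right mult.assoc)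
      show ?thesis
      proof (cases "s = 0")
        case True
        hence "Lam m q = 0" using Lam_2 q s by simp
        thus ?thesis using l1 by simp
      next
        case False
        thus ?thesis using l1 al(3)[of s] by simp
      qed
    next
      case False
      have "l (f ^ j * q) = 0" for j
      proof (rule l_other[OF F])
        fix i
        show "d * j + m \<noteq> 2 + d * i"
        proof
          assume e: "d * j + m = 2 + d * i"
          show False
          proof (cases "j \<le> i")
            case True
            hence "d * j \<le> d * i" by (rule mult_le_mono2)
            hence "m = 2 + (d * i - d * j)" using e by linarith
            hence "m = 2 + d * (i - j)" by (simp only: diff_mult_distrib2)
            thus False using False by blast
          next
            case False
            hence "d * Suc i \<le> d * j" by (intro mult_le_mono2) simp
            thus False using e d by simp
          qed
        qed
      qed
      thus ?thesis by (simp add: lG)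
    qed
  qed
  have l_G: "l (G * q) = 0" for q
  proof -
    obtain K where K: "\<forall>m\<ge>K. hcomp m q = 0" using hcomp_eventually_0 by blast
    have "q = (\<Sum>m<K. hcomp m q)" using K by (intro hcomp_decompose) auto
    hence "G * q = G * (\<Sum>m<K. hcomp m q)" by simp
    also have "\<dots> = (\<Sum>m<K. cst 1 * (G * hcomp m q))" unfolding sum_distrib_left by simp
    finally have "l (G * q) = (\<Sum>m<K. 1 * l (G * hcomp m q))"
      using linear_functional_sum[OF lin, of "\<lambda>_. 1" "\<lambda>m. G * hcomp m q" "{..<K}"] by simp
    also have "\<dots> = 0" using l_G_form[OF hcomp_in_forms] by simp
    finally show ?thesis .
  qed
  have l_KG: "l q = 0" if "q \<in> KG" for q
  proof -
    obtain y where "q - G * y \<in> II" using \<open>q \<in> KG\<close> unfolding KG_def by blast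
    hence "l (q - G * y) = 0" by (rule l_I)
    thus ?thesis using l_G[of y] by (simp add: linear_functionalD[OF lin])
  qed
  have main: "q \<in> KG" if "\<forall>r. l (q * r) = 0" "\<forall>m\<ge>D. hcomp m q = 0" for q D
    using that
  proof (induction D arbitrary: q)
    case 0
    have "q = 0" by (rule hcomp_eqI) (use 0 in simp)
    thus ?case by simp
  next
    case (Suc D)
    note H = Suc.prems(1) and deg = Suc.prems(2)
    have "\<exists>s. (s = 0 \<or> d * n \<le> D \<and> s \<in> forms (D - d * n)) \<and> hcomp D q - f ^ n * s \<in> II"
    proof (cases "D \<le> d * n + 2")
      case True
      define j where "j = d * n + 2 - D"
      have Dj: "D + j = d * n + 2" using True by (simp add: j_def)
      show ?thesis
      proof (rule duality[OF hcomp_in_forms Dj])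
        fix r :: "('v, 'k) mpoly" assume r: "r \<in> forms j"
        have hc: "hcomp m (q * r) = (if j \<le> m then hcomp (m - j) q * r else 0)" for m
          using hcomp_form_mult[OF r, of m q] by (simp add: mult.commute)
        have K: "\<forall>m\<ge>Suc (d * n + 2). hcomp m (q * r) = 0"
        proof (intro allI impI)
          fix m assume "Suc (d * n + 2) \<le> m"
          hence "Suc D \<le> m - j" "j \<le> m" using Dj by auto
          thus "hcomp m (q * r) = 0" using deg hc by simp
        qed
        have "0 = l (q * r)" using H by simp
        also have "\<dots> = (\<Sum>i<Suc (d * n + 2). if i = n then Lam (D + j) (hcomp D q * r) else 0)"
          unfolding l_eq[OF K]
        proof (rule sum.cong[OF refl])
          fix i
          consider "i < n" | "i = n" | "n < i" by linarith
          thus "al i * Lam (2 + d * i) (hcomp (2 + d * i) (q * r)) = (if i = n then Lam (D + j) (hcomp D q * r) else 0)"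
          proof cases
            case 1
            thus ?thesis using al(1) by simp
          next
            case 2
            have "2 + d * n = D + j" "D + j - j = D" using Dj by auto
            thus ?thesis using 2 al(2) hc[of "D + j"] by simp
          next
            case 3
            hence "d * n < d * i" using d by simp
            hence "Suc (d * n + 2) \<le> 2 + d * i" by linarith
            hence "hcomp (2 + d * i) (q * r) = 0" using K by blast
            thus ?thesis using 3 by simp
          qed
        qed
        also have "\<dots> = Lam (D + j) (hcomp D q * r)"
        proof -
          have "n < Suc (d * n + 2)" using le_d_mult[of n] by linarith
          hence "n \<in> {..<Suc (d * n + 2)}" by (rule lessThan_iff[THEN iffD2])
          thus ?thesis by (simp only: sum.delta[OF finite_lessThan] if_True)
        qed
        finally show "Lam (D + j) (hcomp D q * r) = 0" by simp
      qed
    next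
      case False
      show ?thesis
      proof (cases "d * n + Suc 3 \<le> D")
        case True
        then obtain s where "s \<in> forms (D - d * n)" "hcomp D q - f ^ n * s \<in> II"
          using divide_f_power[OF hcomp_in_forms True, of q] by blast
        thus ?thesis using True by (intro exI[of _ s]) simp
      next
        case False2: False
        hence "D = Suc (d * n + 2)" using False by simp
        have e: "D - d * n = Suc 2" "d * n \<le> D" using \<open>D = Suc (d * n + 2)\<close> by auto
        obtain s where s: "s \<in> forms (Suc 2)" "P.val (Suc 2) s = P.val D (hcomp D q)" "Q.val (Suc 2) s = Q.val D (hcomp D q)"
          by (rule component_form[of 2 "P.val D (hcomp D q)" "Q.val D (hcomp D q)"])
            (auto intro: P.val(1) Q.val(1))
        have fs: "f ^ n * s \<in> forms D" by (rule forms_mult_eq[OF f_power_form s(1)]) (use e in simp)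
        have De: "D = d * n + Suc 2" using e by simp
        have "P.val D (f ^ n * s) = P.val D (hcomp D q)" "Q.val D (f ^ n * s) = Q.val D (hcomp D q)"
          using P.val_mult[OF f_power_form f_power_cong(1) s(1), of n] Q.val_mult[OF f_power_form f_power_cong(2) s(1), of n] s
          by (simp_all add: De)
        hence "P.val D (hcomp D q + cst (- 1) * (f ^ n * s)) = 0" "Q.val D (hcomp D q + cst (- 1) * (f ^ n * s)) = 0"
          unfolding P.val_linear[OF hcomp_in_forms fs] Q.val_linear[OF hcomp_in_forms fs] by (simp_all add: cst_uminus)
        moreover have F: "hcomp D q + cst (- 1) * (f ^ n * s) \<in> forms D" using fs hcomp_in_forms by blast
        ultimately have "hcomp D q + cst (- 1) * (f ^ n * s) \<in> II"
          using P.val_eq_0_iff[OF F] Q.val_eq_0_iff[OF F] by blast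
        thus ?thesis using s(1) e by (intro exI[of _ s]) (simp add: cst_uminus)
      qed
    qed
    then obtain s where s: "s = 0 \<or> d * n \<le> D \<and> s \<in> forms (D - d * n)" "hcomp D q - f ^ n * s \<in> II"
      by (elim exE conjE) (rule that)
    let ?q = "q - G * s - (hcomp D q - f ^ n * s)"
    have GK: "G * s + (hcomp D q - f ^ n * s) \<in> KG" unfolding KG_def using s(2) by (auto intro!: exI[of _ s])
    have "l (?q * r) = 0" for r
    proof -
      have "l ((G * s + (hcomp D q - f ^ n * s)) * r) = 0" by (rule l_KG[OF KG.mult_right[OF GK]])
      moreover have "?q * r = q * r - (G * s + (hcomp D q - f ^ n * s)) * r" by (simp add: algebra_simps)
      ultimately show ?thesis using H by (simp add: linear_functionalD[OF lin])
    qed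
    hence "?q \<in> KG" using Suc.IH[OF _ reduce_top[OF deg s(1)]] by blast
    thus "q \<in> KG" by (rule KG.comb2[OF _ GK, of _ _ 1 1]) simp
  qed
  have "(\<forall>r. l (q * r) = 0) \<longleftrightarrow> q \<in> KG" for q
  proof
    assume H: "\<forall>r. l (q * r) = 0"
    obtain D where "\<forall>m\<ge>D. hcomp m q = 0" using hcomp_eventually_0 by blast
    with H show "q \<in> KG" by (rule main)
  next
    assume "q \<in> KG"
    thus "\<forall>r. l (q * r) = 0" using l_KG KG.mult_right by blast
  qed
  thus ?thesis using lin by blast
qed

end

end

section \<open>Quotients and localizations of the polynomial ring\<close>

lemma polys_simps [simp]:
  "carrier polys = UNIV" "p \<otimes>\<^bsub>polys\<^esub> q = p * q" "p \<oplus>\<^bsub>polys\<^esub> q = p + q"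
  "\<one>\<^bsub>polys\<^esub> = 1" "\<zero>\<^bsub>polys\<^esub> = 0"
  by (simp_all add: ring_of_type_algebra_def)

lemma cring_polys: "cring polys"
  by (rule cring_from_type_algebra)

lemma polys_minus [simp]: "\<ominus>\<^bsub>polys\<^esub> p = - p" "p \<ominus>\<^bsub>polys\<^esub> q = p - q"
proof -
  interpret S: cring polys by (rule cring_polys)
  show 1: "\<ominus>\<^bsub>polys\<^esub> p = - p" for p :: "('a, 'b) mpoly"
    by (rule S.minus_equality) auto
  show "p \<ominus>\<^bsub>polys\<^esub> q = p - q" by (simp add: a_minus_def 1)
qed

lemma cring_idealI:
  fixes R (structure)
  assumes R: "cring R" and J: "J \<subseteq> carrier R" "\<zero> \<in> J" "\<And>a b. a \<in> J \<Longrightarrow> b \<in> J \<Longrightarrow> a \<oplus> b \<in> J"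
    "\<And>a x. a \<in> J \<Longrightarrow> x \<in> carrier R \<Longrightarrow> x \<otimes> a \<in> J"
  shows "ideal J R"
proof -
  interpret cring R by fact
  have neg: "\<ominus> a \<in> J" if "a \<in> J" for a
    using J(4)[OF that, of "\<ominus> \<one>"] J(1) that by (simp add: l_minus subset_iff)
  show ?thesis
  proof (rule idealI[OF ring_axioms])
    show "subgroup J (add_monoid R)"
      by (rule subgroup.intro) (use J neg in \<open>auto simp: a_inv_def[symmetric]\<close>)
    show "x \<otimes> a \<in> J" if "a \<in> J" "x \<in> carrier R" for a x using J(4) that by blast
    thus "a \<otimes> x \<in> J" if "a \<in> J" "x \<in> carrier R" for a x
      using m_comm[of a x] that J(1) by auto
  qed
qed

lemma (in ideal) zero_mem: "\<zero> \<in> I"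
  by (rule additive_subgroup.zero_closed[OF is_additive_subgroup])

lemma (in ideal) add_mem: "a \<in> I \<Longrightarrow> b \<in> I \<Longrightarrow> a \<oplus> b \<in> I"
  by (rule additive_subgroup.a_closed[OF is_additive_subgroup])

lemma poly_ideal_iff: "ideal I polys \<longleftrightarrow> poly_ideal I"
proof
  assume "ideal I polys"
  then interpret ideal I polys .
  show "poly_ideal I"
  proof
    show "0 \<in> I" using zero_mem by simp
    show "p + q \<in> I" if "p \<in> I" "q \<in> I" for p q using add_mem[OF that] by simp
    show "q * p \<in> I" if "p \<in> I" for p q using I_l_closed[OF that, of q] by simp
  qed
next
  assume "poly_ideal I"
  then interpret poly_ideal I .
  show "ideal I polys" by (rule cring_idealI[OF cring_polys]) (auto intro: add mult)
qed

abbreviation cls :: "('v::finite, 'k::field) mpoly set \<Rightarrow> ('v, 'k) mpoly \<Rightarrow> ('v, 'k) mpoly set"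
  where "cls I p \<equiv> I +>\<^bsub>polys\<^esub> p"

context poly_ideal
begin

lemma ideal_polys: "ideal I polys"
  using poly_ideal_iff poly_ideal_axioms by blast

lemma cls_eq_iff: "cls I p = cls I q \<longleftrightarrow> p - q \<in> I"
  using ring.quotient_eq_iff_same_a_r_cos[OF cring.axioms(1)[OF cring_polys] ideal_polys, of p q] by simp

lemma cring_quotient: "cring (polys Quot I)"
  by (rule ideal.quotient_is_cring[OF ideal_polys cring_polys])

lemma carrier_quotient: "carrier (polys Quot I) = range (cls I)"
  by (auto simp: FactRing_def A_RCOSETS_def')

lemma cls_carrier [simp]: "cls I p \<in> carrier (polys Quot I)"
  by (simp add: carrier_quotient)

lemma cls_hom: "(\<lambda>p. cls I p) \<in> ring_hom polys (polys Quot I)"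
  by (rule ideal.rcos_ring_hom[OF ideal_polys])

lemma cls_ops:
  "cls I p \<otimes>\<^bsub>polys Quot I\<^esub> cls I q = cls I (p * q)"
  "cls I p \<oplus>\<^bsub>polys Quot I\<^esub> cls I q = cls I (p + q)"
  "\<one>\<^bsub>polys Quot I\<^esub> = cls I 1"
  using ring_hom_mult[OF cls_hom, of p q] ring_hom_add[OF cls_hom, of p q] ring_hom_one[OF cls_hom] by auto

lemma cls_zero: "\<zero>\<^bsub>polys Quot I\<^esub> = cls I 0"
proof -
  interpret R: cring "polys Quot I" by (rule cring_quotient)
  have "cls I 0 \<oplus>\<^bsub>polys Quot I\<^esub> cls I 0 = cls I 0" by (simp add: cls_ops)
  thus ?thesis using R.add.l_cancel_one[of "cls I 0" "cls I 0"] by simp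
qed

lemma cls_minus: "cls I p \<ominus>\<^bsub>polys Quot I\<^esub> cls I q = cls I (p - q)"
proof -
  interpret R: cring "polys Quot I" by (rule cring_quotient)
  have "cls I (- q) \<oplus>\<^bsub>polys Quot I\<^esub> cls I q = \<zero>\<^bsub>polys Quot I\<^esub>" by (simp add: cls_ops cls_zero)
  hence "\<ominus>\<^bsub>polys Quot I\<^esub> cls I q = cls I (- q)" by (rule R.minus_equality) auto
  thus ?thesis by (simp add: a_minus_def cls_ops)
qed

end

text \<open>
  The localization of \<open>S/I\<close> at the classes of \<open>W\<close>, with the elements written as fractions
  \<open>Fr p s\<close> of polynomials. It serves both for the local rings of \<open>R\<close> and for the section rings.
\<close>

locale fractions = poly_ideal I for I :: "('v::finite, 'k::field) mpoly set" +
  fixes W :: "('v, 'k) mpoly set"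
  assumes one_W: "1 \<in> W" and mult_W: "s \<in> W \<Longrightarrow> t \<in> W \<Longrightarrow> s * t \<in> W"
begin

abbreviation L :: "(('v, 'k) mpoly set \<times> ('v, 'k) mpoly set) set ring"
  where "L \<equiv> localization (polys Quot I) (cls I ` W)"

definition Fr :: "('v, 'k) mpoly \<Rightarrow> ('v, 'k) mpoly \<Rightarrow> (('v, 'k) mpoly set \<times> ('v, 'k) mpoly set) set"
  where "Fr p s = frac_class (polys Quot I) (cls I ` W) (cls I p) (cls I s)"

lemma Fr_mem: 
  assumes "t \<in> W" shows "(cls I q, cls I t) \<in> Fr p s \<longleftrightarrow> (\<exists>u\<in>W. u * (p * t - q * s) \<in> I)"
proof -
  have "cls I u \<otimes>\<^bsub>polys Quot I\<^esub> (cls I p \<otimes>\<^bsub>polys Quot I\<^esub> cls I t \<ominus>\<^bsub>polys Quot I\<^esub> cls I q \<otimes>\<^bsub>polys Quot I\<^esub> cls I s)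
      = \<zero>\<^bsub>polys Quot I\<^esub> \<longleftrightarrow> u * (p * t - q * s) \<in> I" for u
    unfolding cls_ops cls_minus cls_zero cls_eq_iff by simp
  thus ?thesis using assms by (auto simp: Fr_def frac_class_def)
qed

lemma Fr_elem:
  assumes "x \<in> Fr p s" obtains q t where "x = (cls I q, cls I t)" "t \<in> W" "\<exists>u\<in>W. u * (p * t - q * s) \<in> I"
proof -
  obtain a b where x: "x = (a, b)" by (cases x)
  have "a \<in> carrier (polys Quot I)" "b \<in> cls I ` W" using assms by (auto simp: x Fr_def frac_class_def)
  then obtain q t where "a = cls I q" "b = cls I t" "t \<in> W" by (auto simp: carrier_quotient)
  thus ?thesis using that Fr_mem assms x by blast
qed

lemma Fr_eq_iff:
  assumes s: "s \<in> W" and t: "t \<in> W"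
  shows "Fr p s = Fr q t \<longleftrightarrow> (\<exists>u\<in>W. u * (p * t - q * s) \<in> I)"
proof
  assume "Fr p s = Fr q t"
  moreover have "(cls I q, cls I t) \<in> Fr q t" using Fr_mem[OF t] one_W by (auto intro!: bexI[of _ 1])
  ultimately show "\<exists>u\<in>W. u * (p * t - q * s) \<in> I" using Fr_mem[OF t] by blast
next
  have sub: "Fr q t \<subseteq> Fr p s" if s: "s \<in> W" "t \<in> W" and u: "u \<in> W" "u * (p * t - q * s) \<in> I" for p q s t u
  proof
    fix x assume "x \<in> Fr q t"
    then obtain q' t' w where x: "x = (cls I q', cls I t')" "t' \<in> W" "w \<in> W" "w * (q * t' - q' * t) \<in> I"
      using Fr_elem by metis
    have "u * w * t * (p * t' - q' * s) \<in> I"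
      by (rule comb2[OF u(2) x(4), of _ "w * t'" "u * s"]) (simp add: algebra_simps)
    moreover have "u * w * t \<in> W" using u x s mult_W by blast
    ultimately show "x \<in> Fr p s" using Fr_mem[OF x(2)] x(1) by blast
  qed
  assume "\<exists>u\<in>W. u * (p * t - q * s) \<in> I"
  then obtain u where u: "u \<in> W" "u * (p * t - q * s) \<in> I" by blast
  have "u * (q * s - p * t) \<in> I" by (rule comb1[OF u(2), of _ "-1"]) (simp add: algebra_simps)
  thus "Fr p s = Fr q t" using sub[OF s t u] sub[OF t s u(1)] by blast
qed

lemma Fr_eqI: "s \<in> W \<Longrightarrow> t \<in> W \<Longrightarrow> p * t - q * s \<in> I \<Longrightarrow> Fr p s = Fr q t"
  using Fr_eq_iff one_W by (metis mult_1)

lemma carrier_L: "carrier L = {Fr p s | p s. s \<in> W}"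
  by (auto simp: localization_def Fr_def carrier_quotient)

lemma Fr_carrier [simp]: "s \<in> W \<Longrightarrow> Fr p s \<in> carrier L"
  by (auto simp: carrier_L)

lemma Fr_one: "\<one>\<^bsub>L\<^esub> = Fr 1 1" and Fr_zero: "\<zero>\<^bsub>L\<^esub> = Fr 0 1"
  by (simp_all add: localization_def Fr_def cls_ops cls_zero)

text \<open>
  The operations of a localization are unions over all representatives; they may be computed with
  any choice once the result is known to be independent of it.
\<close>

lemma Fr_union:
  assumes s: "s \<in> W" and t: "t \<in> W"
    and F: "\<And>p' s' q' t'. s' \<in> W \<Longrightarrow> t' \<in> W \<Longrightarrow> (\<exists>u\<in>W. u * (p * s' - p' * s) \<in> I) \<Longrightarrow>
      (\<exists>u\<in>W. u * (q * t' - q' * t) \<in> I) \<Longrightarrow> H (cls I p', cls I s') (cls I q', cls I t') = Z"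
  shows "(\<Union>x\<in>Fr p s. \<Union>y\<in>Fr q t. H x y) = Z"
proof -
  have "H x y = Z" if xy: "x \<in> Fr p s" "y \<in> Fr q t" for x y
  proof -
    obtain p' s' where x: "x = (cls I p', cls I s')" "s' \<in> W" "\<exists>u\<in>W. u * (p * s' - p' * s) \<in> I"
      using Fr_elem[OF xy(1)] by metis
    obtain q' t' where y: "y = (cls I q', cls I t')" "t' \<in> W" "\<exists>u\<in>W. u * (q * t' - q' * t) \<in> I"
      using Fr_elem[OF xy(2)] by metis
    show ?thesis unfolding x(1) y(1) by (rule F[OF x(2) y(2) x(3) y(3)])
  qed
  moreover have "(cls I p, cls I s) \<in> Fr p s" "(cls I q, cls I t) \<in> Fr q t"
    using Fr_mem one_W s t by (auto intro!: bexI[of _ 1])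
  ultimately show ?thesis by blast
qed

lemma Fr_mult:
  assumes s: "s \<in> W" and t: "t \<in> W"
  shows "Fr p s \<otimes>\<^bsub>L\<^esub> Fr q t = Fr (p * q) (s * t)"
proof -
  have "Fr p s \<otimes>\<^bsub>L\<^esub> Fr q t = (\<Union>x\<in>Fr p s. \<Union>y\<in>Fr q t. frac_class (polys Quot I) (cls I ` W)
      (fst x \<otimes>\<^bsub>polys Quot I\<^esub> fst y) (snd x \<otimes>\<^bsub>polys Quot I\<^esub> snd y))"
    by (simp add: localization_def)
  also have "\<dots> = Fr (p * q) (s * t)"
  proof (rule Fr_union[OF s t])
    fix p' s' q' t' assume st: "s' \<in> W" "t' \<in> W" and "\<exists>u\<in>W. u * (p * s' - p' * s) \<in> I" "\<exists>u\<in>W. u * (q * t' - q' * t) \<in> I"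
    then obtain u w where uw: "u \<in> W" "u * (p * s' - p' * s) \<in> I" "w \<in> W" "w * (q * t' - q' * t) \<in> I" by blast
    have "u * w * (p' * q' * (s * t) - p * q * (s' * t')) \<in> I"
      by (rule comb2[OF uw(2,4), of _ "- w * q * t'" "- u * p' * s"]) (simp add: algebra_simps)
    hence "Fr (p' * q') (s' * t') = Fr (p * q) (s * t)" using Fr_eq_iff mult_W st s t uw by blast
    thus "frac_class (polys Quot I) (cls I ` W) (fst (cls I p', cls I s') \<otimes>\<^bsub>polys Quot I\<^esub> fst (cls I q', cls I t'))
      (snd (cls I p', cls I s') \<otimes>\<^bsub>polys Quot I\<^esub> snd (cls I q', cls I t')) = Fr (p * q) (s * t)"
      by (simp add: cls_ops Fr_def)
  qed
  finally show ?thesis .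
qed

lemma Fr_add:
  assumes s: "s \<in> W" and t: "t \<in> W"
  shows "Fr p s \<oplus>\<^bsub>L\<^esub> Fr q t = Fr (p * t + q * s) (s * t)"
proof -
  have "Fr p s \<oplus>\<^bsub>L\<^esub> Fr q t = (\<Union>x\<in>Fr p s. \<Union>y\<in>Fr q t. frac_class (polys Quot I) (cls I ` W)
      ((fst x \<otimes>\<^bsub>polys Quot I\<^esub> snd y) \<oplus>\<^bsub>polys Quot I\<^esub> (fst y \<otimes>\<^bsub>polys Quot I\<^esub> snd x)) (snd x \<otimes>\<^bsub>polys Quot I\<^esub> snd y))"
    by (simp add: localization_def)
  also have "\<dots> = Fr (p * t + q * s) (s * t)"
  proof (rule Fr_union[OF s t])
    fix p' s' q' t' assume st: "s' \<in> W" "t' \<in> W" and "\<exists>u\<in>W. u * (p * s' - p' * s) \<in> I" "\<exists>u\<in>W. u * (q * t' - q' * t) \<in> I"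
    then obtain u w where uw: "u \<in> W" "u * (p * s' - p' * s) \<in> I" "w \<in> W" "w * (q * t' - q' * t) \<in> I" by blast
    have "u * w * ((p' * t' + q' * s') * (s * t) - (p * t + q * s) * (s' * t')) \<in> I"
      by (rule comb2[OF uw(2,4), of _ "- w * t * t'" "- u * s * s'"]) (simp add: algebra_simps)
    hence "Fr (p' * t' + q' * s') (s' * t') = Fr (p * t + q * s) (s * t)" using Fr_eq_iff mult_W st s t uw by blast
    thus "frac_class (polys Quot I) (cls I ` W)
      (fst (cls I p', cls I s') \<otimes>\<^bsub>polys Quot I\<^esub> snd (cls I q', cls I t') \<oplus>\<^bsub>polys Quot I\<^esub>
        fst (cls I q', cls I t') \<otimes>\<^bsub>polys Quot I\<^esub> snd (cls I p', cls I s'))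
      (snd (cls I p', cls I s') \<otimes>\<^bsub>polys Quot I\<^esub> snd (cls I q', cls I t')) = Fr (p * t + q * s) (s * t)"
      by (simp add: cls_ops Fr_def)
  qed
  finally show ?thesis .
qed

lemma L_cases:
  assumes "x \<in> carrier L" obtains p s where "x = Fr p s" "s \<in> W"
  using assms by (auto simp: carrier_L)

lemma cring_L: "cring L"
proof (rule cringI)
  show "abelian_group L"
  proof (rule abelian_groupI)
    fix x y z assume xyz: "x \<in> carrier L" "y \<in> carrier L" "z \<in> carrier L"
    obtain p s where x: "x = Fr p s" "s \<in> W" using L_cases[OF xyz(1)] .
    obtain q t where y: "y = Fr q t" "t \<in> W" using L_cases[OF xyz(2)] .
    obtain r u where z: "z = Fr r u" "u \<in> W" using L_cases[OF xyz(3)] .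
    show "x \<oplus>\<^bsub>L\<^esub> y \<in> carrier L" using x y mult_W by (simp add: Fr_add)
    show "x \<oplus>\<^bsub>L\<^esub> y \<oplus>\<^bsub>L\<^esub> z = x \<oplus>\<^bsub>L\<^esub> (y \<oplus>\<^bsub>L\<^esub> z)"
      using x y z mult_W by (simp add: Fr_add) (simp add: algebra_simps)
    show "x \<oplus>\<^bsub>L\<^esub> y = y \<oplus>\<^bsub>L\<^esub> x" using x y by (simp add: Fr_add) (simp add: algebra_simps)
    show "\<zero>\<^bsub>L\<^esub> \<oplus>\<^bsub>L\<^esub> x = x" using x one_W by (simp add: Fr_zero Fr_add)
    have "Fr (- p) s \<oplus>\<^bsub>L\<^esub> x = \<zero>\<^bsub>L\<^esub>"
      unfolding x(1) Fr_add[OF x(2) x(2)] Fr_zero by (rule Fr_eqI) (auto simp: x mult_W one_W)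
    thus "\<exists>y\<in>carrier L. y \<oplus>\<^bsub>L\<^esub> x = \<zero>\<^bsub>L\<^esub>" using x by (intro bexI[of _ "Fr (- p) s"]) auto
  qed (simp add: Fr_zero one_W)
  show "comm_monoid L"
  proof (rule comm_monoidI)
    fix x y z assume xyz: "x \<in> carrier L" "y \<in> carrier L" "z \<in> carrier L"
    obtain p s where x: "x = Fr p s" "s \<in> W" using L_cases[OF xyz(1)] .
    obtain q t where y: "y = Fr q t" "t \<in> W" using L_cases[OF xyz(2)] .
    obtain r u where z: "z = Fr r u" "u \<in> W" using L_cases[OF xyz(3)] .
    show "x \<otimes>\<^bsub>L\<^esub> y \<in> carrier L" using x y mult_W by (simp add: Fr_mult)
    show "x \<otimes>\<^bsub>L\<^esub> y \<otimes>\<^bsub>L\<^esub> z = x \<otimes>\<^bsub>L\<^esub> (y \<otimes>\<^bsub>L\<^esub> z)"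
      using x y z mult_W by (simp add: Fr_mult mult.assoc)
    show "x \<otimes>\<^bsub>L\<^esub> y = y \<otimes>\<^bsub>L\<^esub> x" using x y by (simp add: Fr_mult mult.commute)
    show "\<one>\<^bsub>L\<^esub> \<otimes>\<^bsub>L\<^esub> x = x" using x one_W by (simp add: Fr_one Fr_mult)
  qed (simp add: Fr_one one_W)
  fix x y z assume xyz: "x \<in> carrier L" "y \<in> carrier L" "z \<in> carrier L"
  obtain p s where x: "x = Fr p s" "s \<in> W" using L_cases[OF xyz(1)] .
  obtain q t where y: "y = Fr q t" "t \<in> W" using L_cases[OF xyz(2)] .
  obtain r u where z: "z = Fr r u" "u \<in> W" using L_cases[OF xyz(3)] .
  show "(x \<oplus>\<^bsub>L\<^esub> y) \<otimes>\<^bsub>L\<^esub> z = x \<otimes>\<^bsub>L\<^esub> z \<oplus>\<^bsub>L\<^esub> y \<otimes>\<^bsub>L\<^esub> z"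
    unfolding x(1) y(1) z(1) Fr_add[OF x(2) y(2)] Fr_mult[OF x(2) z(2)] Fr_mult[OF y(2) z(2)]
      Fr_mult[OF mult_W[OF x(2) y(2)] z(2)] Fr_add[OF mult_W[OF x(2) z(2)] mult_W[OF y(2) z(2)]]
    by (rule Fr_eqI) (use x y z mult_W in \<open>auto simp: algebra_simps\<close>)
qed

lemma Fr_eq_0_iff: "s \<in> W \<Longrightarrow> Fr p s = \<zero>\<^bsub>L\<^esub> \<longleftrightarrow> (\<exists>u\<in>W. u * p \<in> I)"
  using Fr_eq_iff[OF _ one_W, of s p 0] by (simp add: Fr_zero)

lemma Fr_hom: "(\<lambda>p. Fr p 1) \<in> ring_hom polys L"
  by (rule ring_hom_memI) (auto simp: Fr_mult Fr_add Fr_one one_W)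

lemma Fr_split: "s \<in> W \<Longrightarrow> Fr p s = Fr 1 s \<otimes>\<^bsub>L\<^esub> Fr p 1" "s \<in> W \<Longrightarrow> Fr p 1 = Fr s 1 \<otimes>\<^bsub>L\<^esub> Fr p s"
proof -
  assume s: "s \<in> W"
  show "Fr p s = Fr 1 s \<otimes>\<^bsub>L\<^esub> Fr p 1" using s one_W by (simp add: Fr_mult)
  show "Fr p 1 = Fr s 1 \<otimes>\<^bsub>L\<^esub> Fr p s"
    unfolding Fr_mult[OF one_W s] by (rule Fr_eqI) (use s one_W in \<open>auto simp: mult.commute\<close>)
qed

lemma Fr_minus: 
  assumes "s \<in> W" "t \<in> W" shows "Fr p s \<ominus>\<^bsub>L\<^esub> Fr q t = Fr (p * t - q * s) (s * t)"
proof -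
  interpret L: cring L by (rule cring_L)
  have "Fr (- q) t \<oplus>\<^bsub>L\<^esub> Fr q t = \<zero>\<^bsub>L\<^esub>"
    unfolding Fr_add[OF assms(2,2)] Fr_zero by (rule Fr_eqI) (auto simp: assms mult_W one_W)
  hence "\<ominus>\<^bsub>L\<^esub> Fr q t = Fr (- q) t" by (rule L.minus_equality) (use assms in auto)
  thus ?thesis using assms by (simp add: a_minus_def Fr_add)
qed

text \<open>
The contraction to \<open>S\<close> of an ideal of the localization; it determines the ideal.
\<close>

definition preim :: "(('v, 'k) mpoly set \<times> ('v, 'k) mpoly set) set set \<Rightarrow> ('v, 'k) mpoly set"
  where "preim J = {p. Fr p 1 \<in> J}"

lemma Fr_in_ideal_iff:
  assumes "ideal J L" "s \<in> W" shows "Fr p s \<in> J \<longleftrightarrow> p \<in> preim J"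
proof -
  interpret J: ideal J L by fact
  show ?thesis
  proof
    assume "Fr p s \<in> J"
    hence "Fr s 1 \<otimes>\<^bsub>L\<^esub> Fr p s \<in> J" by (rule J.I_l_closed) (rule Fr_carrier[OF one_W])
    thus "p \<in> preim J" unfolding Fr_split(2)[OF assms(2), symmetric] by (simp add: preim_def)
  next
    assume "p \<in> preim J"
    hence "Fr p 1 \<in> J" by (simp add: preim_def)
    hence "Fr 1 s \<otimes>\<^bsub>L\<^esub> Fr p 1 \<in> J" by (rule J.I_l_closed) (rule Fr_carrier[OF assms(2)])
    thus "Fr p s \<in> J" unfolding Fr_split(1)[OF assms(2), symmetric] .
  qed
qed

lemma preim_ideal:
  assumes "ideal J L" shows "poly_ideal (preim J)" "I \<subseteq> preim J"
    "u \<in> W \<Longrightarrow> u * p \<in> preim J \<Longrightarrow> p \<in> preim J"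
proof -
  interpret J: ideal J L by fact
  have z: "Fr p 1 \<in> J" if "p \<in> I" for p
  proof -
    have "Fr p 1 = \<zero>\<^bsub>L\<^esub>" unfolding Fr_zero by (rule Fr_eqI) (use one_W that in auto)
    thus ?thesis using J.zero_mem by simp
  qed
  thus "I \<subseteq> preim J" by (auto simp: preim_def)
  show "poly_ideal (preim J)"
  proof
    show "0 \<in> preim J" using z[OF zero] by (simp add: preim_def)
    fix p q assume p: "p \<in> preim J"
    show "q * p \<in> preim J"
      using J.I_l_closed[of "Fr p 1" "Fr q 1"] p one_W by (simp add: preim_def Fr_mult)
    assume "q \<in> preim J"
    thus "p + q \<in> preim J" using J.add_mem[of "Fr p 1" "Fr q 1"] p one_W by (simp add: preim_def Fr_add)
  qed
  show "p \<in> preim J" if "u \<in> W" "u * p \<in> preim J"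
  proof -
    have "Fr (u * p) u \<in> J" using Fr_in_ideal_iff[OF assms that(1)] that(2) by simp
    moreover have "Fr (u * p) u = Fr p 1" by (rule Fr_eqI) (use that one_W in \<open>auto simp: mult.commute\<close>)
    ultimately show ?thesis by (simp add: preim_def)
  qed
qed

lemma ideal_eqI:
  assumes "ideal J L" "ideal J' L" "preim J = preim J'" shows "J = J'"
proof -
  have "x \<in> J \<longleftrightarrow> x \<in> J'" if "x \<in> carrier L" for x
    using L_cases[OF that] Fr_in_ideal_iff[OF assms(1)] Fr_in_ideal_iff[OF assms(2)] assms(3) by metis
  moreover have "J \<subseteq> carrier L" "J' \<subseteq> carrier L"
    using assms(1,2)[THEN ideal.Icarr] by auto
  ultimately show ?thesis by blast
qed

lemma ideal_of_poly_ideal: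
  assumes "poly_ideal A" "I \<subseteq> A" "\<And>u p. u \<in> W \<Longrightarrow> u * p \<in> A \<Longrightarrow> p \<in> A"
  shows "ideal {Fr p s | p s. p \<in> A \<and> s \<in> W} L" "preim {Fr p s | p s. p \<in> A \<and> s \<in> W} = A"
proof -
  interpret A: poly_ideal A by fact
  show "ideal {Fr p s | p s. p \<in> A \<and> s \<in> W} L"
  proof (rule cring_idealI[OF cring_L])
    show "{Fr p s | p s. p \<in> A \<and> s \<in> W} \<subseteq> carrier L" by auto
    show "\<zero>\<^bsub>L\<^esub> \<in> {Fr p s | p s. p \<in> A \<and> s \<in> W}" unfolding Fr_zero using A.zero one_W by blast
    fix a b assume "a \<in> {Fr p s | p s. p \<in> A \<and> s \<in> W}"
    then obtain p s where a: "a = Fr p s" "p \<in> A" "s \<in> W" by blast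
    {
      assume "b \<in> {Fr p s | p s. p \<in> A \<and> s \<in> W}"
      then obtain q t where b: "b = Fr q t" "q \<in> A" "t \<in> W" by blast
      have "p * t + q * s \<in> A" using a b by (intro A.add A.mult_right)
      thus "a \<oplus>\<^bsub>L\<^esub> b \<in> {Fr p s | p s. p \<in> A \<and> s \<in> W}"
        unfolding a(1) b(1) Fr_add[OF a(3) b(3)] using mult_W[OF a(3) b(3)] by blast
    next
      assume "b \<in> carrier L"
      then obtain q t where b: "b = Fr q t" "t \<in> W" using L_cases by blast
      show "b \<otimes>\<^bsub>L\<^esub> a \<in> {Fr p s | p s. p \<in> A \<and> s \<in> W}"
        unfolding a(1) b(1) Fr_mult[OF b(2) a(3)] using mult_W[OF b(2) a(3)] A.mult[OF a(2)] by blast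
    }
  qed
  have "p \<in> A" if e: "Fr p 1 = Fr q s" "q \<in> A" "s \<in> W" for p q s
  proof -
    obtain u where u: "u \<in> W" "u * (p * s - q * 1) \<in> I" using Fr_eq_iff[OF one_W e(3)] e(1) by blast
    have "u * (p * s - q * 1) \<in> A" using u assms(2) by blast
    hence "u * s * p \<in> A" by (rule A.comb2[OF _ e(2), of _ _ 1 u]) (simp add: algebra_simps)
    thus ?thesis using assms(3) mult_W u e by blast
  qed
  thus "preim {Fr p s | p s. p \<in> A \<and> s \<in> W} = A"
    unfolding preim_def using one_W by blast
qed

lemma noetherian_L:
  assumes FG: "\<And>A. poly_ideal A \<Longrightarrow> I \<subseteq> A \<Longrightarrow>
      \<exists>F. finite F \<and> F \<subseteq> A \<and> (\<forall>q\<in>A. \<exists>c. q - (\<Sum>b\<in>F. c b * b) \<in> I)"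
  shows "noetherian_ring L"
proof (rule ring.noetherian_ringI)
  interpret L: cring L by (rule cring_L)
  show "ring L" by (rule L.ring_axioms)
  fix J assume J: "ideal J L"
  interpret J: ideal J L by fact
  obtain F where F: "finite F" "F \<subseteq> preim J" "\<forall>q\<in>preim J. \<exists>c. q - (\<Sum>b\<in>F. c b * b) \<in> I"
    using FG[OF preim_ideal(1,2)[OF J]] by (elim exE conjE) (rule that)
  let ?F = "(\<lambda>p. Fr p 1) ` F"
  have sub: "?F \<subseteq> carrier L" using one_W by auto
  have idF: "ideal (Idl\<^bsub>L\<^esub> ?F) L" by (rule L.genideal_ideal[OF sub])
  interpret K: poly_ideal "preim (Idl\<^bsub>L\<^esub> ?F)" by (rule preim_ideal(1)[OF idF])
  have FK: "F \<subseteq> preim (Idl\<^bsub>L\<^esub> ?F)" using L.genideal_self[OF sub] by (auto simp: preim_def)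
  have "preim J \<subseteq> preim (Idl\<^bsub>L\<^esub> ?F)"
  proof
    fix q assume "q \<in> preim J"
    from bspec[OF F(3) this] obtain c where c: "q - (\<Sum>b\<in>F. c b * b) \<in> I" by (rule exE)
    have "(\<Sum>b\<in>F. c b * b) \<in> preim (Idl\<^bsub>L\<^esub> ?F)" using FK by (intro K.sum K.mult) auto
    thus "q \<in> preim (Idl\<^bsub>L\<^esub> ?F)" using K.cong_mem c preim_ideal(2)[OF idF] by blast
  qed
  moreover have "Idl\<^bsub>L\<^esub> ?F \<subseteq> J" using F(2) by (intro L.genideal_minimal J) (auto simp: preim_def)
  ultimately have "preim J = preim (Idl\<^bsub>L\<^esub> ?F)" by (auto simp: preim_def)
  hence "J = Idl\<^bsub>L\<^esub> ?F" by (rule ideal_eqI[OF J idF])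
  thus "\<exists>A\<subseteq>carrier L. finite A \<and> J = Idl\<^bsub>L\<^esub> A" using F(1) sub by (intro exI[of _ ?F]) auto
qed

end

lemma noetherian_quotient:
  assumes I: "poly_ideal I" and FG: "\<And>A. poly_ideal A \<Longrightarrow> I \<subseteq> A \<Longrightarrow>
      \<exists>F. finite F \<and> F \<subseteq> A \<and> (\<forall>q\<in>A. \<exists>c. q - (\<Sum>b\<in>F. c b * b) \<in> I)"
  shows "noetherian_ring (polys Quot I)"
proof (rule ring.noetherian_ringI)
  interpret poly_ideal I by fact
  interpret R: cring "polys Quot I" by (rule cring_quotient)
  show "ring (polys Quot I)" by (rule R.ring_axioms)
  fix J assume J: "ideal J (polys Quot I)"
  interpret J: ideal J "polys Quot I" by fact
  define A where "A = {p. cls I p \<in> J}"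
  have A: "poly_ideal A"
  proof
    show "0 \<in> A" using J.zero_mem by (simp add: A_def cls_zero)
    fix p q assume p: "p \<in> A"
    show "q * p \<in> A" using J.I_l_closed[of "cls I p" "cls I q"] p by (simp add: A_def cls_ops)
    assume "q \<in> A"
    thus "p + q \<in> A" using J.add_mem[of "cls I p" "cls I q"] p by (simp add: A_def cls_ops)
  qed
  have IA: "I \<subseteq> A"
  proof
    fix p assume "p \<in> I"
    hence "cls I p = cls I 0" by (simp add: cls_eq_iff)
    thus "p \<in> A" using J.zero_mem by (simp add: A_def cls_zero)
  qed
  obtain F where F: "finite F" "F \<subseteq> A" "\<forall>q\<in>A. \<exists>c. q - (\<Sum>b\<in>F. c b * b) \<in> I"
    using FG[OF A IA] by (elim exE conjE) (rule that)
  let ?F = "cls I ` F"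
  have sub: "?F \<subseteq> carrier (polys Quot I)" by auto
  interpret K: ideal "Idl\<^bsub>polys Quot I\<^esub> ?F" "polys Quot I" by (rule R.genideal_ideal[OF sub])
  have sum: "cls I (\<Sum>b\<in>Z. c b * b) \<in> Idl\<^bsub>polys Quot I\<^esub> ?F" if "finite Z" "Z \<subseteq> F" for Z c
    using that
  proof (induction Z)
    case empty
    show ?case using K.zero_mem by (simp add: cls_zero)
  next
    case (insert b Z)
    have "cls I b \<in> Idl\<^bsub>polys Quot I\<^esub> ?F" using R.genideal_self[OF sub] insert.prems by auto
    hence "cls I (c b) \<otimes>\<^bsub>polys Quot I\<^esub> cls I b \<in> Idl\<^bsub>polys Quot I\<^esub> ?F" by (rule K.I_l_closed) simp
    thus ?case using K.add_mem insert by (simp add: cls_ops[symmetric])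
  qed
  have "J \<subseteq> Idl\<^bsub>polys Quot I\<^esub> ?F"
  proof
    fix x assume x: "x \<in> J"
    then obtain q where q: "x = cls I q" using J.Icarr carrier_quotient by blast
    hence "q \<in> A" using x by (simp add: A_def)
    from bspec[OF F(3) this] obtain c where c: "q - (\<Sum>b\<in>F. c b * b) \<in> I" by (rule exE)
    hence "x = cls I (\<Sum>b\<in>F. c b * b)" unfolding q by (simp add: cls_eq_iff)
    thus "x \<in> Idl\<^bsub>polys Quot I\<^esub> ?F" using sum[OF F(1) order_refl, of c] by simp
  qed
  moreover have "Idl\<^bsub>polys Quot I\<^esub> ?F \<subseteq> J" using F(2) by (intro R.genideal_minimal J) (auto simp: A_def)
  ultimately show "\<exists>A\<subseteq>carrier (polys Quot I). finite A \<and> J = Idl\<^bsub>polys Quot I\<^esub> A"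
    using F(1) sub by (intro exI[of _ ?F]) auto
qed

section \<open>Frobenius algebras are self-injective\<close>

lemma ring_hom_polys_preimage:
  assumes T: "cring T" and \<tau>: "\<tau> \<in> ring_hom polys T" and J: "ideal J T"
  shows "poly_ideal {p. \<tau> p \<in> J}"
proof -
  interpret T: cring T by fact
  interpret J: ideal J T by fact
  interpret h: ring_hom_cring polys T \<tau>
    by (rule ring_hom_cring.intro[OF cring_polys T]) (simp add: ring_hom_cring_axioms_def \<tau>)
  show ?thesis
  proof
    show "0 \<in> {p. \<tau> p \<in> J}" using h.hom_zero J.zero_mem by simp
    fix p q assume p: "p \<in> {p. \<tau> p \<in> J}"
    show "q * p \<in> {p. \<tau> p \<in> J}" using h.hom_mult[of q p] J.I_l_closed[of "\<tau> p" "\<tau> q"] p by simp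
    assume "q \<in> {p. \<tau> p \<in> J}"
    thus "p + q \<in> {p. \<tau> p \<in> J}" using h.hom_add[of p q] J.add_mem[of "\<tau> p" "\<tau> q"] p by simp
  qed
qed

text \<open>
In a domain \<open>s\<^sup>j = s\<^sup>j\<^sup>+\<^sup>1 y\<close> makes a nonzero \<open>s\<close> invertible.
\<close>

lemma primes_maximal_if_powers_stabilize:
  assumes T: "cring T" and \<tau>: "\<tau> \<in> ring_hom polys T" "\<tau> ` UNIV = carrier T"
    and st: "\<And>s. \<exists>j y. \<tau> (s ^ j - s ^ Suc j * y) = \<zero>\<^bsub>T\<^esub>"
    and P: "primeideal P T"
  shows "maximalideal P T"
proof -
  interpret T: cring T by fact
  interpret P: primeideal P T by fact
  interpret h: ring_hom_cring polys T \<tau>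
    by (rule ring_hom_cring.intro[OF cring_polys T]) (simp add: ring_hom_cring_axioms_def \<tau>)
  have hc [simp]: "\<tau> p \<in> carrier T" for p using h.hom_closed by simp
  interpret A: poly_ideal "{p. \<tau> p \<in> P}" by (rule ring_hom_polys_preimage[OF T \<tau>(1) P.is_ideal])
  have prime: "\<tau> p \<in> P \<or> \<tau> q \<in> P" if "\<tau> (p * q) \<in> P" for p q
    using P.I_prime[of "\<tau> p" "\<tau> q"] h.hom_mult[of p q] that by simp
  have one: "\<tau> 1 \<notin> P"
    using P.one_imp_carrier P.I_notcarr h.hom_one by auto
  show ?thesis
  proof (rule maximalidealI[OF P.is_ideal P.I_notcarr])
    fix J assume J: "ideal J T" "P \<subseteq> J" "J \<subseteq> carrier T"
    interpret J: ideal J T by fact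
    interpret B: poly_ideal "{p. \<tau> p \<in> J}" by (rule ring_hom_polys_preimage[OF T \<tau>(1) J(1)])
    show "J = P \<or> J = carrier T"
    proof (cases "J = P")
      case False
      then obtain x where "x \<in> J" "x \<notin> P" using J(2) by blast
      then obtain s where s: "\<tau> s \<in> J" "\<tau> s \<notin> P" using \<tau>(2) J(3) by (metis imageE subsetD)
      obtain j y where jy: "\<tau> (s ^ j - s ^ Suc j * y) = \<zero>\<^bsub>T\<^esub>" using st by blast
      have sj: "\<tau> (s ^ j) \<notin> P"
      proof (induction j)
        case (Suc j)
        thus ?case using prime[of s "s ^ j"] s(2) by auto
      qed (simp add: one)
      have "s ^ j * (1 - s * y) = s ^ j - s ^ Suc j * y" by (simp add: algebra_simps)
      hence "\<tau> (s ^ j * (1 - s * y)) \<in> P" using jy P.zero_mem by simp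
      hence "\<tau> (1 - s * y) \<in> J" using prime sj J(2) by blast
      moreover have "\<tau> (s * y) \<in> J" using B.mult_right[of s y] s(1) by simp
      ultimately have "1 - s * y + s * y \<in> {p. \<tau> p \<in> J}" by (intro B.add) auto
      hence "\<tau> 1 \<in> J" by simp
      thus ?thesis using J.one_imp_carrier h.hom_one by simp
    qed simp
  qed
qed

text \<open>
  Let \<open>h\<close> be a homomorphism from an ideal to the ring. The functional \<open>l \<circ> h\<close> on the ideal is
  \<open>p \<mapsto> l (c p)\<close> for some \<open>c\<close> by \<open>represent_on_ideal\<close>, and then \<open>h p - c p\<close> generates an ideal in the
  kernel of \<open>l\<close>, so it is zero. Baer's criterion is satisfied by multiplication by \<open>c\<close>.
\<close>

lemma self_injective_if_frobenius:
  assumes T: "cring T" and \<tau>: "\<tau> \<in> ring_hom polys T" "\<tau> ` UNIV = carrier T"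
    and fin: "finite_ideal {q. \<tau> q = \<zero>\<^bsub>T\<^esub>} M"
    and l: "linear_functional l" "\<And>q. (\<forall>r. l (q * r) = 0) \<longleftrightarrow> \<tau> q = \<zero>\<^bsub>T\<^esub>"
  shows "self_injective T"
  unfolding self_injective_def
proof (intro allI impI ballI)
  interpret T: cring T by fact
  interpret h: ring_hom_cring polys T \<tau>
    by (rule ring_hom_cring.intro[OF cring_polys T]) (simp add: ring_hom_cring_axioms_def \<tau>)
  have hc [simp]: "\<tau> p \<in> carrier T" for p using h.hom_closed by simp
  have h_add: "\<tau> (p + q) = \<tau> p \<oplus>\<^bsub>T\<^esub> \<tau> q" and h_mult: "\<tau> (p * q) = \<tau> p \<otimes>\<^bsub>T\<^esub> \<tau> q" for p q
    using h.hom_add[of p q] h.hom_mult[of p q] by auto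
  interpret K: finite_ideal "{q. \<tau> q = \<zero>\<^bsub>T\<^esub>}" M by fact
  have h_eq: "\<tau> p = \<tau> q \<longleftrightarrow> \<tau> (p - q) = \<zero>\<^bsub>T\<^esub>" for p q
  proof
    assume e: "\<tau> p = \<tau> q"
    have "\<tau> (p - q) = \<tau> p \<oplus>\<^bsub>T\<^esub> \<tau> (- q)" using h_add[of p "- q"] by simp
    also have "\<dots> = \<tau> (q - q)" using h_add[of q "- q"] e by simp
    finally show "\<tau> (p - q) = \<zero>\<^bsub>T\<^esub>" using h.hom_zero by simp
  next
    assume "\<tau> (p - q) = \<zero>\<^bsub>T\<^esub>"
    thus "\<tau> p = \<tau> q" using h_add[of "p - q" q] by simp
  qed
  have lK: "l q = 0" if "\<tau> q = \<zero>\<^bsub>T\<^esub>" for q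
    using l(2)[of q] that mult_1_right[of q] by metis
  have l_cong: "l p = l q" if "\<tau> p = \<tau> q" for p q
    using lK[of "p - q"] that h_eq linear_functionalD(4)[OF l(1)] by simp
  fix J hh assume J: "ideal J T"
    and hh: "hh \<in> mod_hom T (scalar_module id T J) (scalar_module id T (carrier T))"
  interpret J: ideal J T by fact
  have hh_c: "hh x \<in> carrier T" if "x \<in> J" for x
    using hh that by (auto simp: mod_hom_def scalar_module_def)
  have hh_add: "hh (x \<oplus>\<^bsub>T\<^esub> y) = hh x \<oplus>\<^bsub>T\<^esub> hh y" if "x \<in> J" "y \<in> J" for x y
    using hh that by (auto simp: mod_hom_def scalar_module_def)
  have hh_mult: "hh (a \<otimes>\<^bsub>T\<^esub> x) = a \<otimes>\<^bsub>T\<^esub> hh x" if "x \<in> J" "a \<in> carrier T" for x a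
    using hh that by (auto simp: mod_hom_def scalar_module_def)
  define A where "A = {p. \<tau> p \<in> J}"
  have A: "poly_ideal A" unfolding A_def by (rule ring_hom_polys_preimage[OF T \<tau>(1) J])
  interpret A: poly_ideal A by (rule A)
  have KA: "{q. \<tau> q = \<zero>\<^bsub>T\<^esub>} \<subseteq> A" using J.zero_mem by (auto simp: A_def)
  define hp where "hp p = (SOME q. \<tau> q = hh (\<tau> p))" for p
  have hp: "\<tau> (hp p) = hh (\<tau> p)" if "p \<in> A" for p
  proof -
    have "hh (\<tau> p) \<in> \<tau> ` UNIV" using hh_c that \<tau>(2) by (simp add: A_def)
    hence "\<exists>q. \<tau> q = hh (\<tau> p)" by (metis imageE)
    thus ?thesis unfolding hp_def by (rule someI_ex)
  qed
  define \<chi> where "\<chi> p = l (hp p)" for p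
  have \<chi>_eq: "\<chi> p = l q" if "p \<in> A" "\<tau> q = hh (\<tau> p)" for p q
    unfolding \<chi>_def by (rule l_cong) (simp add: hp that)
  have \<chi>_lin: "\<chi> (p + cst c * q) = \<chi> p + c * \<chi> q" if pq: "p \<in> A" "q \<in> A" for p q c
  proof -
    have "\<tau> (hp p + cst c * hp q) = hh (\<tau> (p + cst c * q))"
      unfolding h_add h_mult using pq hp hh_add hh_mult J.I_l_closed by (simp add: A_def)
    hence "\<chi> (p + cst c * q) = l (hp p + cst c * hp q)"
      using pq by (intro \<chi>_eq A.add A.mult)
    thus ?thesis by (simp add: \<chi>_def linear_functionalD[OF l(1)])
  qed
  have hh0: "hh \<zero>\<^bsub>T\<^esub> = \<zero>\<^bsub>T\<^esub>"
    using hh_mult[of "\<zero>\<^bsub>T\<^esub>" "\<zero>\<^bsub>T\<^esub>"] J.zero_mem hh_c by simp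
  have \<chi>_0: "\<chi> q = 0" if "q \<in> {q. \<tau> q = \<zero>\<^bsub>T\<^esub>}" for q
  proof -
    have "\<tau> q = \<zero>\<^bsub>T\<^esub>" "q \<in> A" using that KA by auto
    hence "\<chi> q = l 0" using hh0 h.hom_zero by (intro \<chi>_eq) simp_all
    thus ?thesis by (simp add: linear_functionalD[OF l(1)])
  qed
  have nd: "q \<in> {q. \<tau> q = \<zero>\<^bsub>T\<^esub>}" if "\<And>r. l (q * r) = 0" for q using l(2)[of q] that by blast
  obtain c where c: "\<forall>p\<in>A. \<chi> p = l (c * p)"
    using K.represent_on_ideal[OF l(1) _ nd A KA \<chi>_lin \<chi>_0] lK by blast
  have main: "hh (\<tau> p) = \<tau> (c * p)" if p: "p \<in> A" for p
  proof -
    have "l ((hp p - c * p) * r) = 0" for r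
    proof -
      have "\<tau> (hp p * r) = hh (\<tau> (p * r))"
      proof -
        have "\<tau> (hp p * r) = \<tau> r \<otimes>\<^bsub>T\<^esub> hh (\<tau> p)"
          using hp[OF p] h_mult[of r "hp p"] by (simp add: mult.commute)
        also have "\<dots> = hh (\<tau> r \<otimes>\<^bsub>T\<^esub> \<tau> p)" using p hh_mult by (simp add: A_def)
        finally show ?thesis by (simp add: h_mult[symmetric] mult.commute)
      qed
      hence "l (hp p * r) = \<chi> (p * r)" using \<chi>_eq[OF A.mult_right[OF p]] by simp
      also have "\<dots> = l (c * (p * r))" using c A.mult_right[OF p] by blast
      finally show ?thesis by (simp add: left_diff_distrib linear_functionalD[OF l(1)] mult.assoc)
    qed
    hence "\<tau> (hp p - c * p) = \<zero>\<^bsub>T\<^esub>" using l(2) by blast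
    hence "\<tau> (hp p) = \<tau> (c * p)" using h_eq[of "hp p" "c * p"] by blast
    thus ?thesis using hp[OF p] by simp
  qed
  define g where "g = (\<lambda>x\<in>carrier T. \<tau> c \<otimes>\<^bsub>T\<^esub> x)"
  have "g \<in> mod_hom T (scalar_module id T (carrier T)) (scalar_module id T (carrier T))"
    by (auto simp: mod_hom_def scalar_module_def g_def T.r_distr T.m_lcomm)
  moreover have "g x = hh x" if x: "x \<in> J" for x
  proof -
    have xc: "x \<in> carrier T" using J.Icarr[OF x] .
    then obtain p where p: "x = \<tau> p" using \<tau>(2) by (metis imageE)
    hence "p \<in> A" using x by (simp add: A_def)
    hence "hh x = \<tau> c \<otimes>\<^bsub>T\<^esub> \<tau> p" using main[of p] by (simp add: p h_mult)
    thus ?thesis using xc by (simp add: g_def p)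
  qed
  ultimately show "\<exists>g\<in>mod_hom T (scalar_module id T (carrier T)) (scalar_module id T (carrier T)). \<forall>x\<in>J. g x = hh x"
    by blast
qed

section \<open>Local Gorenstein rings of the coordinate ring\<close>

lemma genideal_empty: "cring R \<Longrightarrow> Idl\<^bsub>R\<^esub> {} = {\<zero>\<^bsub>R\<^esub>}"
proof -
  assume "cring R"
  then interpret cring R .
  have "Idl\<^bsub>R\<^esub> {} \<subseteq> {\<zero>\<^bsub>R\<^esub>}" by (rule genideal_minimal[OF zeroideal]) simp
  moreover have "\<zero>\<^bsub>R\<^esub> \<in> Idl\<^bsub>R\<^esub> {}" by (rule ideal.zero_mem[OF genideal_ideal]) simp
  ultimately show ?thesis by blast
qed

text \<open>
Compare the components of \<open>u p\<close> from below.
\<close>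

lemma (in homogeneous_ideal) lowest_component_nzd:
  assumes u: "\<And>i. i < k \<Longrightarrow> hcomp i u = 0" and nzd: "\<And>p. hcomp k u * p \<in> I \<Longrightarrow> p \<in> I" and up: "u * p \<in> I"
  shows "p \<in> I"
proof (rule memI)
  fix m
  show "hcomp m p \<in> I"
  proof (induction m rule: less_induct)
    case (less m)
    have "hcomp (k + m) (u * p) = (\<Sum>i\<le>k + m. hcomp i u * hcomp (k + m - i) p)" by (rule hcomp_mult)
    also have "\<dots> = hcomp k u * hcomp m p + (\<Sum>i\<in>{..k + m} - {k}. hcomp i u * hcomp (k + m - i) p)"
      by (subst sum.remove[of _ k]) auto
    finally have e: "hcomp k u * hcomp m p = hcomp (k + m) (u * p) - (\<Sum>i\<in>{..k + m} - {k}. hcomp i u * hcomp (k + m - i) p)"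
      by simp
    have "(\<Sum>i\<in>{..k + m} - {k}. hcomp i u * hcomp (k + m - i) p) \<in> I"
    proof (rule sum)
      fix i assume i: "i \<in> {..k + m} - {k}"
      show "hcomp i u * hcomp (k + m - i) p \<in> I"
      proof (cases "i < k")
        case True
        thus ?thesis by (simp add: u)
      next
        case False
        hence "k + m - i < m" using i by auto
        thus ?thesis by (intro mult less.IH)
      qed
    qed
    hence "hcomp k u * hcomp m p \<in> I" unfolding e by (intro diff hcomp_mem[OF up])
    thus ?case by (rule nzd)
  qed
qed

lemma hcomp_0_cst: "\<exists>c. hcomp 0 p = cst c"
  using hcomp_in_forms[of 0 p] forms_0_iff by blast

lemma (in homogeneous_ideal) constant_term_nzd:
  assumes "hcomp 0 u \<noteq> 0" "u * p \<in> I" shows "p \<in> I"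
proof (rule lowest_component_nzd[of 0 u, OF _ _ assms(2)])
  fix p
  obtain c where c: "hcomp 0 u = cst c" using hcomp_0_cst by blast
  assume "hcomp 0 u * p \<in> I"
  thus "p \<in> I" using cst_cancel[of c p] assms(1) c by auto
qed simp

lemma irrelevant_ideal: "poly_ideal {p. hcomp 0 p = 0}"
  by unfold_locales (auto simp: hcomp_add hcomp_mult)

lemma irrelevant_ideal_prime: "hcomp 0 (p * q) = 0 \<Longrightarrow> hcomp 0 p = 0 \<or> hcomp 0 (q :: ('v::finite, 'k::field) mpoly) = 0"
proof -
  assume 0: "hcomp 0 (p * q) = 0"
  obtain a b where ab: "hcomp 0 p = cst a" "hcomp 0 q = cst b" using hcomp_0_cst by metis
  have "cst (a * b) = hcomp 0 (p * q)" by (simp add: hcomp_mult ab cst_mult)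
  hence "a * b = 0" using 0 by simp
  thus ?thesis using ab by auto
qed

lemma irrelevant_ideal_powers: "hcomp 0 p = 0 \<Longrightarrow> m < k \<Longrightarrow> hcomp m (p ^ k) = 0"
proof (induction k arbitrary: m)
  case (Suc k)
  have "hcomp m (p * p ^ k) = (\<Sum>i\<le>m. hcomp i p * hcomp (m - i) (p ^ k))" by (rule hcomp_mult)
  also have "\<dots> = 0"
  proof (rule sum.neutral, rule ballI)
    fix i assume "i \<in> {..m}"
    show "hcomp i p * hcomp (m - i) (p ^ k) = 0"
    proof (cases "i = 0")
      case False
      hence "m - i < k" using Suc.prems \<open>i \<in> {..m}\<close> by auto
      thus ?thesis using Suc by simp
    qed (simp add: Suc.prems)
  qed
  finally show ?case by simp
qed simp

context fractions
begin

lemma quotient_L: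
  assumes J: "ideal J L"
  shows "cring (L Quot J)" "(\<lambda>x. J +>\<^bsub>L\<^esub> x) \<in> ring_hom L (L Quot J)"
    "s \<in> W \<Longrightarrow> t \<in> W \<Longrightarrow> J +>\<^bsub>L\<^esub> Fr p s = J +>\<^bsub>L\<^esub> Fr q t \<longleftrightarrow> p * t - q * s \<in> preim J"
    "s \<in> W \<Longrightarrow> J +>\<^bsub>L\<^esub> Fr p s = \<zero>\<^bsub>L Quot J\<^esub> \<longleftrightarrow> p \<in> preim J"
    "x \<in> carrier (L Quot J) \<Longrightarrow> \<exists>p. \<exists>s\<in>W. x = J +>\<^bsub>L\<^esub> Fr p s"
proof -
  interpret J: ideal J L by fact
  show T: "cring (L Quot J)" by (rule J.quotient_is_cring[OF cring_L])
  show hom: "(\<lambda>x. J +>\<^bsub>L\<^esub> x) \<in> ring_hom L (L Quot J)" by (rule J.rcos_ring_hom)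
  show eq: "J +>\<^bsub>L\<^esub> Fr p s = J +>\<^bsub>L\<^esub> Fr q t \<longleftrightarrow> p * t - q * s \<in> preim J" if st: "s \<in> W" "t \<in> W" for p s q t
    unfolding J.quotient_eq_iff_same_a_r_cos[OF J Fr_carrier[OF st(1)] Fr_carrier[OF st(2)], symmetric]
      Fr_minus[OF st] Fr_in_ideal_iff[OF J mult_W[OF st]] ..
  interpret h: ring_hom_cring L "L Quot J" "\<lambda>x. J +>\<^bsub>L\<^esub> x"
    by (rule ring_hom_cring.intro[OF cring_L T]) (simp add: ring_hom_cring_axioms_def hom)
  have z: "\<zero>\<^bsub>L Quot J\<^esub> = J +>\<^bsub>L\<^esub> Fr 0 1" using h.hom_zero by (simp only: Fr_zero)
  show "J +>\<^bsub>L\<^esub> Fr p s = \<zero>\<^bsub>L Quot J\<^esub> \<longleftrightarrow> p \<in> preim J" if "s \<in> W"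
    unfolding z eq[OF that one_W] by simp
  show "\<exists>p. \<exists>s\<in>W. x = J +>\<^bsub>L\<^esub> Fr p s" if "x \<in> carrier (L Quot J)"
  proof -
    have "\<exists>y\<in>carrier L. x = J +>\<^bsub>L\<^esub> y" using that by (auto simp: FactRing_def A_RCOSETS_def')
    thus ?thesis by (auto simp: carrier_L)
  qed
qed

text \<open>
  If everything that kills \<open>a\<close> kills \<open>b\<close>, then \<open>x a \<mapsto> x b\<close> is a homomorphism on the ideal of \<open>a\<close>;
  extended to the whole self-injective ring it becomes multiplication by an element.
\<close>

lemma divides_if_annihilator_le:
  assumes J: "ideal J L" and inj: "self_injective (L Quot J)"
    and ann: "\<And>p. a * p \<in> preim J \<Longrightarrow> b * p \<in> preim J"
  shows "\<exists>c. \<exists>s\<in>W. s * b - a * c \<in> preim J"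
proof -
  let ?T = "L Quot J" and ?\<pi> = "\<lambda>x. J +>\<^bsub>L\<^esub> x"
  note Q = quotient_L[OF J]
  interpret T: cring ?T by (rule Q(1))
  interpret h: ring_hom_cring L ?T ?\<pi>
    by (rule ring_hom_cring.intro[OF cring_L Q(1)]) (simp add: ring_hom_cring_axioms_def Q(2))
  define \<alpha> where "\<alpha> = ?\<pi> (Fr a 1)"
  define \<beta> where "\<beta> = ?\<pi> (Fr b 1)"
  have ab: "\<alpha> \<in> carrier ?T" "\<beta> \<in> carrier ?T" unfolding \<alpha>_def \<beta>_def using one_W by (auto intro: h.hom_closed)
  have ann': "x \<otimes>\<^bsub>?T\<^esub> \<beta> = y \<otimes>\<^bsub>?T\<^esub> \<beta>"
    if xy: "x \<in> carrier ?T" "y \<in> carrier ?T" "x \<otimes>\<^bsub>?T\<^esub> \<alpha> = y \<otimes>\<^bsub>?T\<^esub> \<alpha>" for x y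
  proof -
    obtain p s where x: "s \<in> W" "x = ?\<pi> (Fr p s)" using Q(5)[OF xy(1)] by blast
    obtain q t where y: "t \<in> W" "y = ?\<pi> (Fr q t)" using Q(5)[OF xy(2)] by blast
    have m: "?\<pi> (Fr p s) \<otimes>\<^bsub>?T\<^esub> ?\<pi> (Fr c 1) = ?\<pi> (Fr (p * c) s)" if "s \<in> W" for p s c
      using h.hom_mult[of "Fr p s" "Fr c 1"] that one_W by (simp add: Fr_mult)
    have "p * a * t - q * a * s \<in> preim J"
      using xy(3) unfolding x(2) y(2) \<alpha>_def m[OF x(1)] m[OF y(1)] Q(3)[OF x(1) y(1)] .
    hence "a * (p * t - q * s) \<in> preim J" by (simp add: algebra_simps)
    hence "b * (p * t - q * s) \<in> preim J" by (rule ann)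
    hence "p * b * t - q * b * s \<in> preim J" by (simp add: algebra_simps)
    thus ?thesis unfolding x(2) y(2) \<beta>_def m[OF x(1)] m[OF y(1)] Q(3)[OF x(1) y(1)] .
  qed
  define Z where "Z = {x \<otimes>\<^bsub>?T\<^esub> \<alpha> | x. x \<in> carrier ?T}"
  have Z: "ideal Z ?T" unfolding Z_def using T.cgenideal_ideal[OF ab(1)] by (simp add: cgenideal_def)
  define hh where "hh = (\<lambda>z\<in>Z. (SOME x. x \<in> carrier ?T \<and> z = x \<otimes>\<^bsub>?T\<^esub> \<alpha>) \<otimes>\<^bsub>?T\<^esub> \<beta>)"
  have hh: "hh (x \<otimes>\<^bsub>?T\<^esub> \<alpha>) = x \<otimes>\<^bsub>?T\<^esub> \<beta>" if x: "x \<in> carrier ?T" for x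
  proof -
    let ?y = "SOME y. y \<in> carrier ?T \<and> x \<otimes>\<^bsub>?T\<^esub> \<alpha> = y \<otimes>\<^bsub>?T\<^esub> \<alpha>"
    have "?y \<in> carrier ?T \<and> x \<otimes>\<^bsub>?T\<^esub> \<alpha> = ?y \<otimes>\<^bsub>?T\<^esub> \<alpha>"
      by (rule someI[of _ x]) (simp add: x)
    hence "x \<otimes>\<^bsub>?T\<^esub> \<beta> = ?y \<otimes>\<^bsub>?T\<^esub> \<beta>" using ann'[OF x] by blast
    moreover have "x \<otimes>\<^bsub>?T\<^esub> \<alpha> \<in> Z" using x by (auto simp: Z_def)
    ultimately show ?thesis by (simp add: hh_def)
  qed
  have Zc: "Z \<subseteq> carrier ?T" using ab by (auto simp: Z_def)
  have "hh \<in> mod_hom ?T (scalar_module id ?T Z) (scalar_module id ?T (carrier ?T))"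
    unfolding mod_hom_def scalar_module_def
  proof (simp, intro conjI ballI)
    show "hh \<in> Z \<rightarrow>\<^sub>E carrier ?T"
    proof (rule PiE_I)
      fix z assume "z \<in> Z"
      then obtain x where "z = x \<otimes>\<^bsub>?T\<^esub> \<alpha>" "x \<in> carrier ?T" by (auto simp: Z_def)
      thus "hh z \<in> carrier ?T" using hh ab by simp
    qed (simp add: hh_def)
    fix z assume z: "z \<in> Z"
    then obtain x where x: "z = x \<otimes>\<^bsub>?T\<^esub> \<alpha>" "x \<in> carrier ?T" by (auto simp: Z_def)
    {
      fix w assume "w \<in> Z"
      then obtain y where y: "w = y \<otimes>\<^bsub>?T\<^esub> \<alpha>" "y \<in> carrier ?T" by (auto simp: Z_def)
      have "z \<oplus>\<^bsub>?T\<^esub> w = (x \<oplus>\<^bsub>?T\<^esub> y) \<otimes>\<^bsub>?T\<^esub> \<alpha>" using x y ab by (simp add: T.l_distr)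
      thus "hh (z \<oplus>\<^bsub>?T\<^esub> w) = hh z \<oplus>\<^bsub>?T\<^esub> hh w"
        using hh[OF x(2)] hh[OF y(2)] hh[OF T.a_closed[OF x(2) y(2)]] x y ab by (simp add: T.l_distr[symmetric])
    }
    fix c assume c: "c \<in> carrier ?T"
    have "c \<otimes>\<^bsub>?T\<^esub> z = (c \<otimes>\<^bsub>?T\<^esub> x) \<otimes>\<^bsub>?T\<^esub> \<alpha>" using x c ab by (simp add: T.m_assoc)
    thus "hh (c \<otimes>\<^bsub>?T\<^esub> z) = c \<otimes>\<^bsub>?T\<^esub> hh z"
      using hh[OF x(2)] hh[OF T.m_closed[OF c x(2)]] x c ab by (simp add: T.m_assoc[symmetric])
  qed
  then obtain g where g: "g \<in> mod_hom ?T (scalar_module id ?T (carrier ?T)) (scalar_module id ?T (carrier ?T))"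
    "\<forall>x\<in>Z. g x = hh x"
    using inj Z unfolding self_injective_def by blast
  have one_a: "\<one>\<^bsub>?T\<^esub> \<otimes>\<^bsub>?T\<^esub> \<alpha> = \<alpha>" using ab by simp
  hence "\<alpha> \<in> Z" unfolding Z_def using T.one_closed by (metis (mono_tags, lifting) mem_Collect_eq)
  have "\<beta> = hh \<alpha>" using hh[OF T.one_closed] one_a ab by simp
  also have "\<dots> = g \<alpha>" using g(2) \<open>\<alpha> \<in> Z\<close> by simp
  also have "\<dots> = \<alpha> \<otimes>\<^bsub>?T\<^esub> g \<one>\<^bsub>?T\<^esub>"
  proof -
    have "g (\<alpha> \<otimes>\<^bsub>?T\<^esub> \<one>\<^bsub>?T\<^esub>) = \<alpha> \<otimes>\<^bsub>?T\<^esub> g \<one>\<^bsub>?T\<^esub>"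
      using g(1) ab T.one_closed unfolding mod_hom_def scalar_module_def by (simp del: T.r_one)
    thus ?thesis using ab by simp
  qed
  finally have \<beta>: "\<beta> = \<alpha> \<otimes>\<^bsub>?T\<^esub> g \<one>\<^bsub>?T\<^esub>" .
  have "g \<one>\<^bsub>?T\<^esub> \<in> carrier ?T" using g(1) T.one_closed unfolding mod_hom_def scalar_module_def by auto
  then obtain c s where c: "s \<in> W" "g \<one>\<^bsub>?T\<^esub> = ?\<pi> (Fr c s)" using Q(5) by blast
  have "?\<pi> (Fr b 1) = ?\<pi> (Fr (a * c) s)"
    using \<beta> h.hom_mult[of "Fr a 1" "Fr c s"] c one_W by (simp add: \<alpha>_def \<beta>_def Fr_mult)
  hence "b * s - a * c * 1 \<in> preim J" using Q(3)[OF one_W c(1)] by simp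
  thus ?thesis using c(1) by (intro exI[of _ c] bexI[of _ s]) (simp_all add: mult.commute)
qed

text \<open>
  The element \<open>g\<close> is a regular sequence of length one. Modulo \<open>g\<close> the localization at \<open>M'\<close> is the
  quotient of \<open>S\<close> by the elements that some \<open>s\<close> outside \<open>M'\<close> carries into \<open>(I, g)\<close>, because there
  every \<open>s\<close> outside \<open>M'\<close> is already invertible. With the local idempotent \<open>e\<close>, the functional
  \<open>q \<mapsto> l (e q)\<close> makes it a Frobenius algebra.
\<close>

lemma gorenstein_localI:
  assumes M': "poly_ideal M'" "I \<subseteq> M'" "1 \<notin> M'" "\<And>p q. p * q \<in> M' \<Longrightarrow> p \<in> M' \<or> q \<in> M'"
    and W: "W = - M'"
    and FG: "\<And>A. poly_ideal A \<Longrightarrow> I \<subseteq> A \<Longrightarrow>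
      \<exists>F. finite F \<and> F \<subseteq> A \<and> (\<forall>q\<in>A. \<exists>c. q - (\<Sum>b\<in>F. c b * b) \<in> I)"
    and g: "g \<in> M'" "\<And>p. g * p \<in> I \<Longrightarrow> p \<in> I"
    and fin: "finite_ideal {q. \<exists>y. q - g * y \<in> I} M"
    and l: "linear_functional l" "\<And>q. (\<forall>r. l (q * r) = 0) \<longleftrightarrow> q \<in> {q. \<exists>y. q - g * y \<in> I}"
  shows "gorenstein_local L"
proof -
  interpret L: cring L by (rule cring_L)
  interpret M': poly_ideal M' by fact
  define K where "K = {q. \<exists>y. q - g * y \<in> I}"
  interpret K: finite_ideal K M unfolding K_def by (rule fin)
  have KM: "K \<subseteq> M'"
  proof
    fix q assume "q \<in> K"
    then obtain y where "q - g * y \<in> I" by (auto simp: K_def)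
    hence "q - g * y \<in> M'" using M'(2) by blast
    thus "q \<in> M'" by (rule M'.cong_mem[OF _ M'.mult_right[OF g(1)]])
  qed
  have IK: "I \<subseteq> K" by (auto simp: K_def intro!: exI[of _ 0])
  have gK: "g \<in> K" by (auto simp: K_def intro!: exI[of _ 1])
  define N where "N = {Fr p s | p s. p \<in> M' \<and> s \<in> W}"
  have satM: "p \<in> M'" if "u \<in> W" "u * p \<in> M'" for u p using M'(4)[OF that(2)] that(1) W by blast
  have N: "ideal N L" "preim N = M'"
    unfolding N_def by (rule ideal_of_poly_ideal[OF M'(1,2)], erule (1) satM)+
  have proper: "J \<subseteq> N" if J: "ideal J L" "J \<noteq> carrier L" for J
  proof
    interpret J: ideal J L by fact
    fix x assume x: "x \<in> J"
    then obtain p s where p: "x = Fr p s" "s \<in> W" using L_cases J.Icarr by blast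
    hence pJ: "p \<in> preim J" using Fr_in_ideal_iff[OF J(1)] x by simp
    have "p \<in> M'"
    proof (rule ccontr)
      assume "p \<notin> M'"
      hence "p \<in> W" by (simp add: W)
      hence "1 \<in> preim J" using preim_ideal(3)[OF J(1), of p 1] pJ by simp
      hence "\<one>\<^bsub>L\<^esub> \<in> J" by (simp add: preim_def Fr_one)
      thus False using J.one_imp_carrier J(2) by blast
    qed
    thus "x \<in> N" using p by (auto simp: N_def)
  qed
  have Nne: "carrier L \<noteq> N"
  proof
    assume "carrier L = N"
    hence "1 \<in> preim N" using one_W by (auto simp: preim_def)
    thus False using N(2) M'(3) by simp
  qed
  have max: "maximalideal N L"
  proof (rule maximalidealI[OF N(1) Nne])
    fix J assume "ideal J L" "N \<subseteq> J" "J \<subseteq> carrier L"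
    thus "J = N \<or> J = carrier L" using proper by blast
  qed
  have ex1: "\<exists>!M. maximalideal M L"
  proof (rule ex1I[of "\<lambda>M. maximalideal M L" N, OF max])
    fix J assume J: "maximalideal J L"
    have "ideal J L" "carrier L \<noteq> J" by (rule maximalideal.axioms(1)[OF J], rule maximalideal.I_notcarr[OF J])
    hence "J \<subseteq> N" using proper by blast
    thus "J = N"
      using maximalideal.I_maximal[OF J N(1)] Nne ideal.Icarr[OF N(1)] by blast
  qed
  define K' where "K' = {q. \<exists>s\<in>W. s * q \<in> K}"
  have K': "poly_ideal K'"
  proof
    show "0 \<in> K'" using one_W by (auto simp: K'_def)
    fix p q assume "p \<in> K'"
    then obtain s where s: "s \<in> W" "s * p \<in> K" by (auto simp: K'_def)
    have "s * (q * p) \<in> K" by (rule K.comb1[OF s(2), of _ q]) (simp add: algebra_simps)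
    thus "q * p \<in> K'" using s(1) by (auto simp: K'_def)
    assume "q \<in> K'"
    then obtain t where t: "t \<in> W" "t * q \<in> K" by (auto simp: K'_def)
    have "s * t * (p + q) \<in> K" by (rule K.comb2[OF s(2) t(2), of _ t s]) (simp add: algebra_simps)
    thus "p + q \<in> K'" using mult_W[OF s(1) t(1)] by (auto simp: K'_def)
  qed
  have KK': "K \<subseteq> K'" using one_W by (auto simp: K'_def intro!: bexI[of _ 1])
  have satK': "p \<in> K'" if up: "u \<in> W" "u * p \<in> K'" for u p
  proof -
    obtain s where s: "s \<in> W" "s * (u * p) \<in> K" using up(2) by (auto simp: K'_def)
    have "s * u \<in> W" using mult_W s(1) up(1) by blast
    moreover have "s * u * p \<in> K" using s(2) by (simp add: mult.assoc)
    ultimately show ?thesis unfolding K'_def by blast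
  qed
  define J where "J = {Fr p s | p s. p \<in> K' \<and> s \<in> W}"
  have IK': "I \<subseteq> K'" using IK KK' by blast
  have J: "ideal J L" "preim J = K'"
    unfolding J_def by (rule ideal_of_poly_ideal[OF K' IK'], erule (1) satK')+
  let ?x = "Fr g 1"
  have xc: "{?x} \<subseteq> carrier L" using one_W by simp
  have idx: "ideal (Idl\<^bsub>L\<^esub> {?x}) L" by (rule L.genideal_ideal[OF xc])
  have Jx: "Idl\<^bsub>L\<^esub> {?x} = J"
  proof
    show "Idl\<^bsub>L\<^esub> {?x} \<subseteq> J"
      by (rule L.genideal_minimal[OF J(1)]) (use J_def gK KK' one_W in auto)
    interpret X: poly_ideal "preim (Idl\<^bsub>L\<^esub> {?x})" by (rule preim_ideal(1)[OF idx])
    have gX: "g \<in> preim (Idl\<^bsub>L\<^esub> {?x})" using L.genideal_self[OF xc] by (auto simp: preim_def)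
    show "J \<subseteq> Idl\<^bsub>L\<^esub> {?x}"
    proof
      fix z assume "z \<in> J"
      then obtain p t where z: "z = Fr p t" "p \<in> K'" "t \<in> W" by (auto simp: J_def)
      then obtain s y where s: "s \<in> W" "s * p - g * y \<in> I" by (auto simp: K'_def K_def)
      have "s * p - g * y \<in> preim (Idl\<^bsub>L\<^esub> {?x})" using s(2) preim_ideal(2)[OF idx] by blast
      hence "s * p \<in> preim (Idl\<^bsub>L\<^esub> {?x})" by (rule X.cong_mem[OF _ X.mult_right[OF gX]])
      hence "p \<in> preim (Idl\<^bsub>L\<^esub> {?x})" by (rule preim_ideal(3)[OF idx s(1)])
      thus "z \<in> Idl\<^bsub>L\<^esub> {?x}" using Fr_in_ideal_iff[OF idx z(3)] z(1) by simp
    qed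
  qed
  have reg: "regular_sequence L [?x]"
    unfolding regular_sequence_def
  proof (intro conjI allI impI ballI)
    show "set [?x] \<subseteq> carrier L" using xc by simp
    have "?x \<in> N" using g(1) one_W by (auto simp: N_def)
    hence "Idl\<^bsub>L\<^esub> {?x} \<subseteq> N" by (intro L.genideal_minimal[OF N(1)]) simp
    moreover have "N \<subseteq> carrier L" using ideal.Icarr[OF N(1)] by blast
    ultimately show "Idl\<^bsub>L\<^esub> set [?x] \<noteq> carrier L" using Nne by auto
    fix i a assume i: "i < length [?x]" and a: "a \<in> carrier L"
      and m: "[?x] ! i \<otimes>\<^bsub>L\<^esub> a \<in> Idl\<^bsub>L\<^esub> set (take i [?x])"
    have i0: "i = 0" using i by simp
    obtain p s where p: "a = Fr p s" "s \<in> W" using L_cases[OF a] .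
    have "Fr (g * p) s = \<zero>\<^bsub>L\<^esub>" using m one_W p i0 genideal_empty[OF cring_L] by (simp add: Fr_mult)
    then obtain u where u: "u \<in> W" "u * (g * p) \<in> I" using Fr_eq_0_iff[OF p(2)] by blast
    have "g * (u * p) \<in> I" using u(2) by (simp add: algebra_simps)
    hence "u * p \<in> I" by (rule g(2))
    hence "a = \<zero>\<^bsub>L\<^esub>" using Fr_eq_0_iff[OF p(2)] u(1) p(1) by blast
    thus "a \<in> Idl\<^bsub>L\<^esub> set (take i [?x])" using i0 genideal_empty[OF cring_L] by simp
  qed
  note Q = quotient_L[OF J(1), unfolded J(2)]
  define \<tau> where "\<tau> = (\<lambda>p. J +>\<^bsub>L\<^esub> Fr p 1)"
  have \<tau>: "\<tau> \<in> ring_hom polys (L Quot J)"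
    using ring_hom_trans[OF Fr_hom Q(2)] by (simp add: \<tau>_def comp_def)
  have \<tau>0: "\<tau> q = \<zero>\<^bsub>L Quot J\<^esub> \<longleftrightarrow> q \<in> K'" for q unfolding \<tau>_def by (rule Q(4)[OF one_W])
  have stab: "\<exists>j y. s ^ j * (1 - s * y) \<in> K" for s
  proof -
    obtain j y where "s ^ j - s ^ Suc j * y \<in> K" using K.power_stabilizes by blast
    hence "s ^ j * (1 - s * y) \<in> K" by (simp add: algebra_simps)
    thus ?thesis by blast
  qed
  have powW: "s ^ j \<in> W" if "s \<in> W" for s j using that by (induction j) (auto intro: one_W mult_W)
  have surj: "\<tau> ` UNIV = carrier (L Quot J)"
  proof
    show "\<tau> ` UNIV \<subseteq> carrier (L Quot J)" using ring_hom_closed[OF \<tau>] by auto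
    show "carrier (L Quot J) \<subseteq> \<tau> ` UNIV"
    proof
      fix x assume "x \<in> carrier (L Quot J)"
      then obtain p s where x: "s \<in> W" "x = J +>\<^bsub>L\<^esub> Fr p s" using Q(5) by blast
      obtain j y where "s ^ j * (1 - s * y) \<in> K" using stab by blast
      hence k: "1 - s * y \<in> K'" using satK'[OF powW[OF x(1)], of j "1 - s * y"] KK' by blast
      have "p * 1 - (p * y) * s \<in> K'" by (rule poly_ideal.comb1[OF K' k, of _ p]) (simp add: algebra_simps)
      hence "x = \<tau> (p * y)" unfolding x(2) \<tau>_def Q(3)[OF x(1) one_W] .
      thus "x \<in> \<tau> ` UNIV" by blast
    qed
  qed
  have primes: "maximalideal P (L Quot J)" if "primeideal P (L Quot J)" for P
  proof (rule primes_maximal_if_powers_stabilize[OF Q(1) \<tau> surj _ that])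
    fix s
    obtain j y where "s ^ j - s ^ Suc j * y \<in> K" using K.power_stabilizes by blast
    hence "\<tau> (s ^ j - s ^ Suc j * y) = \<zero>\<^bsub>L Quot J\<^esub>" unfolding \<tau>0 using KK' by blast
    thus "\<exists>j y. \<tau> (s ^ j - s ^ Suc j * y) = \<zero>\<^bsub>L Quot J\<^esub>" by blast
  qed
  have self: "self_injective (L Quot J)"
  proof -
    obtain e where e: "e \<notin> M'" "\<forall>q s. s \<notin> M' \<longrightarrow> s * q \<in> K \<longrightarrow> e * q \<in> K"
      using K.local_idempotent[OF M'(1) KM M'(3,4)] by blast
    have eK: "e * q \<in> K \<longleftrightarrow> q \<in> K'" for q
      using e unfolding K'_def W by blast
    have fin': "finite_ideal {q. \<tau> q = \<zero>\<^bsub>L Quot J\<^esub>} M"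
    proof -
      interpret X: poly_ideal K' by (rule K')
      have "finite_ideal K' M"
      proof
        show "finite M" by (rule K.finM)
        fix q
        obtain c where "q - (\<Sum>b\<in>M. cst (c b) * b) \<in> K" using K.spanM[of q] by (rule exE)
        thus "\<exists>c. q - (\<Sum>b\<in>M. cst (c b) * b) \<in> K'" using KK' by blast
      qed
      moreover have "{q. \<tau> q = \<zero>\<^bsub>L Quot J\<^esub>} = K'" using \<tau>0 by blast
      ultimately show ?thesis by simp
    qed
    have lin: "linear_functional (\<lambda>q. l (e * q))"
      unfolding linear_functional_def
      by (simp add: distrib_left mult.left_commute[of e "cst c" for c] linear_functionalD[OF l(1)])
    show ?thesis
    proof (rule self_injective_if_frobenius[OF Q(1) \<tau> surj fin' lin])
      fix q
      have "(\<forall>r. l (e * (q * r)) = 0) \<longleftrightarrow> e * q \<in> K" using l(2)[of "e * q"] by (simp add: mult.assoc K_def)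
      thus "(\<forall>r. l (e * (q * r)) = 0) \<longleftrightarrow> \<tau> q = \<zero>\<^bsub>L Quot J\<^esub>" by (simp add: eK \<tau>0)
    qed
  qed
  show ?thesis
    unfolding gorenstein_local_def
  proof (intro conjI exI[of _ "[?x]"])
    show "cring L" by (rule cring_L)
    show "noetherian_ring L" by (rule noetherian_L[OF FG])
    show "\<exists>!M. maximalideal M L" by (rule ex1)
    show "regular_sequence L [?x]" by (rule reg)
    have e: "Idl\<^bsub>L\<^esub> set [?x] = J" using Jx by simp
    show "\<forall>P. primeideal P (L Quot Idl\<^bsub>L\<^esub> set [?x]) \<longrightarrow> maximalideal P (L Quot Idl\<^bsub>L\<^esub> set [?x])"
      unfolding e using primes by blast
    show "self_injective (L Quot Idl\<^bsub>L\<^esub> set [?x])" unfolding e by (rule self)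
  qed
qed

end

context poly_ideal
begin

lemma cls_image_ideal:
  assumes A: "poly_ideal A" shows "ideal (cls I ` A) (polys Quot I)"
proof -
  interpret A: poly_ideal A by fact
  show ?thesis
  proof (rule cring_idealI[OF cring_quotient])
    show "cls I ` A \<subseteq> carrier (polys Quot I)" by auto
    show "\<zero>\<^bsub>polys Quot I\<^esub> \<in> cls I ` A" by (auto simp: cls_zero)
    show "a \<oplus>\<^bsub>polys Quot I\<^esub> b \<in> cls I ` A" if "a \<in> cls I ` A" "b \<in> cls I ` A" for a b
      using that A.add by (auto simp: cls_ops)
    show "x \<otimes>\<^bsub>polys Quot I\<^esub> a \<in> cls I ` A" if "a \<in> cls I ` A" "x \<in> carrier (polys Quot I)" for a x
      using that A.mult by (auto simp: cls_ops carrier_quotient)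
  qed
qed

lemma maximalideal_preimage:
  assumes M: "maximalideal M (polys Quot I)"
  defines "M' \<equiv> {p. cls I p \<in> M}"
  shows "poly_ideal M'" "I \<subseteq> M'" "1 \<notin> M'" "\<And>p q. p * q \<in> M' \<Longrightarrow> p \<in> M' \<or> q \<in> M'"
    "\<And>s. s \<notin> M' \<Longrightarrow> \<exists>y. 1 - s * y \<in> M'" "carrier (polys Quot I) - M = cls I ` (- M')"
proof -
  interpret R: cring "polys Quot I" by (rule cring_quotient)
  interpret M: maximalideal M "polys Quot I" by fact
  interpret Pr: primeideal M "polys Quot I" by (rule R.maximalideal_prime[OF M])
  show M': "poly_ideal M'" unfolding M'_def by (rule ring_hom_polys_preimage[OF cring_quotient cls_hom M.is_ideal])
  interpret M': poly_ideal M' by (rule M')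
  show I: "I \<subseteq> M'"
  proof
    fix p assume "p \<in> I"
    hence "cls I p = cls I 0" by (simp add: cls_eq_iff)
    thus "p \<in> M'" using M.zero_mem by (simp add: M'_def cls_zero)
  qed
  show one: "1 \<notin> M'"
    using M.one_imp_carrier M.I_notcarr by (auto simp: M'_def cls_ops(3))
  show prime: "p \<in> M' \<or> q \<in> M'" if "p * q \<in> M'" for p q
    using Pr.I_prime[of "cls I p" "cls I q"] that by (simp add: M'_def cls_ops)
  show "carrier (polys Quot I) - M = cls I ` (- M')"
    by (auto simp: carrier_quotient M'_def)
  show "\<exists>y. 1 - s * y \<in> M'" if s: "s \<notin> M'" for s
  proof -
    define A where "A = {p. \<exists>y. p - s * y \<in> M'}"
    have A: "poly_ideal A" unfolding A_def by (rule poly_ideal_add_principal[OF M'])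
    interpret A: poly_ideal A by (rule A)
    have MA: "M' \<subseteq> A" by (auto simp: A_def intro!: exI[of _ 0])
    have sA: "s \<in> A" by (auto simp: A_def intro!: exI[of _ 1])
    let ?J = "cls I ` A"
    have J: "ideal ?J (polys Quot I)" by (rule cls_image_ideal[OF A])
    have "M \<subseteq> ?J"
    proof
      fix x assume x: "x \<in> M"
      then obtain p where "x = cls I p" using M.Icarr carrier_quotient by blast
      thus "x \<in> ?J" using x MA by (auto simp: M'_def)
    qed
    moreover have "cls I s \<in> ?J" "cls I s \<notin> M" using sA s by (auto simp: M'_def)
    ultimately have "?J = carrier (polys Quot I)"
      using M.I_maximal[OF J] ideal.Icarr[OF J] by blast
    hence "cls I 1 \<in> ?J" by (simp only: cls_carrier)
    then obtain p where p: "cls I 1 = cls I p" "p \<in> A" by (rule imageE)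
    hence "1 - p \<in> I" by (simp add: cls_eq_iff)
    hence "1 - p \<in> A" using I MA by blast
    hence "1 \<in> A" by (rule A.cong_mem[OF _ p(2)])
    thus ?thesis by (simp add: A_def)
  qed
qed

lemma maximalideal_image:
  assumes A: "poly_ideal A" "I \<subseteq> A" "1 \<notin> A" "\<And>s. s \<notin> A \<Longrightarrow> \<exists>y. 1 - s * y \<in> A"
  shows "maximalideal (cls I ` A) (polys Quot I)" "carrier (polys Quot I) - cls I ` A = cls I ` (- A)"
proof -
  interpret R: cring "polys Quot I" by (rule cring_quotient)
  interpret A: poly_ideal A by fact
  have mem: "cls I p \<in> cls I ` A \<longleftrightarrow> p \<in> A" for p
  proof
    assume "cls I p \<in> cls I ` A"
    then obtain q where "q \<in> A" "p - q \<in> I" by (auto simp: cls_eq_iff)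
    thus "p \<in> A" using A.cong_mem A(2) by blast
  qed simp
  show "carrier (polys Quot I) - cls I ` A = cls I ` (- A)"
    using mem by (auto simp: carrier_quotient)
  have id: "ideal (cls I ` A) (polys Quot I)" by (rule cls_image_ideal[OF A(1)])
  show "maximalideal (cls I ` A) (polys Quot I)"
  proof (rule maximalidealI[OF id])
    show "carrier (polys Quot I) \<noteq> cls I ` A" using mem[of 1] A(3) cls_carrier by metis
    fix J assume J: "ideal J (polys Quot I)" "cls I ` A \<subseteq> J" "J \<subseteq> carrier (polys Quot I)"
    interpret J: ideal J "polys Quot I" by fact
    interpret B: poly_ideal "{p. cls I p \<in> J}" by (rule ring_hom_polys_preimage[OF cring_quotient cls_hom J(1)])
    show "J = cls I ` A \<or> J = carrier (polys Quot I)"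
    proof (cases "J \<subseteq> cls I ` A")
      case False
      then obtain x where "x \<in> J" "x \<notin> cls I ` A" by blast
      moreover from this obtain s where "x = cls I s" using J(3) carrier_quotient by blast
      ultimately have s: "cls I s \<in> J" "s \<notin> A" by auto
      obtain y where "1 - s * y \<in> A" using A(4)[OF s(2)] by blast
      hence "1 - s * y \<in> {p. cls I p \<in> J}" using J(2) by blast
      hence "1 \<in> {p. cls I p \<in> J}" by (rule B.cong_mem) (use B.mult_right s(1) in auto)
      thus ?thesis using J.one_imp_carrier by (simp add: cls_ops(3)[symmetric])
    qed (use J in blast)
  qed
qed

end

text \<open>
  A maximal ideal contains a monic polynomial in \<open>f\<close>: either \<open>f\<close> itself, or, if it contains
  \<open>1 - f y\<close>, a multiple of this element, which is not a zero divisor because of its constant term. The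
  lowest term of such a polynomial is a power of \<open>f\<close> up to a constant, so the polynomial is not a
  zero divisor either.
\<close>

theorem (in gorenstein_pair) gorenstein_coordinate_ring: "gorenstein_ring (polys Quot II)"
  unfolding gorenstein_ring_def
proof (intro conjI allI impI)
  show "cring (polys Quot II)" by (rule I.cring_quotient)
  show "noetherian_ring (polys Quot II)"
    by (rule noetherian_quotient[OF I.poly_ideal_axioms ideals_finitely_generated])
  fix M assume M: "maximalideal M (polys Quot II)"
  define M' where "M' = {p. cls II p \<in> M}"
  note M' = I.maximalideal_preimage[OF M, folded M'_def]
  interpret M': poly_ideal M' by (rule M'(1))
  interpret F: fractions "II" "- M'"
    by unfold_locales (use M'(3,4) in auto)
  have fk: "f ^ k * p \<in> II \<Longrightarrow> p \<in> II" for k p by (rule f_nzd)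
  have "\<exists>n g. g n = 1 \<and> (\<Sum>j\<le>n. cst (g j) * f ^ j) \<in> M'"
  proof (cases "f \<in> M'")
    case True
    thus ?thesis by (intro exI[of _ 1] exI[of _ "\<lambda>j. if j = 1 then 1 else 0"]) (simp add: One_nat_def)
  next
    case False
    obtain y where y: "1 - f * y \<in> M'" using M'(5)[OF False] by blast
    have hu: "hcomp 0 (1 - f * y) = 1"
      using d by (simp add: hcomp_diff hcomp_form[OF one_in_forms] hcomp_form_mult[OF f_form])
    have u: "p \<in> II" if "(1 - f * y) * p \<in> II" for p
      by (rule I.constant_term_nzd[OF _ that]) (simp add: hu)
    obtain s c z where c: "\<exists>i\<le>s. c i \<noteq> 0" "(\<Sum>i\<le>s. cst (c i) * f ^ i) - (1 - f * y) * z \<in> II"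
      using polynomial_in_multiples[OF u] by blast
    have cM: "(\<Sum>i\<le>s. cst (c i) * f ^ i) \<in> M'"
    proof -
      have "(\<Sum>i\<le>s. cst (c i) * f ^ i) - (1 - f * y) * z \<in> M'" using c(2) M'(2) by blast
      thus ?thesis by (rule M'.cong_mem[OF _ M'.mult_right[OF y]])
    qed
    define n where "n = Max {i. i \<le> s \<and> c i \<noteq> 0}"
    have fin: "finite {i. i \<le> s \<and> c i \<noteq> 0}" by simp
    have n: "n \<le> s" "c n \<noteq> 0" using Max_in[OF fin] c(1) by (auto simp: n_def)
    have above: "c i = 0" if "i \<le> s" "n < i" for i
      using Max_ge[OF fin, of i] that unfolding n_def by (auto simp: not_less[symmetric])
    have "(\<Sum>i\<le>s. cst (c i) * f ^ i) = (\<Sum>i\<le>n. cst (c i) * f ^ i)"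
      by (rule sum.mono_neutral_right) (use n above in \<open>auto simp: not_le\<close>)
    hence "cst (inverse (c n)) * (\<Sum>i\<le>n. cst (c i) * f ^ i) \<in> M'" using cM by (intro M'.mult) simp
    hence "(\<Sum>i\<le>n. cst (inverse (c n) * c i) * f ^ i) \<in> M'"
      by (simp add: sum_distrib_left cst_mult mult.assoc)
    thus ?thesis using n by (intro exI[of _ n] exI[of _ "\<lambda>i. inverse (c n) * c i"]) simp
  qed
  then obtain n g where g: "g n = 1" "(\<Sum>j\<le>n. cst (g j) * f ^ j) \<in> M'" by blast
  define G where "G = (\<Sum>j\<le>n. cst (g j) * f ^ j)"
  have G_nzd: "p \<in> II" if Gp: "G * p \<in> II" for p
  proof -
    define j0 where "j0 = (LEAST j. j \<le> n \<and> g j \<noteq> 0)"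
    have j0: "j0 \<le> n" "g j0 \<noteq> 0" using LeastI[of "\<lambda>j. j \<le> n \<and> g j \<noteq> 0" n] g(1) by (auto simp: j0_def)
    have below: "g j = 0" if "j < j0" for j
      using not_less_Least[of j "\<lambda>j. j \<le> n \<and> g j \<noteq> 0"] that j0(1) by (auto simp: j0_def)
    have hG: "hcomp m G = (\<Sum>j\<le>n. if m = d * j then cst (g j) * f ^ j else 0)" for m
      unfolding G_def hcomp_sum by (rule sum.cong) (auto simp: hcomp_cst_mult hcomp_form[OF f_power_form])
    show ?thesis
    proof (rule I.lowest_component_nzd[of "d * j0" G, OF _ _ Gp])
      show "hcomp i G = 0" if "i < d * j0" for i
        unfolding hG by (rule sum.neutral) (use that below in auto)
      fix p assume p: "hcomp (d * j0) G * p \<in> II"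
      have "hcomp (d * j0) G = (\<Sum>j\<le>n. if j = j0 then cst (g j0) * f ^ j0 else 0)"
        unfolding hG by (rule sum.cong) (use d in auto)
      also have "\<dots> = cst (g j0) * f ^ j0" using j0 by (simp add: sum.delta)
      finally have "cst (g j0) * (f ^ j0 * p) \<in> II" using p by (simp add: mult.assoc)
      thus "p \<in> II" using I.cst_cancel[OF j0(2)] fk by blast
    qed
  qed
  obtain l where l: "linear_functional l" "\<And>q. (\<forall>r. l (q * r) = 0) \<longleftrightarrow> q \<in> {q. \<exists>y. q - G * y \<in> II}"
    using frobenius_functional[OF g(1) G_def] unfolding KG_def[OF g(1) G_def] by blast
  have "gorenstein_local F.L"
    by (rule F.gorenstein_localI[OF M'(1-4) refl ideals_finitely_generated g(2)[folded G_def] G_nzd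
        finite_ideal_KG[OF g(1) G_def, unfolded KG_def[OF g(1) G_def]] l])
  thus "gorenstein_local (localization (polys Quot II) (carrier (polys Quot II) - M))"
    unfolding M'(6) .
qed

section \<open>The socle when the coordinate ring is Gorenstein\<close>

lemma (in poly_ideal) forms_span_irrelevant:
  assumes "V \<subseteq> I" "hcomp 0 m = 0" shows "m \<in> I"
proof -
  obtain K where K: "\<forall>d\<ge>K. hcomp d m = 0" using hcomp_eventually_0 by blast
  have "hcomp i m \<in> I" for i
  proof (cases "i = 0")
    case False
    thus ?thesis using forms_subset_mono[OF poly_ideal_axioms assms(1), of i] hcomp_in_forms by force
  qed (simp add: assms(2))
  hence "(\<Sum>i<K. hcomp i m) \<in> I" by (intro sum)
  thus ?thesis using hcomp_decompose[of K m] K by simp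
qed

lemma (in fractions) preim_principal:
  assumes s: "s \<in> W"
  shows "q \<in> preim (Idl\<^bsub>L\<^esub> {Fr p s}) \<longleftrightarrow> (\<exists>t\<in>W. \<exists>y. t * q - p * y \<in> I)"
proof
  interpret L: cring L by (rule cring_L)
  have c: "{Fr p s} \<subseteq> carrier L" using s by simp
  have id: "ideal (Idl\<^bsub>L\<^esub> {Fr p s}) L" by (rule L.genideal_ideal[OF c])
  interpret A: poly_ideal "preim (Idl\<^bsub>L\<^esub> {Fr p s})" by (rule preim_ideal(1)[OF id])
  {
    assume "q \<in> preim (Idl\<^bsub>L\<^esub> {Fr p s})"
    hence "Fr q 1 \<in> PIdl\<^bsub>L\<^esub> (Fr p s)"
      using L.cgenideal_eq_genideal[of "Fr p s"] s by (simp add: preim_def)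
    then obtain x where x: "x \<in> carrier L" "Fr q 1 = x \<otimes>\<^bsub>L\<^esub> Fr p s" by (auto simp: cgenideal_def)
    obtain y t where y: "x = Fr y t" "t \<in> W" using L_cases[OF x(1)] .
    have "Fr q 1 = Fr (y * p) (t * s)" using x(2) y s by (simp add: Fr_mult)
    then obtain u where u: "u \<in> W" "u * (q * (t * s) - y * p * 1) \<in> I"
      using Fr_eq_iff[OF one_W mult_W[OF y(2) s]] by blast
    have "(u * (t * s)) * q - p * (u * y) \<in> I" using u(2) by (simp add: algebra_simps)
    moreover have "u * (t * s) \<in> W" using u(1) y(2) s mult_W by blast
    ultimately show "\<exists>t\<in>W. \<exists>y. t * q - p * y \<in> I" by blast
  }
  assume "\<exists>t\<in>W. \<exists>y. t * q - p * y \<in> I"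
  then obtain t y where t: "t \<in> W" "t * q - p * y \<in> I" by blast
  have "p \<in> preim (Idl\<^bsub>L\<^esub> {Fr p s})"
    using Fr_in_ideal_iff[OF id s, of p] L.genideal_self[OF c] by blast
  hence "p * y \<in> preim (Idl\<^bsub>L\<^esub> {Fr p s})" by (rule A.mult_right)
  hence "t * q \<in> preim (Idl\<^bsub>L\<^esub> {Fr p s})" using t(2) preim_ideal(2)[OF id] A.cong_mem by blast
  thus "q \<in> preim (Idl\<^bsub>L\<^esub> {Fr p s})" by (rule preim_ideal(3)[OF id t(1)])
qed

context two_bases_denominator
begin

abbreviation (input) irr :: "('v, 'k) mpoly set"
  where "irr \<equiv> {p. hcomp 0 p = 0}"

text \<open>
  If \<open>m q = a1 + a2\<close> with \<open>a1\<close> in \<open>I1\<close> and \<open>a2\<close> in \<open>I2\<close>, then \<open>e m q\<close> and \<open>f a2\<close> agree modulo both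
  ideals. Thus multiplication by \<open>e\<close> carries the socle of \<open>S/J\<close> into the socle of \<open>R/f\<close>.
\<close>

lemma socle_transfer:
  assumes e: "e - f \<in> I1" "e \<in> I2" and soc: "\<And>x. x \<in> V \<Longrightarrow> x * q \<in> J" and m: "hcomp 0 m = 0"
  shows "\<exists>y. m * (e * q) - f * y \<in> II"
proof -
  have "poly_ideal {m. m * q \<in> J}"
    by unfold_locales (auto simp: distrib_right mult.assoc intro: J.add J.mult)
  hence "m \<in> {m. m * q \<in> J}" by (rule poly_ideal.forms_span_irrelevant[OF _ _ m]) (use soc in auto)
  then obtain a1 a2 where a: "m * q = a1 + a2" "a1 \<in> I1" "a2 \<in> I2" by (auto simp: J_def)
  have "m * (e * q) - f * a2 = (m * q) * (e - f) + f * (m * q - a2)" by (simp add: algebra_simps)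
  hence "m * (e * q) - f * a2 = (m * q) * (e - f) + f * a1" by (simp add: a(1))
  hence "m * (e * q) - f * a2 \<in> I1" by (rule P.comb2[OF e(1) a(2)])
  moreover have "m * (e * q) - f * a2 \<in> I2"
    by (rule Q.comb2[OF e(2) a(3), of _ "m * q" "- f"]) (simp add: algebra_simps)
  ultimately show ?thesis by blast
qed

text \<open>
The map of the preceding lemma is injective, also after localization at the origin.
\<close>

lemma socle_transfer_back:
  assumes e: "e - f \<in> I1" "e \<in> I2" and s: "hcomp 0 s \<noteq> 0" and y: "s * (e * q) - f * y \<in> II"
  shows "q \<in> J"
proof -
  have "f * y \<in> I2"
    by (rule Q.comb2[OF e(2) IntD2[OF y], of _ "s * q" "-1"]) (simp add: algebra_simps)
  hence y2: "y \<in> I2" by (rule Q.nzd_if_cong[OF f2])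
  have "f * (s * q - y) \<in> I1"
    by (rule P.comb2[OF e(1) IntD1[OF y], of _ "- (s * q)" 1]) (simp add: algebra_simps)
  hence "s * q - y \<in> I1" by (rule P.nzd_if_cong[OF f1])
  hence "(s * q - y) + y \<in> J" unfolding J_def using y2 by blast
  hence "s * q \<in> J" by simp
  thus ?thesis by (rule J.constant_term_nzd[OF s])
qed

lemma f_nzd': "f * p \<in> II \<Longrightarrow> p \<in> II"
  using f_nzd[of 1 p] by simp

lemma hcomp_0_f_mult [simp]: "hcomp 0 (f * p) = 0"
  using d by (simp add: hcomp_form_mult[OF f_form])

text \<open>
  A multiple of \<open>u\<close> is a polynomial in \<open>f\<close>; split off the lowest power of \<open>f\<close>. What is left has a
  nonzero constant term and is a unit of the local ring at the origin.
\<close>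

lemma f_power_in_saturation:
  assumes A: "poly_ideal A" "II \<subseteq> A" "\<And>s p. hcomp 0 s \<noteq> 0 \<Longrightarrow> s * p \<in> A \<Longrightarrow> p \<in> A"
    and u: "u \<in> A" "\<And>p. u * p \<in> II \<Longrightarrow> p \<in> II"
  shows "\<exists>i. f ^ i \<in> A"
proof -
  interpret A: poly_ideal A by fact
  obtain s c y where c: "\<exists>i\<le>s. c i \<noteq> 0" "(\<Sum>i\<le>s. cst (c i) * f ^ i) - u * y \<in> II"
    using polynomial_in_multiples[OF u(2)] by blast
  have cA: "(\<Sum>i\<le>s. cst (c i) * f ^ i) \<in> A"
    using A.cong_mem[OF _ A.mult_right[OF u(1)]] c(2) A(2) by blast
  define j where "j = (LEAST i. i \<le> s \<and> c i \<noteq> 0)"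
  have j: "j \<le> s" "c j \<noteq> 0" using LeastI_ex[of "\<lambda>i. i \<le> s \<and> c i \<noteq> 0"] c(1) by (auto simp: j_def)
  have below: "c i = 0" if "i < j" for i
    using not_less_Least[of i "\<lambda>i. i \<le> s \<and> c i \<noteq> 0"] that j(1) by (auto simp: j_def)
  define w where "w = (\<Sum>i\<in>{j..s}. cst (c i) * f ^ (i - j))"
  have "(\<Sum>i\<le>s. cst (c i) * f ^ i) = (\<Sum>i\<in>{j..s}. cst (c i) * f ^ i)"
    by (rule sum.mono_neutral_right) (use below in \<open>auto simp: not_le\<close>)
  also have "\<dots> = w * f ^ j"
    unfolding w_def sum_distrib_right by (rule sum.cong) (auto simp: mult.assoc power_add[symmetric])
  finally have "w * f ^ j \<in> A" using cA by simp
  moreover have "hcomp 0 w \<noteq> 0"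
  proof -
    have "w = cst (c j) + (\<Sum>i\<in>{Suc j..s}. cst (c i) * f ^ (i - j))"
      unfolding w_def using j by (simp add: sum.atLeast_Suc_atMost)
    also have "(\<Sum>i\<in>{Suc j..s}. cst (c i) * f ^ (i - j)) = f * (\<Sum>i\<in>{Suc j..s}. cst (c i) * f ^ (i - Suc j))"
      unfolding sum_distrib_left
      by (rule sum.cong) (auto simp: Suc_diff_Suc[symmetric] Suc_le_eq algebra_simps)
    finally show ?thesis using j by (simp add: hcomp_add hcomp_form[OF cst_in_forms])
  qed
  ultimately show ?thesis using A(3) by blast
qed

lemma power_in_saturation:
  assumes A: "poly_ideal A" "II \<subseteq> A" "f ^ i \<in> A" and p: "hcomp 0 p = 0"
  shows "\<exists>k. p ^ k \<in> A"
proof -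
  interpret A: poly_ideal A by fact
  define k where "k = d * i + Suc N"
  obtain K where K: "\<forall>m\<ge>K. hcomp m (p ^ k) = 0" using hcomp_eventually_0 by blast
  have "hcomp m (p ^ k) \<in> A" for m
  proof (cases "m < k")
    case False
    then obtain s where "hcomp m (p ^ k) - f ^ i * s \<in> II"
      using divide_f_power[OF hcomp_in_forms, of i m "p ^ k"] by (auto simp: k_def)
    thus ?thesis using A.cong_mem[OF _ A.mult_right[OF A(3)]] A(2) by blast
  qed (simp add: irrelevant_ideal_powers[OF p])
  hence "(\<Sum>m<K. hcomp m (p ^ k)) \<in> A" by (intro A.sum)
  thus ?thesis using hcomp_decompose[of K "p ^ k"] K by auto
qed

text \<open>
  Work in the local ring at the origin, with a regular sequence modulo which it is self-injective.
  The sequence is not empty, since otherwise the nonzerodivisor \<open>f\<close> would be a unit. It has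
  only one element \<open>p1\<close>, since modulo a first element every element of the maximal ideal is
  nilpotent. Finally \<open>p1 (e q) = f a\<close> carries the socle from \<open>R/f\<close> to \<open>R/p1\<close>, where self-injectivity
  makes any two nonzero socle elements multiples of each other.
\<close>

theorem simple_socle_if_gorenstein:
  assumes G: "gorenstein_ring (polys Quot II)"
    and e: "e - f \<in> I1" "e \<in> I2"
    and soc: "\<And>x. x \<in> V \<Longrightarrow> x * q1 \<in> J" "\<And>x. x \<in> V \<Longrightarrow> x * q2 \<in> J"
  shows "q1 \<in> J \<or> (\<exists>c. q2 - cst c * q1 \<in> J)"
proof -
  let ?I = "II"
  have prime: "hcomp 0 s \<noteq> 0 \<Longrightarrow> hcomp 0 t \<noteq> 0 \<Longrightarrow> hcomp 0 (s * t) \<noteq> 0" for s t :: "('v, 'k) mpoly"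
    using irrelevant_ideal_prime by blast
  have hcomp_1: "hcomp 0 (1 :: ('v, 'k) mpoly) = 1" by (simp add: hcomp_form[OF one_in_forms])
  interpret F: fractions ?I "- irr"
    by unfold_locales (use prime hcomp_1 in auto)
  interpret L: cring F.L by (rule F.cring_L)
  have I_irr: "?I \<subseteq> irr"
  proof (rule subsetI, rule ccontr)
    fix p assume p: "p \<in> ?I" "p \<notin> irr"
    hence "1 \<in> ?I" by (intro I.constant_term_nzd[of p 1]) auto
    thus False using one_notin_I by blast
  qed
  have max: "maximalideal (cls ?I ` irr) (polys Quot ?I)" "carrier (polys Quot ?I) - cls ?I ` irr = cls ?I ` (- irr)"
  proof -
    have inv: "\<exists>y. 1 - s * y \<in> irr" if "s \<notin> irr" for s
    proof -
      obtain c where c: "hcomp 0 s = cst c" using hcomp_0_cst by blast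
      hence "c \<noteq> 0" using that by auto
      hence "hcomp 0 (1 - s * cst (inverse c)) = 0"
        using cst_inverse[of c] hcomp_1 by (simp add: hcomp_diff mult.commute[of s] hcomp_cst_mult c)
      thus ?thesis by blast
    qed
    show "maximalideal (cls ?I ` irr) (polys Quot ?I)" "carrier (polys Quot ?I) - cls ?I ` irr = cls ?I ` (- irr)"
      by (rule I.maximalideal_image[OF irrelevant_ideal I_irr _ inv]; use hcomp_1 in simp)+
  qed
  hence "gorenstein_local F.L" using G unfolding gorenstein_ring_def by metis
  then obtain xs where xs: "regular_sequence F.L xs" and inj: "self_injective (F.L Quot (Idl\<^bsub>F.L\<^esub> (set xs)))"
    unfolding gorenstein_local_def by (elim exE conjE) (rule that)
  have xc: "set xs \<subseteq> carrier F.L" and proper: "Idl\<^bsub>F.L\<^esub> (set xs) \<noteq> carrier F.L"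
    and reg: "\<And>i a. i < length xs \<Longrightarrow> a \<in> carrier F.L \<Longrightarrow> xs ! i \<otimes>\<^bsub>F.L\<^esub> a \<in> Idl\<^bsub>F.L\<^esub> (set (take i xs)) \<Longrightarrow>
      a \<in> Idl\<^bsub>F.L\<^esub> (set (take i xs))"
    using xs unfolding regular_sequence_def by auto
  have A: "ideal (Idl\<^bsub>F.L\<^esub> (set xs)) F.L" by (rule L.genideal_ideal[OF xc])
  define A where "A = F.preim (Idl\<^bsub>F.L\<^esub> (set xs))"
  interpret A: poly_ideal A unfolding A_def by (rule F.preim_ideal(1)[OF A])
  have IA: "?I \<subseteq> A" unfolding A_def by (rule F.preim_ideal(2)[OF A])
  have satA: "p \<in> A" if "hcomp 0 s \<noteq> 0" "s * p \<in> A" for s p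
    using F.preim_ideal(3)[OF A, of s p] that by (simp add: A_def)
  have one_A: "1 \<notin> A"
  proof
    assume "1 \<in> A"
    hence "\<one>\<^bsub>F.L\<^esub> \<in> Idl\<^bsub>F.L\<^esub> (set xs)" by (simp add: A_def F.preim_def F.Fr_one)
    thus False using ideal.one_imp_carrier[OF A] proper by blast
  qed
  have A_irr: "hcomp 0 p = 0" if "p \<in> A" for p using satA[of p 1] that one_A by auto
  have mem_A: "p \<in> A" if "F.Fr p s \<in> set xs" "s \<in> - irr" for p s
  proof -
    have "F.Fr p s \<in> Idl\<^bsub>F.L\<^esub> (set xs)" using L.genideal_self[OF xc] that by blast
    thus ?thesis using F.Fr_in_ideal_iff[OF A that(2), of p] by (simp add: A_def)
  qed
  note E = F.divides_if_annihilator_le[OF A inj, folded A_def]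
  show ?thesis
  proof (cases xs)
    case Nil
    have A_I: "A \<subseteq> ?I"
    proof
      fix p assume "p \<in> A"
      hence "F.Fr p 1 = \<zero>\<^bsub>F.L\<^esub>" using genideal_empty[OF F.cring_L] by (simp add: A_def F.preim_def Nil)
      then obtain u where "u \<in> - irr" "u * p \<in> ?I" using F.Fr_eq_0_iff[OF F.one_W, of p] by blast
      thus "p \<in> ?I" using I.constant_term_nzd[of u p] by auto
    qed
    have "\<exists>c. \<exists>s\<in>- irr. s * 1 - f * c \<in> A"
      by (rule E) (use f_nzd' A_I IA in auto)
    then obtain c s where cs: "hcomp 0 s \<noteq> 0" "s - f * c \<in> A" by auto
    have "hcomp 0 (s - f * c) = 0" by (rule A_irr[OF cs(2)])
    thus ?thesis using cs(1) by (simp add: hcomp_diff)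
  next
    case (Cons x1 rest)
    obtain p1 s1 where x1: "x1 = F.Fr p1 s1" "s1 \<in> - irr" using F.L_cases[of x1] xc Cons by auto
    have p1A: "p1 \<in> A" using mem_A[of p1 s1] x1 Cons by auto
    have p1_nzd: "p \<in> ?I" if p: "p1 * p \<in> ?I" for p
    proof -
      have "x1 \<otimes>\<^bsub>F.L\<^esub> F.Fr p 1 = \<zero>\<^bsub>F.L\<^esub>"
        unfolding x1(1) F.Fr_mult[OF x1(2) F.one_W]
        using F.Fr_eq_0_iff[OF F.mult_W[OF x1(2) F.one_W]] F.one_W p by (metis mult_1)
      hence "F.Fr p 1 = \<zero>\<^bsub>F.L\<^esub>"
        using reg[of 0 "F.Fr p 1"] F.one_W Cons genideal_empty[OF F.cring_L] by simp
      then obtain u where "u \<in> - irr" "u * p \<in> ?I" using F.Fr_eq_0_iff[OF F.one_W, of p] by blast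
      thus ?thesis using I.constant_term_nzd[of u p] by auto
    qed
    have x1c: "{x1} \<subseteq> carrier F.L" using x1 by simp
    have A1: "ideal (Idl\<^bsub>F.L\<^esub> {x1}) F.L" by (rule L.genideal_ideal[OF x1c])
    define A1 where "A1 = F.preim (Idl\<^bsub>F.L\<^esub> {x1})"
    interpret A1: poly_ideal A1 unfolding A1_def by (rule F.preim_ideal(1)[OF A1])
    have IA1: "?I \<subseteq> A1" unfolding A1_def by (rule F.preim_ideal(2)[OF A1])
    have satA1: "p \<in> A1" if "hcomp 0 s \<noteq> 0" "s * p \<in> A1" for s p
      using F.preim_ideal(3)[OF A1, of s p] that by (simp add: A1_def)
    have A1_iff: "q \<in> A1 \<longleftrightarrow> (\<exists>t\<in>- irr. \<exists>y. t * q - p1 * y \<in> ?I)" for q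
      unfolding A1_def x1(1) by (rule F.preim_principal[OF x1(2)])
    have p1A1: "p1 \<in> A1" unfolding A1_iff by (intro bexI[of _ 1] exI[of _ 1]) (use F.one_W in auto)
    have A1A: "A1 \<subseteq> A"
    proof -
      have "Idl\<^bsub>F.L\<^esub> {x1} \<subseteq> Idl\<^bsub>F.L\<^esub> (set xs)"
        by (rule L.genideal_minimal[OF A]) (use L.genideal_self[OF xc] Cons in auto)
      thus ?thesis by (auto simp: A1_def A_def F.preim_def)
    qed
    show ?thesis
    proof (cases rest)
      case rest: (Cons x2 rest')
      obtain p2 s2 where x2: "x2 = F.Fr p2 s2" "s2 \<in> - irr" using F.L_cases[of x2] xc Cons rest by auto
      have p2: "hcomp 0 p2 = 0" using A_irr mem_A[of p2 s2] x2 Cons rest by auto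
      have p2_nzd: "p \<in> A1" if "p2 * p \<in> A1" for p
      proof -
        have m: "x2 \<otimes>\<^bsub>F.L\<^esub> F.Fr p 1 \<in> Idl\<^bsub>F.L\<^esub> {x1}"
          unfolding x2(1) F.Fr_mult[OF x2(2) F.one_W]
            F.Fr_in_ideal_iff[OF A1 F.mult_W[OF x2(2) F.one_W]] A1_def[symmetric] using that .
        have "F.Fr p 1 \<in> Idl\<^bsub>F.L\<^esub> {x1}"
          using reg[of "Suc 0" "F.Fr p 1"] F.one_W m Cons rest by simp
        thus ?thesis by (simp add: A1_def F.preim_def)
      qed
      have "p \<in> A1" if "p2 ^ k * p \<in> A1" for k p
        using that by (induction k arbitrary: p) (auto simp: mult.assoc dest: p2_nzd)
      moreover have "\<exists>i. f ^ i \<in> A1"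
        by (rule f_power_in_saturation[OF A1.poly_ideal_axioms IA1 _ p1A1 p1_nzd], erule (1) satA1)
      then obtain k where "p2 ^ k \<in> A1"
        using power_in_saturation[OF A1.poly_ideal_axioms IA1 _ p2] by blast
      ultimately have "1 \<in> A1" by (metis mult.right_neutral)
      thus ?thesis using A1A one_A by blast
    next
      case Nil
      have AA1: "A = A1" by (simp add: A_def A1_def Cons Nil)
      have p1_irr: "hcomp 0 p1 = 0" by (rule A_irr[OF p1A])
      have in_J: "q \<in> J" if a: "a \<in> A" "p1 * (e * q) - f * a \<in> ?I" for a q
      proof -
        obtain s y where s: "hcomp 0 s \<noteq> 0" "s * a - p1 * y \<in> ?I" using a(1) unfolding AA1 A1_iff by auto
        have "p1 * (s * (e * q) - f * y) \<in> ?I"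
          by (rule I.comb2[OF a(2) s(2), of _ s f]) (simp add: algebra_simps)
        thus ?thesis by (rule socle_transfer_back[OF e s(1) p1_nzd])
      qed
      have fwd: "m * a \<in> A" if soc: "\<And>x. x \<in> V \<Longrightarrow> x * q \<in> J" and a: "p1 * (e * q) - f * a \<in> ?I"
        and m: "hcomp 0 m = 0" for a q m
      proof -
        obtain y where y: "m * (e * q) - f * y \<in> ?I" using socle_transfer[OF e soc m] by blast
        have "f * (m * a - p1 * y) \<in> ?I"
          by (rule I.comb2[OF a y, of _ "- m" p1]) (simp add: algebra_simps)
        hence "m * a - p1 * y \<in> ?I" by (rule f_nzd')
        hence "m * a - p1 * y \<in> A" using IA by blast
        thus ?thesis by (rule A.cong_mem[OF _ A.mult_right[OF p1A]])
      qed
      obtain a1 where a1: "p1 * (e * q1) - f * a1 \<in> ?I" using socle_transfer[OF e soc(1) p1_irr] by blast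
      obtain a2 where a2: "p1 * (e * q2) - f * a2 \<in> ?I" using socle_transfer[OF e soc(2) p1_irr] by blast
      show ?thesis
      proof (cases "a1 \<in> A")
        case True
        thus ?thesis using in_J[OF _ a1] by blast
      next
        case False
        have "\<exists>c. \<exists>s\<in>- irr. s * a2 - a1 * c \<in> A"
        proof (rule E)
          fix p assume "a1 * p \<in> A"
          hence "p * a1 \<in> A" by (simp add: mult.commute)
          hence "hcomp 0 p = 0" using satA False by blast
          hence "p * a2 \<in> A" using fwd[OF soc(2) a2] by blast
          thus "a2 * p \<in> A" by (simp add: mult.commute)
        qed
        then obtain c s where cs: "hcomp 0 s \<noteq> 0" "s * a2 - a1 * c \<in> A" by auto
        obtain s0 c0 where h: "hcomp 0 s = cst s0" "hcomp 0 c = cst c0" using hcomp_0_cst by metis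
        have s0: "s0 \<noteq> 0" using cs(1) h by auto
        have "hcomp 0 (s - cst s0) = 0" "hcomp 0 (c - cst c0) = 0"
          by (simp_all add: hcomp_diff h hcomp_form[OF cst_in_forms])
        hence low: "(s - cst s0) * a2 \<in> A" "(c - cst c0) * a1 \<in> A" using fwd[OF soc(1) a1] fwd[OF soc(2) a2] by auto
        have "cst s0 * a2 - cst c0 * a1 \<in> A"
          by (rule A.comb3[OF cs(2) low, of _ 1 "-1" 1]) (simp add: algebra_simps)
        hence m: "cst (inverse s0) * (cst s0 * a2 - cst c0 * a1) \<in> A" by (rule A.mult)
        \<comment> \<open>The socle is killed by the maximal ideal, so only the constant terms of \<open>s\<close> and \<open>c\<close> matter.\<close>
        define \<gamma> where "\<gamma> = inverse s0 * c0"
        have "cst (inverse s0) * (cst s0 * a2 - cst c0 * a1) = (cst (inverse s0) * cst s0) * a2 - cst \<gamma> * a1"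
          by (simp add: \<gamma>_def cst_mult algebra_simps)
        also have "\<dots> = a2 - cst \<gamma> * a1" by (simp only: cst_inverse[OF s0] mult_1)
        finally have "a2 - cst \<gamma> * a1 \<in> A" using m by (simp only:)
        moreover have "p1 * (e * (q2 - cst \<gamma> * q1)) - f * (a2 - cst \<gamma> * a1) \<in> ?I"
          by (rule I.comb2[OF a1 a2, of _ "- cst \<gamma>" 1]) (simp add: algebra_simps)
        ultimately have "q2 - cst \<gamma> * q1 \<in> J" by (rule in_J)
        thus ?thesis by blast
      qed
    qed
  qed
qed

end

section \<open>Closed subschemes and nonvanishing forms\<close>

locale closed_ideal = homogeneous_ideal I for I :: "('v::finite, 'k::field) mpoly set" +
  assumes saturated: "(\<And>q. q \<in> forms N \<Longrightarrow> p * q \<in> I) \<Longrightarrow> p \<in> I"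

lemma closed_ideal_if_closed_subscheme:
  assumes "closed_subscheme I" shows "closed_ideal I"
proof -
  have I: "ideal I polys" "I = Idl\<^bsub>polys\<^esub> (I \<inter> (\<Union>d. forms d))"
    and sat: "\<And>p. (\<exists>N. \<forall>q\<in>forms N. p * q \<in> I) \<Longrightarrow> p \<in> I"
    using assms unfolding closed_subscheme_def by auto
  interpret poly_ideal I using I(1) poly_ideal_iff by blast
  define K where "K = {p. \<forall>d. hcomp d p \<in> I}"
  have "poly_ideal K"
  proof
    fix p q assume p: "p \<in> K"
    show "q * p \<in> K" using p by (auto simp: K_def hcomp_mult intro!: sum mult)
    assume "q \<in> K"
    thus "p + q \<in> K" using p by (auto simp: K_def hcomp_add intro: add)
  qed (simp add: K_def)
  hence "Idl\<^bsub>polys\<^esub> (I \<inter> (\<Union>d. forms d)) \<subseteq> K"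
    by (intro ring.genideal_minimal[OF cring.axioms(1)[OF cring_polys]])
      (auto simp: poly_ideal_iff K_def hcomp_form)
  hence "I \<subseteq> K" using I(2) by blast
  show ?thesis
  proof
    show "hcomp d p \<in> I" if "p \<in> I" for p d using \<open>I \<subseteq> K\<close> that by (auto simp: K_def)
    show "p \<in> I" if "\<And>q. q \<in> forms N \<Longrightarrow> p * q \<in> I" for N p using sat that by blast
  qed
qed

lemma set_add_polys: "A <+>\<^bsub>polys\<^esub> B = {a + b | a b. a \<in> A \<and> b \<in> B}"
  by (auto simp: set_add_def set_mult_def ring_of_type_algebra_def)

lemma PIdl_polys: "PIdl\<^bsub>polys\<^esub> s = {y * s | y. True}"
  by (auto simp: cgenideal_def)

context closed_ideal
begin

abbreviation nonvan :: "nat \<Rightarrow> ('v, 'k) mpoly set"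
  where "nonvan \<equiv> nonvanishing_forms I"

lemma nonvan_iff: "s \<in> nonvan d \<longleftrightarrow> s \<in> forms d \<and> (\<exists>N. \<forall>q\<in>forms N. \<exists>y. q - s * y \<in> I)"
proof -
  have "q \<in> I <+>\<^bsub>polys\<^esub> (PIdl\<^bsub>polys\<^esub> s) \<longleftrightarrow> (\<exists>y. q - s * y \<in> I)" for q
  proof
    assume "q \<in> I <+>\<^bsub>polys\<^esub> (PIdl\<^bsub>polys\<^esub> s)"
    then obtain a y where "q = a + y * s" "a \<in> I" by (auto simp: set_add_polys PIdl_polys)
    hence "q - s * y \<in> I" by (simp add: mult.commute)
    thus "\<exists>y. q - s * y \<in> I" ..
  next
    assume "\<exists>y. q - s * y \<in> I"
    then obtain y where "q - s * y \<in> I" ..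
    moreover have "q = (q - s * y) + y * s" by (simp add: mult.commute)
    ultimately show "q \<in> I <+>\<^bsub>polys\<^esub> (PIdl\<^bsub>polys\<^esub> s)" unfolding set_add_polys PIdl_polys by blast
  qed
  thus ?thesis unfolding nonvanishing_forms_def by blast
qed

lemma nonvan_form: "s \<in> nonvan d \<Longrightarrow> s \<in> forms d"
  by (simp add: nonvan_iff)

lemma nonvan_nzd:
  assumes "s \<in> nonvan d" "s * p \<in> I" shows "p \<in> I"
proof -
  obtain N where N: "\<forall>q\<in>forms N. \<exists>y. q - s * y \<in> I" using assms(1) nonvan_iff by blast
  show ?thesis
  proof (rule saturated[of N])
    fix q :: "('v, 'k) mpoly" assume "q \<in> forms N"
    then obtain y where "q - s * y \<in> I" using N by blast
    thus "p * q \<in> I" by (rule comb2[OF _ assms(2), of _ _ p y]) (simp add: algebra_simps)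
  qed
qed

lemma nonvan_divide:
  assumes "s \<in> nonvan d"
  shows "\<exists>N. \<forall>m\<ge>N. \<forall>q\<in>forms m. d \<le> m \<and> (\<exists>y\<in>forms (m - d). q - s * y \<in> I)"
proof -
  obtain N where s: "s \<in> forms d" and N: "\<forall>q\<in>forms N. \<exists>y. q - s * y \<in> I" using assms nonvan_iff by blast
  interpret K: poly_ideal "{p. \<exists>y. p - s * y \<in> I}" by (rule poly_ideal_add_principal) unfold_locales
  show ?thesis
  proof (intro exI[of _ "N + d"] allI impI ballI conjI)
    fix m :: nat and q :: "('v, 'k) mpoly" assume m: "N + d \<le> m" and q: "q \<in> forms m"
    show "d \<le> m" using m by simp
    have "forms m \<subseteq> {p. \<exists>y. p - s * y \<in> I}"
      by (rule forms_subset_mono[OF K.poly_ideal_axioms, of N]) (use N m in auto)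
    then obtain y where "q - s * y \<in> I" using q by blast
    hence "hcomp m (q - s * y) \<in> I" by (rule hcomp_mem)
    hence "q - s * hcomp (m - d) y \<in> I"
      using \<open>d \<le> m\<close> by (simp add: hcomp_diff hcomp_form[OF q] hcomp_form_mult[OF s])
    thus "\<exists>y\<in>forms (m - d). q - s * y \<in> I" using hcomp_in_forms by blast
  qed
qed

lemma nonvan_mult:
  assumes "s \<in> nonvan d" "t \<in> nonvan e" shows "s * t \<in> nonvan (d + e)"
proof -
  obtain N where N: "\<forall>m\<ge>N. \<forall>q\<in>forms m. d \<le> m \<and> (\<exists>y\<in>forms (m - d). q - s * y \<in> I)"
    using nonvan_divide[OF assms(1)] by blast
  obtain M where M: "\<forall>m\<ge>M. \<forall>q\<in>forms m. e \<le> m \<and> (\<exists>y\<in>forms (m - e). q - t * y \<in> I)"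
    using nonvan_divide[OF assms(2)] by blast
  have "\<exists>y. q - s * t * y \<in> I" if q: "q \<in> forms (N + M + d)" for q
  proof -
    obtain y where y: "y \<in> forms (N + M)" "q - s * y \<in> I" using N[rule_format, OF _ q] by auto
    obtain z where z: "y - t * z \<in> I" using M[rule_format, OF _ y(1)] by auto
    have "q - s * t * z \<in> I" by (rule comb2[OF y(2) z, of _ 1 s]) (simp add: algebra_simps)
    thus ?thesis ..
  qed
  thus ?thesis unfolding nonvan_iff using forms_mult nonvan_form assms by blast
qed

lemma one_nonvan: "1 \<in> nonvan 0"
proof -
  have "\<exists>y. q - 1 * y \<in> I" for q by (rule exI[of _ q]) simp
  thus ?thesis by (simp add: nonvan_iff)
qed

lemma nonvan_power: "s \<in> nonvan d \<Longrightarrow> s ^ k \<in> nonvan (d * k)"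
proof (induction k)
  case (Suc k)
  hence "s * s ^ k \<in> nonvan (d + d * k)" by (intro nonvan_mult) auto
  thus ?case by simp
qed (simp add: one_nonvan)

lemma nonvan_divisor:
  assumes "s \<in> nonvan d" "x \<in> forms e" "s - t * x \<in> I" shows "x \<in> nonvan e"
proof -
  obtain N where N: "\<forall>q\<in>forms N. \<exists>y. q - s * y \<in> I" using assms(1) nonvan_iff by blast
  have "\<exists>y. q - x * y \<in> I" if q: "q \<in> forms N" for q
  proof -
    obtain y where y: "q - s * y \<in> I" using N q by blast
    have "q - x * (t * y) \<in> I" by (rule comb2[OF y assms(3), of _ 1 y]) (simp add: algebra_simps)
    thus ?thesis ..
  qed
  thus ?thesis using assms(2) unfolding nonvan_iff by blast
qed

definition W :: "('v, 'k) mpoly set" where "W = (\<Union>d. nonvan d)"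

lemma W_nonvan: "s \<in> nonvan d \<Longrightarrow> s \<in> W"
  by (auto simp: W_def)

sublocale F: fractions I W
  by unfold_locales (use one_nonvan nonvan_mult in \<open>unfold W_def, blast+\<close>)

lemma W_nzd: "u \<in> W \<Longrightarrow> u * p \<in> I \<Longrightarrow> p \<in> I"
  using nonvan_nzd by (auto simp: W_def)

lemma section_ring_eq: "section_ring I = F.L"
  by (simp add: section_ring_def homogeneous_coordinate_ring_def denominators_def W_def image_UN)

lemma fraction_eq: "fraction I p s = F.Fr p s"
  unfolding F.Fr_def by (simp add: fraction_def homogeneous_coordinate_ring_def denominators_def W_def image_UN)

lemma Fr_eq:
  assumes "s \<in> W" "t \<in> W" shows "F.Fr p s = F.Fr q t \<longleftrightarrow> p * t - q * s \<in> I"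
proof
  assume "F.Fr p s = F.Fr q t"
  then obtain u where "u \<in> W" "u * (p * t - q * s) \<in> I" unfolding F.Fr_eq_iff[OF assms] by (rule bexE)
  thus "p * t - q * s \<in> I" by (rule W_nzd)
qed (rule F.Fr_eqI[OF assms])

lemma sections_eq: "sections I n = {F.Fr p s | p s d. s \<in> nonvan d \<and> p \<in> forms (d + n)}"
  by (simp add: sections_def fraction_eq)

lemma sectionI: "s \<in> nonvan d \<Longrightarrow> p \<in> forms (d + n) \<Longrightarrow> F.Fr p s \<in> sections I n"
  unfolding sections_eq by blast

lemma sectionE:
  assumes "x \<in> sections I n" obtains p s d where "x = F.Fr p s" "s \<in> nonvan d" "s \<in> W" "p \<in> forms (d + n)"
proof -
  obtain p s d where "x = F.Fr p s" "s \<in> nonvan d" "p \<in> forms (d + n)" using assms by (auto simp: sections_eq)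
  thus ?thesis using that W_nonvan by metis
qed

lemma section_carrier: "x \<in> sections I n \<Longrightarrow> x \<in> carrier F.L"
  by (auto elim!: sectionE)

lemma section_add:
  assumes "x \<in> sections I n" "y \<in> sections I n" shows "x \<oplus>\<^bsub>F.L\<^esub> y \<in> sections I n"
proof -
  obtain p s d where x: "x = F.Fr p s" "s \<in> nonvan d" "s \<in> W" "p \<in> forms (d + n)" using sectionE[OF assms(1)] .
  obtain q t e where y: "y = F.Fr q t" "t \<in> nonvan e" "t \<in> W" "q \<in> forms (e + n)" using sectionE[OF assms(2)] .
  have "p * t + q * s \<in> forms (d + e + n)"
    by (intro forms_add forms_mult_eq[OF x(4) nonvan_form[OF y(2)]] forms_mult_eq[OF y(4) nonvan_form[OF x(2)]]) auto
  thus ?thesis unfolding x(1) y(1) F.Fr_add[OF x(3) y(3)] by (rule sectionI[OF nonvan_mult[OF x(2) y(2)]])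
qed

lemma section_mult:
  assumes "x \<in> sections I m" "y \<in> sections I n" shows "x \<otimes>\<^bsub>F.L\<^esub> y \<in> sections I (m + n)"
proof -
  obtain p s d where x: "x = F.Fr p s" "s \<in> nonvan d" "s \<in> W" "p \<in> forms (d + m)" using sectionE[OF assms(1)] .
  obtain q t e where y: "y = F.Fr q t" "t \<in> nonvan e" "t \<in> W" "q \<in> forms (e + n)" using sectionE[OF assms(2)] .
  have "p * q \<in> forms (d + e + (m + n))" by (rule forms_mult_eq[OF x(4) y(4)]) auto
  thus ?thesis unfolding x(1) y(1) F.Fr_mult[OF x(3) y(3)] by (rule sectionI[OF nonvan_mult[OF x(2) y(2)]])
qed

lemma const_section_eq: "const_section I c = F.Fr (cst c) 1"
  by (simp add: const_section_def fraction_eq)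

lemma const_section_mem: "const_section I c \<in> sections I 0"
  unfolding const_section_eq by (rule sectionI[OF one_nonvan]) simp

lemma ring_structure_ring: "ring (structure_ring I)"
proof -
  interpret L: cring F.L by (rule F.cring_L)
  have "subring (sections I 0) F.L"
  proof (rule L.subringI)
    show "sections I 0 \<subseteq> carrier F.L" using section_carrier by blast
    show "\<one>\<^bsub>F.L\<^esub> \<in> sections I 0" unfolding F.Fr_one by (rule sectionI[OF one_nonvan]) simp
    show "\<ominus>\<^bsub>F.L\<^esub> h \<in> sections I 0" if h: "h \<in> sections I 0" for h
    proof -
      have c: "const_section I (-1) \<in> carrier F.L" "h \<in> carrier F.L"
        using h const_section_mem section_carrier by auto
      have "const_section I (-1) = \<ominus>\<^bsub>F.L\<^esub> \<one>\<^bsub>F.L\<^esub>"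
        using F.Fr_minus[OF F.one_W F.one_W, of 0 1] L.l_zero[OF L.a_inv_closed[OF L.one_closed]]
        by (simp add: const_section_eq F.Fr_one F.Fr_zero[symmetric] cst_uminus a_minus_def)
      hence "\<ominus>\<^bsub>F.L\<^esub> h = const_section I (-1) \<otimes>\<^bsub>F.L\<^esub> h" using c by (simp add: L.l_minus)
      thus ?thesis using section_mult[OF const_section_mem h, of "-1"] by simp
    qed
    show "h1 \<otimes>\<^bsub>F.L\<^esub> h2 \<in> sections I 0" if "h1 \<in> sections I 0" "h2 \<in> sections I 0" for h1 h2
      using section_mult[OF that] by simp
    show "h1 \<oplus>\<^bsub>F.L\<^esub> h2 \<in> sections I 0" if "h1 \<in> sections I 0" "h2 \<in> sections I 0" for h1 h2
      using section_add[OF that] .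
  qed
  thus ?thesis unfolding structure_ring_def section_ring_eq by (rule L.subring_is_ring)
qed

text \<open>
  The recursive definition of dimension, read off in terms of forms: all fractions \<open>q/t\<close> of degree 0
  are combinations of \<open>n\<close> fixed fractions \<open>p\<^sub>i/s\<close> with a common denominator.
\<close>

lemma coordinates_if_has_degree:
  assumes "has_degree I n"
  shows "\<exists>D s p. s \<in> nonvan D \<and> (\<forall>i<n. p i \<in> forms D) \<and>
    (\<forall>d. \<forall>t\<in>nonvan d. \<forall>q\<in>forms d. \<exists>c. s * q - t * (\<Sum>i<n. cst (c i) * p i) \<in> I)"
proof -
  let ?R = "structure_ring I"
  interpret R: ring ?R by (rule ring_structure_ring)
  have R: "carrier ?R = sections I 0" "\<zero>\<^bsub>?R\<^esub> = F.Fr 0 1" "\<And>x y. x \<oplus>\<^bsub>?R\<^esub> y = x \<oplus>\<^bsub>F.L\<^esub> y"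
    "\<And>x y. x \<otimes>\<^bsub>?R\<^esub> y = x \<otimes>\<^bsub>F.L\<^esub> y"
    by (simp_all add: structure_ring_def section_ring_eq F.Fr_zero)
  have dim: "R.dimension n (range (const_section I)) (sections I 0)" using assms by (simp add: has_degree_def)
  have "E \<subseteq> sections I 0 \<and> (\<exists>D s p. s \<in> nonvan D \<and> (\<forall>i<n. p i \<in> forms D) \<and>
    (\<forall>t\<in>W. \<forall>q. F.Fr q t \<in> E \<longrightarrow> (\<exists>c. s * q - t * (\<Sum>i<n. cst (c i) * p i) \<in> I)))"
    if "R.dimension n K E" "K = range (const_section I)" for n K E
    using that
  proof (induction rule: R.dimension.induct)
    case (zero_dim K)
    have "\<exists>c. 1 * q - t * (\<Sum>i<(0::nat). cst (c i) * p i) \<in> I"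
      if "t \<in> W" "F.Fr q t \<in> {\<zero>\<^bsub>?R\<^esub>}" for t q p
      using that Fr_eq[OF that(1) F.one_W] by (simp add: R)
    hence "\<forall>t\<in>W. \<forall>q. F.Fr q t \<in> {\<zero>\<^bsub>?R\<^esub>} \<longrightarrow> (\<exists>c. 1 * q - t * (\<Sum>i<(0::nat). cst (c i) * p i) \<in> I)" for p by blast
    thus ?case
      using one_nonvan R.zero_closed by (intro conjI exI[of _ 0] exI[of _ 1] exI[of _ "\<lambda>_. 0"]) (auto simp: R)
  next
    case (Suc_dim v E n K)
    obtain D s p where IH: "E \<subseteq> sections I 0" "s \<in> nonvan D" "\<forall>i<n. p i \<in> forms D"
      "\<forall>t\<in>W. \<forall>q. F.Fr q t \<in> E \<longrightarrow> (\<exists>c. s * q - t * (\<Sum>i<n. cst (c i) * p i) \<in> I)"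
      using Suc_dim.IH[OF Suc_dim.prems] by (elim exE conjE) (rule that)
    obtain p0 s0 d0 where v: "v = F.Fr p0 s0" "s0 \<in> nonvan d0" "s0 \<in> W" "p0 \<in> forms (d0 + 0)"
      using sectionE[OF Suc_dim.hyps(1)[unfolded R]] .
    have mem: "x \<in> R.line_extension K v E \<Longrightarrow> \<exists>k. \<exists>y\<in>E. x = (const_section I k \<otimes>\<^bsub>F.L\<^esub> v) \<oplus>\<^bsub>F.L\<^esub> y" for x
      unfolding R.line_extension_def Suc_dim.prems by (auto simp: set_add_def' r_coset_def R)
    define p' where "p' = (\<lambda>i. if i < n then p i * s0 else p0 * s)"
    have "R.line_extension K v E \<subseteq> sections I 0"
    proof
      fix x assume "x \<in> R.line_extension K v E"
      then obtain k y where "y \<in> E" "x = (const_section I k \<otimes>\<^bsub>F.L\<^esub> v) \<oplus>\<^bsub>F.L\<^esub> y" using mem by blast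
      moreover have "const_section I k \<otimes>\<^bsub>F.L\<^esub> v \<in> sections I 0"
        using section_mult[OF const_section_mem, of v 0] Suc_dim.hyps(1) by (simp add: R)
      ultimately show "x \<in> sections I 0" using section_add IH(1) by blast
    qed
    moreover have "s * s0 \<in> nonvan (D + d0)" by (rule nonvan_mult[OF IH(2) v(2)])
    moreover have "p' i \<in> forms (D + d0)" for i
      using forms_mult[of "p i" D s0 d0] forms_mult_eq[OF v(4) nonvan_form[OF IH(2)], of "D + d0"] IH(3) nonvan_form[OF v(2)]
        forms_0
      by (cases "i < n") (auto simp: p'_def)
    moreover have "\<exists>c. s * s0 * q - t * (\<Sum>i<Suc n. cst (c i) * p' i) \<in> I"
      if t: "t \<in> W" and q: "F.Fr q t \<in> R.line_extension K v E" for t q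
    proof -
      obtain k y where y: "y \<in> E" "F.Fr q t = (const_section I k \<otimes>\<^bsub>F.L\<^esub> v) \<oplus>\<^bsub>F.L\<^esub> y" using mem[OF q] by blast
      obtain a b d where ab: "y = F.Fr a b" "b \<in> W" using sectionE[of y 0] y(1) IH(1) by blast
      obtain c where c: "s * a - b * (\<Sum>i<n. cst (c i) * p i) \<in> I" using IH(4) ab y(1) by blast
      have "F.Fr q t = F.Fr (cst k * p0 * b + a * s0) (s0 * b)"
        using y(2) v(3) ab F.one_W F.mult_W by (simp add: const_section_eq v(1) F.Fr_mult F.Fr_add)
      hence e: "q * (s0 * b) - (cst k * p0 * b + a * s0) * t \<in> I" using Fr_eq[OF t F.mult_W[OF v(3) ab(2)]] by blast
      have s: "(\<Sum>i<Suc n. cst ((c(n := k)) i) * p' i) = (\<Sum>i<n. cst (c i) * p i) * s0 + cst k * p0 * s"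
        by (simp add: p'_def sum_distrib_right mult.assoc)
      have "b * (s * s0 * q - t * (\<Sum>i<Suc n. cst ((c(n := k)) i) * p' i)) \<in> I"
        unfolding s by (rule comb2[OF e c, of _ s "t * s0"]) (simp add: algebra_simps)
      thus ?thesis using W_nzd[OF ab(2)] by blast
    qed
    ultimately show ?case by blast
  qed
  from this[OF dim refl] obtain D s p where *: "s \<in> nonvan D" "\<forall>i<n. p i \<in> forms D"
    "\<forall>t\<in>W. \<forall>q. F.Fr q t \<in> sections I 0 \<longrightarrow> (\<exists>c. s * q - t * (\<Sum>i<n. cst (c i) * p i) \<in> I)"
    by (elim exE conjE) (rule that)
  show ?thesis
  proof (intro exI[of _ D] exI[of _ s] exI[of _ p] conjI allI ballI)
    fix d t and q :: "('v, 'k) mpoly" assume "t \<in> nonvan d" "q \<in> forms d"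
    thus "\<exists>c. s * q - t * (\<Sum>i<n. cst (c i) * p i) \<in> I"
      using *(3) W_nonvan sectionI[of t d q 0] by auto
  qed (use * in auto)
qed

lemma dependent_if_has_degree:
  assumes deg: "has_degree I n" and t: "t \<in> nonvan d" and Y: "finite Y" "n < card Y"
    and q: "\<And>j. j \<in> Y \<Longrightarrow> q j \<in> forms d"
  shows "\<exists>c. (\<exists>j\<in>Y. c j \<noteq> 0) \<and> (\<Sum>j\<in>Y. cst (c j) * q j) \<in> I"
proof -
  obtain D s p where s: "s \<in> nonvan D" and
    *: "\<forall>d. \<forall>t\<in>nonvan d. \<forall>q\<in>forms d. \<exists>c. s * q - t * (\<Sum>i<n. cst (c i) * p i) \<in> I"
    using coordinates_if_has_degree[OF deg] by (elim exE conjE) (rule that)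
  have "\<forall>j\<in>Y. \<exists>c. s * q j - t * (\<Sum>i<n. cst (c i) * p i) \<in> I" using * t q by blast
  then obtain a where a: "\<forall>j\<in>Y. s * q j - t * (\<Sum>i<n. cst (a j i) * p i) \<in> I" by (rule bchoice[THEN exE])
  obtain c where c: "\<exists>j\<in>Y. c j \<noteq> 0" "\<forall>i\<in>{..<n}. (\<Sum>j\<in>Y. c j * a j i) = 0"
    using exists_linear_dependency[of "{..<n}" Y a] Y by auto
  have "(\<Sum>j\<in>Y. cst (c j) * (s * q j - t * (\<Sum>i<n. cst (a j i) * p i))) \<in> I"
    using a by (intro sum mult) blast
  also have "(\<Sum>j\<in>Y. cst (c j) * (s * q j - t * (\<Sum>i<n. cst (a j i) * p i)))
    = s * (\<Sum>j\<in>Y. cst (c j) * q j) - t * (\<Sum>j\<in>Y. \<Sum>i<n. cst (c j * a j i) * p i)"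
    by (simp add: sum_subtractf sum_distrib_left algebra_simps cst_mult)
  also have "(\<Sum>j\<in>Y. \<Sum>i<n. cst (c j * a j i) * p i) = (\<Sum>i<n. cst (\<Sum>j\<in>Y. c j * a j i) * p i)"
    by (subst sum.swap) (simp add: cst_sum sum_distrib_right)
  also have "\<dots> = 0" by (rule sum.neutral) (use c(2) in simp)
  finally show ?thesis using c(1) nonvan_nzd[OF s] by auto
qed

end

section \<open>Triviality of the twisting sheaf on a finite scheme\<close>

text \<open>
  Setting \<open>t = 1\<close> loses nothing in a single degree: compare components from below, and use that the
  components of \<open>y\<close> vanish in the end.
\<close>

lemma (in poly_ideal) homogeneous_in_dehomogenization:
  assumes hom: "homogeneous_ideal I" and t: "t \<in> forms D" "0 < D" "\<And>p. t * p \<in> I \<Longrightarrow> p \<in> I"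
    and p: "p \<in> forms m" "p - (t - 1) * y \<in> I"
  shows "p \<in> I"
proof -
  interpret homogeneous_ideal I by fact
  have comp: "(if i = m then p else 0) - (if D \<le> i then t * hcomp (i - D) y else 0) + hcomp i y \<in> I" for i
  proof -
    have "hcomp i (p - (t - 1) * y) = (if i = m then p else 0) - (if D \<le> i then t * hcomp (i - D) y else 0) + hcomp i y"
      by (simp add: left_diff_distrib hcomp_diff hcomp_form[OF p(1)] hcomp_form_mult[OF t(1)])
    thus ?thesis using hcomp_mem[OF p(2), of i] by simp
  qed
  have below: "hcomp i y \<in> I" if "i < m" for i
    using that
  proof (induction i rule: less_induct)
    case (less i)
    show ?case
    proof (cases "D \<le> i")
      case True
      hence "hcomp (i - D) y \<in> I" using less t(2) by simp
      thus ?thesis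
        by (rule comb2[OF comp[of i], of _ _ 1 t]) (use True less.prems in simp)
    next
      case False
      thus ?thesis using comp[of i] less.prems by simp
    qed
  qed
  have above: "t ^ k * p + hcomp (m + D * k) y \<in> I" for k
  proof (induction k)
    case 0
    have "(if D \<le> m then t * hcomp (m - D) y else 0) \<in> I" using below[of "m - D"] t(2) mult by auto
    thus ?case by (rule comb2[OF comp[of m], of _ _ 1 1]) simp
  next
    case (Suc k)
    show ?case by (rule comb2[OF comp[of "m + D * Suc k"] Suc, of _ 1 t]) (use t(2) in \<open>simp add: algebra_simps\<close>)
  qed
  obtain K where K: "\<forall>d\<ge>K. hcomp d y = 0" using hcomp_eventually_0 by blast
  have "K \<le> m + D * K" using t(2) by (cases D) auto
  hence "t ^ K * p \<in> I" using above[of K] K by simp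
  thus ?thesis by (induction K) (auto simp: mult.assoc dest: t(3))
qed

lemma (in poly_ideal) radical_of_colon: "poly_ideal {p. \<exists>M. p ^ M * g \<in> I}"
proof
  show "0 \<in> {p. \<exists>M. p ^ M * g \<in> I}" by (auto intro!: exI[of _ "1"])
  fix p q assume "p \<in> {p. \<exists>M. p ^ M * g \<in> I}"
  then obtain M where M: "p ^ M * g \<in> I" by blast
  have "(q * p) ^ M * g \<in> I" by (rule comb1[OF M, of _ "q ^ M"]) (simp add: power_mult_distrib mult.assoc)
  thus "q * p \<in> {p. \<exists>M. p ^ M * g \<in> I}" by blast
  assume "q \<in> {p. \<exists>M. p ^ M * g \<in> I}"
  then obtain M' where M': "q ^ M' * g \<in> I" by blast
  have "of_nat (M + M' choose k) * p ^ k * q ^ (M + M' - k) * g \<in> I" for k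
  proof (cases "M \<le> k")
    case True
    hence "p ^ k = p ^ (k - M) * p ^ M" by (simp add: power_add[symmetric])
    thus ?thesis by (intro comb1[OF M, of _ "of_nat (M + M' choose k) * p ^ (k - M) * q ^ (M + M' - k)"]) (simp add: mult.assoc mult.left_commute)
  next
    case False
    hence "q ^ (M + M' - k) = q ^ (M - k) * q ^ M'" by (simp add: power_add[symmetric])
    thus ?thesis by (intro comb1[OF M', of _ "of_nat (M + M' choose k) * p ^ k * q ^ (M - k)"]) (simp add: mult.assoc)
  qed
  hence "(\<Sum>k\<le>M + M'. of_nat (M + M' choose k) * p ^ k * q ^ (M + M' - k) * g) \<in> I" by (intro sum)
  hence "(p + q) ^ (M + M') * g \<in> I" by (simp only: binomial_ring sum_distrib_right)
  thus "p + q \<in> {p. \<exists>M. p ^ M * g \<in> I}" by blast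
qed

text \<open>
  A nowhere vanishing section of \<open>O(1)\<close> exists because a finite scheme is a disjoint union of pieces on
  each of which some variable is invertible, and these variables can be glued. The
  computation takes place in \<open>S\<close> modulo \<open>I\<close> and \<open>t - 1\<close>, where \<open>t\<close> is a nowhere vanishing form of
  degree \<open>D\<close>; degrees then make sense modulo \<open>D\<close>, and \<open>graded c\<close> consists of the elements of degree
  \<open>c\<close>, that is, of the sections of \<open>O(c)\<close>.
\<close>

context closed_ideal
begin

context
  fixes t :: "('v, 'k) mpoly" and D n :: nat
  assumes t: "t \<in> nonvan D" and D: "0 < D" and deg: "has_degree I n"
begin

definition I\<^sub>t :: "('v, 'k) mpoly set" where "I\<^sub>t = {p. \<exists>y. p - (t - 1) * y \<in> I}"

definition graded :: "nat \<Rightarrow> ('v, 'k) mpoly set"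
  where "graded c = {p. \<exists>k. \<exists>q\<in>forms (D * k + c). p - q \<in> I\<^sub>t}"

lemma I\<^sub>t: "poly_ideal I\<^sub>t"
  unfolding I\<^sub>t_def by (rule poly_ideal_add_principal) unfold_locales

lemma t_cong: "p * t ^ j - p \<in> I\<^sub>t"
proof -
  interpret A: poly_ideal I\<^sub>t by (rule I\<^sub>t)
  have 1: "t - 1 \<in> I\<^sub>t" unfolding I\<^sub>t_def by (auto intro!: exI[of _ 1])
  have "t ^ j - 1 ^ j \<in> I\<^sub>t" by (rule A.cong_power[OF 1])
  thus ?thesis by (rule A.comb1[of _ _ p]) (simp add: algebra_simps)
qed

lemma I_sub: "I \<subseteq> I\<^sub>t"
  unfolding I\<^sub>t_def by (auto intro!: exI[of _ 0])

lemma gradedI: "p \<in> forms (D * k + c) \<Longrightarrow> p \<in> graded c"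
  unfolding graded_def using poly_ideal.zero[OF I\<^sub>t] by (auto intro!: exI[of _ k] bexI[of _ p])

lemma graded_mult: "p \<in> graded a \<Longrightarrow> q \<in> graded b \<Longrightarrow> p * q \<in> graded (a + b)"
proof -
  interpret A: poly_ideal I\<^sub>t by (rule I\<^sub>t)
  assume "p \<in> graded a" "q \<in> graded b"
  then obtain k p' l q' where p: "p' \<in> forms (D * k + a)" "p - p' \<in> I\<^sub>t" and q: "q' \<in> forms (D * l + b)" "q - q' \<in> I\<^sub>t"
    by (auto simp: graded_def)
  have "p' * q' \<in> forms (D * (k + l) + (a + b))"
    by (rule forms_mult_eq[OF p(1) q(1)]) (simp add: algebra_simps)
  thus ?thesis unfolding graded_def using A.cong_mult[OF p(2) q(2)] by blast
qed

lemma graded_add: "p \<in> graded a \<Longrightarrow> q \<in> graded a \<Longrightarrow> p + q \<in> graded a"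
proof -
  interpret A: poly_ideal I\<^sub>t by (rule I\<^sub>t)
  assume "p \<in> graded a" "q \<in> graded a"
  then obtain k p' l q' where p: "p' \<in> forms (D * k + a)" "p - p' \<in> I\<^sub>t" and q: "q' \<in> forms (D * l + a)" "q - q' \<in> I\<^sub>t"
    by (auto simp: graded_def)
  have tf: "t ^ j \<in> forms (D * j)" for j by (rule forms_power[OF nonvan_form[OF t]])
  have "p' * t ^ l + q' * t ^ k \<in> forms (D * (k + l) + a)"
    by (intro forms_add forms_mult_eq[OF p(1) tf] forms_mult_eq[OF q(1) tf]) (auto simp: algebra_simps)
  moreover have "(p + q) - (p' * t ^ l + q' * t ^ k) \<in> I\<^sub>t"
    using A.cong_add[OF A.cong_trans[OF p(2) A.cong_sym[OF t_cong[of p' l]]]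
      A.cong_trans[OF q(2) A.cong_sym[OF t_cong[of q' k]]]] .
  ultimately show ?thesis unfolding graded_def by blast
qed

lemma graded_0: "0 \<in> graded a" "cst c \<in> graded 0" "1 \<in> graded 0"
  by (rule gradedI[of _ 0]; simp)+

lemma graded_cst_mult: "p \<in> graded a \<Longrightarrow> cst c * p \<in> graded a"
  using graded_mult[OF graded_0(2), of p a c] by simp

lemma graded_diff: "p \<in> graded a \<Longrightarrow> q \<in> graded a \<Longrightarrow> p - q \<in> graded a"
  using graded_add[OF _ graded_cst_mult[of q a "-1"], of p] by (simp add: cst_uminus)

lemma graded_power: "p \<in> graded 0 \<Longrightarrow> p ^ k \<in> graded 0"
  by (induction k) (auto simp: graded_0 dest: graded_mult)

lemma graded_sum: "(\<And>i. i \<in> A \<Longrightarrow> p i \<in> graded a) \<Longrightarrow> sum p A \<in> graded a"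
  by (induction A rule: infinite_finite_induct) (auto simp: graded_0 intro: graded_add)

text \<open>
The dimension bounds the number of independent powers of \<open>a\<close>, as in \<open>power_stabilizes\<close>.
\<close>

lemma graded_powers_stabilize:
  assumes a: "a \<in> forms D"
  shows "\<exists>j. \<exists>b\<in>graded 0. a ^ j - a ^ Suc j * b \<in> I\<^sub>t"
proof -
  interpret A: poly_ideal I\<^sub>t by (rule I\<^sub>t)
  have "a ^ i * t ^ (n - i) \<in> forms (D * n)" if "i \<in> {..n}" for i
    by (rule forms_mult_eq[OF forms_power[OF a] forms_power[OF nonvan_form[OF t]]])
      (use that in \<open>simp add: distrib_left[symmetric]\<close>)
  then obtain c where c: "\<exists>i\<in>{..n}. c i \<noteq> 0" "(\<Sum>i\<le>n. cst (c i) * (a ^ i * t ^ (n - i))) \<in> I"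
    using dependent_if_has_degree[OF deg nonvan_power[OF t, of n], of "{..n}" "\<lambda>i. a ^ i * t ^ (n - i)"] by auto
  have "(\<Sum>i\<le>n. cst (c i) * a ^ i * t ^ (n - i) - cst (c i) * a ^ i) \<in> I\<^sub>t" by (rule A.sum) (rule t_cong)
  hence d: "(\<Sum>i\<le>n. cst (c i) * a ^ i) \<in> I\<^sub>t"
    by (rule A.comb2[of _ "\<Sum>i\<le>n. cst (c i) * (a ^ i * t ^ (n - i))" _ "-1" 1])
      (use c(2) I_sub in \<open>auto simp: sum_subtractf mult.assoc\<close>)
  define j where "j = (LEAST i. i \<le> n \<and> c i \<noteq> 0)"
  have j: "j \<le> n" "c j \<noteq> 0" using LeastI_ex[of "\<lambda>i. i \<le> n \<and> c i \<noteq> 0"] c(1) by (auto simp: j_def)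
  have below: "c i = 0" if "i < j" for i
    using not_less_Least[of i "\<lambda>i. i \<le> n \<and> c i \<noteq> 0"] that j(1) by (auto simp: j_def)
  define w where "w = (\<Sum>i\<in>{Suc j..n}. cst (c i) * a ^ (i - Suc j))"
  have "(\<Sum>i\<le>n. cst (c i) * a ^ i) = (\<Sum>i\<in>{j..n}. cst (c i) * a ^ i)"
    by (rule sum.mono_neutral_right) (use below in \<open>auto simp: not_le\<close>)
  also have "\<dots> = cst (c j) * a ^ j + (\<Sum>i\<in>{Suc j..n}. cst (c i) * a ^ i)"
    using j by (simp add: sum.atLeast_Suc_atMost)
  also have "(\<Sum>i\<in>{Suc j..n}. cst (c i) * a ^ i) = a ^ Suc j * w"
    unfolding w_def sum_distrib_left
    by (rule sum.cong) (auto simp: mult.left_commute[of "a ^ _" "cst _"] power_add[symmetric] simp del: power_Suc)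
  finally have "cst (inverse (c j)) * (cst (c j) * a ^ j + a ^ Suc j * w) \<in> I\<^sub>t" using d by (intro A.mult) simp
  also have "cst (inverse (c j)) * (cst (c j) * a ^ j + a ^ Suc j * w) =
    (cst (inverse (c j)) * cst (c j)) * a ^ j - a ^ Suc j * (cst (- inverse (c j)) * w)"
    by (simp add: algebra_simps cst_uminus)
  also have "\<dots> = a ^ j - a ^ Suc j * (cst (- inverse (c j)) * w)" by (simp only: cst_inverse[OF j(2)] mult_1)
  finally have "a ^ j - a ^ Suc j * (cst (- inverse (c j)) * w) \<in> I\<^sub>t" .
  moreover have "w \<in> graded 0"
    unfolding w_def by (intro graded_sum graded_cst_mult graded_power gradedI[of _ 1]) (use a in simp)
  ultimately show ?thesis using graded_cst_mult by blast
qed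

text \<open>
  The idempotent \<open>e\<close> is the union of the pieces on which one of the variables in \<open>S\<close> is invertible,
  and \<open>u\<close> is a section of \<open>O(1)\<close> that is invertible there, with inverse \<open>w\<close>. A new variable \<open>x\<close> has a
  Fitting idempotent \<open>\<epsilon>\<close>, on which it is invertible, and it is used on the part of \<open>\<epsilon>\<close> outside \<open>e\<close>.
\<close>

lemma partial_unit:
  assumes "finite S"
  shows "\<exists>e\<in>graded 0. \<exists>u\<in>graded 1. \<exists>w\<in>graded (D - 1). e * e - e \<in> I\<^sub>t \<and> u * w - e \<in> I\<^sub>t \<and>
    (\<forall>v\<in>S. \<exists>M. pvar v ^ M * (1 - e) \<in> I\<^sub>t)"
  using assms
proof induction
  case empty
  have z: "0 \<in> I\<^sub>t" using poly_ideal.zero[OF I\<^sub>t] .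
  show ?case
    by (rule bexI[OF bexI[OF bexI[OF _ graded_0(1)] graded_0(1)] graded_0(1)]) (simp add: z)
next
  case (insert v S)
  interpret A: poly_ideal I\<^sub>t by (rule I\<^sub>t)
  obtain e u w where e: "e \<in> graded 0" "e * e - e \<in> I\<^sub>t" and u: "u \<in> graded 1" "w \<in> graded (D - 1)" "u * w - e \<in> I\<^sub>t"
    and S: "\<forall>v\<in>S. \<exists>M. pvar v ^ M * (1 - e) \<in> I\<^sub>t" using insert.IH by (elim bexE conjE) (rule that)
  let ?x = "pvar v :: ('v, 'k) mpoly"
  have xD: "?x ^ D \<in> forms D" by (rule forms_power_1) simp
  obtain j b where b: "b \<in> graded 0" "(?x ^ D) ^ j - (?x ^ D) ^ Suc j * b \<in> I\<^sub>t"
    using graded_powers_stabilize[OF xD] by blast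
  define a where "a = ?x ^ D"
  have a: "a \<in> graded 0" unfolding a_def by (rule gradedI[of _ 1]) (use xD in simp)
  have st: "a ^ j - a ^ j * (a * b) \<in> I\<^sub>t" using b(2) by (simp add: a_def mult.assoc mult.left_commute mult.commute)
  have st': "a ^ j - a ^ j * (a * b) ^ i \<in> I\<^sub>t" for i
  proof (induction i)
    case (Suc i)
    show ?case by (rule A.comb2[OF Suc st, of _ 1 "(a * b) ^ i"]) (simp add: algebra_simps)
  qed simp
  define \<epsilon> where "\<epsilon> = (a * b) ^ j"
  have \<epsilon>: "\<epsilon> \<in> graded 0" unfolding \<epsilon>_def using graded_power graded_mult[OF a b(1)] by simp
  have \<epsilon>i: "\<epsilon> * (a * b) ^ i - \<epsilon> \<in> I\<^sub>t" for i
    by (rule A.comb1[OF st'[of i], of _ "- (b ^ j)"]) (simp add: \<epsilon>_def power_mult_distrib algebra_simps)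
  have \<epsilon>\<epsilon>: "\<epsilon> * \<epsilon> - \<epsilon> \<in> I\<^sub>t" using \<epsilon>i[of j] by (simp add: \<epsilon>_def)
  have nil: "a ^ j * (1 - \<epsilon>) \<in> I\<^sub>t" using st'[of j] by (simp add: \<epsilon>_def algebra_simps)
  define e' where "e' = e + (1 - e) * \<epsilon>"
  define u' where "u' = u * e + (1 - e) * \<epsilon> * ?x"
  define r where "r = ?x ^ (D - 1) * b"
  define w' where "w' = w * e + (1 - e) * \<epsilon> * r"
  have 1: "(1 - e) * \<epsilon> \<in> graded 0" using graded_mult[OF graded_diff[OF graded_0(3) e(1)] \<epsilon>] by simp
  have x1: "?x \<in> graded 1" by (rule gradedI[of _ 0]) simp
  have xD1: "?x ^ (D - 1) \<in> graded (D - 1)" by (rule gradedI[of _ 0]) (simp add: forms_power_1)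
  have "e' \<in> graded 0" unfolding e'_def by (rule graded_add[OF e(1) 1])
  moreover have "u' \<in> graded 1" unfolding u'_def
    using graded_add[OF graded_mult[OF u(1) e(1)], of "(1 - e) * \<epsilon> * ?x"] graded_mult[OF 1 x1] by simp
  moreover have "w' \<in> graded (D - 1)" unfolding w'_def
    using graded_add[OF graded_mult[OF u(2) e(1)], of "(1 - e) * \<epsilon> * r"]
      graded_mult[OF 1 graded_mult[OF xD1 b(1)]] by (simp add: r_def)
  moreover have "e' * e' - e' \<in> I\<^sub>t" unfolding e'_def
    by (rule A.comb2[OF e(2) \<epsilon>\<epsilon>, of _ "1 - 2 * \<epsilon> + \<epsilon> * \<epsilon>" "1 - e"]) (simp add: algebra_simps)
  moreover have "u' * w' - e' \<in> I\<^sub>t"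
  proof -
    have xx: "?x * (?x ^ (D - 1) * b) = a * b"
      unfolding a_def by (simp add: mult.assoc[symmetric] power_Suc[symmetric] D del: power_Suc)
    hence \<epsilon>1: "\<epsilon> * (?x * r) - \<epsilon> \<in> I\<^sub>t" using \<epsilon>i[of 1] by (simp add: r_def)
    have r: "e * e * (u * w - e) + (e + 1 - (u * \<epsilon> * r + \<epsilon> * ?x * w) + \<epsilon>) * (e * e - e) \<in> I\<^sub>t"
      by (rule A.comb2[OF u(3) e(2) refl])
    show ?thesis
      by (rule A.comb3[OF r \<epsilon>1 \<epsilon>\<epsilon>, of _ 1 "(1 - e) * (1 - e) * \<epsilon>" "(1 - e) * (1 - e)"])
        (simp add: u'_def w'_def e'_def algebra_simps)
  qed
  moreover have "\<exists>M. pvar v' ^ M * (1 - e') \<in> I\<^sub>t" if v': "v' \<in> insert v S" for v'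
  proof (cases "v' = v")
    case True
    have "?x ^ (D * j) * (1 - e') \<in> I\<^sub>t"
      by (rule A.comb1[OF nil, of _ "1 - e"]) (simp add: e'_def a_def power_mult algebra_simps)
    thus ?thesis using True by blast
  next
    case False
    then obtain M where M: "pvar v' ^ M * (1 - e) \<in> I\<^sub>t" using S v' by blast
    have "pvar v' ^ M * (1 - e') \<in> I\<^sub>t"
      by (rule A.comb1[OF M, of _ "1 - \<epsilon>"]) (simp add: e'_def algebra_simps)
    thus ?thesis ..
  qed
  ultimately show ?case by blast
qed

text \<open>
  When all variables are treated, every form of positive degree is nilpotent outside \<open>e\<close>. As \<open>t\<close> is
  both nilpotent and equal to 1 there, \<open>e = 1\<close>.
\<close>

lemma unit_of_degree_one: "\<exists>u d s. u \<in> nonvan (Suc d) \<and> s \<in> nonvan d"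
proof -
  interpret A: poly_ideal I\<^sub>t by (rule I\<^sub>t)
  obtain e u w where e: "e \<in> graded 0" "e * e - e \<in> I\<^sub>t" and u: "u \<in> graded 1" "w \<in> graded (D - 1)" "u * w - e \<in> I\<^sub>t"
    and S: "\<forall>v\<in>UNIV. \<exists>M. pvar v ^ M * (1 - e) \<in> I\<^sub>t" using partial_unit[of UNIV, OF finite] by (elim bexE conjE) (rule that)
  define R where "R = {p. \<exists>M. p ^ M * (1 - e) \<in> I\<^sub>t}"
  interpret R: poly_ideal R unfolding R_def by (rule A.radical_of_colon)
  have "V \<subseteq> R"
  proof
    fix p :: "('v, 'k) mpoly" assume "p \<in> V"
    hence "p = (\<Sum>v\<in>UNIV. cst (coord p v) * pvar v)" by (rule forms_1_expand)
    moreover have "pvar v \<in> R" for v using S by (auto simp: R_def)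
    ultimately show "p \<in> R" by (metis (no_types, lifting) R.sum R.mult)
  qed
  hence "forms D \<subseteq> R" by (rule forms_subset_mono[OF R.poly_ideal_axioms]) (use D in simp)
  then obtain M where M: "t ^ M * (1 - e) \<in> I\<^sub>t" using nonvan_form[OF t] by (auto simp: R_def)
  have "1 - e \<in> I\<^sub>t" by (rule A.comb2[OF t_cong[of "1 - e" M] M, of _ "-1" 1]) (simp add: algebra_simps)
  hence uw: "u * w - 1 \<in> I\<^sub>t" by (rule A.comb2[OF u(3), of _ _ 1 "-1"]) simp
  obtain k U where U: "U \<in> forms (D * k + 1)" "u - U \<in> I\<^sub>t" using u(1) by (auto simp: graded_def)
  obtain l V where V: "V \<in> forms (D * l + (D - 1))" "w - V \<in> I\<^sub>t" using u(2) by (auto simp: graded_def)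
  let ?m = "k + l + 1"
  have tf: "t ^ j \<in> forms (D * j)" for j by (rule forms_power[OF nonvan_form[OF t]])
  have "U * V \<in> forms (D * ?m)" by (rule forms_mult_eq[OF U(1) V(1)]) (use D in \<open>simp add: algebra_simps\<close>)
  hence hom: "t ^ ?m - U * V \<in> forms (D * ?m)" using tf[of ?m] by (intro forms_diff)
  have "u * w - U * V \<in> I\<^sub>t" by (rule A.cong_mult[OF U(2) V(2)])
  hence "t ^ ?m - U * V \<in> I\<^sub>t"
    using A.comb3[OF t_cong[of 1 ?m] uw, of "u * w - U * V" _ 1 "-1" 1] by simp
  then obtain y where y: "(t ^ ?m - U * V) - (t - 1) * y \<in> I" by (auto simp: I\<^sub>t_def)
  have "t ^ ?m - V * U \<in> I"
    using homogeneous_in_dehomogenization[OF homogeneous_ideal_axioms nonvan_form[OF t] D nonvan_nzd[OF t] hom y]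
    by (simp add: mult.commute)
  hence "U \<in> nonvan (Suc (D * k))"
    using nonvan_divisor[OF nonvan_power[OF t, of ?m], of U "Suc (D * k)" V] U(1) by (simp add: Suc_eq_plus1)
  thus ?thesis using nonvan_power[OF t, of k] by blast
qed

end

text \<open>
  Multiplication by \<open>t/u\<close> embeds the sections of \<open>O(1)\<close> into the structure ring, and they contain
  \<open>V\<close>, which has the same dimension as the structure ring.
\<close>

lemma divide_nonvanishing:
  assumes deg: "has_degree I CARD('v)" and linear: "\<And>x. x \<in> V \<Longrightarrow> x \<in> I \<Longrightarrow> x = 0"
    and u: "u \<in> nonvan (Suc d)" and t: "t \<in> nonvan d" and s: "s \<in> nonvan e" and p: "p \<in> forms (Suc e)"
  shows "\<exists>x\<in>V. p - s * x \<in> I"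
proof -
  define q where "q j = (case j of None \<Rightarrow> p * t | Some v \<Rightarrow> pvar v * (s * t))" for j
  have "q j \<in> forms (Suc d + e)" for j
  proof (cases j)
    case None
    thus ?thesis using forms_mult_eq[OF p nonvan_form[OF t], of "Suc d + e"] by (simp add: q_def)
  next
    case (Some v)
    thus ?thesis using forms_mult_1[OF pvar_in_forms[of v] nonvan_form[OF nonvan_mult[OF s t]]]
      by (simp add: q_def add.commute)
  qed
  moreover have "CARD('v) < card (UNIV :: 'v option set)" by simp
  ultimately obtain c where c: "\<exists>j\<in>UNIV. c j \<noteq> 0" "(\<Sum>j\<in>UNIV. cst (c j) * q j) \<in> I"
    using dependent_if_has_degree[OF deg nonvan_mult[OF u s], of UNIV q] by auto
  define x where "x = (\<Sum>v\<in>UNIV. cst (c (Some v)) * pvar v)"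
  have x: "x \<in> V" unfolding x_def by (intro forms_sum forms_cst_mult) simp
  have "(\<Sum>j\<in>UNIV. cst (c j) * q j) = t * (cst (c None) * p + s * x)"
    by (simp add: UNIV_option_conv sum.reindex q_def x_def sum_distrib_left algebra_simps)
  hence px: "cst (c None) * p + s * x \<in> I" using c(2) nonvan_nzd[OF t] by simp
  have c0: "c None \<noteq> 0"
  proof
    assume "c None = 0"
    hence "x \<in> I" using px nonvan_nzd[OF s] by simp
    hence "x = 0" using linear x by blast
    have "c (Some v) = coord x v" for v by (simp add: x_def coord_sum if_distrib cong: if_cong)
    hence "c j = 0" for j using \<open>x = 0\<close> \<open>c None = 0\<close> by (cases j) auto
    thus False using c(1) by blast
  qed
  have "cst (inverse (c None)) * (cst (c None) * p + s * x) \<in> I" using px by (rule mult)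
  also have "cst (inverse (c None)) * (cst (c None) * p + s * x) = (cst (inverse (c None)) * cst (c None)) * p - s * (cst (- inverse (c None)) * x)"
    by (simp add: algebra_simps cst_uminus)
  also have "\<dots> = p - s * (cst (- inverse (c None)) * x)" by (simp only: cst_inverse[OF c0] mult_1)
  finally show ?thesis using forms_cst_mult[OF x] by blast
qed

end

locale basis_subscheme = closed_ideal I + basis_ideal I v for I :: "('v::finite, 'k::field) mpoly set" and v +
  assumes divide: "s \<in> nonvanishing_forms I d \<Longrightarrow> p \<in> forms (Suc d) \<Longrightarrow> \<exists>x\<in>V. p - s * x \<in> I"
    and v_nonvan: "v \<in> nonvanishing_forms I 1"

theorem basis_subscheme_if_is_basis:
  fixes I :: "('v::finite, 'k::field) mpoly set"
  assumes "is_basis I" shows "\<exists>v. basis_subscheme I v"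
proof -
  have sub: "closed_subscheme I" "\<exists>d>0. nonvanishing_forms I d \<noteq> {}" and deg: "has_degree I CARD('v)"
    and nd: "nondegenerate I"
    using assms by (auto simp: is_basis_def finite_subscheme_def)
  interpret closed_ideal I by (rule closed_ideal_if_closed_subscheme[OF sub(1)])
  have linear: "x = 0" if x: "x \<in> V" "x \<in> I" for x
  proof (rule ccontr)
    assume "x \<noteq> 0"
    moreover have "PIdl\<^bsub>polys\<^esub> x \<subseteq> I" using x(2) mult by (auto simp: PIdl_polys)
    ultimately show False using nd x(1) unfolding nondegenerate_def by blast
  qed
  obtain D t where t: "0 < D" "t \<in> nonvan D" using sub(2) by blast
  obtain u d s where us: "u \<in> nonvan (Suc d)" "s \<in> nonvan d"
    using unit_of_degree_one[OF t(2,1) deg] by (elim exE conjE) (rule that)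
  have divide: "\<exists>x\<in>V. p - s * x \<in> I" if "s \<in> nonvan e" "p \<in> forms (Suc e)" for s e p
    by (rule divide_nonvanishing[OF deg linear us that])
  obtain v where v: "v \<in> V" "u - s * v \<in> I" using divide[OF us(2) nonvan_form[OF us(1)]] by blast
  have vn: "v \<in> nonvan 1" by (rule nonvan_divisor[OF us(1) v])
  have "basis_subscheme I v"
  proof
    show "v \<in> V" by (rule v(1))
    show "v * p \<in> I \<Longrightarrow> p \<in> I" for p by (rule nonvan_nzd[OF vn])
    show "x \<in> V \<Longrightarrow> x \<in> I \<Longrightarrow> x = 0" for x by (rule linear)
    show "p \<in> forms 2 \<Longrightarrow> \<exists>x\<in>V. p - v * x \<in> I" for p using divide[OF vn, of p] by (simp add: numeral_2_eq_2 One_nat_def)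
    show "s \<in> nonvan d \<Longrightarrow> p \<in> forms (Suc d) \<Longrightarrow> \<exists>x\<in>V. p - s * x \<in> I" for s d p by (rule divide)
    show "v \<in> nonvan 1" by (rule vn)
  qed
  thus ?thesis ..
qed

section \<open>Serre duality on a finite scheme\<close>

context closed_ideal
begin

abbreviation sec_mult (infixl "\<star>" 70) where "x \<star> y \<equiv> x \<otimes>\<^bsub>F.L\<^esub> y"
abbreviation sec_add (infixl "\<bbbplus>" 65) where "x \<bbbplus> y \<equiv> x \<oplus>\<^bsub>F.L\<^esub> y"

text \<open>
  An element of \<open>K(-1)\<close> is determined by its values under the Serre pairing, and these can be any
  linear functional on the sections of \<open>O(1)\<close>. A map from \<open>O(1)\<close> to \<open>K(-1)\<close> is therefore a pairing on
  these sections, and it is a homomorphism of modules when multiplication by functions can be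
  moved from one argument to the other (\<open>twist_hom_iff\<close>).
\<close>

definition section_functional :: "(('v, 'k) section_fraction \<Rightarrow> 'k) \<Rightarrow> bool"
  where "section_functional \<tau> \<longleftrightarrow> (\<forall>x\<in>sections I 1. \<forall>y\<in>sections I 1. \<forall>c.
    \<tau> (x \<bbbplus> y) = \<tau> x + \<tau> y \<and> \<tau> (const_section I c \<star> x) = c * \<tau> x)"

lemma section_functionalD:
  assumes "section_functional \<tau>" "x \<in> sections I 1"
  shows "y \<in> sections I 1 \<Longrightarrow> \<tau> (x \<bbbplus> y) = \<tau> x + \<tau> y" "\<tau> (const_section I c \<star> x) = c * \<tau> x"
  using assms unfolding section_functional_def by blast+

text \<open>
The element of \<open>K(-1)\<close> with Serre pairing \<open>\<tau>\<close>.
\<close>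

definition tw :: "(('v, 'k) section_fraction \<Rightarrow> 'k) \<Rightarrow> ('v, 'k) section_fraction \<Rightarrow> ('v, 'k) section_fraction \<Rightarrow> 'k"
  where "tw \<tau> = (\<lambda>s\<in>sections I 1. \<lambda>a\<in>sections I 0. \<tau> (a \<star> s))"

abbreviation (input) twisted_dual ("\<K>") where "\<K> \<equiv> carrier (canonical_twist I)"

lemma one_section: "F.Fr 1 1 \<in> sections I 0"
  by (rule sectionI[OF one_nonvan]) simp

lemma section_mult_0: "a \<in> sections I 0 \<Longrightarrow> x \<in> sections I n \<Longrightarrow> a \<star> x \<in> sections I n"
  using section_mult[of a 0 x n] by simp

lemma section_algebra:
  assumes "x \<in> sections I l" "y \<in> sections I m" "z \<in> sections I n"
  shows "x \<star> y = y \<star> x" "x \<star> y \<star> z = x \<star> (y \<star> z)" "(x \<bbbplus> y) \<star> z = x \<star> z \<bbbplus> y \<star> z"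
    "z \<star> (x \<bbbplus> y) = z \<star> x \<bbbplus> z \<star> y" "F.Fr 1 1 \<star> x = x"
proof -
  interpret L: cring F.L by (rule F.cring_L)
  note c = assms[THEN section_carrier]
  show "x \<star> y = y \<star> x" by (rule L.m_comm[OF c(1,2)])
  show "x \<star> y \<star> z = x \<star> (y \<star> z)" "(x \<bbbplus> y) \<star> z = x \<star> z \<bbbplus> y \<star> z" "z \<star> (x \<bbbplus> y) = z \<star> x \<bbbplus> z \<star> y"
    using c by (simp_all add: L.m_assoc L.l_distr L.r_distr)
  show "F.Fr 1 1 \<star> x = x" using c L.l_one by (simp add: F.Fr_one)
qed

lemma canonical_carrier:
  "carrier (canonical_module I) = {\<eta> \<in> extensional (sections I 0). \<forall>x\<in>sections I 0. \<forall>y\<in>sections I 0. \<forall>c.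
     \<eta> (x \<bbbplus> y) = \<eta> x + \<eta> y \<and> \<eta> (const_section I c \<star> x) = c * \<eta> x}"
  by (auto simp: canonical_module_def mod_hom_def scalar_module_def section_ring_eq ring_of_type_algebra_def PiE_def)

lemma twist_carrier:
  "\<phi> \<in> carrier (canonical_twist I) \<longleftrightarrow> \<phi> \<in> sections I 1 \<rightarrow>\<^sub>E carrier (canonical_module I) \<and>
    (\<forall>x\<in>sections I 1. \<forall>y\<in>sections I 1. \<phi> (x \<bbbplus> y) = (\<lambda>b\<in>sections I 0. \<phi> x b + \<phi> y b)) \<and>
    (\<forall>a\<in>sections I 0. \<forall>x\<in>sections I 1. \<phi> (a \<star> x) = (\<lambda>b\<in>sections I 0. \<phi> x (a \<star> b)))"
  by (simp add: canonical_twist_def Hom_module_def mod_hom_def twist_def scalar_module_def structure_ring_def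
    section_ring_eq canonical_module_def)

lemma serre_eq: "serre_pairing I s \<phi> = \<phi> s (F.Fr 1 1)"
  by (simp add: serre_pairing_def trace_def section_ring_eq F.Fr_one)

lemma tw_mem:
  assumes \<tau>: "section_functional \<tau>" shows "tw \<tau> \<in> \<K>"
  unfolding twist_carrier canonical_carrier
proof (intro conjI ballI PiE_I CollectI allI)
  show "tw \<tau> s = undefined" if "s \<notin> sections I 1" for s using that by (simp add: tw_def)
  fix s assume s: "s \<in> sections I 1"
  thus "tw \<tau> s \<in> extensional (sections I 0)" by (simp add: tw_def)
  fix a assume a: "a \<in> sections I 0"
  show "tw \<tau> s (const_section I c \<star> a) = c * tw \<tau> s a" for c
    using section_functionalD(2)[OF \<tau> section_mult_0[OF a s]] s a
    by (simp add: tw_def section_mult_0 const_section_mem section_algebra(2)[OF const_section_mem a s])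
  show "tw \<tau> s (a \<bbbplus> b) = tw \<tau> s a + tw \<tau> s b" if b: "b \<in> sections I 0" for b
    using section_functionalD(1)[OF \<tau> section_mult_0[OF a s] section_mult_0[OF b s]] s a b
    by (simp add: tw_def section_add section_algebra(3)[OF a b s])
next
  fix s t assume s: "s \<in> sections I 1" and t: "t \<in> sections I 1"
  show "tw \<tau> (s \<bbbplus> t) = (\<lambda>b\<in>sections I 0. tw \<tau> s b + tw \<tau> t b)"
    using s t by (auto simp: tw_def section_add section_algebra(4)[OF s t] section_functionalD(1)[OF \<tau>] section_mult_0 intro!: restrict_ext)
next
  fix a s assume a: "a \<in> sections I 0" and s: "s \<in> sections I 1"
  have "b \<star> (a \<star> s) = (a \<star> b) \<star> s" if b: "b \<in> sections I 0" for b
    using section_algebra(2)[OF b a s] section_algebra(1)[OF a b s] by simp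
  thus "tw \<tau> (a \<star> s) = (\<lambda>b\<in>sections I 0. tw \<tau> s (a \<star> b))"
    using a s by (auto simp: tw_def section_mult_0 intro!: restrict_ext)
qed

lemma serre_tw:
  assumes "s \<in> sections I 1" shows "serre_pairing I s (tw \<tau>) = \<tau> s"
  using assms one_section section_algebra(5)[OF assms assms assms] by (simp add: serre_eq tw_def)

lemma serre_mult:
  assumes "\<phi> \<in> \<K>" "a \<in> sections I 0" "s \<in> sections I 1"
  shows "serre_pairing I (a \<star> s) \<phi> = \<phi> s a"
proof -
  have "a \<star> F.Fr 1 1 = a" using section_algebra(1)[OF assms(2) one_section assms(3)] section_algebra(5)[OF assms(2,2,2)] by simp
  moreover have "\<phi> (a \<star> s) = (\<lambda>b\<in>sections I 0. \<phi> s (a \<star> b))" using assms unfolding twist_carrier by blast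
  ultimately show ?thesis using one_section by (simp add: serre_eq)
qed

lemma serre_functional:
  assumes \<phi>: "\<phi> \<in> \<K>" shows "section_functional (\<lambda>s. serre_pairing I s \<phi>)"
  unfolding section_functional_def
proof (intro ballI allI conjI)
  fix x y c assume x: "x \<in> sections I 1" and y: "y \<in> sections I 1"
  have "\<phi> (x \<bbbplus> y) = (\<lambda>b\<in>sections I 0. \<phi> x b + \<phi> y b)" using \<phi> x y unfolding twist_carrier by blast
  thus "serre_pairing I (x \<bbbplus> y) \<phi> = serre_pairing I x \<phi> + serre_pairing I y \<phi>"
    using one_section by (simp add: serre_eq)
  have "\<phi> x \<in> carrier (canonical_module I)" using \<phi> x unfolding twist_carrier by blast
  hence "\<phi> x (const_section I c \<star> F.Fr 1 1) = c * \<phi> x (F.Fr 1 1)"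
    unfolding canonical_carrier using one_section by blast
  moreover have "const_section I c \<star> F.Fr 1 1 = const_section I c"
    using F.one_W by (simp add: const_section_eq F.Fr_mult)
  ultimately show "serre_pairing I (const_section I c \<star> x) \<phi> = c * serre_pairing I x \<phi>"
    using serre_mult[OF \<phi> const_section_mem x, of c] by (simp add: serre_eq)
qed

lemma twist_eqI:
  assumes "\<phi> \<in> \<K>" "\<psi> \<in> \<K>"
    and "\<And>s. s \<in> sections I 1 \<Longrightarrow> serre_pairing I s \<phi> = serre_pairing I s \<psi>"
  shows "\<phi> = \<psi>"
proof
  fix s
  have ext: "\<phi> \<in> extensional (sections I 1)" "\<psi> \<in> extensional (sections I 1)" using assms(1,2) by (auto simp: twist_carrier PiE_def)
  show "\<phi> s = \<psi> s"
  proof (cases "s \<in> sections I 1")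
    case True
    have "\<phi> s \<in> extensional (sections I 0)" "\<psi> s \<in> extensional (sections I 0)"
      using assms(1,2) True by (auto simp: twist_carrier canonical_carrier PiE_def Pi_def)
    moreover have "\<phi> s a = \<psi> s a" if "a \<in> sections I 0" for a
      using assms(3)[OF section_mult_0[OF that True]] serre_mult[OF assms(1) that True] serre_mult[OF assms(2) that True] by simp
    ultimately show ?thesis by (rule extensionalityI)
  next
    case False
    thus ?thesis using ext by (simp add: extensional_def)
  qed
qed

lemma twist_hom_iff:
  "\<Phi> \<in> mod_hom (structure_ring I) (twist I 1) (canonical_twist I) \<longleftrightarrow>
    \<Phi> \<in> sections I 1 \<rightarrow>\<^sub>E carrier (canonical_twist I) \<and>
    (\<forall>x\<in>sections I 1. \<forall>y\<in>sections I 1. \<forall>s\<in>sections I 1.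
      serre_pairing I s (\<Phi> (x \<bbbplus> y)) = serre_pairing I s (\<Phi> x) + serre_pairing I s (\<Phi> y)) \<and>
    (\<forall>a\<in>sections I 0. \<forall>x\<in>sections I 1. \<forall>s\<in>sections I 1.
      serre_pairing I s (\<Phi> (a \<star> x)) = serre_pairing I (a \<star> s) (\<Phi> x))"
  (is "_ \<longleftrightarrow> ?ext \<and> ?add \<and> ?mult")
proof -
  let ?C = "carrier (canonical_twist I)"
  have plus: "\<phi> \<oplus>\<^bsub>canonical_twist I\<^esub> \<psi> = tw (\<lambda>s. serre_pairing I s \<phi> + serre_pairing I s \<psi>)"
    if \<phi>: "\<phi> \<in> ?C" and \<psi>: "\<psi> \<in> ?C" for \<phi> \<psi>
    unfolding tw_def using serre_mult[OF \<phi>] serre_mult[OF \<psi>]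
    by (auto simp: canonical_twist_def Hom_module_def twist_def scalar_module_def canonical_module_def intro!: restrict_ext)
  have smult: "a \<odot>\<^bsub>canonical_twist I\<^esub> \<phi> = tw (\<lambda>s. serre_pairing I (a \<star> s) \<phi>)" if a: "a \<in> sections I 0" and \<phi>: "\<phi> \<in> ?C" for a \<phi>
  proof -
    have "serre_pairing I (a \<star> (b \<star> s)) \<phi> = \<phi> s (a \<star> b)" if "b \<in> sections I 0" "s \<in> sections I 1" for b s
      using serre_mult[OF \<phi> section_mult_0[OF a that(1)] that(2)] section_algebra(2)[OF a that] by simp
    thus ?thesis
      unfolding tw_def
      by (auto simp: canonical_twist_def Hom_module_def twist_def scalar_module_def canonical_module_def section_ring_eq intro!: restrict_ext)
  qed
  have f1: "section_functional (\<lambda>s. serre_pairing I s \<phi> + serre_pairing I s \<psi>)" if "\<phi> \<in> ?C" "\<psi> \<in> ?C" for \<phi> \<psi>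
    using serre_functional[OF that(1)] serre_functional[OF that(2)]
    by (simp add: section_functional_def distrib_left)
  have f2: "section_functional (\<lambda>s. serre_pairing I (a \<star> s) \<phi>)" if a: "a \<in> sections I 0" and "\<phi> \<in> ?C" for a \<phi>
    unfolding section_functional_def
  proof (intro ballI allI conjI)
    fix x y c assume x: "x \<in> sections I 1" and y: "y \<in> sections I 1"
    note l = section_functionalD[OF serre_functional[OF that(2)] section_mult_0[OF a x]]
    show "serre_pairing I (a \<star> (x \<bbbplus> y)) \<phi> = serre_pairing I (a \<star> x) \<phi> + serre_pairing I (a \<star> y) \<phi>"
      using l(1)[OF section_mult_0[OF a y]] by (simp add: section_algebra(4)[OF x y a])
    have "a \<star> (const_section I c \<star> x) = const_section I c \<star> (a \<star> x)"
      using section_algebra(1)[OF a const_section_mem a, of c] section_algebra(2)[OF a const_section_mem x, of c]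
        section_algebra(2)[OF const_section_mem a x, of c] by simp
    thus "serre_pairing I (a \<star> (const_section I c \<star> x)) \<phi> = c * serre_pairing I (a \<star> x) \<phi>"
      using l(2) by simp
  qed
  have add_iff: "\<theta> = \<phi> \<oplus>\<^bsub>canonical_twist I\<^esub> \<psi> \<longleftrightarrow> (\<forall>s\<in>sections I 1. serre_pairing I s \<theta> = serre_pairing I s \<phi> + serre_pairing I s \<psi>)"
    if "\<theta> \<in> ?C" "\<phi> \<in> ?C" "\<psi> \<in> ?C" for \<theta> \<phi> \<psi>
    unfolding plus[OF that(2,3)]
    using twist_eqI[OF that(1) tw_mem[OF f1[OF that(2,3)]]] by (auto simp: serre_tw)
  have smult_iff: "\<theta> = a \<odot>\<^bsub>canonical_twist I\<^esub> \<phi> \<longleftrightarrow> (\<forall>s\<in>sections I 1. serre_pairing I s \<theta> = serre_pairing I (a \<star> s) \<phi>)"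
    if "\<theta> \<in> ?C" "\<phi> \<in> ?C" "a \<in> sections I 0" for \<theta> \<phi> a
    unfolding smult[OF that(3,2)]
    using twist_eqI[OF that(1) tw_mem[OF f2[OF that(3,2)]]] by (auto simp: serre_tw)
  have hom: "\<Phi> \<in> mod_hom (structure_ring I) (twist I 1) (canonical_twist I) \<longleftrightarrow> ?ext \<and>
    (\<forall>x\<in>sections I 1. \<forall>y\<in>sections I 1. \<Phi> (x \<bbbplus> y) = \<Phi> x \<oplus>\<^bsub>canonical_twist I\<^esub> \<Phi> y) \<and>
    (\<forall>a\<in>sections I 0. \<forall>x\<in>sections I 1. \<Phi> (a \<star> x) = a \<odot>\<^bsub>canonical_twist I\<^esub> \<Phi> x)"
    by (simp add: mod_hom_def twist_def scalar_module_def structure_ring_def section_ring_eq)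
  have \<Phi>: "\<Phi> x \<in> ?C" if "?ext" "x \<in> sections I 1" for x using that by (rule PiE_mem)
  have "?ext \<Longrightarrow> (\<forall>x\<in>sections I 1. \<forall>y\<in>sections I 1. \<Phi> (x \<bbbplus> y) = \<Phi> x \<oplus>\<^bsub>canonical_twist I\<^esub> \<Phi> y) \<longleftrightarrow> ?add"
    by (intro ball_cong refl add_iff \<Phi> section_add)
  moreover have "?ext \<Longrightarrow> (\<forall>a\<in>sections I 0. \<forall>x\<in>sections I 1. \<Phi> (a \<star> x) = a \<odot>\<^bsub>canonical_twist I\<^esub> \<Phi> x) \<longleftrightarrow> ?mult"
    by (intro ball_cong refl smult_iff \<Phi> section_mult_0)
  ultimately show ?thesis unfolding hom by blast
qed

lemma restrict_form_eq: "restrict_form I x = F.Fr x 1"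
  by (simp add: restrict_form_def fraction_eq)

lemma restrict_form_section: "x \<in> V \<Longrightarrow> F.Fr x 1 \<in> sections I 1"
  by (rule sectionI[OF one_nonvan]) simp

lemma restrict_form_add: "F.Fr (x + y) 1 = F.Fr x 1 \<bbbplus> F.Fr y 1"
  using F.one_W by (simp add: F.Fr_add)

lemma restrict_form_cst_mult: "F.Fr (cst c * x) 1 = const_section I c \<star> F.Fr x 1"
  using F.one_W by (simp add: F.Fr_mult const_section_eq)

end

section \<open>Orthogonal bases and balanced forms\<close>

lemma dual_linear_forms_carrier:
  "carrier (dual_linear_forms :: ('k::field, ('v::finite, 'k) mpoly \<Rightarrow> 'k) module) =
    {\<chi> \<in> extensional V. \<forall>x\<in>V. \<forall>y\<in>V. \<forall>c. \<chi> (x + y) = \<chi> x + \<chi> y \<and> \<chi> (cst c * x) = c * \<chi> x}"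
  by (auto simp: dual_linear_forms_def Hom_module_def mod_hom_def linear_forms_def scalar_module_def
    ring_of_type_algebra_def PiE_def)

lemma nonsingular_form_hom:
  "nonsingular_form (B :: ('v::finite, 'k::field) mpoly \<Rightarrow> ('v, 'k) mpoly \<Rightarrow> 'k) \<longleftrightarrow>
    B \<in> V \<rightarrow>\<^sub>E carrier dual_linear_forms \<and>
    (\<forall>x\<in>V. \<forall>y\<in>V. B (x + y) = (\<lambda>z\<in>V. B x z + B y z)) \<and>
    (\<forall>c. \<forall>x\<in>V. B (cst c * x) = (\<lambda>z\<in>V. c * B x z)) \<and>
    bij_betw B V (carrier dual_linear_forms)"
  by (simp add: nonsingular_form_def mod_iso_def mod_hom_def dual_linear_forms_def Hom_module_def linear_forms_def
    scalar_module_def ring_of_type_algebra_def)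

lemma nonsingular_formD:
  assumes "nonsingular_form B" shows "bilinear B" "nondegenerate_form B"
proof -
  note B = assms[unfolded nonsingular_form_hom]
  have lin: "B (x + cst c * y) z = B x z + c * B y z" if "x \<in> V" "y \<in> V" "z \<in> V" for x y z c
  proof -
    have "B (x + cst c * y) = (\<lambda>z\<in>V. B x z + B (cst c * y) z)" "B (cst c * y) = (\<lambda>z\<in>V. c * B y z)"
      using B that forms_cst_mult by blast+
    thus ?thesis using that by simp
  qed
  have val: "B x \<in> carrier dual_linear_forms" if "x \<in> V" for x using B that by blast
  have right: "B z (x + cst c * y) = B z x + c * B z y" if "x \<in> V" "y \<in> V" "z \<in> V" for x y z c
  proof -
    have "B z (x + cst c * y) = B z x + B z (cst c * y)" "B z (cst c * y) = c * B z y"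
      using val[OF that(3)] that forms_cst_mult unfolding dual_linear_forms_carrier by blast+
    thus ?thesis by simp
  qed
  show bil: "bilinear B" unfolding bilinear_def using lin right by blast
  show "nondegenerate_form B"
    unfolding nondegenerate_form_def
  proof (intro ballI impI)
    fix x :: "('a, 'b) mpoly" assume x: "x \<in> V" "\<forall>y\<in>V. B x y = 0"
    have "B x = B 0"
      by (rule extensionalityI[of _ "V"])
        (use val[OF x(1)] val[OF forms_0] x bilinearD(9)[OF bil x(1) x(1)] in \<open>auto simp: dual_linear_forms_carrier\<close>)
    moreover have "inj_on B V" using B by (auto simp: bij_betw_def)
    ultimately show "x = 0" using x(1) by (auto dest: inj_onD)
  qed
qed

lemma nonsingular_formI:
  assumes "bilinear B" "nondegenerate_form B" and sym: "\<And>x y. x \<in> V \<Longrightarrow> y \<in> V \<Longrightarrow> B x y = B y x"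
  shows "nonsingular_form (\<lambda>x\<in>V. \<lambda>y\<in>V. B x y)"
proof -
  let ?B = "\<lambda>x\<in>V. \<lambda>y\<in>V. B x y"
  note b = bilinearD[OF assms(1)]
  have mem: "?B x \<in> carrier dual_linear_forms" if "x \<in> V" for x
    using that by (auto simp: dual_linear_forms_carrier b forms_add forms_cst_mult)
  have "inj_on ?B V"
  proof (rule inj_onI)
    fix x y assume xy: "x \<in> V" "y \<in> V" "?B x = ?B y"
    have "B (x - y) z = 0" if z: "z \<in> V" for z
      using fun_cong[OF xy(3), of z] xy(1,2) z by (simp add: b)
    thus "x = y" using assms(2) forms_diff[OF xy(1,2)] unfolding nondegenerate_form_def by force
  qed
  moreover have "\<chi> \<in> ?B ` V" if \<chi>: "\<chi> \<in> carrier dual_linear_forms" for \<chi>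
  proof -
    have "\<exists>x\<in>V. \<forall>y\<in>V. B x y = \<chi> y"
      by (rule represent_functional[OF assms]) (use \<chi> in \<open>auto simp: dual_linear_forms_carrier forms_cst_mult\<close>)
    then obtain x where x: "x \<in> V" "\<forall>y\<in>V. B x y = \<chi> y" by blast
    have "\<chi> = ?B x"
      by (rule extensionalityI[of _ "V"]) (use x \<chi> in \<open>auto simp: dual_linear_forms_carrier\<close>)
    thus ?thesis using x(1) by blast
  qed
  ultimately have "bij_betw ?B V (carrier dual_linear_forms)" using mem by (auto simp: bij_betw_def)
  thus ?thesis
    unfolding nonsingular_form_hom using mem by (auto simp: b forms_add forms_cst_mult intro!: restrict_ext)
qed

context basis_subscheme
begin

lemma section_is_linear_form:
  assumes "s \<in> sections I 1" shows "\<exists>x\<in>V. s = F.Fr x 1"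
proof -
  obtain p t d where s: "s = F.Fr p t" "t \<in> nonvan d" "t \<in> W" "p \<in> forms (d + 1)" using sectionE[OF assms] .
  obtain x where x: "x \<in> V" "p - t * x \<in> I" using divide[OF s(2)] s(4) by (auto simp: Suc_eq_plus1)
  hence "s = F.Fr x 1" unfolding s(1) Fr_eq[OF s(3) F.one_W] by (simp add: mult.commute)
  thus ?thesis using x(1) by blast
qed

lemma restrict_form_inj: "x \<in> V \<Longrightarrow> y \<in> V \<Longrightarrow> F.Fr x 1 = F.Fr y 1 \<Longrightarrow> x = y"
  using Fr_eq[OF F.one_W F.one_W, of x y] linear_mem[OF forms_diff[of x 1 y]] by simp

lemma inv_restrict_form: "x \<in> V \<Longrightarrow> inv_into V (restrict_form I) (F.Fr x 1) = x"
  unfolding restrict_form_eq[symmetric]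
  by (rule inv_into_f_f) (auto simp: inj_on_def restrict_form_eq intro: restrict_form_inj)

definition lift_functional :: "(('v, 'k) mpoly \<Rightarrow> 'k) \<Rightarrow> ('v, 'k) section_fraction \<Rightarrow> 'k"
  where "lift_functional \<chi> s = \<chi> (inv_into V (restrict_form I) s)"

lemma lift_functional: "x \<in> V \<Longrightarrow> lift_functional \<chi> (F.Fr x 1) = \<chi> x"
  by (simp add: lift_functional_def inv_restrict_form)

lemma dual_restrict_form_bij:
  "bij_betw (dual_restrict_form I) \<K> (carrier dual_linear_forms)"
  unfolding bij_betw_def
proof
  have val: "dual_restrict_form I \<phi> x = serre_pairing I (F.Fr x 1) \<phi>" if "x \<in> V" for \<phi> x
    using that by (simp add: dual_restrict_form_def restrict_form_eq)
  show "inj_on (dual_restrict_form I) \<K>"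
  proof (rule inj_onI)
    fix \<phi> \<psi> assume *: "\<phi> \<in> \<K>" "\<psi> \<in> \<K>"
      and eq: "dual_restrict_form I \<phi> = dual_restrict_form I \<psi>"
    show "\<phi> = \<psi>"
    proof (rule twist_eqI[OF *])
      fix s assume "s \<in> sections I 1"
      then obtain x where x: "x \<in> V" "s = F.Fr x 1" using section_is_linear_form by blast
      show "serre_pairing I s \<phi> = serre_pairing I s \<psi>"
        using val[OF x(1), of \<phi>] val[OF x(1), of \<psi>] eq by (simp add: x(2))
    qed
  qed
  show "dual_restrict_form I ` \<K> = carrier dual_linear_forms"
  proof
    show "dual_restrict_form I ` \<K> \<subseteq> carrier dual_linear_forms"
    proof
      fix \<chi> assume "\<chi> \<in> dual_restrict_form I ` \<K>"
      then obtain \<phi> where \<phi>: "\<phi> \<in> \<K>" "\<chi> = dual_restrict_form I \<phi>" by blast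
      note l = section_functionalD[OF serre_functional[OF \<phi>(1)] restrict_form_section]
      show "\<chi> \<in> carrier dual_linear_forms"
        unfolding dual_linear_forms_carrier \<phi>(2)
        by (auto simp: val forms_add forms_cst_mult restrict_form_add restrict_form_cst_mult l restrict_form_section)
          (simp add: dual_restrict_form_def)
    qed
    show "carrier dual_linear_forms \<subseteq> dual_restrict_form I ` \<K>"
    proof
      fix \<chi> :: "('v, 'k) mpoly \<Rightarrow> 'k" assume \<chi>: "\<chi> \<in> carrier dual_linear_forms"
      have f: "section_functional (lift_functional \<chi>)"
        unfolding section_functional_def
      proof (intro ballI allI conjI)
        fix s t c assume "s \<in> sections I 1" "t \<in> sections I 1"
        obtain x where x: "x \<in> V" "s = F.Fr x 1" using section_is_linear_form[OF \<open>s \<in> sections I 1\<close>] by blast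
        obtain y where y: "y \<in> V" "t = F.Fr y 1" using section_is_linear_form[OF \<open>t \<in> sections I 1\<close>] by blast
        show "lift_functional \<chi> (s \<bbbplus> t) = lift_functional \<chi> s + lift_functional \<chi> t"
          "lift_functional \<chi> (const_section I c \<star> s) = c * lift_functional \<chi> s"
          using \<chi> x(1) y(1) unfolding x(2) y(2) restrict_form_add[symmetric] restrict_form_cst_mult[symmetric]
          by (auto simp: lift_functional forms_add forms_cst_mult dual_linear_forms_carrier)
      qed
      have "\<chi> = dual_restrict_form I (tw (lift_functional \<chi>))"
        by (rule extensionalityI[of _ "V"])
          (use \<chi> in \<open>auto simp: val serre_tw restrict_form_section lift_functional dual_linear_forms_carrier\<close>,
           simp add: dual_restrict_form_def)
      thus "\<chi> \<in> dual_restrict_form I ` \<K>" using tw_mem[OF f] by blast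
    qed
  qed
qed

lemma induced_map:
  assumes B: "nonsingular_form B" and x: "x \<in> V"
  shows "induced_map I B (F.Fr x 1) \<in> \<K>"
    "y \<in> V \<Longrightarrow> serre_pairing I (F.Fr y 1) (induced_map I B (F.Fr x 1)) = B x y"
proof -
  have Bx: "B x \<in> dual_restrict_form I ` \<K>"
    using B x dual_restrict_form_bij unfolding nonsingular_form_hom bij_betw_def by blast
  have e: "induced_map I B (F.Fr x 1) = inv_into \<K> (dual_restrict_form I) (B x)"
    using x by (simp add: induced_map_def restrict_form_section inv_restrict_form)
  show "induced_map I B (F.Fr x 1) \<in> \<K>" unfolding e by (rule inv_into_into[OF Bx])
  have "dual_restrict_form I (induced_map I B (F.Fr x 1)) = B x" unfolding e by (rule f_inv_into_f[OF Bx])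
  thus "y \<in> V \<Longrightarrow> serre_pairing I (F.Fr y 1) (induced_map I B (F.Fr x 1)) = B x y"
    by (auto simp: dual_restrict_form_def restrict_form_eq fun_eq_iff split: if_splits)
qed

lemma degree_0_multiple:
  assumes a: "t \<in> nonvan d" "p \<in> forms d" and x: "x \<in> V"
  obtains y where "y \<in> V" "F.Fr p t \<star> F.Fr x 1 = F.Fr y 1" "p * x - t * y \<in> I"
proof -
  have "p * x \<in> forms (Suc d)" by (rule forms_mult_eq[OF a(2) x]) simp
  then obtain y where y: "y \<in> V" "p * x - t * y \<in> I" using divide[OF a(1)] by blast
  have "F.Fr p t \<star> F.Fr x 1 = F.Fr (p * x) t" using W_nonvan[OF a(1)] F.one_W by (simp add: F.Fr_mult)
  also have "\<dots> = F.Fr y 1" unfolding Fr_eq[OF W_nonvan[OF a(1)] F.one_W] using y(2) by (simp add: mult.commute)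
  finally show ?thesis using that y by blast
qed

text \<open>
  The pairing that belongs to the induced map is \<open>B\<close> itself. If \<open>B\<close> is balanced, multiplication by
  functions moves across, since \<open>(a x) y\<close> and \<open>x (a y)\<close> have the same product. Conversely
  \<open>B x y\<close> is the pairing of \<open>v\<close> with the section \<open>x y / v\<close>.
\<close>

theorem induced_map_iso_iff:
  assumes B: "nonsingular_form B"
  shows "induced_map I B \<in> mod_iso (structure_ring I) (twist I 1) (canonical_twist I) \<longleftrightarrow> balanced I B"
proof -
  let ?\<Phi> = "induced_map I B"
  note bil = bilinearD[OF nonsingular_formD(1)[OF B]]
  have ext: "?\<Phi> \<in> sections I 1 \<rightarrow>\<^sub>E \<K>"
  proof (rule PiE_I)
    fix s assume "s \<in> sections I 1"
    then obtain x where "x \<in> V" "s = F.Fr x 1" using section_is_linear_form by blast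
    thus "?\<Phi> s \<in> \<K>" using induced_map(1)[OF B] by simp
  qed (simp add: induced_map_def)
  have add: "serre_pairing I s (?\<Phi> (x \<bbbplus> y)) = serre_pairing I s (?\<Phi> x) + serre_pairing I s (?\<Phi> y)"
    if xys: "x \<in> sections I 1" "y \<in> sections I 1" "s \<in> sections I 1" for x y s
  proof -
    obtain x' y' s' where x': "x' \<in> V" "x = F.Fr x' 1" and y': "y' \<in> V" "y = F.Fr y' 1"
      and s': "s' \<in> V" "s = F.Fr s' 1"
      using xys[THEN section_is_linear_form] by blast
    show ?thesis unfolding x'(2) y'(2) s'(2) restrict_form_add[symmetric]
      using x'(1) y'(1) s'(1) by (simp add: induced_map(2)[OF B] forms_add bil)
  qed
  have bij: "bij_betw ?\<Phi> (sections I 1) \<K>"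
  proof -
    have "bij_betw (restrict_form I) V (sections I 1)"
      unfolding bij_betw_def
    proof
      show "inj_on (restrict_form I) V" by (auto simp: inj_on_def restrict_form_eq intro: restrict_form_inj)
      show "restrict_form I ` V = sections I 1"
        using section_is_linear_form by (auto simp: restrict_form_eq restrict_form_section)
    qed
    hence "bij_betw (inv_into V (restrict_form I)) (sections I 1) V" by (rule bij_betw_inv_into)
    moreover have "bij_betw B V (carrier dual_linear_forms)" using B by (simp add: nonsingular_form_hom)
    moreover note bij_betw_inv_into[OF dual_restrict_form_bij]
    ultimately have "bij_betw (inv_into \<K> (dual_restrict_form I) \<circ> (B \<circ> inv_into V (restrict_form I)))
      (sections I 1) \<K>" by (intro bij_betw_trans)
    thus ?thesis by (rule bij_betw_cong[THEN iffD1, rotated]) (simp add: induced_map_def)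
  qed
  have "(\<forall>a\<in>sections I 0. \<forall>x\<in>sections I 1. \<forall>s\<in>sections I 1. serre_pairing I s (?\<Phi> (a \<star> x)) = serre_pairing I (a \<star> s) (?\<Phi> x)) \<longleftrightarrow> balanced I B"
  proof
    assume bal: "balanced I B"
    show "\<forall>a\<in>sections I 0. \<forall>x\<in>sections I 1. \<forall>s\<in>sections I 1. serre_pairing I s (?\<Phi> (a \<star> x)) = serre_pairing I (a \<star> s) (?\<Phi> x)"
    proof (intro ballI)
      fix a x s assume as: "a \<in> sections I 0" and xs: "x \<in> sections I 1" "s \<in> sections I 1"
      obtain p t d where a: "a = F.Fr p t" "t \<in> nonvan d" "t \<in> W" "p \<in> forms (d + 0)" using sectionE[OF as] .
      obtain x' s' where x': "x' \<in> V" "x = F.Fr x' 1" and s': "s' \<in> V" "s = F.Fr s' 1"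
        using xs[THEN section_is_linear_form] by blast
      have p: "p \<in> forms d" using a(4) by simp
      obtain y where y: "y \<in> V" "F.Fr p t \<star> F.Fr x' 1 = F.Fr y 1" "p * x' - t * y \<in> I"
        using degree_0_multiple[OF a(2) p x'(1)] .
      obtain z where z: "z \<in> V" "F.Fr p t \<star> F.Fr s' 1 = F.Fr z 1" "p * s' - t * z \<in> I"
        using degree_0_multiple[OF a(2) p s'(1)] .
      have "t * (y * s' - x' * z) \<in> I" by (rule comb2[OF y(3) z(3), of _ "- s'" x']) (simp add: algebra_simps)
      hence "y * s' - x' * z \<in> I" by (rule nonvan_nzd[OF a(2)])
      hence "B y s' = B x' z" using bal x'(1) s'(1) y(1) z(1) unfolding balanced_def by blast
      thus "serre_pairing I s (?\<Phi> (a \<star> x)) = serre_pairing I (a \<star> s) (?\<Phi> x)"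
        unfolding a(1) x'(2) s'(2) y(2) z(2) using x'(1) s'(1) y(1) z(1) by (simp add: induced_map(2)[OF B])
    qed
  next
    assume h: "\<forall>a\<in>sections I 0. \<forall>x\<in>sections I 1. \<forall>s\<in>sections I 1. serre_pairing I s (?\<Phi> (a \<star> x)) = serre_pairing I (a \<star> s) (?\<Phi> x)"
    have key: "B x y = serre_pairing I (F.Fr (x * y) v) (?\<Phi> (F.Fr v 1))" if "x \<in> V" "y \<in> V" for x y
    proof -
      have vW: "v \<in> W" by (rule W_nonvan[OF v_nonvan])
      have x: "F.Fr x v \<in> sections I 0" by (rule sectionI[OF v_nonvan]) (use that in simp)
      have "F.Fr x v \<star> F.Fr v 1 = F.Fr x 1"
        unfolding F.Fr_mult[OF vW F.one_W] by (subst Fr_eq) (use vW F.one_W in auto)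
      moreover have "F.Fr x v \<star> F.Fr y 1 = F.Fr (x * y) v" unfolding F.Fr_mult[OF vW F.one_W] by simp
      ultimately show ?thesis
        using h[rule_format, OF x restrict_form_section[OF v_form] restrict_form_section[OF that(2)]] that
        by (simp add: induced_map(2)[OF B])
    qed
    show "balanced I B"
      unfolding balanced_def
    proof (intro ballI impI)
      fix x y z w assume xy: "x \<in> V" "y \<in> V" and zw: "z \<in> V" "w \<in> V" and e: "x * y - z * w \<in> I"
      have vW: "v \<in> W" by (rule W_nonvan[OF v_nonvan])
      have "F.Fr (x * y) v = F.Fr (z * w) v"
        unfolding Fr_eq[OF vW vW] using mult_right[OF e, of v] by (simp add: algebra_simps)
      thus "B x y = B z w" using key[OF xy] key[OF zw] by simp
    qed
  qed
  thus ?thesis unfolding mod_iso_def twist_hom_iff using ext add bij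
    by (simp add: twist_def scalar_module_def)
qed

end

section \<open>Sections as pairs of linear forms\<close>

text \<open>
A basis contained in a closed subscheme, onto which sections of \<open>O(1)\<close> can be restricted.
\<close>

locale sub_basis = G: closed_ideal I + B: basis_subscheme K v
  for I K :: "('v::finite, 'k::field) mpoly set" and v +
  assumes sub: "I \<subseteq> K"
begin

lemma nonvan_sub: "t \<in> G.nonvan m \<Longrightarrow> t \<in> B.nonvan m"
  unfolding G.nonvan_iff B.nonvan_iff using sub by blast

definition component :: "('v, 'k) section_fraction \<Rightarrow> ('v, 'k) mpoly"
  where "component s = (SOME x. x \<in> V \<and>
    (\<exists>p t m. s = G.F.Fr p t \<and> t \<in> G.nonvan m \<and> p \<in> forms (m + 1) \<and> p - t * x \<in> K))"

lemma component_unique: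
  assumes "t \<in> G.nonvan m" "t' \<in> G.nonvan m'" "G.F.Fr p t = G.F.Fr p' t'"
    and "x \<in> V" "x' \<in> V" "p - t * x \<in> K" "p' - t' * x' \<in> K"
  shows "x = x'"
proof -
  have "p * t' - p' * t \<in> K"
    using assms(3) sub unfolding G.Fr_eq[OF G.W_nonvan[OF assms(1)] G.W_nonvan[OF assms(2)]] by blast
  hence "(t * t') * (x - x') \<in> K"
    by (rule B.comb3[OF _ assms(6,7), of _ _ 1 "- t'" t]) (simp add: algebra_simps)
  hence "x - x' \<in> K" by (rule B.nonvan_nzd[OF nonvan_sub[OF G.nonvan_mult[OF assms(1,2)]]])
  thus ?thesis using B.linear_mem[OF forms_diff[OF assms(4,5)]] by simp
qed

lemma component:
  assumes t: "t \<in> G.nonvan m" "p \<in> forms (m + 1)"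
  shows "component (G.F.Fr p t) \<in> V" "p - t * component (G.F.Fr p t) \<in> K"
proof -
  obtain x where x: "x \<in> V" "p - t * x \<in> K"
    using B.divide[OF nonvan_sub[OF t(1)], of p] t(2) by (auto simp: Suc_eq_plus1)
  have "component (G.F.Fr p t) \<in> V \<and> (\<exists>p' t' m'. G.F.Fr p t = G.F.Fr p' t' \<and> t' \<in> G.nonvan m' \<and>
    p' \<in> forms (m' + 1) \<and> p' - t' * component (G.F.Fr p t) \<in> K)" (is "?y \<in> _ \<and> _")
    unfolding component_def by (rule someI[of _ x]) (use x t in blast)
  then obtain p' t' m' where *: "?y \<in> V" "G.F.Fr p t = G.F.Fr p' t'" "t' \<in> G.nonvan m'" "p' - t' * ?y \<in> K"
    by (elim exE conjE) (rule that)
  have "x = ?y" by (rule component_unique[OF t(1) *(3,2) x(1) *(1) x(2) *(4)])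
  thus "?y \<in> V" "p - t * ?y \<in> K" using x by auto
qed

lemma component_eqI:
  assumes "t \<in> G.nonvan m" "p \<in> forms (m + 1)" "x \<in> V" "p - t * x \<in> K"
  shows "component (G.F.Fr p t) = x"
  by (rule component_unique[OF assms(1,1) refl component(1)[OF assms(1,2)] assms(3) component(2)[OF assms(1,2)] assms(4)])

lemma component_form: "s \<in> sections I 1 \<Longrightarrow> component s \<in> V"
  using component(1) by (auto elim!: G.sectionE)

lemma component_add:
  assumes "s \<in> sections I 1" "s' \<in> sections I 1"
  shows "component (G.sec_add s s') = component s + component s'"
proof -
  obtain p t m where s: "s = G.F.Fr p t" "t \<in> G.nonvan m" "t \<in> G.W" "p \<in> forms (m + 1)" using G.sectionE[OF assms(1)] .
  obtain p' t' m' where s': "s' = G.F.Fr p' t'" "t' \<in> G.nonvan m'" "t' \<in> G.W" "p' \<in> forms (m' + 1)" using G.sectionE[OF assms(2)] .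
  note c = component[OF s(2,4)] component[OF s'(2,4)]
  have f: "p * t' + p' * t \<in> forms (m + m' + 1)"
    by (intro forms_add forms_mult_eq[OF s(4) G.nonvan_form[OF s'(2)]] forms_mult_eq[OF s'(4) G.nonvan_form[OF s(2)]]) auto
  have k: "p * t' + p' * t - (t * t') * (component (G.F.Fr p t) + component (G.F.Fr p' t')) \<in> K"
    by (rule B.comb2[OF c(2,4), of _ t' t]) (simp add: algebra_simps)
  show ?thesis
    unfolding s(1) s'(1) G.F.Fr_add[OF s(3) s'(3)]
    by (rule component_eqI[OF G.nonvan_mult[OF s(2) s'(2)] f forms_add[OF c(1,3)] k])
qed

lemma component_mult:
  assumes a: "u \<in> G.nonvan l" "q \<in> forms l" and s: "s \<in> sections I 1"
  shows "q * component s - u * component (G.sec_mult (G.F.Fr q u) s) \<in> K"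
proof -
  obtain p t m where s': "s = G.F.Fr p t" "t \<in> G.nonvan m" "t \<in> G.W" "p \<in> forms (m + 1)" using G.sectionE[OF s] .
  have qp: "q * p \<in> forms (l + m + 1)" by (rule forms_mult_eq[OF a(2) s'(4)]) simp
  have e: "G.sec_mult (G.F.Fr q u) s = G.F.Fr (q * p) (u * t)"
    unfolding s'(1) by (rule G.F.Fr_mult[OF G.W_nonvan[OF a(1)] s'(3)])
  have "t * (q * component s - u * component (G.sec_mult (G.F.Fr q u) s)) \<in> K"
    unfolding e
    by (rule B.comb2[OF component(2)[OF s'(2,4), folded s'(1)] component(2)[OF G.nonvan_mult[OF a(1) s'(2)] qp], of _ "- q" 1])
      (simp add: algebra_simps)
  thus ?thesis by (rule B.nonvan_nzd[OF nonvan_sub[OF s'(2)]])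
qed

lemma component_const:
  assumes s: "s \<in> sections I 1" shows "component (G.sec_mult (const_section I c) s) = cst c * component s"
proof -
  have "cst c * component s - 1 * component (G.sec_mult (const_section I c) s) \<in> K"
    unfolding G.const_section_eq by (rule component_mult[OF G.one_nonvan _ s]) simp
  hence "cst c * component s - component (G.sec_mult (const_section I c) s) = 0"
    using component_form[OF s] component_form[OF G.section_mult_0[OF G.const_section_mem s]]
    by (intro B.linear_mem forms_diff forms_cst_mult) auto
  thus ?thesis by simp
qed

lemma component_restrict: "x \<in> V \<Longrightarrow> component (G.F.Fr x 1) = x"
  by (rule component_eqI[OF G.one_nonvan]) auto

text \<open>
Restriction commutes with multiplication by functions, as in \<open>induced_map_iso_iff\<close>.
\<close>

lemma component_balanced:
  assumes bal: "balanced K B" and a: "a \<in> sections I 0" and s: "s \<in> sections I 1" "s' \<in> sections I 1"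
  shows "B (component (G.sec_mult a s)) (component s') = B (component s) (component (G.sec_mult a s'))"
proof -
  obtain q u l where u: "a = G.F.Fr q u" "u \<in> G.nonvan l" "q \<in> forms (l + 0)" using G.sectionE[OF a] by metis
  hence q: "q \<in> forms l" by simp
  have "u * (component (G.sec_mult a s) * component s' - component s * component (G.sec_mult a s')) \<in> K"
    unfolding u(1)
    by (rule B.comb2[OF component_mult[OF u(2) q s(1)] component_mult[OF u(2) q s(2)], of _ "- component s'" "component s"])
      (simp add: algebra_simps)
  hence "component (G.sec_mult a s) * component s' - component s * component (G.sec_mult a s') \<in> K"
    by (rule B.nonvan_nzd[OF nonvan_sub[OF u(2)]])
  thus ?thesis using bal component_form s G.section_mult_0[OF a] unfolding balanced_def by blast
qed

end

locale associated_pair = two_bases_denominator I1 I2 v1 v2 N f d +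
  C1: sub_basis "I1 \<inter> I2" I1 v1 + C2: sub_basis "I1 \<inter> I2" I2 v2
  for I1 I2 :: "('v::finite, 'k::field) mpoly set" and v1 v2 N f d +
  fixes e assumes N: "N \<le> d" and e: "e \<in> forms d" "e - f \<in> I1" "e \<in> I2"
begin

abbreviation (input) Sec :: "nat \<Rightarrow> ('v, 'k) section_fraction set" where "Sec \<equiv> sections II"
abbreviation (input) Fra where "Fra \<equiv> C1.G.F.Fr"
abbreviation (input) plus (infixl "\<bbbplus>" 65) where "x \<bbbplus> y \<equiv> C1.G.sec_add x y"
abbreviation (input) times (infixl "\<star>" 70) where "x \<star> y \<equiv> C1.G.sec_mult x y"

lemma f_nonvan: "f \<in> C1.G.nonvan d"
  unfolding C1.G.nonvan_iff
proof (intro conjI exI[of _ "d + Suc N"] ballI)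
  show "f \<in> forms d" by (rule f_form)
  fix q :: "('v, 'k) mpoly" assume "q \<in> forms (d + Suc N)"
  thus "\<exists>y. q - f * y \<in> II" using divide_f_power[of q "d + Suc N" 1] by auto
qed

lemma section_eqI:
  assumes "s \<in> Sec 1" "s' \<in> Sec 1" "C1.component s = C1.component s'" "C2.component s = C2.component s'"
  shows "s = s'"
proof -
  obtain p t m where s: "s = Fra p t" "t \<in> C1.G.nonvan m" "t \<in> C1.G.W" "p \<in> forms (m + 1)" using C1.G.sectionE[OF assms(1)] .
  obtain p' t' m' where s': "s' = Fra p' t'" "t' \<in> C1.G.nonvan m'" "t' \<in> C1.G.W" "p' \<in> forms (m' + 1)"
    using C1.G.sectionE[OF assms(2)] .
  have "p * t' - p' * t \<in> I1"
    by (rule P.comb2[OF C1.component(2)[OF s(2,4)] C1.component(2)[OF s'(2,4)], of _ t' "- t"])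
      (use assms(3) in \<open>simp add: s(1) s'(1) algebra_simps\<close>)
  moreover have "p * t' - p' * t \<in> I2"
    by (rule Q.comb2[OF C2.component(2)[OF s(2,4)] C2.component(2)[OF s'(2,4)], of _ t' "- t"])
      (use assms(4) in \<open>simp add: s(1) s'(1) algebra_simps\<close>)
  ultimately show ?thesis unfolding s(1) s'(1) C1.G.Fr_eq[OF s(3) s'(3)] by blast
qed

text \<open>
The section with given components, which exists by the Chinese remainder theorem.
\<close>

definition pair :: "('v, 'k) mpoly \<Rightarrow> ('v, 'k) mpoly \<Rightarrow> ('v, 'k) section_fraction"
  where "pair x y = (SOME s. s \<in> Sec 1 \<and> C1.component s = x \<and> C2.component s = y)"

lemma pair:
  assumes "x \<in> V" "y \<in> V"
  shows "pair x y \<in> Sec 1" "C1.component (pair x y) = x" "C2.component (pair x y) = y"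
proof -
  have p: "\<exists>p\<in>forms (Suc d). p - v1 ^ d * x \<in> I1 \<and> p - v2 ^ d * y \<in> I2"
    by (rule chinese_remainder) (use assms P.v_power_mult_form Q.v_power_mult_form N in auto)
  then obtain p where p: "p \<in> forms (Suc d)" "p - v1 ^ d * x \<in> I1" "p - v2 ^ d * y \<in> I2" by blast
  have p': "p \<in> forms (d + 1)" using p(1) by (simp add: Suc_eq_plus1)
  have 1: "p - f * x \<in> I1" by (rule P.comb2[OF p(2) f1, of _ 1 "- x"]) (simp add: algebra_simps)
  have 2: "p - f * y \<in> I2" by (rule Q.comb2[OF p(3) f2, of _ 1 "- y"]) (simp add: algebra_simps)
  have "Fra p f \<in> Sec 1 \<and> C1.component (Fra p f) = x \<and> C2.component (Fra p f) = y"
    using C1.G.sectionI[OF f_nonvan p'] C1.component_eqI[OF f_nonvan p' assms(1) 1] C2.component_eqI[OF f_nonvan p' assms(2) 2] by blast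
  hence "pair x y \<in> Sec 1 \<and> C1.component (pair x y) = x \<and> C2.component (pair x y) = y"
    unfolding pair_def by (rule someI)
  thus "pair x y \<in> Sec 1" "C1.component (pair x y) = x" "C2.component (pair x y) = y" by auto
qed

lemma pair_linear:
  assumes "x \<in> V" "y \<in> V" "x' \<in> V" "y' \<in> V"
  shows "pair (x + cst c * x') (y + cst c * y') = pair x y \<bbbplus> (const_section II c \<star> pair x' y')"
proof -
  have m: "const_section II c \<star> pair x' y' \<in> Sec 1"
    by (rule C1.G.section_mult_0[OF C1.G.const_section_mem pair(1)[OF assms(3,4)]])
  note a = C1.G.section_add[OF pair(1)[OF assms(1,2)] m]
  have f: "x + cst c * x' \<in> V" "y + cst c * y' \<in> V" using assms by (auto intro: forms_cst_mult)
  show ?thesis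
    by (rule section_eqI[OF pair(1)[OF f] a])
      (simp_all add: pair[OF f] C1.component_add[OF pair(1)[OF assms(1,2)] m] C2.component_add[OF pair(1)[OF assms(1,2)] m]
        C1.component_const[OF pair(1)[OF assms(3,4)]] C2.component_const[OF pair(1)[OF assms(3,4)]] pair assms)
qed

text \<open>
  The pairing \<open>\<beta>\<close> is perfect because \<open>B\<close> is nondegenerate, and a section with components \<open>(x, y)\<close> is
  orthogonal to the diagonal when \<open>B x z = B y z\<close> for all \<open>z\<close>, that is, when it is in the diagonal.
\<close>

theorem self_associated_if_common_form:
  assumes B: "bilinear B" "nondegenerate_form B" "balanced I1 B" "balanced I2 B"
  shows "self_associated II"
proof -
  let ?C = "carrier (canonical_twist II)" and ?serre = "serre_pairing II"
  have bil: "B (x + y) z = B x z + B y z" "B z (x + y) = B z x + B z y" "B (x - y) z = B x z - B y z"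
    if "x \<in> V" "y \<in> V" "z \<in> V" for x y z
    using bilinearD[OF B(1) that] by auto
  have bil0: "B z (cst c * x) = c * B z x" if "x \<in> V" "z \<in> V" for x z c
    using bilinearD[OF B(1) that(1) that(1) that(2)] by auto
  have bil00: "B z 0 = 0" if "z \<in> V" for z
    using bilinearD[OF B(1) that that that] by auto
  note cf = C1.component_form C2.component_form
  have sym: "B x y = B y x" if "x \<in> V" "y \<in> V" for x y
    by (rule balanced_sym[OF B(3) P.poly_ideal_axioms that])
  have nd: "x = y" if xy: "x \<in> V" "y \<in> V" "\<And>z. z \<in> V \<Longrightarrow> B x z = B y z" for x y
  proof -
    have "\<forall>z\<in>V. B (x - y) z = 0" using xy(3) bil(3)[OF xy(1,2)] by simp
    hence "x - y = 0" using B(2) forms_diff[OF xy(1,2)] unfolding nondegenerate_form_def by blast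
    thus ?thesis by simp
  qed
  define \<beta> where "\<beta> s s' = B (C1.component s) (C1.component s') - B (C2.component s) (C2.component s')" for s s'
  define \<Phi> where "\<Phi> = (\<lambda>s\<in>Sec 1. C1.G.tw (\<beta> s))"
  have functional: "C1.G.section_functional (\<beta> s)" if s: "s \<in> Sec 1" for s
    unfolding C1.G.section_functional_def
    by (simp add: \<beta>_def C1.component_add C2.component_add C1.component_const C2.component_const cf s bil bil0 algebra_simps)
  have val: "?serre s' (\<Phi> s) = \<beta> s s'" if "s \<in> Sec 1" "s' \<in> Sec 1" for s s'
    using that by (simp add: \<Phi>_def C1.G.serre_tw)
  have mem: "\<Phi> s \<in> ?C" if "s \<in> Sec 1" for s using C1.G.tw_mem[OF functional[OF that]] that by (simp add: \<Phi>_def)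
  have hom: "\<Phi> \<in> mod_hom (structure_ring II) (twist II 1) (canonical_twist II)"
    unfolding C1.G.twist_hom_iff
  proof (intro conjI ballI)
    show "\<Phi> \<in> Sec 1 \<rightarrow>\<^sub>E ?C" by (rule PiE_I) (use mem in \<open>auto simp: \<Phi>_def\<close>)
    fix x y s assume xys: "x \<in> Sec 1" "y \<in> Sec 1" "s \<in> Sec 1"
    show "?serre s (\<Phi> (x \<bbbplus> y)) = ?serre s (\<Phi> x) + ?serre s (\<Phi> y)"
      by (simp add: val xys C1.G.section_add \<beta>_def C1.component_add C2.component_add cf bil)
  next
    fix a x s assume a: "a \<in> Sec 0" and xs: "x \<in> Sec 1" "s \<in> Sec 1"
    show "?serre s (\<Phi> (a \<star> x)) = ?serre (a \<star> s) (\<Phi> x)"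
      by (simp add: val xs a C1.G.section_mult_0 \<beta>_def C1.component_balanced[OF B(3) a xs] C2.component_balanced[OF B(4) a xs])
  qed
  have inj: "inj_on \<Phi> (Sec 1)"
  proof (rule inj_onI)
    fix s s' assume s: "s \<in> Sec 1" "s' \<in> Sec 1" "\<Phi> s = \<Phi> s'"
    hence eq: "\<beta> s z = \<beta> s' z" if "z \<in> Sec 1" for z using val[OF s(1) that] val[OF s(2) that] by simp
    show "s = s'"
    proof (rule section_eqI[OF s(1,2)]; rule nd[OF cf(1)[OF s(1)] cf(1)[OF s(2)]] nd[OF cf(2)[OF s(1)] cf(2)[OF s(2)]])
      fix z :: "('v, 'k) mpoly" assume z: "z \<in> V"
      show "B (C1.component s) z = B (C1.component s') z"
        using eq[OF pair(1)[OF z forms_0]] by (simp add: \<beta>_def pair z bil00[OF cf(2)] s(1,2))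
      show "B (C2.component s) z = B (C2.component s') z"
        using eq[OF pair(1)[OF forms_0 z]] by (simp add: \<beta>_def pair z bil00[OF cf(1)] s(1,2))
    qed
  qed
  have surj: "\<exists>s\<in>Sec 1. \<phi> = \<Phi> s" if \<phi>: "\<phi> \<in> ?C" for \<phi>
  proof -
    note l = C1.G.section_functionalD[OF C1.G.serre_functional[OF \<phi>]]
    have lin: "?serre (pair (x + cst c * x') (y + cst c * y')) \<phi> = ?serre (pair x y) \<phi> + c * ?serre (pair x' y') \<phi>"
      if xy: "x \<in> V" "y \<in> V" "x' \<in> V" "y' \<in> V" for x y x' y' c
      unfolding pair_linear[OF xy] using l(1)[OF pair(1)[OF xy(1,2)] C1.G.section_mult_0[OF C1.G.const_section_mem pair(1)[OF xy(3,4)]]]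
        l(2)[OF pair(1)[OF xy(3,4)]] by simp
    have "\<exists>x\<in>V. \<forall>y\<in>V. B x y = ?serre (pair y 0) \<phi>"
      by (rule represent_functional[OF B(1,2) sym]) (use lin[OF _ forms_0 _ forms_0] in auto)
    then obtain x1 where x1: "x1 \<in> V" "\<forall>y\<in>V. B x1 y = ?serre (pair y 0) \<phi>" by blast
    have "\<exists>x\<in>V. \<forall>y\<in>V. B x y = - ?serre (pair 0 y) \<phi>"
      by (rule represent_functional[OF B(1,2) sym]) (use lin[OF forms_0 _ forms_0] in auto)
    then obtain x2 where x2: "x2 \<in> V" "\<forall>y\<in>V. B x2 y = - ?serre (pair 0 y) \<phi>" by blast
    have "\<phi> = \<Phi> (pair x1 x2)"
    proof (rule C1.G.twist_eqI[OF \<phi> mem[OF pair(1)[OF x1(1) x2(1)]]])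
      fix s assume s: "s \<in> Sec 1"
      let ?x = "C1.component s" and ?y = "C2.component s"
      have "s = pair ?x ?y" by (rule section_eqI) (simp_all add: pair cf s)
      moreover have "?serre (pair ?x ?y) \<phi> = ?serre (pair ?x 0) \<phi> + ?serre (pair 0 ?y) \<phi>"
        using lin[OF cf(1)[OF s] forms_0 forms_0 cf(2)[OF s], of 1] by simp
      ultimately show "?serre s \<phi> = ?serre s (\<Phi> (pair x1 x2))"
        using x1 x2 s by (simp add: val pair \<beta>_def cf)
    qed
    thus ?thesis using pair(1)[OF x1(1) x2(1)] by blast
  qed
  have iso: "\<Phi> \<in> mod_iso (structure_ring II) (twist II 1) (canonical_twist II)"
    unfolding mod_iso_def using hom inj surj mem
    by (auto simp: bij_betw_def twist_def scalar_module_def)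
  have "\<Phi> ` restrict_form II ` V = V_perp II"
  proof
    show "\<Phi> ` restrict_form II ` V \<subseteq> V_perp II"
      by (auto simp: V_perp_def C1.G.restrict_form_eq mem val C1.G.restrict_form_section \<beta>_def
        C1.component_restrict C2.component_restrict)
    show "V_perp II \<subseteq> \<Phi> ` restrict_form II ` V"
    proof
      fix \<phi> assume \<phi>: "\<phi> \<in> V_perp II"
      then obtain s where s: "s \<in> Sec 1" "\<phi> = \<Phi> s" using surj by (auto simp: V_perp_def)
      have "C1.component s = C2.component s"
      proof (rule nd[OF cf(1)[OF s(1)] cf(2)[OF s(1)]])
        fix z :: "('v, 'k) mpoly" assume z: "z \<in> V"
        have "\<beta> s (Fra z 1) = 0"
          using \<phi> z val[OF s(1) C1.G.restrict_form_section[OF z]] by (simp add: V_perp_def C1.G.restrict_form_eq s(2))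
        thus "B (C1.component s) z = B (C2.component s) z"
          using z by (simp add: \<beta>_def C1.component_restrict C2.component_restrict)
      qed
      hence "s = Fra (C1.component s) 1"
        by (intro section_eqI s C1.G.restrict_form_section cf) (simp_all add: C1.component_restrict C2.component_restrict cf s(1))
      thus "\<phi> \<in> \<Phi> ` restrict_form II ` V"
        using s cf(1)[OF s(1)] by (auto simp: C1.G.restrict_form_eq)
    qed
  qed
  thus ?thesis unfolding self_associated_def using iso by blast
qed

text \<open>
  With the idempotent \<open>e/f\<close> of the first basis, the form is \<open>B x y = b (x e/f) y\<close>. It is balanced
  since \<open>x e/f\<close> is \<open>v1\<close> times the function \<open>x e v1\<^sup>d\<^sup>-\<^sup>1 / f\<^sup>2\<close>, which can be moved to \<open>y\<close>. If \<open>x\<close> is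
  orthogonal to \<open>V\<close> under \<open>B\<close>, then \<open>x e/f\<close> is in the diagonal; as it vanishes on the second
  basis, it is zero.
\<close>

theorem common_form_if_self_associated:
  assumes "self_associated II"
  shows "\<exists>B. bilinear B \<and> nondegenerate_form B \<and> balanced I1 B \<and> balanced I2 B"
proof -
  let ?I = "II" and ?serre = "serre_pairing II" and ?\<rho> = "\<lambda>x. Fra x 1"
  obtain \<Phi> where iso: "\<Phi> \<in> mod_iso (structure_ring ?I) (twist ?I 1) (canonical_twist ?I)"
    and perp: "\<Phi> ` restrict_form ?I ` V = V_perp ?I"
    using assms unfolding self_associated_def by blast
  have hom: "\<Phi> \<in> mod_hom (structure_ring ?I) (twist ?I 1) (canonical_twist ?I)" and inj: "inj_on \<Phi> (Sec 1)"
    using iso by (auto simp: mod_iso_def bij_betw_def twist_def scalar_module_def)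
  define b where "b s s' = ?serre s' (\<Phi> s)" for s s'
  have mem: "\<Phi> s \<in> carrier (canonical_twist ?I)" if "s \<in> Sec 1" for s using hom that unfolding C1.G.twist_hom_iff by blast
  have b_left: "b (s \<bbbplus> s') z = b s z + b s' z" "a \<in> Sec 0 \<Longrightarrow> b (a \<star> s) z = b s (a \<star> z)"
    if "s \<in> Sec 1" "s' \<in> Sec 1" "z \<in> Sec 1" for s s' z a
    using hom that unfolding C1.G.twist_hom_iff b_def by blast+
  have b_right: "b s (z \<bbbplus> z') = b s z + b s z'" "b s (const_section ?I c \<star> z) = c * b s z"
    if "s \<in> Sec 1" "z \<in> Sec 1" "z' \<in> Sec 1" for s z z' c
    using C1.G.section_functionalD[OF C1.G.serre_functional[OF mem[OF that(1)]] that(2)] that(3) by (simp_all add: b_def)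
  note \<rho> = C1.G.restrict_form_section
  have V: "s \<in> ?\<rho> ` V" if s: "s \<in> Sec 1" "\<And>y. y \<in> V \<Longrightarrow> b s (?\<rho> y) = 0" for s
  proof -
    have "\<Phi> s \<in> V_perp ?I" using mem[OF s(1)] s(2) by (simp add: V_perp_def b_def C1.G.restrict_form_eq)
    then obtain x where x: "x \<in> V" "\<Phi> s = \<Phi> (?\<rho> x)" unfolding perp[symmetric] by (auto simp: C1.G.restrict_form_eq)
    hence "s = ?\<rho> x" using inj s(1) \<rho>[OF x(1)] by (auto dest: inj_onD)
    thus ?thesis using x(1) by blast
  qed
  have b_V: "b (?\<rho> x) (?\<rho> y) = 0" if "x \<in> V" "y \<in> V" for x y
  proof -
    have "\<Phi> (?\<rho> x) \<in> V_perp ?I" unfolding perp[symmetric] using that(1) by (auto simp: C1.G.restrict_form_eq)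
    thus ?thesis using that(2) by (simp add: V_perp_def b_def C1.G.restrict_form_eq)
  qed
  note fW = C1.G.W_nonvan[OF f_nonvan]
  have part: "Fra (g * x) f \<in> Sec 1" if "g \<in> forms d" "x \<in> V" for g x
    by (rule C1.G.sectionI[OF f_nonvan forms_mult[OF that]])
  have add: "Fra (g * (x + cst c * y)) f = Fra (g * x) f \<bbbplus> (const_section ?I c \<star> Fra (g * y) f)" for g x y c
    unfolding C1.G.const_section_eq C1.G.F.Fr_mult[OF C1.G.F.one_W fW] mult_1_left C1.G.F.Fr_add[OF fW fW]
    by (rule C1.G.F.Fr_eqI[OF fW C1.G.F.mult_W[OF fW fW]]) (simp add: algebra_simps)
  have bal: "balanced K (\<lambda>x y. b (Fra (g * x) f) (?\<rho> y))"
    if g: "g \<in> forms d" and v: "v \<in> V" "g * (v ^ d - f) \<in> ?I" and K: "\<And>z. z \<in> K \<Longrightarrow> g * z \<in> ?I" for g v K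
  proof -
    have ff: "f * f \<in> C1.G.nonvan (d + d)" by (rule C1.G.nonvan_mult[OF f_nonvan f_nonvan])
    note ffW = C1.G.W_nonvan[OF ff]
    have dd: "v ^ (d - 1) \<in> forms (d - 1)" by (rule forms_power_1[OF v(1)])
    have key: "b (Fra (g * x) f) (?\<rho> y) = b (?\<rho> v) (Fra (g * v ^ (d - 1) * (x * y)) (f * f))"
      if xy: "x \<in> V" "y \<in> V" for x y
    proof -
      define a where "a = Fra (g * x * v ^ (d - 1)) (f * f)"
      have a: "a \<in> Sec 0" unfolding a_def
        by (rule C1.G.sectionI[OF ff]) (rule forms_mult_eq[OF forms_mult[OF g xy(1)] dd], use d in simp)
      have vd: "v ^ (d - 1) * v = v ^ d" using d by (simp add: power_Suc2[symmetric] Suc_diff_1 del: power_Suc)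
      have "a \<star> ?\<rho> v = Fra (g * x * v ^ (d - 1) * v) (f * f)"
        unfolding a_def C1.G.F.Fr_mult[OF ffW C1.G.F.one_W] by simp
      also have "\<dots> = Fra (g * x) f"
        by (rule C1.G.F.Fr_eqI[OF ffW fW]) (rule I.comb1[OF v(2), of _ "x * f"], simp add: vd[symmetric] algebra_simps)
      finally have 1: "a \<star> ?\<rho> v = Fra (g * x) f" .
      have 2: "a \<star> ?\<rho> y = Fra (g * v ^ (d - 1) * (x * y)) (f * f)"
        unfolding a_def C1.G.F.Fr_mult[OF ffW C1.G.F.one_W] by (simp add: ac_simps)
      show ?thesis
        using b_left(2)[OF \<rho>[OF v(1)] \<rho>[OF v(1)] \<rho>[OF xy(2)] a] unfolding 1 2 .
    qed
    show ?thesis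
      unfolding balanced_def
    proof (intro ballI impI)
      fix x y z w assume xy: "x \<in> V" "y \<in> V" and zw: "z \<in> V" "w \<in> V" and K': "x * y - z * w \<in> K"
      have "Fra (g * v ^ (d - 1) * (x * y)) (f * f) = Fra (g * v ^ (d - 1) * (z * w)) (f * f)"
        by (rule C1.G.F.Fr_eqI[OF ffW ffW]) (rule I.comb1[OF K[OF K'], of _ "v ^ (d - 1) * f * f"], simp add: algebra_simps)
      thus "b (Fra (g * x) f) (?\<rho> y) = b (Fra (g * z) f) (?\<rho> w)" using key[OF xy] key[OF zw] by simp
    qed
  qed
  define B where "B x y = b (Fra (e * x) f) (?\<rho> y)" for x y
  have bil: "bilinear B"
    unfolding bilinear_def B_def
  proof (intro ballI allI conjI)
    fix x y z :: "('v, 'k) mpoly" and c assume xyz: "x \<in> V" "y \<in> V" "z \<in> V"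
    have cy: "const_section ?I c \<star> Fra (e * y) f \<in> Sec 1"
      by (rule C1.G.section_mult_0[OF C1.G.const_section_mem part[OF e(1) xyz(2)]])
    show "b (Fra (e * (x + cst c * y)) f) (?\<rho> z) = b (Fra (e * x) f) (?\<rho> z) + c * b (Fra (e * y) f) (?\<rho> z)"
      unfolding add using b_left(1)[OF part[OF e(1) xyz(1)] cy \<rho>[OF xyz(3)]]
        b_left(2)[OF part[OF e(1) xyz(2)] cy \<rho>[OF xyz(3)] C1.G.const_section_mem]
        b_right(2)[OF part[OF e(1) xyz(2)] \<rho>[OF xyz(3)] \<rho>[OF xyz(3)]] by simp
    have cy': "const_section ?I c \<star> ?\<rho> y \<in> Sec 1" by (rule C1.G.section_mult_0[OF C1.G.const_section_mem \<rho>[OF xyz(2)]])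
    show "b (Fra (e * z) f) (?\<rho> (x + cst c * y)) = b (Fra (e * z) f) (?\<rho> x) + c * b (Fra (e * z) f) (?\<rho> y)"
      unfolding C1.G.restrict_form_add C1.G.restrict_form_cst_mult
      using b_right(1)[OF part[OF e(1) xyz(3)] \<rho>[OF xyz(1)] cy'] b_right(2)[OF part[OF e(1) xyz(3)] \<rho>[OF xyz(2)] cy'] by simp
  qed
  have bal1: "balanced I1 B"
    unfolding B_def
  proof (rule bal[OF e(1) P.v_form])
    show "e * (v1 ^ d - f) \<in> ?I" using P.mult[OF P.uminus[OF f1], of e] Q.mult_right[OF e(3)] by simp
    show "z \<in> I1 \<Longrightarrow> e * z \<in> ?I" for z using P.mult Q.mult_right[OF e(3)] by blast
  qed
  have bal2: "balanced I2 B"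
  proof -
    have e2: "f - e \<in> forms d" "f - e \<in> I1" using e f_form P.cong_sym by auto
    have compl: "balanced I2 (\<lambda>x y. b (Fra ((f - e) * x) f) (?\<rho> y))"
    proof (rule bal[OF e2(1) Q.v_form])
      show "(f - e) * (v2 ^ d - f) \<in> ?I" using Q.mult[OF Q.uminus[OF f2], of "f - e"] P.mult_right[OF e2(2)] by simp
      show "z \<in> I2 \<Longrightarrow> (f - e) * z \<in> ?I" for z using Q.mult P.mult_right[OF e2(2)] by blast
    qed
    have neg: "b (Fra ((f - e) * x) f) (?\<rho> y) = - B x y" if xy: "x \<in> V" "y \<in> V" for x y
    proof -
      have "Fra ((f - e) * x) f \<bbbplus> Fra (e * x) f = ?\<rho> x"
        unfolding C1.G.F.Fr_add[OF fW fW]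
        by (rule C1.G.F.Fr_eqI[OF C1.G.F.mult_W[OF fW fW] C1.G.F.one_W]) (simp add: algebra_simps)
      hence "b (Fra ((f - e) * x) f) (?\<rho> y) + B x y = 0"
        using b_left(1)[OF part[OF e2(1) xy(1)] part[OF e(1) xy(1)] \<rho>[OF xy(2)]] b_V[OF xy] by (simp add: B_def)
      thus ?thesis by (simp add: eq_neg_iff_add_eq_0)
    qed
    show ?thesis
      unfolding balanced_def
    proof (intro ballI impI)
      fix x y z w assume xy: "x \<in> V" "y \<in> V" and zw: "z \<in> V" "w \<in> V" and m: "x * y - z * w \<in> I2"
      have "b (Fra ((f - e) * x) f) (?\<rho> y) = b (Fra ((f - e) * z) f) (?\<rho> w)"
        using compl[unfolded balanced_def, rule_format, OF xy zw m] .
      thus "B x y = B z w" unfolding neg[OF xy] neg[OF zw] by simp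
    qed
  qed
  have "nondegenerate_form B"
    unfolding nondegenerate_form_def
  proof (intro ballI impI)
    fix x :: "('v, 'k) mpoly" assume x: "x \<in> V" "\<forall>y\<in>V. B x y = 0"
    have "Fra (e * x) f \<in> ?\<rho> ` V" by (rule V[OF part[OF e(1) x(1)]]) (use x(2) in \<open>simp add: B_def\<close>)
    then obtain z where z: "z \<in> V" "Fra (e * x) f = ?\<rho> z" by blast
    hence ez: "e * x - z * f \<in> ?I" using C1.G.Fr_eq[OF fW C1.G.F.one_W, of "e * x" z] by simp
    have "f * z \<in> I2" by (rule Q.comb2[OF IntD2[OF ez] e(3), of _ "-1" x]) (simp add: algebra_simps)
    hence "z \<in> I2" by (rule Q.nzd_if_cong[OF f2])
    hence "z = 0" using Q.linear_mem z(1) by blast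
    hence "f * x \<in> I1"
      by (intro P.comb2[OF IntD1[OF ez] e(2), of _ 1 "- x"]) (simp add: algebra_simps)
    hence "x \<in> I1" by (rule P.nzd_if_cong[OF f1])
    thus "x = 0" using P.linear_mem x(1) by blast
  qed
  thus ?thesis using bil bal1 bal2 by blast
qed

end

section \<open>The theorem\<close>

lemma common_form_iff:
  assumes "is_basis I1" "is_basis I2"
  shows "common_form I1 I2 B \<longleftrightarrow> nonsingular_form B \<and> balanced I1 B \<and> balanced I2 B"
proof -
  obtain v1 where "basis_subscheme I1 v1" using basis_subscheme_if_is_basis[OF assms(1)] by blast
  then interpret P: basis_subscheme I1 v1 .
  obtain v2 where "basis_subscheme I2 v2" using basis_subscheme_if_is_basis[OF assms(2)] by blast
  then interpret Q: basis_subscheme I2 v2 .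
  show ?thesis
    using P.induced_map_iso_iff Q.induced_map_iso_iff assms by (auto simp: common_form_def orthogonal_basis_def)
qed

lemma balanced_cong:
  assumes "\<And>x y. x \<in> V \<Longrightarrow> y \<in> V \<Longrightarrow> B x y = B' x y"
  shows "balanced I B \<longleftrightarrow> balanced I B'"
  unfolding balanced_def using assms by simp

lemma common_formI:
  assumes bases: "is_basis I1" "is_basis I2"
    and B: "bilinear B" "nondegenerate_form B" "balanced I1 B" "balanced I2 B"
  shows "common_form I1 I2 (\<lambda>x\<in>V. \<lambda>y\<in>V. B x y)"
proof -
  let ?B = "\<lambda>x\<in>V. \<lambda>y\<in>V. B x y"
  obtain v1 where "basis_subscheme I1 v1" using basis_subscheme_if_is_basis[OF bases(1)] by blast
  then interpret P: basis_subscheme I1 v1 .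
  have "nonsingular_form ?B"
    by (rule nonsingular_formI[OF B(1,2) balanced_sym[OF B(3) P.poly_ideal_axioms]])
  moreover have "balanced I ?B \<longleftrightarrow> balanced I B" for I by (rule balanced_cong) simp
  ultimately show ?thesis unfolding common_form_iff[OF bases] using B by blast
qed

text \<open>
The factor is not zero because the zero form is degenerate.
\<close>

lemma unique_common_form_if_arithmetically_gorenstein:
  assumes bases: "is_basis I1" "is_basis I2" and pair: "associated_pair I1 I2 v1 v2 N f d e"
    and G: "arithmetically_gorenstein (I1 \<inter> I2)"
  shows "unique_common_form I1 I2"
proof -
  interpret associated_pair I1 I2 v1 v2 N f d e by fact
  have G': "gorenstein_ring (polys Quot (I1 \<inter> I2))"
    using G by (simp add: arithmetically_gorenstein_def homogeneous_coordinate_ring_def)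
  obtain B where B: "bilinear B" "nondegenerate_form B" "balanced I1 B" "balanced I2 B"
    and uniq: "\<And>B'. bilinear B' \<Longrightarrow> balanced I1 B' \<Longrightarrow> balanced I2 B' \<Longrightarrow>
      \<exists>c. \<forall>x\<in>V. \<forall>y\<in>V. B' x y = c * B x y"
    using form_from_simple_socle[OF simple_socle_if_gorenstein[OF G' e(2,3)]] by blast
  let ?B = "\<lambda>x\<in>V. \<lambda>y\<in>V. B x y"
  have "\<exists>c. c \<noteq> 0 \<and> (\<forall>x\<in>V. \<forall>y\<in>V. B' x y = c * ?B x y)" if B': "common_form I1 I2 B'" for B'
  proof -
    have ns: "nonsingular_form B'" and bal: "balanced I1 B'" "balanced I2 B'"
      using B' common_form_iff[OF bases] by auto
    obtain c where c: "\<forall>x\<in>V. \<forall>y\<in>V. B' x y = c * B x y"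
      using uniq[OF nonsingular_formD(1)[OF ns] bal] by blast
    have "c \<noteq> 0"
    proof
      assume "c = 0"
      hence "(pvar undefined :: ('a, 'b) mpoly) = 0"
        using nonsingular_formD(2)[OF ns] c unfolding nondegenerate_form_def by simp
      thus False using pvar_neq_0 by blast
    qed
    thus ?thesis using c by (intro exI[of _ c]) simp
  qed
  thus ?thesis unfolding unique_common_form_def using common_formI[OF bases B] by blast
qed

text \<open>
  Cubics lie in \<open>J\<close>, so the disjointness of the bases holds with the bound 3, and the denominator
  \<open>f\<close> is chosen afresh for it.
\<close>

lemma arithmetically_gorenstein_if_unique_common_form:
  fixes I1 I2 :: "('v::finite, 'k::field) mpoly set"
  assumes bases: "is_basis I1" "is_basis I2" and two: "two_bases I1 I2 v1 v2 N"
    and k: "CARD('k) \<noteq> 2" and unique: "unique_common_form I1 I2"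
  shows "arithmetically_gorenstein (I1 \<inter> I2)"
proof -
  obtain B where common: "common_form I1 I2 B" and uniq: "\<And>B'. common_form I1 I2 B' \<Longrightarrow>
      \<exists>c. c \<noteq> 0 \<and> (\<forall>x\<in>V. \<forall>y\<in>V. B' x y = c * B x y)"
    using unique unfolding unique_common_form_def by blast
  have ns: "nonsingular_form B" and bal: "balanced I1 B" "balanced I2 B"
    using common common_form_iff[OF bases] by auto
  note B = nonsingular_formD[OF ns] bal
  interpret T: two_bases I1 I2 v1 v2 N by fact
  interpret F: two_bases_form I1 I2 v1 v2 N B by unfold_locales (use B in auto)
  have uniq': "\<exists>c. \<forall>x\<in>V. \<forall>y\<in>V. B' x y = c * B x y"
    if B': "bilinear B'" "nondegenerate_form B'" "balanced I1 B'" "balanced I2 B'" for B'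
  proof -
    obtain c where "\<forall>x\<in>V. \<forall>y\<in>V. (\<lambda>x\<in>V. \<lambda>y\<in>V. B' x y) x y = c * B x y"
      using uniq[OF common_formI[OF bases B']] by blast
    thus ?thesis by (intro exI[of _ c]) simp
  qed
  obtain c0 :: 'k where c0: "c0 \<noteq> 0" "c0 \<noteq> 1"
  proof (rule ccontr)
    assume "\<not> thesis"
    hence "(UNIV :: 'k set) = {0, 1}" using that by blast
    hence "CARD('k) = card {0, 1 :: 'k}" by simp
    thus False using k by simp
  qed
  have scalar: "\<exists>c. \<forall>x\<in>V. u x = cst c * x" if "F.sa u" for u
    by (rule F.sa_scalar[OF uniq' c0 that])
  have ker: "p \<in> T.J" if "p \<in> forms 2" "T.P.quad_functional B p = 0" for p
    by (rule F.kernel_in_J[OF scalar that])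
  have cub: "forms 3 \<subseteq> T.J" by (rule F.cubics_in_J[OF ker])
  interpret T3: two_bases I1 I2 v1 v2 3
    by unfold_locales (use cub in \<open>simp add: T.J_def\<close>)
  obtain f d where f: "3 \<le> d" "f \<in> forms d" "f - v1 ^ d \<in> I1" "f - v2 ^ d \<in> I2"
    using T3.exists_denominator by (elim exE conjE) (rule that)
  interpret gorenstein_pair I1 I2 v1 v2 f d B
    by unfold_locales (use f B scalar ker in auto)
  show ?thesis
    using gorenstein_coordinate_ring by (simp add: arithmetically_gorenstein_def homogeneous_coordinate_ring_def)
qed

theorem theorem8p3:
  fixes \<Gamma> \<Gamma>1 \<Gamma>2 :: "('v::finite, 'k::field) mpoly set" and r :: nat
  assumes "CARD('v) = r + 1"
    and "finite_subscheme \<Gamma>" and "gorenstein_scheme \<Gamma>" and "has_degree \<Gamma> (2 * r + 2)"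
    and "closed_subscheme \<Gamma>1" and "closed_subscheme \<Gamma>2" and "disjoint_union \<Gamma> \<Gamma>1 \<Gamma>2"
    and "is_basis \<Gamma>1" and "is_basis \<Gamma>2"
  shows "(self_associated \<Gamma> \<longleftrightarrow> (\<exists>B. common_form \<Gamma>1 \<Gamma>2 B)) \<and>
    (arithmetically_gorenstein \<Gamma> \<longrightarrow> unique_common_form \<Gamma>1 \<Gamma>2) \<and>
    (CARD('k) \<noteq> 2 \<longrightarrow> unique_common_form \<Gamma>1 \<Gamma>2 \<longrightarrow> arithmetically_gorenstein \<Gamma>)"
proof -
  note bases = \<open>is_basis \<Gamma>1\<close> \<open>is_basis \<Gamma>2\<close>
  have \<Gamma>: "\<Gamma> = \<Gamma>1 \<inter> \<Gamma>2" using \<open>disjoint_union \<Gamma> \<Gamma>1 \<Gamma>2\<close> by (simp add: disjoint_union_def)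
  obtain N where N: "forms N \<subseteq> {a + b | a b. a \<in> \<Gamma>1 \<and> b \<in> \<Gamma>2}"
    using \<open>disjoint_union \<Gamma> \<Gamma>1 \<Gamma>2\<close> by (auto simp: disjoint_union_def set_add_polys)
  obtain v1 where "basis_subscheme \<Gamma>1 v1" using basis_subscheme_if_is_basis[OF bases(1)] by blast
  then interpret P: basis_subscheme \<Gamma>1 v1 .
  obtain v2 where "basis_subscheme \<Gamma>2 v2" using basis_subscheme_if_is_basis[OF bases(2)] by blast
  then interpret Q: basis_subscheme \<Gamma>2 v2 .
  have two: "two_bases \<Gamma>1 \<Gamma>2 v1 v2 N"
    by (intro two_bases.intro two_bases_axioms.intro P.basis_ideal_axioms Q.basis_ideal_axioms N)
  obtain f d e where f: "3 \<le> d" "N \<le> d" "f \<in> forms d" "f - v1 ^ d \<in> \<Gamma>1" "f - v2 ^ d \<in> \<Gamma>2"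
    and e: "e \<in> forms d" "e - f \<in> \<Gamma>1" "e \<in> \<Gamma>2"
    using two_bases.exists_denominator[OF two] by (elim exE conjE) (rule that)
  have "closed_subscheme \<Gamma>" using \<open>finite_subscheme \<Gamma>\<close> by (simp add: finite_subscheme_def)
  hence closed: "closed_ideal (\<Gamma>1 \<inter> \<Gamma>2)" unfolding \<Gamma> by (rule closed_ideal_if_closed_subscheme)
  have pair: "associated_pair \<Gamma>1 \<Gamma>2 v1 v2 N f d e"
    by (intro associated_pair.intro two_bases_denominator.intro two_bases_denominator_axioms.intro
        associated_pair_axioms.intro sub_basis.intro sub_basis_axioms.intro two closed
        P.basis_subscheme_axioms Q.basis_subscheme_axioms f e) auto
  have form: "(\<exists>B. common_form \<Gamma>1 \<Gamma>2 B) \<longleftrightarrow>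
    (\<exists>B. bilinear B \<and> nondegenerate_form B \<and> balanced \<Gamma>1 B \<and> balanced \<Gamma>2 B)"
    using common_formI[OF bases] nonsingular_formD unfolding common_form_iff[OF bases] by blast
  have "self_associated \<Gamma> \<longleftrightarrow> (\<exists>B. common_form \<Gamma>1 \<Gamma>2 B)"
    unfolding form \<Gamma>
    using associated_pair.self_associated_if_common_form[OF pair] associated_pair.common_form_if_self_associated[OF pair] by blast
  moreover have "arithmetically_gorenstein \<Gamma> \<Longrightarrow> unique_common_form \<Gamma>1 \<Gamma>2"
    unfolding \<Gamma> by (rule unique_common_form_if_arithmetically_gorenstein[OF bases pair])
  moreover have "CARD('k) \<noteq> 2 \<Longrightarrow> unique_common_form \<Gamma>1 \<Gamma>2 \<Longrightarrow> arithmetically_gorenstein \<Gamma>"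
    unfolding \<Gamma> by (rule arithmetically_gorenstein_if_unique_common_form[OF bases two])
  ultimately show ?thesis by blast
qed

end
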